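(* Assume $C_D:=\sup_N\hat\mu^N_{D_N}(\log(1+|x|^2))<\infty$ and $\hat\mu^N_{D_N}\to\mu_D$ weakly. Then (1) $S_{\mu_D}$ is a good rate function on $\mathcal C([0,1],\mathcal P(\mathbb R))$; (2) for any closed set $F\subset\mathcal C([0,1],\mathcal P(\mathbb R))$, $$\limsup_{N\to\infty}\frac1{N^2}\log\mathbb P(\hat\mu^N\in F)\le-\inf_{\nu\in F}S_{\mu_D}(\nu).$$
   Context: $D_N$ deterministic real diagonal $N\times N$ matrices; $\hat\mu^N=(\hat\mu^N_t)_{t\in[0,1]}$ the spectral measure process of $D_N+\mathbf H^N(t)$, where $\mathbf H^N$ is the Hermitian Brownian motion ($H_{kl}=(B^1_{kl}+iB^2_{kl})/\sqrt{2N}$, $k<l$, $H_{kk}=B_{kk}/\sqrt N$, independent standard Brownian motions). $\mathcal C([0,1],\mathcal P(\mathbb R))$ has the metric $D(\mu,\nu)=\sup_td(\mu_t,\nu_t)$ with $d$ the bounded-Lipschitz metric. $S_\mu(\nu)=+\infty$ if $\nu_0\ne\mu$; otherwise $S_\mu(\nu)=\sup_{f\in\mathcal C^{2,1}_b(\mathbb R\times[0,1])}\sup_{0\le s\le t\le1}\{S^{s,t}(\nu,f)-\frac12\langle f,f\rangle^{s,t}_\nu\}$ with $S^{s,t}(\nu,f)=\int f(x,t)d\nu_t-\int f(x,s)d\nu_s-\int_s^t\int\partial_uf\,d\nu_udu-\frac12\int_s^t\iint\frac{\partial_xf(x,u)-\partial_xf(y,u)}{x-y}d\nu_u(x)d\nu_u(y)du$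 and $\langle f,f\rangle^{s,t}_\nu=\int_s^t\int(\partial_xf)^2d\nu_udu$. *)

theory Defs
  imports "HOL-Probability.Probability" "Jordan_Normal_Form.Char_Poly"
begin

text \<open>P(R) is rendered by the library notion real_distribution (probability measure on the Borel sets).
  The bounded-Lipschitz unit ball: functions with sup-norm plus Lipschitz constant at most 1.\<close>

definition BL_unit :: "(real \<Rightarrow> real) set" where
  "BL_unit = {f. \<exists>a b. 0 \<le> a \<and> 0 \<le> b \<and> a + b \<le> 1 \<and> (\<forall>x. \<bar>f x\<bar> \<le> a) \<and>
                       (\<forall>x y. \<bar>f x - f y\<bar> \<le> b * \<bar>x - y\<bar>)}"

definition bl_dist :: "real measure \<Rightarrow> real measure \<Rightarrow> real" where
  "bl_dist \<mu> \<nu> = (SUP f\<in>BL_unit. \<bar>(\<integral>x. f x \<partial>\<mu>) - (\<integral>x. f x \<partial>\<nu>)\<bar>)"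

text \<open>A path is a function from times to measures; only its values on [0,1] matter.\<close>

definition path_dist :: "(real \<Rightarrow> real measure) \<Rightarrow> (real \<Rightarrow> real measure) \<Rightarrow> real" where
  "path_dist \<mu> \<nu> = (SUP t\<in>{0..1}. bl_dist (\<mu> t) (\<nu> t))"

definition path_space :: "(real \<Rightarrow> real measure) set" where
  "path_space = {\<nu>. (\<forall>t\<in>{0..1}. real_distribution (\<nu> t)) \<and>
      (\<forall>t\<in>{0..1}. \<forall>e>0. \<exists>\<delta>>0. \<forall>s\<in>{0..1}. \<bar>s - t\<bar> < \<delta> \<longrightarrow> bl_dist (\<nu> s) (\<nu> t) < e)}"

definition path_closed :: "(real \<Rightarrow> real measure) set \<Rightarrow> bool" where
  "path_closed F \<longleftrightarrow> F \<subseteq> path_space \<and>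
     (\<forall>\<nu> (seq :: nat \<Rightarrow> real \<Rightarrow> real measure). \<nu> \<in> path_space \<and> (\<forall>n. seq n \<in> F) \<and> (\<lambda>n. path_dist (seq n) \<nu>) \<longlonglongrightarrow> 0
        \<longrightarrow> \<nu> \<in> F)"

definition good_rate_function :: "'a set \<Rightarrow> ('a \<Rightarrow> 'a \<Rightarrow> real) \<Rightarrow> ('a \<Rightarrow> ereal) \<Rightarrow> bool" where
  "good_rate_function X rho I \<longleftrightarrow>
     (\<forall>x\<in>X. 0 \<le> I x) \<and>
     (\<forall>x\<in>X. \<forall>seq :: nat \<Rightarrow> 'a. (\<forall>n. seq n \<in> X) \<and> (\<lambda>n. rho (seq n) x) \<longlonglongrightarrow> 0
        \<longrightarrow> I x \<le> liminf (\<lambda>n. I (seq n))) \<and>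
     (\<forall>a::real. \<forall>seq :: nat \<Rightarrow> 'a. (\<forall>n. seq n \<in> X \<and> I (seq n) \<le> ereal a) \<longrightarrow>
        (\<exists>(r :: nat \<Rightarrow> nat) x. strict_mono r \<and> x \<in> X \<and> I x \<le> ereal a \<and> (\<lambda>n. rho (seq (r n)) x) \<longlonglongrightarrow> 0))"

definition C21b :: "(real \<Rightarrow> real \<Rightarrow> real) \<Rightarrow> (real \<Rightarrow> real \<Rightarrow> real) \<Rightarrow>
    (real \<Rightarrow> real \<Rightarrow> real) \<Rightarrow> (real \<Rightarrow> real \<Rightarrow> real) \<Rightarrow> bool" where
  "C21b f fx fxx ft \<longleftrightarrow>
     (\<forall>x. \<forall>t\<in>{0..1}.
        ((\<lambda>y. f y t) has_real_derivative fx x t) (at x) \<and>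
        ((\<lambda>y. fx y t) has_real_derivative fxx x t) (at x) \<and>
        ((\<lambda>s. f x s) has_real_derivative ft x t) (at t within {0..1})) \<and>
     (\<forall>g\<in>{f, fx, fxx, ft}.
        continuous_on (UNIV \<times> {0..1}) (\<lambda>(x, t). g x t) \<and>
        bounded ((\<lambda>(x, t). g x t) ` (UNIV \<times> {0..1})))"

definition divided_diff :: "(real \<Rightarrow> real) \<Rightarrow> (real \<Rightarrow> real) \<Rightarrow> real \<Rightarrow> real \<Rightarrow> real" where
  "divided_diff g g' x y = (if x = y then g' x else (g x - g y) / (x - y))"

definition S_st :: "(real \<Rightarrow> real measure) \<Rightarrow> (real \<Rightarrow> real \<Rightarrow> real) \<Rightarrow> (real \<Rightarrow> real \<Rightarrow> real) \<Rightarrow>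
    (real \<Rightarrow> real \<Rightarrow> real) \<Rightarrow> (real \<Rightarrow> real \<Rightarrow> real) \<Rightarrow> real \<Rightarrow> real \<Rightarrow> real" where
  "S_st \<nu> f fx fxx ft s t =
     (\<integral>x. f x t \<partial>\<nu> t) - (\<integral>x. f x s \<partial>\<nu> s)
     - (LBINT u:{s..t}. (\<integral>x. ft x u \<partial>\<nu> u))
     - 1/2 * (LBINT u:{s..t}. (\<integral>z. divided_diff (\<lambda>x. fx x u) (\<lambda>x. fxx x u) (fst z) (snd z)
                                   \<partial>(\<nu> u \<Otimes>\<^sub>M \<nu> u)))"

definition bracket_st :: "(real \<Rightarrow> real measure) \<Rightarrow> (real \<Rightarrow> real \<Rightarrow> real) \<Rightarrow> real \<Rightarrow> real \<Rightarrow> real" where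
  "bracket_st \<nu> fx s t = (LBINT u:{s..t}. (\<integral>x. (fx x u)\<^sup>2 \<partial>\<nu> u))"

definition S_rate :: "real measure \<Rightarrow> (real \<Rightarrow> real measure) \<Rightarrow> ereal" where
  "S_rate \<mu> \<nu> = (if \<nu> 0 \<noteq> \<mu> then \<infinity> else
     (SUP (f, fx, fxx, ft)\<in>{(f, fx, fxx, ft). C21b f fx fxx ft}.
        SUP (s, t)\<in>{(s, t). 0 \<le> s \<and> s \<le> t \<and> t \<le> 1}.
          ereal (S_st \<nu> f fx fxx ft s t - 1/2 * bracket_st \<nu> fx s t)))"

definition empirical :: "real multiset \<Rightarrow> real measure" where
  "empirical xs = distr (measure_pmf (pmf_of_multiset xs)) borel (\<lambda>x. x)"

text \<open>Real eigenvalues of a complex square matrix counted with (algebraic) multiplicity; for a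
  Hermitian matrix these are all its eigenvalues.\<close>

definition real_eigenvalues :: "complex mat \<Rightarrow> real multiset" where
  "real_eigenvalues A = Abs_multiset (\<lambda>x. order (complex_of_real x) (char_poly A))"

definition spectral_measure :: "complex mat \<Rightarrow> real measure" where
  "spectral_measure A = empirical (real_eigenvalues A)"

definition diag_real :: "nat \<Rightarrow> (nat \<Rightarrow> real) \<Rightarrow> complex mat" where
  "diag_real N d = mat_diag N (\<lambda>k. complex_of_real (d k))"

definition herm_BM :: "nat \<Rightarrow> (nat \<times> nat \<Rightarrow> real \<Rightarrow> 'w \<Rightarrow> real) \<Rightarrow> real \<Rightarrow> 'w \<Rightarrow> complex mat" where
  "herm_BM N B t \<omega> = Matrix.mat N N (\<lambda>(k, l).
     if k < l then Complex (B (k, l) t \<omega>) (B (l, k) t \<omega>) / complex_of_real (sqrt (2 * real N))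
     else if l < k then Complex (B (l, k) t \<omega>) (- B (k, l) t \<omega>) / complex_of_real (sqrt (2 * real N))
     else complex_of_real (B (k, k) t \<omega> / sqrt (real N)))"

definition spectral_process ::
    "nat \<Rightarrow> (nat \<Rightarrow> real) \<Rightarrow> (nat \<times> nat \<Rightarrow> real \<Rightarrow> 'w \<Rightarrow> real) \<Rightarrow> 'w \<Rightarrow> real \<Rightarrow> real measure" where
  "spectral_process N d B \<omega> = (\<lambda>t. spectral_measure (diag_real N d + herm_BM N B t \<omega>))"

definition indep_std_BMs :: "'w measure \<Rightarrow> 'i set \<Rightarrow> ('i \<Rightarrow> real \<Rightarrow> 'w \<Rightarrow> real) \<Rightarrow> bool" where
  "indep_std_BMs M I B \<longleftrightarrow>
     (\<forall>i\<in>I. \<forall>t\<in>{0..1}. B i t \<in> borel_measurable M) \<and>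
     (\<forall>i\<in>I. \<forall>\<omega>\<in>space M. B i 0 \<omega> = 0 \<and> continuous_on {0..1} (\<lambda>t. B i t \<omega>)) \<and>
     (\<forall>n (ts :: nat \<Rightarrow> real). 0 \<le> ts 0 \<and> ts n \<le> 1 \<and> (\<forall>j<n. ts j < ts (Suc j)) \<longrightarrow>
        prob_space.indep_vars M (\<lambda>_. borel)
          (\<lambda>(i, j) \<omega>. B i (ts (Suc j)) \<omega> - B i (ts j) \<omega>) (I \<times> {..<n}) \<and>
        (\<forall>i\<in>I. \<forall>j<n. distributed M lborel (\<lambda>\<omega>. B i (ts (Suc j)) \<omega> - B i (ts j) \<omega>)
                          (normal_density 0 (sqrt (ts (Suc j) - ts j)))))"

definition outer_prob :: "'w measure \<Rightarrow> 'w set \<Rightarrow> real" where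
  "outer_prob M A = (INF E\<in>{E\<in>sets M. A \<inter> space M \<subseteq> E}. measure M E)"

definition log_ereal :: "real \<Rightarrow> ereal" where
  "log_ereal p = (if p \<le> 0 then - \<infinity> else ereal (ln p))"

end

(*
  Upper bound. For a fixed test function the time interval is cut into small steps. A third-order
  Taylor expansion of the trace, written through the coupling |<u_i, v_j>|^2 / N of the spectral
  measures of two Hermitian matrices with eigenbases u and v, shows that one step changes the
  conditional expectation of the exponential of N^2 times the discretised functional by a factor
  1 + O(h^(3/2)), where h is the step size. Letting h tend to 0 (Fatou) gives
  E exp(N^2 J_f) <= 1 without stochastic calculus, so J_f > a has probability at most exp(-N^2 a).
  Smoothing f in space removes the Lipschitz assumption on its second derivative that the Taylor
  bound needs.

  Exponential tightness. The same coupling bounds the distance of two spectral measures by the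
  normalised Hilbert-Schmidt norm of the difference of the matrices (Hoffman-Wielandt). Gaussian
  tails for dyadic increments and chaining then confine the paths to a set which is relatively
  compact, uniformly in N, outside an event of probability exp(-L N^2). The part of F in that set is
  covered by finitely many sets {J_f > a} or {nu_0 far from mu_D}.

  Goodness. Along paths of bounded rate, the test functions x^2 / (R^2 + x^2) give uniform
  tightness, and multiples of cos(xi x) and sin(xi x) give equicontinuity of the characteristic
  functions.
*)
theory Submission
  imports Defs "HOL-Library.Diagonal_Subsequence" "HOL-Real_Asymp.Real_Asymp"
    "Jordan_Normal_Form.Schur_Decomposition"
begin

section \<open>Weak convergence and the bounded-Lipschitz metric\<close>

text \<open>Stochastic calculus for the eigenvalues asks for their simplicity and smoothness in the
  entries. The weights |<u_i, v_j>|^2 exist for arbitrary eigenbases: with A = Y - X, the identity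
  <u_i, A v_j> = (mu_j - lam_i) <u_i, v_j> turns Taylor's formula for a trace into matrix elements
  of A, and exchanging the basis v for u in the second-order term costs only the Lipschitz constant
  of f_xx. What is left is linear and quadratic in a Gaussian increment, so its expectation is
  exact. The constant in O(h^(3/2)) may depend on N, since h tends to 0 while N is fixed, but not on
  the current position; hence only sup norms and Lipschitz constants enter it. The speed N^2
  reflects the entry variance 1/N: the mean of the second-order term yields half the double integral
  of the divided difference, half the variance of the linear term yields half the bracket, and both
  carry the factor N^2. F is an arbitrary closed set and its probability an outer one, so the event
  is enclosed in measurable ones. The logarithmic moment serves to control the tails of the initial
  laws uniformly in N.\<close>

lemma real_distribution_borel: "real_distribution \<mu> \<Longrightarrow> f \<in> borel_measurable borel \<Longrightarrow> f \<in> borel_measurable \<mu>"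
  using measurable_cong_sets[OF real_distribution.events_eq_borel refl] by blast

lemma real_distribution_integrable:
  fixes f :: "real \<Rightarrow> real"
  assumes "real_distribution \<mu>" "f \<in> borel_measurable borel" "\<And>x. \<bar>f x\<bar> \<le> B"
  shows "integrable \<mu> f"
proof -
  interpret real_distribution \<mu> by fact
  show ?thesis
    using assms real_distribution_borel by (intro integrable_const_bound[of _ B]) auto
qed

text \<open>A function that is not integrable has Bochner integral 0, and \<open>B\<close> is
  nonnegative; thus the bound also covers integrands whose measurability has not been
  established.\<close>

lemma real_distribution_integral_abs_le:
  fixes f :: "real \<Rightarrow> real"
  assumes "real_distribution \<mu>" "\<And>x. \<bar>f x\<bar> \<le> B"
  shows "\<bar>integral\<^sup>L \<mu> f\<bar> \<le> B"
proof -
  interpret real_distribution \<mu> by fact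
  have B: "0 \<le> B" using assms(2)[of 0] by linarith
  show ?thesis
  proof (cases "integrable \<mu> f")
    case True
    have "\<bar>integral\<^sup>L \<mu> f\<bar> \<le> (\<integral>x. \<bar>f x\<bar> \<partial>\<mu>)" using integral_abs_bound .
    also have "\<dots> \<le> (\<integral>x. B \<partial>\<mu>)" using True assms(2) by (intro integral_mono) auto
    finally show ?thesis using prob_space by (simp add: space_eq_univ)
  qed (simp add: not_integrable_integral_eq B)
qed

lemma BL_unit_abs_le: "f \<in> BL_unit \<Longrightarrow> \<bar>f x\<bar> \<le> 1"
  unfolding BL_unit_def by (auto intro: order_trans[of _ _ 1])

lemma BL_unit_lipschitz: "f \<in> BL_unit \<Longrightarrow> \<bar>f x - f y\<bar> \<le> \<bar>x - y\<bar>"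
  unfolding BL_unit_def
proof clarsimp
  fix a b :: real assume "0 \<le> a" "a + b \<le> 1" and *: "\<forall>x y. \<bar>f x - f y\<bar> \<le> b * \<bar>x - y\<bar>"
  then have "b * \<bar>x - y\<bar> \<le> 1 * \<bar>x - y\<bar>" by (intro mult_right_mono) auto
  with * show "\<bar>f x - f y\<bar> \<le> \<bar>x - y\<bar>" by (metis mult_1 order_trans)
qed

lemma BL_unit_borel [measurable_dest]: "f \<in> BL_unit \<Longrightarrow> f \<in> borel_measurable borel"
proof -
  assume f: "f \<in> BL_unit"
  have "continuous_on UNIV f"
    unfolding continuous_on_iff
  proof (intro ballI allI impI)
    fix x e :: real assume "0 < e"
    then show "\<exists>d>0. \<forall>x'\<in>UNIV. dist x' x < d \<longrightarrow> dist (f x') (f x) < e"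
      using BL_unit_lipschitz[OF f] by (intro exI[of _ e]) (auto simp: dist_real_def intro: le_less_trans)
  qed
  then show ?thesis by (rule borel_measurable_continuous_onI)
qed

lemma zero_in_BL_unit: "(\<lambda>x. 0) \<in> BL_unit"
  unfolding BL_unit_def by (auto intro!: exI[of _ 0])

lemma bl_dist_bdd:
  assumes "real_distribution \<mu>" "real_distribution \<nu>"
  shows "bdd_above ((\<lambda>f. \<bar>(\<integral>x. f x \<partial>\<mu>) - (\<integral>x. f x \<partial>\<nu>)\<bar>) ` BL_unit)"
proof (rule bdd_aboveI2[where M=2])
  fix f assume f: "f \<in> BL_unit"
  show "\<bar>(\<integral>x. f x \<partial>\<mu>) - (\<integral>x. f x \<partial>\<nu>)\<bar> \<le> 2"
    using real_distribution_integral_abs_le[of \<mu> f 1] real_distribution_integral_abs_le[of \<nu> f 1]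
      BL_unit_abs_le[OF f] assms by fastforce
qed

lemma bl_dist_ge:
  assumes "real_distribution \<mu>" "real_distribution \<nu>" "f \<in> BL_unit"
  shows "\<bar>(\<integral>x. f x \<partial>\<mu>) - (\<integral>x. f x \<partial>\<nu>)\<bar> \<le> bl_dist \<mu> \<nu>"
  unfolding bl_dist_def using bl_dist_bdd[OF assms(1,2)] assms(3) by (intro cSUP_upper) auto

lemma bl_dist_le:
  assumes "\<And>f. f \<in> BL_unit \<Longrightarrow> \<bar>(\<integral>x. f x \<partial>\<mu>) - (\<integral>x. f x \<partial>\<nu>)\<bar> \<le> c"
  shows "bl_dist \<mu> \<nu> \<le> c"
  unfolding bl_dist_def using assms zero_in_BL_unit by (intro cSUP_least) auto

lemma bl_dist_sym: "bl_dist \<mu> \<nu> = bl_dist \<nu> \<mu>"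
  unfolding bl_dist_def by (simp add: abs_minus_commute)

lemma bl_dist_nonneg: "real_distribution \<mu> \<Longrightarrow> real_distribution \<nu> \<Longrightarrow> 0 \<le> bl_dist \<mu> \<nu>"
  using bl_dist_ge[OF _ _ zero_in_BL_unit] by fastforce

lemma bl_dist_le_2: "real_distribution \<mu> \<Longrightarrow> real_distribution \<nu> \<Longrightarrow> bl_dist \<mu> \<nu> \<le> 2"
proof (rule bl_dist_le)
  fix f assume a: "real_distribution \<mu>" "real_distribution \<nu>" and f: "f \<in> BL_unit"
  show "\<bar>(\<integral>x. f x \<partial>\<mu>) - (\<integral>x. f x \<partial>\<nu>)\<bar> \<le> 2"
    using real_distribution_integral_abs_le[of \<mu> f 1] real_distribution_integral_abs_le[of \<nu> f 1]
      BL_unit_abs_le[OF f] a by fastforce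
qed

lemma bl_dist_triangle:
  assumes "real_distribution \<mu>" "real_distribution \<nu>" "real_distribution \<rho>"
  shows "bl_dist \<mu> \<rho> \<le> bl_dist \<mu> \<nu> + bl_dist \<nu> \<rho>"
proof (rule bl_dist_le)
  fix f assume f: "f \<in> BL_unit"
  show "\<bar>(\<integral>x. f x \<partial>\<mu>) - (\<integral>x. f x \<partial>\<rho>)\<bar> \<le> bl_dist \<mu> \<nu> + bl_dist \<nu> \<rho>"
    using bl_dist_ge[OF assms(1,2) f] bl_dist_ge[OF assms(2,3) f] by linarith
qed

section \<open>Weak convergence through Skorokhod representations\<close>

text \<open>Skorokhod's representation replaces the laws by random variables converging pointwise on
  one space, where dominated convergence applies. The hypothesis \<open>conv\<close> (continuous
  convergence) allows the integrand to vary with \<open>n\<close>, as it does when a time argument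
  converges together with the measures.\<close>

lemma weak_conv_moving_integral:
  fixes g :: "nat \<Rightarrow> real \<Rightarrow> real"
  assumes \<mu>: "\<And>n. real_distribution (\<mu> n)" "real_distribution M" "weak_conv_m \<mu> M"
    and g [measurable]: "\<And>n. g n \<in> borel_measurable borel" "h \<in> borel_measurable borel"
    and B: "\<And>n x. \<bar>g n x\<bar> \<le> B"
    and conv: "\<And>x xs. xs \<longlonglongrightarrow> x \<Longrightarrow> (\<lambda>n. g n (xs n)) \<longlonglongrightarrow> h x"
  shows "(\<lambda>n. \<integral>x. g n x \<partial>\<mu> n) \<longlonglongrightarrow> (\<integral>x. h x \<partial>M)"
proof -
  obtain \<Omega> :: "real measure" and Y Z where "prob_space \<Omega>" and [measurable]: "\<And>n. Y n \<in> borel_measurable \<Omega>"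
    and d1: "\<And>n. distr \<Omega> borel (Y n) = \<mu> n" and [measurable]: "Z \<in> borel_measurable \<Omega>"
    and d2: "distr \<Omega> borel Z = M" and l: "\<And>x. x \<in> space \<Omega> \<Longrightarrow> (\<lambda>n. Y n x) \<longlonglongrightarrow> Z x"
    using Skorohod[OF \<mu>] by force
  note d = d1 d2
  interpret prob_space \<Omega> by fact
  show ?thesis
    unfolding d[symmetric]
    by (subst (1 2) integral_distr, measurable)
       (auto intro!: integral_dominated_convergence[where w="\<lambda>x. B"] conv l B)
qed

text \<open>The product measure is the law of the Skorokhod variable applied in both coordinates of
  \<open>\<Omega> \<Otimes>\<^sub>M \<Omega>\<close>, so the argument for single integrals carries
  over.\<close>

lemma weak_conv_moving_integral_pair:
  fixes g :: "nat \<Rightarrow> real \<times> real \<Rightarrow> real"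
  assumes \<mu>: "\<And>n. real_distribution (\<mu> n)" "real_distribution M" "weak_conv_m \<mu> M"
    and g [measurable]: "\<And>n. g n \<in> borel_measurable borel" "h \<in> borel_measurable borel"
    and B: "\<And>n x. \<bar>g n x\<bar> \<le> B"
    and conv: "\<And>x xs. xs \<longlonglongrightarrow> x \<Longrightarrow> (\<lambda>n. g n (xs n)) \<longlonglongrightarrow> h x"
  shows "(\<lambda>n. \<integral>x. g n x \<partial>(\<mu> n \<Otimes>\<^sub>M \<mu> n)) \<longlonglongrightarrow> (\<integral>x. h x \<partial>(M \<Otimes>\<^sub>M M))"
proof -
  obtain \<Omega> :: "real measure" and Y Z where "prob_space \<Omega>" and [measurable]: "\<And>n. Y n \<in> borel_measurable \<Omega>"
    and d1: "\<And>n. distr \<Omega> borel (Y n) = \<mu> n" and [measurable]: "Z \<in> borel_measurable \<Omega>"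
    and d2: "distr \<Omega> borel Z = M" and l: "\<And>x. x \<in> space \<Omega> \<Longrightarrow> (\<lambda>n. Y n x) \<longlonglongrightarrow> Z x"
    using Skorohod[OF \<mu>] by force
  note d = d1 d2
  interpret prob_space \<Omega> by fact
  interpret P: pair_prob_space \<Omega> \<Omega> ..
  have pd: "distr \<Omega> borel f \<Otimes>\<^sub>M distr \<Omega> borel f = distr (\<Omega> \<Otimes>\<^sub>M \<Omega>) borel (\<lambda>(x, y). (f x, f y))"
    if [measurable]: "f \<in> borel_measurable \<Omega>" for f :: "real \<Rightarrow> real"
  proof -
    interpret D: prob_space "distr \<Omega> borel f" by (rule prob_space_distr) measurable
    show ?thesis
      by (subst pair_measure_distr) (auto simp: borel_prod intro: D.sigma_finite_measure_axioms)
  qed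
  have [measurable]: "(\<lambda>(x, y). (f x, f y)) \<in> borel_measurable (\<Omega> \<Otimes>\<^sub>M \<Omega>)"
    if [measurable]: "f \<in> borel_measurable \<Omega>" for f :: "real \<Rightarrow> real"
    by measurable
  show ?thesis
    unfolding d[symmetric]
    apply (subst (1 2) pd, measurable)
    apply (subst (1 2) integral_distr, measurable)
    apply (rule integral_dominated_convergence[where w="\<lambda>x. B"])
    apply (auto intro!: conv l B tendsto_Pair simp: space_pair_measure)
    done
qed

text \<open>In a Skorokhod coupling the expectation of min(2, |Y_n - Z|) bounds the difference of
  integrals for all functions of the unit ball at once, which is the uniformity that the supremum
  needs.\<close>

lemma weak_conv_imp_bl_dist:
  assumes \<mu>: "\<And>n. real_distribution (\<mu> n)" "real_distribution M" "weak_conv_m \<mu> M"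
  shows "(\<lambda>n. bl_dist (\<mu> n) M) \<longlonglongrightarrow> 0"
proof -
  obtain \<Omega> :: "real measure" and Y Z where "prob_space \<Omega>" and [measurable]: "\<And>n. Y n \<in> borel_measurable \<Omega>"
    and d1: "\<And>n. distr \<Omega> borel (Y n) = \<mu> n" and [measurable]: "Z \<in> borel_measurable \<Omega>"
    and d2: "distr \<Omega> borel Z = M" and l: "\<And>x. x \<in> space \<Omega> \<Longrightarrow> (\<lambda>n. Y n x) \<longlonglongrightarrow> Z x"
    using Skorohod[OF \<mu>] by force
  note d = d1 d2
  interpret prob_space \<Omega> by fact
  have lim: "(\<lambda>n. \<integral>x. min 2 \<bar>Y n x - Z x\<bar> \<partial>\<Omega>) \<longlonglongrightarrow> (\<integral>x. 0 \<partial>\<Omega>)"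
  proof (rule integral_dominated_convergence[where w="\<lambda>x. 2"])
    show "AE x in \<Omega>. (\<lambda>n. min 2 \<bar>Y n x - Z x\<bar>) \<longlonglongrightarrow> 0"
    proof (rule AE_I2)
      fix x assume "x \<in> space \<Omega>"
      then have "(\<lambda>n. min 2 \<bar>Y n x - Z x\<bar>) \<longlonglongrightarrow> min 2 \<bar>Z x - Z x\<bar>"
        by (intro tendsto_intros l)
      then show "(\<lambda>n. min 2 \<bar>Y n x - Z x\<bar>) \<longlonglongrightarrow> 0" by simp
    qed
  qed auto
  have le: "bl_dist (\<mu> n) M \<le> (\<integral>x. min 2 \<bar>Y n x - Z x\<bar> \<partial>\<Omega>)" for n
  proof (rule bl_dist_le)
    fix f assume f: "f \<in> BL_unit"
    note [measurable] = BL_unit_borel[OF f]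
    have i: "integrable \<Omega> (\<lambda>x. f (Y n x))" "integrable \<Omega> (\<lambda>x. f (Z x))"
      using BL_unit_abs_le[OF f] by (auto intro!: integrable_const_bound[of _ 1])
    have "\<bar>(\<integral>x. f x \<partial>\<mu> n) - (\<integral>x. f x \<partial>M)\<bar> = \<bar>(\<integral>x. f (Y n x) - f (Z x) \<partial>\<Omega>)\<bar>"
      unfolding d[symmetric] using i by (simp add: integral_distr)
    also have "\<dots> \<le> (\<integral>x. \<bar>f (Y n x) - f (Z x)\<bar> \<partial>\<Omega>)" by (rule integral_abs_bound)
    also have "\<dots> \<le> (\<integral>x. min 2 \<bar>Y n x - Z x\<bar> \<partial>\<Omega>)"
    proof (rule integral_mono)
      show "integrable \<Omega> (\<lambda>x. min 2 \<bar>Y n x - Z x\<bar>)"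
        by (rule integrable_const_bound[of _ 2]) auto
      show "\<bar>f (Y n x) - f (Z x)\<bar> \<le> min 2 \<bar>Y n x - Z x\<bar>" for x
        using BL_unit_abs_le[OF f, of "Y n x"] BL_unit_abs_le[OF f, of "Z x"] BL_unit_lipschitz[OF f, of "Y n x" "Z x"]
        by auto
    qed (use i in auto)
    finally show "\<bar>(\<integral>x. f x \<partial>\<mu> n) - (\<integral>x. f x \<partial>M)\<bar> \<le> (\<integral>x. min 2 \<bar>Y n x - Z x\<bar> \<partial>\<Omega>)" .
  qed
  have lim0: "(\<lambda>n. \<integral>x. min 2 \<bar>Y n x - Z x\<bar> \<partial>\<Omega>) \<longlonglongrightarrow> 0" using lim by simp
  show ?thesis
    by (rule real_tendsto_sandwich[OF _ _ tendsto_const lim0])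
       (intro always_eventually allI bl_dist_nonneg \<mu> le)+
qed

lemma lipschitz_BL_unit:
  assumes B: "\<And>x. \<bar>f x\<bar> \<le> B" and L: "\<And>x y. \<bar>f x - f y\<bar> \<le> L * \<bar>x - y\<bar>" and "0 < B" "0 \<le> L"
  shows "(\<lambda>x. f x / (B + L)) \<in> BL_unit"
  unfolding BL_unit_def
proof (rule CollectI, rule exI[of _ "B / (B + L)"], rule exI[of _ "L / (B + L)"], intro conjI allI)
  have p: "0 < B + L" using assms by linarith
  show "0 \<le> B / (B + L)" "0 \<le> L / (B + L)" using assms by auto
  show "B / (B + L) + L / (B + L) \<le> 1" using p by (simp add: add_divide_distrib[symmetric])
  show "\<bar>f x / (B + L)\<bar> \<le> B / (B + L)" for x using p B[of x] by (simp add: divide_right_mono)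
  show "\<bar>f x / (B + L) - f y / (B + L)\<bar> \<le> L / (B + L) * \<bar>x - y\<bar>" for x y
    using p L[of x y] by (simp add: diff_divide_distrib[symmetric] divide_right_mono)
qed

lemma bl_dist_lipschitz_bound:
  assumes "real_distribution \<mu>" "real_distribution \<nu>"
    and B: "\<And>x. \<bar>f x\<bar> \<le> B" and L: "\<And>x y. \<bar>f x - f y\<bar> \<le> L * \<bar>x - y\<bar>" and "0 < B" "0 \<le> L"
  shows "\<bar>(\<integral>x. f x \<partial>\<mu>) - (\<integral>x. f x \<partial>\<nu>)\<bar> \<le> (B + L) * bl_dist \<mu> \<nu>"
proof -
  have p: "0 < B + L" using assms by linarith
  have "\<bar>(\<integral>x. f x / (B + L) \<partial>\<mu>) - (\<integral>x. f x / (B + L) \<partial>\<nu>)\<bar> \<le> bl_dist \<mu> \<nu>"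
    by (rule bl_dist_ge[OF assms(1,2) lipschitz_BL_unit[OF B L]]) (use assms in auto)
  then show ?thesis
    using p by (simp add: diff_divide_distrib[symmetric] divide_le_eq mult.commute)
qed

lemma cts_step_lipschitz:
  assumes "a < b"
  shows "\<bar>cts_step a b x - cts_step a b y\<bar> \<le> (1 / (b - a)) * \<bar>x - y\<bar>"
proof -
  have c: "cts_step a b z = min 1 (max 0 ((b - z) / (b - a)))" for z
    using assms by (auto simp: cts_step_def min_def max_def divide_le_eq le_divide_eq)
  have "(b - x) / (b - a) - (b - y) / (b - a) = (y - x) / (b - a)"
    by (simp add: diff_divide_distrib[symmetric])
  then have "\<bar>(b - x) / (b - a) - (b - y) / (b - a)\<bar> = (1 / (b - a)) * \<bar>x - y\<bar>"
    using assms by (simp add: abs_minus_commute)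
  moreover have "\<bar>min 1 (max 0 p) - min 1 (max 0 q)\<bar> \<le> \<bar>p - q\<bar>" for p q :: real
    by (auto simp: min_def max_def)
  ultimately show ?thesis unfolding c by metis
qed

text \<open>The piecewise linear functions \<open>cts_step\<close> are Lipschitz, and convergence of
  their integrals already gives convergence of the distribution functions at continuity
  points.\<close>

lemma bl_dist_imp_weak_conv:
  assumes \<mu>: "\<And>n. real_distribution (\<mu> n)" "real_distribution M" and lim: "(\<lambda>n. bl_dist (\<mu> n) M) \<longlonglongrightarrow> 0"
  shows "weak_conv_m \<mu> M"
proof (rule integral_cts_step_conv_imp_weak_conv[OF \<mu>])
  fix a b :: real assume ab: "a < b"
  let ?c = "1 + 1 / (b - a)"
  have 1: "(\<lambda>n. ?c * bl_dist (\<mu> n) M) \<longlonglongrightarrow> 0" by (rule tendsto_mult_right_zero[OF lim])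
  have 2: "\<bar>(\<integral>x. cts_step a b x \<partial>\<mu> n) - (\<integral>x. cts_step a b x \<partial>M)\<bar> \<le> ?c * bl_dist (\<mu> n) M" for n
  proof (rule bl_dist_lipschitz_bound[OF \<mu>])
    show "\<bar>cts_step a b x\<bar> \<le> 1" for x using ab by (auto simp: cts_step_def)
    show "\<bar>cts_step a b x - cts_step a b y\<bar> \<le> 1 / (b - a) * \<bar>x - y\<bar>" for x y
      by (rule cts_step_lipschitz[OF ab])
  qed (use ab in auto)
  have "(\<lambda>n. (\<integral>x. cts_step a b x \<partial>\<mu> n) - (\<integral>x. cts_step a b x \<partial>M)) \<longlonglongrightarrow> 0"
    unfolding real_norm_def[symmetric] using 2
    by (intro Lim_null_comparison[OF _ 1] always_eventually allI) (simp only: real_norm_def)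
  then show "(\<lambda>n. integral\<^sup>L (\<mu> n) (cts_step a b)) \<longlonglongrightarrow> integral\<^sup>L M (cts_step a b)"
    by (rule LIM_zero_cancel)
qed

text \<open>The constant sequence \<open>\<mu>\<close> converges weakly to \<open>\<nu>\<close>, so
  the characteristic functions agree. This translates the clause
  \<open>\<nu> 0 \<noteq> \<mu>\<close> of \<open>S_rate\<close> into a positive distance.\<close>

lemma bl_dist_eq_0_imp_eq:
  assumes "real_distribution \<mu>" "real_distribution \<nu>" "bl_dist \<mu> \<nu> = 0"
  shows "\<mu> = \<nu>"
proof (rule Levy_uniqueness[OF assms(1,2)])
  have w: "weak_conv_m (\<lambda>n. \<mu>) \<nu>" using assms by (intro bl_dist_imp_weak_conv) auto
  show "char \<mu> = char \<nu>"
  proof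
    fix t
    have "(\<lambda>n::nat. char \<mu> t) \<longlonglongrightarrow> char \<nu> t"
      unfolding char_def using assms w
      by (intro weak_conv_imp_integral_bdd_continuous_conv[where B=1]) (auto intro!: continuous_intros)
    then show "char \<mu> t = char \<nu> t" by (simp add: LIMSEQ_const_iff)
  qed
qed

section \<open>Paths of measures\<close>

lemma path_space_dist: "\<nu> \<in> path_space \<Longrightarrow> t \<in> {0..1} \<Longrightarrow> real_distribution (\<nu> t)"
  unfolding path_space_def by auto

lemma path_dist_ge:
  assumes "\<nu> \<in> path_space" "\<rho> \<in> path_space" "t \<in> {0..1}"
  shows "bl_dist (\<nu> t) (\<rho> t) \<le> path_dist \<nu> \<rho>"
  unfolding path_dist_def using assms
  by (intro cSUP_upper bdd_aboveI2[where M=2]) (auto intro!: bl_dist_le_2 path_space_dist)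

lemma path_dist_le:
  assumes "\<And>t. t \<in> {0..1} \<Longrightarrow> bl_dist (\<nu> t) (\<rho> t) \<le> c"
  shows "path_dist \<nu> \<rho> \<le> c"
  unfolding path_dist_def using assms by (intro cSUP_least) auto

lemma path_dist_nonneg: "\<nu> \<in> path_space \<Longrightarrow> \<rho> \<in> path_space \<Longrightarrow> 0 \<le> path_dist \<nu> \<rho>"
  using path_dist_ge[of \<nu> \<rho> 0] bl_dist_nonneg[of "\<nu> 0" "\<rho> 0"] path_space_dist[of _ 0] by fastforce

lemma path_dist_sym: "path_dist \<nu> \<rho> = path_dist \<rho> \<nu>"
  unfolding path_dist_def by (simp add: bl_dist_sym)

lemma path_dist_triangle:
  assumes "\<mu> \<in> path_space" "\<nu> \<in> path_space" "\<rho> \<in> path_space"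
  shows "path_dist \<mu> \<rho> \<le> path_dist \<mu> \<nu> + path_dist \<nu> \<rho>"
proof (rule path_dist_le)
  fix t :: real assume t: "t \<in> {0..1}"
  show "bl_dist (\<mu> t) (\<rho> t) \<le> path_dist \<mu> \<nu> + path_dist \<nu> \<rho>"
    using bl_dist_triangle[OF path_space_dist[OF assms(1) t] path_space_dist[OF assms(2) t] path_space_dist[OF assms(3) t]]
      path_dist_ge[OF assms(1,2) t] path_dist_ge[OF assms(2,3) t] by linarith
qed

lemma path_space_weak_conv:
  assumes \<nu>: "\<nu> \<in> path_space" and "u \<longlonglongrightarrow> t" "\<And>n. u n \<in> {0..1}" "t \<in> {0..1}"
  shows "weak_conv_m (\<lambda>n. \<nu> (u n)) (\<nu> t)"
proof (rule bl_dist_imp_weak_conv)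
  show "(\<lambda>n. bl_dist (\<nu> (u n)) (\<nu> t)) \<longlonglongrightarrow> 0"
  proof (rule LIMSEQ_I)
    fix e :: real assume "0 < e"
    then obtain d where d: "d > 0" "\<forall>s\<in>{0..1}. \<bar>s - t\<bar> < d \<longrightarrow> bl_dist (\<nu> s) (\<nu> t) < e"
      using \<nu> assms(4) unfolding path_space_def by blast
    then obtain n0 where "\<forall>n\<ge>n0. \<bar>u n - t\<bar> < d" using LIMSEQ_D[OF assms(2) d(1)] by auto
    then show "\<exists>no. \<forall>n\<ge>no. norm (bl_dist (\<nu> (u n)) (\<nu> t) - 0) < e"
      using d assms(3,4) bl_dist_nonneg[OF path_space_dist[OF \<nu>] path_space_dist[OF \<nu>]] by (intro exI[of _ n0]) auto
  qed
qed (use assms path_space_dist in auto)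

lemma bl_dist_limit_le:
  assumes "\<And>n. real_distribution (\<mu> n)" "\<And>n. real_distribution (\<nu> n)" "real_distribution M" "real_distribution N"
    and "(\<lambda>n. bl_dist (\<mu> n) M) \<longlonglongrightarrow> 0" "(\<lambda>n. bl_dist (\<nu> n) N) \<longlonglongrightarrow> 0"
    and "\<And>n. bl_dist (\<mu> n) (\<nu> n) \<le> e"
  shows "bl_dist M N \<le> e"
proof -
  have 1: "(\<lambda>n. bl_dist (\<mu> n) M + e + bl_dist (\<nu> n) N) \<longlonglongrightarrow> 0 + e + 0"
    by (intro tendsto_add tendsto_const assms(5,6))
  have 2: "bl_dist M N \<le> bl_dist (\<mu> n) M + e + bl_dist (\<nu> n) N" for n
    using bl_dist_triangle[OF assms(3) assms(1)[of n] assms(4)] bl_dist_triangle[OF assms(1)[of n] assms(2)[of n] assms(4)]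
      assms(7)[of n] bl_dist_sym[of M "\<mu> n"] by linarith
  show ?thesis using LIMSEQ_le_const[OF 1, of "bl_dist M N"] 2 by auto
qed

text \<open>Arzela-Ascoli for measure-valued paths: tightness supplies compactness at each time
  (Prokhorov), a diagonal sequence converges at all rational times, and equicontinuity carries this
  to all times and makes it uniform.\<close>

theorem path_sequence_compact:
  assumes \<nu>: "\<And>n. \<nu> n \<in> path_space"
    and tight: "\<And>e. e > 0 \<Longrightarrow> \<exists>a b. a < b \<and> (\<forall>n. \<forall>t\<in>{0..1}. measure (\<nu> n t) {a<..b} > 1 - e)"
    and equi: "\<And>e. e > 0 \<Longrightarrow> \<exists>\<delta>>0. \<forall>n. \<forall>s\<in>{0..1}. \<forall>t\<in>{0..1}. \<bar>s - t\<bar> < \<delta> \<longrightarrow> bl_dist (\<nu> n s) (\<nu> n t) < e"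
  shows "\<exists>(r :: nat \<Rightarrow> nat) x. strict_mono r \<and> x \<in> path_space \<and> (\<lambda>n. path_dist (\<nu> (r n)) x) \<longlonglongrightarrow> 0"
proof -
  have rd: "real_distribution (\<nu> n t)" if "t \<in> {0..1}" for n t using path_space_dist[OF \<nu> that] .
  have tight_at: "tight (\<lambda>k. \<nu> (s k) t)" if "t \<in> {0..1}" for s :: "nat \<Rightarrow> nat" and t
    unfolding tight_def
  proof (intro conjI allI impI)
    fix e :: real assume "e > 0"
    from tight[OF this] obtain a b where "a < b" "\<forall>n. \<forall>t\<in>{0..1}. measure (\<nu> n t) {a<..b} > 1 - e" by blast
    then show "\<exists>a b. a < b \<and> (\<forall>k. 1 - e < measure (\<nu> (s k) t) {a<..b})" using that by blast
  qed (rule rd[OF that])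
  have lim_at: "\<exists>r L. strict_mono (r::nat \<Rightarrow> nat) \<and> real_distribution L \<and> (\<lambda>k. bl_dist (\<nu> (s (r k)) t) L) \<longlonglongrightarrow> 0"
    if t: "t \<in> {0..1}" for s t
  proof -
    obtain r L where r: "strict_mono (r::nat \<Rightarrow> nat)" "real_distribution L" "weak_conv_m ((\<lambda>k. \<nu> (s k) t) \<circ> id \<circ> r) L"
      using tight_imp_convergent_subsubsequence[OF tight_at[OF t, of s] strict_mono_id] by blast
    have "(\<lambda>k. bl_dist (\<nu> (s (r k)) t) L) \<longlonglongrightarrow> 0"
      using r by (intro weak_conv_imp_bl_dist rd t) (auto simp: comp_def)
    with r show ?thesis by blast
  qed
  define q where "q = from_nat_into (\<rat> \<inter> {0..1::real})"
  have q_range: "range q = \<rat> \<inter> {0..1}"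
    unfolding q_def
  proof (rule range_from_nat_into)
    have "0 \<in> \<rat> \<inter> {0..1::real}" by simp
    then show "\<rat> \<inter> {0..1::real} \<noteq> {}" by blast
  qed (intro countable_Int1 countable_rat)
  then have q01: "q n \<in> {0..1}" for n by auto
  define P where "P n s \<longleftrightarrow> (\<exists>L. real_distribution L \<and> (\<lambda>k. bl_dist (\<nu> (s k) (q n)) L) \<longlonglongrightarrow> 0)" for n and s :: "nat \<Rightarrow> nat"
  interpret subseqs P
  proof
    fix n and s :: "nat \<Rightarrow> nat"
    show "\<exists>r'. strict_mono r' \<and> P n (s \<circ> r')"
      using lim_at[OF q01, of s n] unfolding P_def comp_def by blast
  qed
  define d where "d = diagseq"
  have d_mono: "strict_mono d" unfolding d_def by (rule subseq_diagseq)
  \<comment> \<open>Beyond index n the diagonal sequence is a subsequence of the n-th extracted one;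
    \<open>LIMSEQ_offset\<close> restores the omitted initial segment.\<close>
  have Pd: "P n d" for n
  proof -
    have "P n (diagseq \<circ> ((+) (Suc n)))"
    proof (rule diagseq_holds)
      fix m and r s :: "nat \<Rightarrow> nat" assume "strict_mono r" "P m s"
      then show "P m (s \<circ> r)"
        unfolding P_def comp_def using LIMSEQ_subseq_LIMSEQ[unfolded comp_def] by blast
    qed
    then obtain L where L: "real_distribution L" "(\<lambda>k. bl_dist (\<nu> (diagseq (Suc n + k)) (q n)) L) \<longlonglongrightarrow> 0"
      unfolding P_def comp_def by blast
    have "(\<lambda>k. bl_dist (\<nu> (diagseq k) (q n)) L) \<longlonglongrightarrow> 0"
      by (rule LIMSEQ_offset[where k="Suc n"]) (use L(2) in \<open>simp only: add.commute[of _ "Suc n"]\<close>)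
    with L show ?thesis unfolding P_def d_def by blast
  qed
  have "\<exists>L. real_distribution L \<and> (\<lambda>k. bl_dist (\<nu> (d k) t) L) \<longlonglongrightarrow> 0" if t: "t \<in> {0..1}" for t
  proof -
    obtain r L where r: "strict_mono (r::nat \<Rightarrow> nat)" and L: "real_distribution L"
      and lim: "(\<lambda>k. bl_dist (\<nu> (d (r k)) t) L) \<longlonglongrightarrow> 0" using lim_at[OF t, of d] by blast
    \<comment> \<open>The subsequence \<open>r\<close> only identifies the limit \<open>L\<close>.
      Convergence of the whole sequence \<open>d\<close> is a Cauchy argument through a rational
      time near \<open>t\<close>: five distances, hence \<open>e / 5\<close>.\<close>
    have "(\<lambda>k. bl_dist (\<nu> (d k) t) L) \<longlonglongrightarrow> 0"
    proof (rule LIMSEQ_I)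
      fix e :: real assume e: "0 < e"
      then obtain \<delta> where "\<delta> > 0" and \<delta>: "\<forall>n. \<forall>s\<in>{0..1}. \<forall>t\<in>{0..1}. \<bar>s - t\<bar> < \<delta> \<longrightarrow> bl_dist (\<nu> n s) (\<nu> n t) < e / 5"
        using equi[of "e / 5"] by auto
      have "\<exists>x\<in>\<rat> \<inter> {0..1}. \<bar>x - t\<bar> < \<delta>"
      proof (cases "t = 0")
        case True then show ?thesis using \<open>\<delta> > 0\<close> by (intro bexI[of _ 0]) auto
      next
        case False
        then have "max 0 (t - \<delta>) < t" using t \<open>\<delta> > 0\<close> by auto
        then obtain x where "x \<in> \<rat>" "max 0 (t - \<delta>) < x" "x < t" using Rats_dense_in_real by blast
        then show ?thesis using t by (intro bexI[of _ x]) auto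
      qed
      then obtain m where m: "\<bar>q m - t\<bar> < \<delta>" using q_range by (metis imageE)
      obtain Lq where Lq: "real_distribution Lq" "(\<lambda>k. bl_dist (\<nu> (d k) (q m)) Lq) \<longlonglongrightarrow> 0"
        using Pd[of m] unfolding P_def by blast
      obtain n0 where n0: "\<And>n. n \<ge> n0 \<Longrightarrow> bl_dist (\<nu> (d n) (q m)) Lq < e / 5"
        using LIMSEQ_D[OF Lq(2), of "e/5"] e by fastforce
      obtain n1 where n1: "\<And>n. n \<ge> n1 \<Longrightarrow> bl_dist (\<nu> (d (r n)) t) L < e / 5"
        using LIMSEQ_D[OF lim, of "e/5"] e by fastforce
      define k where "k = max n0 n1"
      have k: "r k \<ge> n0" "k \<ge> n1" using seq_suble[OF r, of k] by (auto simp: k_def)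
      show "\<exists>no. \<forall>n\<ge>no. norm (bl_dist (\<nu> (d n) t) L - 0) < e"
      proof (intro exI[of _ n0] allI impI)
        fix n assume n: "n \<ge> n0"
        let ?a = "\<nu> (d n) t" and ?b = "\<nu> (d n) (q m)" and ?c = "\<nu> (d (r k)) (q m)" and ?f = "\<nu> (d (r k)) t"
        have r1: "real_distribution ?a" "real_distribution ?b" "real_distribution ?c" "real_distribution ?f"
          using rd t q01 by auto
        have "bl_dist ?a L \<le> bl_dist ?a ?b + bl_dist ?b L" by (rule bl_dist_triangle) (use r1 L in auto)
        moreover have "bl_dist ?b L \<le> bl_dist ?b Lq + bl_dist Lq L" by (rule bl_dist_triangle) (use r1 L Lq in auto)
        moreover have "bl_dist Lq L \<le> bl_dist Lq ?c + bl_dist ?c L" by (rule bl_dist_triangle) (use r1 L Lq in auto)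
        moreover have "bl_dist ?c L \<le> bl_dist ?c ?f + bl_dist ?f L" by (rule bl_dist_triangle) (use r1 L Lq in auto)
        moreover have "bl_dist ?a ?b < e / 5" "bl_dist ?c ?f < e / 5"
          using \<delta> m t q01[of m] by (auto simp: abs_minus_commute)
        moreover have "bl_dist ?b Lq < e / 5" "bl_dist Lq ?c < e / 5"
          using n0[OF n] n0[OF k(1)] by (auto simp: bl_dist_sym)
        moreover have "bl_dist ?f L < e / 5" using n1[OF k(2)] .
        ultimately have "bl_dist ?a L < e" by linarith
        then show "norm (bl_dist (\<nu> (d n) t) L - 0) < e" using bl_dist_nonneg[OF r1(1) L] by simp
      qed
    qed
    with L show ?thesis by blast
  qed
  then obtain x where x: "\<And>t. t \<in> {0..1} \<Longrightarrow> real_distribution (x t)"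
    and xlim: "\<And>t. t \<in> {0..1} \<Longrightarrow> (\<lambda>k. bl_dist (\<nu> (d k) t) (x t)) \<longlonglongrightarrow> 0" by metis
  have x_equi: "\<exists>\<delta>>0. (\<forall>s\<in>{0..1}. \<forall>t\<in>{0..1}. \<bar>s - t\<bar> < \<delta> \<longrightarrow> bl_dist (x s) (x t) \<le> e \<and> (\<forall>n. bl_dist (\<nu> n s) (\<nu> n t) < e))"
    if e: "e > 0" for e
  proof -
    obtain \<delta> where "\<delta> > 0" and \<delta>: "\<forall>n. \<forall>s\<in>{0..1}. \<forall>t\<in>{0..1}. \<bar>s - t\<bar> < \<delta> \<longrightarrow> bl_dist (\<nu> n s) (\<nu> n t) < e"
      using equi[OF e] by blast
    have "bl_dist (x s) (x t) \<le> e" if "s \<in> {0..1}" "t \<in> {0..1}" "\<bar>s - t\<bar> < \<delta>" for s t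
      using that \<delta> by (intro bl_dist_limit_le[OF rd rd x x xlim xlim]) (auto intro!: less_imp_le)
    with \<open>\<delta> > 0\<close> \<delta> show ?thesis by blast
  qed
  have xp: "x \<in> path_space"
    unfolding path_space_def
  proof (intro CollectI conjI ballI allI impI x)
    fix t e :: real assume t: "t \<in> {0..1}" and e: "e > 0"
    obtain \<delta> where "\<delta> > 0" and "\<forall>s\<in>{0..1}. \<forall>t\<in>{0..1}. \<bar>s - t\<bar> < \<delta> \<longrightarrow> bl_dist (x s) (x t) \<le> e / 2"
      using x_equi[of "e / 2"] e by fastforce
    with t e show "\<exists>\<delta>>0. \<forall>s\<in>{0..1}. \<bar>s - t\<bar> < \<delta> \<longrightarrow> bl_dist (x s) (x t) < e"
      by (intro exI[of _ \<delta>]) fastforce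
  qed
  have "(\<lambda>n. path_dist (\<nu> (d n)) x) \<longlonglongrightarrow> 0"
  proof (rule LIMSEQ_I)
    fix e :: real assume e: "0 < e"
    obtain \<delta> where "\<delta> > 0" and \<delta>: "\<And>s t n. s \<in> {0..1} \<Longrightarrow> t\<in>{0..1} \<Longrightarrow> \<bar>s - t\<bar> < \<delta> \<Longrightarrow>
        bl_dist (x s) (x t) \<le> e / 4 \<and> bl_dist (\<nu> n s) (\<nu> n t) < e / 4"
      using x_equi[of "e / 4"] e by fastforce
    \<comment> \<open>Convergence is uniform on a finite grid whose mesh 1/m is below the modulus
      \<open>\<delta>\<close>; every \<open>t\<close> is compared with the grid point to its
      left.\<close>
    obtain m :: nat where m: "m > 0" "1 / real m < \<delta>"
      using \<open>\<delta> > 0\<close> by (metis nat_approx_posE zero_less_Suc)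
    have j01: "real j / real m \<in> {0..1}" if "j \<le> m" for j using that m by auto
    have "\<forall>j\<in>{..m}. \<forall>\<^sub>F n in sequentially. bl_dist (\<nu> (d n) (real j / real m)) (x (real j / real m)) < e / 4"
      using e by (intro ballI order_tendstoD(2)[OF xlim[OF j01]]) auto
    then have "\<forall>\<^sub>F n in sequentially. \<forall>j\<in>{..m}. bl_dist (\<nu> (d n) (real j / real m)) (x (real j / real m)) < e / 4"
      by (intro eventually_ball_finite) auto
    then obtain n0 where n0: "\<And>n j. n \<ge> n0 \<Longrightarrow> j \<le> m \<Longrightarrow> bl_dist (\<nu> (d n) (real j / real m)) (x (real j / real m)) < e / 4"
      unfolding eventually_sequentially by auto
    show "\<exists>no. \<forall>n\<ge>no. norm (path_dist (\<nu> (d n)) x - 0) < e"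
    proof (intro exI[of _ n0] allI impI)
      fix n assume n: "n \<ge> n0"
      have "path_dist (\<nu> (d n)) x \<le> 3 * e / 4"
      proof (rule path_dist_le)
        fix t :: real assume t: "t \<in> {0..1}"
        define j where "j = nat \<lfloor>real m * t\<rfloor>"
        have jm: "real j \<le> real m * t" "real m * t < real j + 1"
          using t m by (auto simp: j_def)
        have "real m * t \<le> real m * 1" using t by (intro mult_left_mono) auto
        then have jle: "j \<le> m" using jm by linarith
        let ?q = "real j / real m"
        have close: "\<bar>t - ?q\<bar> < \<delta>"
        proof -
          have "?q \<le> t" using jm m by (simp add: divide_le_eq mult.commute)
          moreover have "t < (real j + 1) / real m" using jm m by (simp add: less_divide_eq mult.commute)
          then have "t - ?q < 1 / real m" by (simp add: add_divide_distrib)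
          ultimately show ?thesis using m by linarith
        qed
        note q = j01[OF jle]
        have "bl_dist (\<nu> (d n) t) (x t) \<le> bl_dist (\<nu> (d n) t) (\<nu> (d n) ?q) + bl_dist (\<nu> (d n) ?q) (x t)"
          by (rule bl_dist_triangle[OF rd[OF t] rd[OF q] x[OF t]])
        moreover have "bl_dist (\<nu> (d n) ?q) (x t) \<le> bl_dist (\<nu> (d n) ?q) (x ?q) + bl_dist (x ?q) (x t)"
          by (rule bl_dist_triangle[OF rd[OF q] x[OF q] x[OF t]])
        moreover have "bl_dist (\<nu> (d n) t) (\<nu> (d n) ?q) < e / 4" using \<delta>[OF t q close] by blast
        moreover have "bl_dist (x ?q) (x t) \<le> e / 4" using \<delta>[OF t q close] bl_dist_sym by metis
        moreover have "bl_dist (\<nu> (d n) ?q) (x ?q) < e / 4" using n0[OF n jle] .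
        ultimately show "bl_dist (\<nu> (d n) t) (x t) \<le> 3 * e / 4" by linarith
      qed
      then show "norm (path_dist (\<nu> (d n)) x - 0) < e" using path_dist_nonneg[OF \<nu> xp] e by simp
    qed
  qed
  with d_mono xp show ?thesis by blast
qed

section \<open>Continuity of the functionals defining the rate function\<close>

lemma divided_diff_commute: "divided_diff g g' x y = divided_diff g g' y x"
  unfolding divided_diff_def using minus_divide_divide[of "g y - g x" "y - x"] by simp

text \<open>The mean value theorem, phrased so that the diagonal \<open>x = y\<close> is included;
  the localisation of \<open>z\<close> is what makes divided differences converge when both
  arguments tend to the same point.\<close>

lemma divided_diff_mvt:
  assumes "\<And>x. (g has_real_derivative g' x) (at x)"
  shows "\<exists>z. \<bar>z - x\<bar> \<le> \<bar>x - y\<bar> \<and> divided_diff g g' x y = g' z"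
proof -
  have *: "\<exists>z. a < z \<and> z < b \<and> divided_diff g g' b a = g' z" if ab: "a < b" for a b
  proof -
    obtain z where "a < z" "z < b" "g b - g a = (b - a) * g' z" using MVT2[OF ab, of g g'] assms by blast
    with ab show ?thesis by (intro exI[of _ z]) (simp add: divided_diff_def)
  qed
  consider "x = y" | "x < y" | "y < x" by linarith
  then show ?thesis
  proof cases
    case 1 then show ?thesis by (intro exI[of _ x]) (auto simp: divided_diff_def)
  next
    case 2
    with *[OF 2] show ?thesis unfolding divided_diff_commute[of g g' x y] by (elim exE) (auto intro!: exI)
  next
    case 3
    with *[OF 3] show ?thesis by (elim exE) (auto intro!: exI)
  qed
qed

lemma divided_diff_abs_le:
  assumes "\<And>x. (g has_real_derivative g' x) (at x)" "\<And>x. \<bar>g' x\<bar> \<le> B"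
  shows "\<bar>divided_diff g g' x y\<bar> \<le> B"
  using divided_diff_mvt[OF assms(1), of x y] assms(2) by auto

text \<open>Off the diagonal this is convergence of quotients. At a diagonal limit the approximating
  points may or may not coincide; an intermediate value \<open>g' n (z n)\<close> with
  \<open>z n\<close> squeezed to \<open>x\<close> treats both possibilities.\<close>

lemma divided_diff_tendsto:
  assumes d: "\<And>n x. (g n has_real_derivative g' n x) (at x)"
    and c: "\<And>x xs. xs \<longlonglongrightarrow> x \<Longrightarrow> (\<lambda>n. g n (xs n)) \<longlonglongrightarrow> h x"
           "\<And>x xs. xs \<longlonglongrightarrow> x \<Longrightarrow> (\<lambda>n. g' n (xs n)) \<longlonglongrightarrow> h' x"
    and xy: "xs \<longlonglongrightarrow> x" "ys \<longlonglongrightarrow> y"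
  shows "(\<lambda>n. divided_diff (g n) (g' n) (xs n) (ys n)) \<longlonglongrightarrow> divided_diff h h' x y"
proof (cases "x = y")
  case False
  then have "\<forall>\<^sub>F n in sequentially. xs n - ys n \<noteq> 0"
    using tendsto_imp_eventually_ne[OF tendsto_diff[OF xy], of 0] by simp
  then have "\<forall>\<^sub>F n in sequentially. (g n (xs n) - g n (ys n)) / (xs n - ys n) = divided_diff (g n) (g' n) (xs n) (ys n)"
    by eventually_elim (auto simp: divided_diff_def)
  moreover have "(\<lambda>n. (g n (xs n) - g n (ys n)) / (xs n - ys n)) \<longlonglongrightarrow> divided_diff h h' x y"
    using False by (auto simp: divided_diff_def intro!: tendsto_intros c xy)
  ultimately show ?thesis by (rule Lim_transform_eventually[rotated])
next
  case True
  have "\<forall>n. \<exists>z. \<bar>z - xs n\<bar> \<le> \<bar>xs n - ys n\<bar> \<and> divided_diff (g n) (g' n) (xs n) (ys n) = g' n z"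
    using divided_diff_mvt[OF d] by auto
  from choice[OF this] obtain z where z: "\<And>n. \<bar>z n - xs n\<bar> \<le> \<bar>xs n - ys n\<bar>"
    "\<And>n. divided_diff (g n) (g' n) (xs n) (ys n) = g' n (z n)" by blast
  have l: "(\<lambda>n. \<bar>xs n - ys n\<bar>) \<longlonglongrightarrow> 0"
    using True tendsto_rabs[OF tendsto_diff[OF xy]] by simp
  have "(\<lambda>n. z n - xs n) \<longlonglongrightarrow> 0"
    by (rule Lim_null_comparison[OF _ l]) (simp add: z(1))
  then have "(\<lambda>n. (z n - xs n) + xs n) \<longlonglongrightarrow> 0 + x" by (intro tendsto_add xy)
  then have "z \<longlonglongrightarrow> x" by simp
  from c(2)[OF this] show ?thesis unfolding z(2) using True by (simp add: divided_diff_def)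
qed

section \<open>Integrals of jointly continuous bounded functions along a path\<close>

text \<open>The condition that \<open>C21b\<close> imposes on each of its four functions, isolated
  so that continuity statements can be proved for one integrand at a time.\<close>

definition cbdd :: "(real \<Rightarrow> real \<Rightarrow> real) \<Rightarrow> bool" where
  "cbdd g \<longleftrightarrow> continuous_on (UNIV \<times> {0..1}) (\<lambda>(x, t). g x t) \<and> bounded ((\<lambda>(x, t). g x t) ` (UNIV \<times> {0..1}))"

lemma cbdd_bound: "cbdd g \<Longrightarrow> \<exists>B>0. \<forall>x. \<forall>t\<in>{0..1}. \<bar>g x t\<bar> \<le> B"
  unfolding cbdd_def bounded_pos by auto

lemma cbdd_seq:
  assumes g: "cbdd g" and x: "xs \<longlonglongrightarrow> x" and u: "us \<longlonglongrightarrow> u" "\<And>n. us n \<in> {0..1}" "u \<in> {0..1}"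
  shows "(\<lambda>n. g (xs n) (us n)) \<longlonglongrightarrow> g x u"
proof -
  have "continuous_on (UNIV \<times> {0..1}) (\<lambda>(x, t). g x t)" using g by (simp add: cbdd_def)
  then have "((\<lambda>(x, t). g x t) \<circ> (\<lambda>n. (xs n, us n))) \<longlonglongrightarrow> (\<lambda>(x, t). g x t) (x, u)"
    using u x by (intro continuous_on_sequentially[THEN iffD1, rule_format]) (auto intro!: tendsto_Pair)
  then show ?thesis by (simp add: comp_def)
qed

lemma cbdd_measurable:
  assumes "cbdd g" "t \<in> {0..1}"
  shows "(\<lambda>x. g x t) \<in> borel_measurable borel"
  by (intro borel_measurable_continuous_onI continuous_on_sequentially[THEN iffD2])
     (auto simp: comp_def intro!: cbdd_seq[OF assms(1) _ tendsto_const] assms(2))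

lemma cbdd_tendsto_integral:
  assumes g: "cbdd g" and \<mu>: "\<And>n. real_distribution (\<mu> n)" "real_distribution M" "weak_conv_m \<mu> M"
    and u: "us \<longlonglongrightarrow> u" "\<And>n. us n \<in> {0..1}" "u \<in> {0..1}"
  shows "(\<lambda>n. \<integral>x. g x (us n) \<partial>\<mu> n) \<longlonglongrightarrow> (\<integral>x. g x u \<partial>M)"
proof -
  obtain B where B: "\<And>x t. t \<in> {0..1} \<Longrightarrow> \<bar>g x t\<bar> \<le> B" using cbdd_bound[OF g] by blast
  show ?thesis
    by (rule weak_conv_moving_integral[OF \<mu>, where B=B])
       (auto intro!: cbdd_measurable[OF g] B u cbdd_seq[OF g] simp del: atLeastAtMost_iff)
qed

lemma divided_diff_measurable:
  assumes "\<And>x. (g has_real_derivative g' x) (at x)" "continuous_on UNIV g'"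
  shows "(\<lambda>z. divided_diff g g' (fst z) (snd z)) \<in> borel_measurable borel"
proof (intro borel_measurable_continuous_onI continuous_on_sequentially[THEN iffD2] allI ballI impI, elim conjE)
  fix xs and x :: "real \<times> real" assume x: "xs \<longlonglongrightarrow> x"
  have g: "continuous_on UNIV g" using assms(1) by (meson DERIV_continuous continuous_at_imp_continuous_on)
  show "((\<lambda>z. divided_diff g g' (fst z) (snd z)) \<circ> xs) \<longlonglongrightarrow> divided_diff g g' (fst x) (snd x)"
    unfolding comp_def
    by (rule divided_diff_tendsto)
       (auto intro!: assms(1) tendsto_fst tendsto_snd x continuous_on_tendsto_compose[OF g] continuous_on_tendsto_compose[OF assms(2)])
qed

lemma cbdd_continuous:
  assumes "cbdd g" "t \<in> {0..1}"
  shows "continuous_on UNIV (\<lambda>x. g x t)"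
  by (intro continuous_on_sequentially[THEN iffD2])
     (auto simp: comp_def intro!: cbdd_seq[OF assms(1) _ tendsto_const] assms(2))

lemma divided_diff_tendsto_integral:
  assumes g: "cbdd g" "cbdd g'" and d: "\<And>x t. t \<in> {0..1} \<Longrightarrow> ((\<lambda>y. g y t) has_real_derivative g' x t) (at x)"
    and \<mu>: "\<And>n. real_distribution (\<mu> n)" "real_distribution M" "weak_conv_m \<mu> M"
    and u: "us \<longlonglongrightarrow> u" "\<And>n. us n \<in> {0..1}" "u \<in> {0..1}"
  shows "(\<lambda>n. \<integral>z. divided_diff (\<lambda>x. g x (us n)) (\<lambda>x. g' x (us n)) (fst z) (snd z) \<partial>(\<mu> n \<Otimes>\<^sub>M \<mu> n))
     \<longlonglongrightarrow> (\<integral>z. divided_diff (\<lambda>x. g x u) (\<lambda>x. g' x u) (fst z) (snd z) \<partial>(M \<Otimes>\<^sub>M M))"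
proof -
  obtain B where B: "\<And>x t. t \<in> {0..1} \<Longrightarrow> \<bar>g' x t\<bar> \<le> B" using cbdd_bound[OF g(2)] by blast
  show ?thesis
  proof (rule weak_conv_moving_integral_pair[OF \<mu>, where B=B])
    show "\<bar>divided_diff (\<lambda>x. g x (us n)) (\<lambda>x. g' x (us n)) (fst z) (snd z)\<bar> \<le> B" for n z
      by (rule divided_diff_abs_le[OF d[OF u(2)] B[OF u(2)]])
    show "(\<lambda>n. divided_diff (\<lambda>x. g x (us n)) (\<lambda>x. g' x (us n)) (fst (xs n)) (snd (xs n)))
         \<longlonglongrightarrow> divided_diff (\<lambda>x. g x u) (\<lambda>x. g' x u) (fst x) (snd x)" if "xs \<longlonglongrightarrow> x" for x xs
      by (rule divided_diff_tendsto)
         (use that in \<open>auto intro!: d u cbdd_seq[OF g(1)] cbdd_seq[OF g(2)] tendsto_fst tendsto_snd simp del: atLeastAtMost_iff\<close>)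
  qed (auto intro!: divided_diff_measurable d u cbdd_continuous[OF g(2)] simp del: atLeastAtMost_iff)
qed

lemma path_integral_continuous:
  assumes "cbdd g" "\<nu> \<in> path_space"
  shows "continuous_on {0..1} (\<lambda>u. \<integral>x. g x u \<partial>\<nu> u)"
proof (intro continuous_on_sequentially[THEN iffD2] allI ballI impI, elim conjE)
  fix us and u :: real assume u: "u \<in> {0..1}" "\<forall>n. us n \<in> {0..1}" "us \<longlonglongrightarrow> u"
  show "((\<lambda>u. \<integral>x. g x u \<partial>\<nu> u) \<circ> us) \<longlonglongrightarrow> (\<integral>x. g x u \<partial>\<nu> u)"
    unfolding comp_def using u
    by (intro cbdd_tendsto_integral[OF assms(1)] path_space_dist[OF assms(2)] path_space_weak_conv[OF assms(2)]) blast+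
qed

lemma path_divided_diff_continuous:
  assumes "cbdd g" "cbdd g'" "\<And>x t. t \<in> {0..1} \<Longrightarrow> ((\<lambda>y. g y t) has_real_derivative g' x t) (at x)" "\<nu> \<in> path_space"
  shows "continuous_on {0..1} (\<lambda>u. \<integral>z. divided_diff (\<lambda>x. g x u) (\<lambda>x. g' x u) (fst z) (snd z) \<partial>(\<nu> u \<Otimes>\<^sub>M \<nu> u))"
proof (intro continuous_on_sequentially[THEN iffD2] allI ballI impI, elim conjE)
  fix us and u :: real assume u: "u \<in> {0..1}" "\<forall>n. us n \<in> {0..1}" "us \<longlonglongrightarrow> u"
  show "((\<lambda>u. \<integral>z. divided_diff (\<lambda>x. g x u) (\<lambda>x. g' x u) (fst z) (snd z) \<partial>(\<nu> u \<Otimes>\<^sub>M \<nu> u)) \<circ> us)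
     \<longlonglongrightarrow> (\<integral>z. divided_diff (\<lambda>x. g x u) (\<lambda>x. g' x u) (fst z) (snd z) \<partial>(\<nu> u \<Otimes>\<^sub>M \<nu> u))"
    unfolding comp_def using u
    by (intro divided_diff_tendsto_integral[OF assms(1-3)] path_space_dist[OF assms(4)] path_space_weak_conv[OF assms(4)]) blast+
qed

lemma integral_divided_diff_abs_le:
  assumes "\<And>x. (g has_real_derivative g' x) (at x)" "\<And>x. \<bar>g' x\<bar> \<le> B" "real_distribution \<mu>"
  shows "\<bar>\<integral>z. divided_diff g g' (fst z) (snd z) \<partial>(\<mu> \<Otimes>\<^sub>M \<mu>)\<bar> \<le> B"
proof -
  interpret real_distribution \<mu> by fact
  interpret P: pair_prob_space \<mu> \<mu> ..
  have B0: "0 \<le> B" using assms(2)[of 0] by linarith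
  show ?thesis
  proof (cases "integrable (\<mu> \<Otimes>\<^sub>M \<mu>) (\<lambda>z. divided_diff g g' (fst z) (snd z))")
    case True
    have "\<bar>\<integral>z. divided_diff g g' (fst z) (snd z) \<partial>(\<mu> \<Otimes>\<^sub>M \<mu>)\<bar> \<le> (\<integral>z. \<bar>divided_diff g g' (fst z) (snd z)\<bar> \<partial>(\<mu> \<Otimes>\<^sub>M \<mu>))"
      by (rule integral_abs_bound)
    also have "\<dots> \<le> (\<integral>z. B \<partial>(\<mu> \<Otimes>\<^sub>M \<mu>))"
      using True by (intro integral_mono divided_diff_abs_le assms) auto
    also have "\<dots> = B" by (simp only: lebesgue_integral_const P.prob_space) simp
    finally show ?thesis .
  qed (simp add: not_integrable_integral_eq B0)
qed

lemma set_integral_tendsto: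
  fixes F :: "nat \<Rightarrow> real \<Rightarrow> real"
  assumes c: "\<And>n. continuous_on {0..1} (F n)" "continuous_on {0..1} G" and st: "0 \<le> s" "t \<le> 1"
    and l: "\<And>u. u \<in> {0..1} \<Longrightarrow> (\<lambda>n. F n u) \<longlonglongrightarrow> G u" and B: "\<And>n u. u \<in> {0..1} \<Longrightarrow> \<bar>F n u\<bar> \<le> B"
  shows "(\<lambda>n. LBINT u:{s..t}. F n u) \<longlonglongrightarrow> (LBINT u:{s..t}. G u)"
  unfolding set_lebesgue_integral_def
proof (rule integral_dominated_convergence[where w="\<lambda>u. indicator {s..t} u * B"])
  have sub: "{s..t} \<subseteq> {0..1}" using st by auto
  have m: "(\<lambda>u. indicator {s..t} u *\<^sub>R f u) \<in> borel_measurable lborel" if "continuous_on {0..1} f" for f :: "real \<Rightarrow> real"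
    using borel_measurable_continuous_on_indicator[OF _ continuous_on_subset[OF that sub]] by simp
  show "(\<lambda>u. indicator {s..t} u *\<^sub>R G u) \<in> borel_measurable lborel"
    "\<And>n. (\<lambda>u. indicator {s..t} u *\<^sub>R F n u) \<in> borel_measurable lborel"
    using c m by auto
  show "integrable lborel (\<lambda>u. indicator {s..t} u * B)"
    by (intro integrable_mult_left integrable_real_indicator) (auto simp: emeasure_lborel_Icc_eq)
  show "AE u in lborel. (\<lambda>n. indicator {s..t} u *\<^sub>R F n u) \<longlonglongrightarrow> indicator {s..t} u *\<^sub>R G u"
    using l sub by (intro AE_I2) (auto split: split_indicator)
  show "AE u in lborel. norm (indicator {s..t} u *\<^sub>R F n u) \<le> indicator {s..t} u * B" for n
    using B[of _ n] sub by (intro AE_I2) (auto split: split_indicator)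
qed

lemma set_integral_abs_le:
  fixes F :: "real \<Rightarrow> real"
  assumes "\<And>u. u \<in> {s..t} \<Longrightarrow> \<bar>F u\<bar> \<le> B" "s \<le> t" "0 \<le> B"
  shows "\<bar>LBINT u:{s..t}. F u\<bar> \<le> (t - s) * B"
proof (cases "set_integrable lborel {s..t} F")
  case True
  have "\<bar>LBINT u:{s..t}. F u\<bar> \<le> (LBINT u:{s..t}. \<bar>F u\<bar>)" using set_integral_norm_bound[OF True] by simp
  also have "\<dots> \<le> (LBINT u:{s..t}. B)"
    using True assms by (intro set_integral_mono set_integrable_abs) (auto simp: set_integrable_def)
  also have "\<dots> = (t - s) * B" using assms by (simp add: set_lebesgue_integral_def)
  finally show ?thesis .
next
  case False
  then show ?thesis using assms by (simp add: set_integrable_def set_lebesgue_integral_def not_integrable_integral_eq)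
qed

lemma C21b_cbdd: "C21b f fx fxx ft \<Longrightarrow> cbdd f \<and> cbdd fx \<and> cbdd fxx \<and> cbdd ft"
  unfolding C21b_def cbdd_def by auto

lemma C21b_deriv:
  assumes "C21b f fx fxx ft" "t \<in> {0..1}"
  shows "((\<lambda>y. f y t) has_real_derivative fx x t) (at x)"
    "((\<lambda>y. fx y t) has_real_derivative fxx x t) (at x)"
    "((\<lambda>s. f x s) has_real_derivative ft x t) (at t within {0..1})"
  using assms unfolding C21b_def by auto

lemma cbdd_power2: "cbdd g \<Longrightarrow> cbdd (\<lambda>x t. (g x t)\<^sup>2)"
proof -
  assume g: "cbdd g"
  obtain B where B: "B > 0" "\<forall>x. \<forall>t\<in>{0..1}. \<bar>g x t\<bar> \<le> B" using cbdd_bound[OF g] by blast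
  have "\<bar>(g x t)\<^sup>2\<bar> \<le> B\<^sup>2" if "t \<in> {0..1}" for x t
    using B that by (metis abs_power2 power2_abs abs_ge_zero power_mono)
  then have "bounded ((\<lambda>(x, t). (g x t)\<^sup>2) ` (UNIV \<times> {0..1}))"
    unfolding bounded_iff by (intro exI[of _ "B\<^sup>2"]) auto
  moreover have "continuous_on (UNIV \<times> {0..1}) (\<lambda>z. ((\<lambda>(x, t). g x t) z)\<^sup>2)"
    using g unfolding cbdd_def by (intro continuous_intros) auto
  ultimately show ?thesis unfolding cbdd_def by (simp add: case_prod_unfold)
qed

lemma path_tendsto_weak_conv:
  assumes "\<And>n. \<nu> n \<in> path_space" "\<rho> \<in> path_space" "(\<lambda>n. path_dist (\<nu> n) \<rho>) \<longlonglongrightarrow> 0" "t \<in> {0..1}"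
  shows "(\<lambda>n. bl_dist (\<nu> n t) (\<rho> t)) \<longlonglongrightarrow> 0" "weak_conv_m (\<lambda>n. \<nu> n t) (\<rho> t)"
proof -
  show 1: "(\<lambda>n. bl_dist (\<nu> n t) (\<rho> t)) \<longlonglongrightarrow> 0"
    by (rule real_tendsto_sandwich[OF _ _ tendsto_const assms(3)])
       (intro always_eventually allI bl_dist_nonneg path_dist_ge path_space_dist assms)+
  show "weak_conv_m (\<lambda>n. \<nu> n t) (\<rho> t)"
    by (rule bl_dist_imp_weak_conv[OF _ _ 1]) (intro path_space_dist assms)+
qed

text \<open>The expression under the two suprema of \<open>S_rate\<close>, for one test function and
  one time interval.\<close>

definition J_st :: "(real \<Rightarrow> real measure) \<Rightarrow> (real \<Rightarrow> real \<Rightarrow> real) \<Rightarrow> (real \<Rightarrow> real \<Rightarrow> real) \<Rightarrow>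
    (real \<Rightarrow> real \<Rightarrow> real) \<Rightarrow> (real \<Rightarrow> real \<Rightarrow> real) \<Rightarrow> real \<Rightarrow> real \<Rightarrow> real" where
  "J_st \<nu> f fx fxx ft s t = S_st \<nu> f fx fxx ft s t - 1/2 * bracket_st \<nu> fx s t"

text \<open>At each time the integrals converge by weak convergence, with bounds uniform in time, so
  dominated convergence handles the time integrals. This continuity makes the sets
  \<open>{\<nu>. a < J_st \<nu> f fx fxx ft s t}\<close> open in the path space and
  \<open>S_rate\<close> lower semicontinuous.\<close>

lemma J_st_tendsto:
  assumes f: "C21b f fx fxx ft" and st: "0 \<le> s" "s \<le> t" "t \<le> 1"
    and \<nu>: "\<And>n. \<nu> n \<in> path_space" "\<rho> \<in> path_space" "(\<lambda>n. path_dist (\<nu> n) \<rho>) \<longlonglongrightarrow> 0"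
  shows "(\<lambda>n. J_st (\<nu> n) f fx fxx ft s t) \<longlonglongrightarrow> J_st \<rho> f fx fxx ft s t"
proof -
  have c: "cbdd f" "cbdd fx" "cbdd fxx" "cbdd ft" using C21b_cbdd[OF f] by auto
  note w = path_tendsto_weak_conv(2)[OF \<nu>]
  have lim: "(\<lambda>n. \<integral>x. g x u \<partial>\<nu> n u) \<longlonglongrightarrow> (\<integral>x. g x u \<partial>\<rho> u)" if "cbdd g" "u \<in> {0..1}" for g u
    using cbdd_tendsto_integral[OF that(1) path_space_dist[OF \<nu>(1) that(2)] path_space_dist[OF \<nu>(2) that(2)] w[OF that(2)] tendsto_const that(2) that(2)] .
  have lim2: "(\<lambda>n. LBINT u:{s..t}. (\<integral>x. g x u \<partial>\<nu> n u)) \<longlonglongrightarrow> (LBINT u:{s..t}. (\<integral>x. g x u \<partial>\<rho> u))" if g: "cbdd g" for g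
  proof -
    obtain B where B: "\<And>x t. t \<in> {0..1} \<Longrightarrow> \<bar>g x t\<bar> \<le> B" using cbdd_bound[OF g] by blast
    show ?thesis
      by (rule set_integral_tendsto[where B=B])
        (use st in \<open>auto intro!: path_integral_continuous g \<nu> lim real_distribution_integral_abs_le B path_space_dist simp del: atLeastAtMost_iff\<close>)
  qed
  obtain B where B: "\<And>x t. t \<in> {0..1} \<Longrightarrow> \<bar>fxx x t\<bar> \<le> B" using cbdd_bound[OF c(3)] by blast
  have lim3: "(\<lambda>n. LBINT u:{s..t}. (\<integral>z. divided_diff (\<lambda>x. fx x u) (\<lambda>x. fxx x u) (fst z) (snd z) \<partial>(\<nu> n u \<Otimes>\<^sub>M \<nu> n u)))
      \<longlonglongrightarrow> (LBINT u:{s..t}. (\<integral>z. divided_diff (\<lambda>x. fx x u) (\<lambda>x. fxx x u) (fst z) (snd z) \<partial>(\<rho> u \<Otimes>\<^sub>M \<rho> u)))"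
  proof (rule set_integral_tendsto[where B=B])
    fix u :: real assume u: "u \<in> {0..1}"
    show "(\<lambda>n. \<integral>z. divided_diff (\<lambda>x. fx x u) (\<lambda>x. fxx x u) (fst z) (snd z) \<partial>(\<nu> n u \<Otimes>\<^sub>M \<nu> n u))
      \<longlonglongrightarrow> (\<integral>z. divided_diff (\<lambda>x. fx x u) (\<lambda>x. fxx x u) (fst z) (snd z) \<partial>(\<rho> u \<Otimes>\<^sub>M \<rho> u))"
      by (rule divided_diff_tendsto_integral[OF c(2,3) C21b_deriv(2)[OF f] path_space_dist[OF \<nu>(1) u] path_space_dist[OF \<nu>(2) u] w[OF u] tendsto_const u u])
    show "\<bar>\<integral>z. divided_diff (\<lambda>x. fx x u) (\<lambda>x. fxx x u) (fst z) (snd z) \<partial>(\<nu> n u \<Otimes>\<^sub>M \<nu> n u)\<bar> \<le> B" for n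
      by (rule integral_divided_diff_abs_le[OF C21b_deriv(2)[OF f u] B[OF u] path_space_dist[OF \<nu>(1) u]])
  qed (use st in \<open>auto intro!: path_divided_diff_continuous[OF c(2,3) C21b_deriv(2)[OF f]] \<nu> simp del: atLeastAtMost_iff\<close>)
  have s01: "s \<in> {0..1}" and t01: "t \<in> {0..1}" using st by auto
  show ?thesis
    unfolding J_st_def S_st_def bracket_st_def
    by (intro tendsto_diff tendsto_mult tendsto_const lim lim2 lim3 c cbdd_power2 s01 t01)
qed

lemma S_rate_J:
  "S_rate \<mu> \<nu> = (if \<nu> 0 \<noteq> \<mu> then \<infinity> else
     (SUP (f, fx, fxx, ft)\<in>{(f, fx, fxx, ft). C21b f fx fxx ft}.
        SUP (s, t)\<in>{(s, t). 0 \<le> s \<and> s \<le> t \<and> t \<le> 1}. ereal (J_st \<nu> f fx fxx ft s t)))"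
  unfolding S_rate_def J_st_def ..

lemma S_rate_ge:
  assumes "C21b f fx fxx ft" "0 \<le> s" "s \<le> t" "t \<le> 1"
  shows "ereal (J_st \<nu> f fx fxx ft s t) \<le> S_rate \<mu> \<nu>"
proof (cases "\<nu> 0 = \<mu>")
  case True
  have "ereal (J_st \<nu> f fx fxx ft s t) \<le> (SUP (s, t)\<in>{(s, t). 0 \<le> s \<and> s \<le> t \<and> t \<le> 1}. ereal (J_st \<nu> f fx fxx ft s t))"
    using assms by (intro SUP_upper2[of "(s, t)"]) auto
  also have "\<dots> \<le> S_rate \<mu> \<nu>"
    unfolding S_rate_J using True assms(1) by (auto intro!: SUP_upper2[of "(f, fx, fxx, ft)"])
  finally show ?thesis .
qed (simp add: S_rate_J)

text \<open>A rate above \<open>a\<close> has one of two reasons, and both are stable under small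
  perturbations of the path. They furnish the two kinds of sets in the covering argument for the
  upper bound.\<close>

lemma S_rate_less_cases:
  assumes "ereal a < S_rate \<mu> \<nu>"
  shows "\<nu> 0 \<noteq> \<mu> \<or> (\<exists>f fx fxx ft s t. C21b f fx fxx ft \<and> 0 \<le> s \<and> s \<le> t \<and> t \<le> 1 \<and> a < J_st \<nu> f fx fxx ft s t)"
proof (cases "\<nu> 0 = \<mu>")
  case True
  with assms show ?thesis unfolding S_rate_J by (auto simp: less_SUP_iff)
qed simp

section \<open>Compactness of the level sets\<close>

text \<open>A supremum of continuous functionals, except for the infinite value at a wrong initial
  law; there a positive \<open>bl_dist\<close> keeps the initial laws of nearby paths away from
  \<open>\<mu>\<close> as well.\<close>

lemma S_rate_lower_semicontinuous:
  assumes \<mu>: "real_distribution \<mu>" and \<nu>: "\<And>n. \<nu> n \<in> path_space" "\<rho> \<in> path_space" "(\<lambda>n. path_dist (\<nu> n) \<rho>) \<longlonglongrightarrow> 0"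
  shows "S_rate \<mu> \<rho> \<le> liminf (\<lambda>n. S_rate \<mu> (\<nu> n))"
  unfolding le_Liminf_iff
proof (intro allI impI)
  fix y assume "y < S_rate \<mu> \<rho>"
  then obtain a :: real where a: "y < ereal a" "ereal a < S_rate \<mu> \<rho>" using ereal_dense2 by blast
  have 0: "(0::real) \<in> {0..1}" by simp
  show "\<forall>\<^sub>F n in sequentially. y < S_rate \<mu> (\<nu> n)"
  proof (cases "\<rho> 0 = \<mu>")
    case False
    have "bl_dist \<mu> (\<rho> 0) \<noteq> 0" using bl_dist_eq_0_imp_eq[OF \<mu> path_space_dist[OF \<nu>(2) 0]] False by blast
    then have "0 < bl_dist \<mu> (\<rho> 0)" using bl_dist_nonneg[OF \<mu> path_space_dist[OF \<nu>(2) 0]] by linarith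
    then have "\<forall>\<^sub>F n in sequentially. bl_dist (\<nu> n 0) (\<rho> 0) < bl_dist \<mu> (\<rho> 0)"
      using order_tendstoD(2)[OF path_tendsto_weak_conv(1)[OF \<nu> 0]] by blast
    then show ?thesis
    proof eventually_elim
      case (elim n)
      then have "S_rate \<mu> (\<nu> n) = \<infinity>" unfolding S_rate_J by auto
      then show ?case using a(1) by (cases y) auto
    qed
  next
    case True
    then obtain f fx fxx ft s t where f: "C21b f fx fxx ft" "0 \<le> s" "s \<le> t" "t \<le> 1" "a < J_st \<rho> f fx fxx ft s t"
      using S_rate_less_cases[OF a(2)] by blast
    have "\<forall>\<^sub>F n in sequentially. a < J_st (\<nu> n) f fx fxx ft s t"
      using order_tendstoD(1)[OF J_st_tendsto[OF f(1-4) \<nu>] f(5)] .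
    then show ?thesis
    proof eventually_elim
      case (elim n)
      then have "ereal a < ereal (J_st (\<nu> n) f fx fxx ft s t)" by simp
      then show ?case using a(1) S_rate_ge[OF f(1-4), of "\<nu> n" \<mu>] by (meson less_le_trans less_trans)
    qed
  qed
qed

section \<open>Time-independent test functions along paths of bounded rate\<close>

lemma C21b_time_independent:
  assumes "\<And>x. (g has_real_derivative g' x) (at x)" "\<And>x. (g' has_real_derivative g'' x) (at x)"
    "continuous_on UNIV g''" "\<And>x. \<bar>g x\<bar> \<le> B0" "\<And>x. \<bar>g' x\<bar> \<le> B1" "\<And>x. \<bar>g'' x\<bar> \<le> B2"
  shows "C21b (\<lambda>x t. c * g x) (\<lambda>x t. c * g' x) (\<lambda>x t. c * g'' x) (\<lambda>x t. 0)"
proof -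
  have c: "continuous_on UNIV g" "continuous_on UNIV g'"
    using assms(1,2) by (meson DERIV_continuous continuous_at_imp_continuous_on)+
  have *: "continuous_on (UNIV \<times> {0..1}) (\<lambda>(x, t). c * h x)" if "continuous_on UNIV h" for h :: "real \<Rightarrow> real"
    unfolding case_prod_unfold by (intro continuous_intros continuous_on_compose2[OF that]) auto
  have **: "bounded ((\<lambda>(x, t). c * h x) ` (UNIV \<times> {0..1::real}))" if "\<And>x. \<bar>h x\<bar> \<le> B" for B and h :: "real \<Rightarrow> real"
    unfolding bounded_iff using that by (intro exI[of _ "\<bar>c\<bar> * B"]) (auto simp: abs_mult intro!: mult_left_mono)
  have z: "continuous_on (UNIV \<times> {0..1}) (\<lambda>(x::real, t::real). 0::real)" "bounded ((\<lambda>(x::real, t). 0::real) ` (UNIV \<times> {0..1::real}))"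
    by (auto simp: case_prod_unfold bounded_iff)
  show ?thesis
    unfolding C21b_def using assms(1,2) *[OF c(1)] *[OF c(2)] *[OF assms(3)] **[OF assms(4)] **[OF assms(5)] **[OF assms(6)] z
    by (auto intro!: DERIV_cmult)
qed

text \<open>For the test function c g the interaction term is at most |c| B2, because a divided
  difference of g' is bounded by sup |g''|, and the bracket is at most (c B1)^2. The left side is
  linear in \<open>c\<close> and the right side quadratic in |c|, so the free factor can be tuned to
  the length of the interval or to the scale of g.\<close>

lemma S_rate_test_function:
  assumes g: "\<And>x. (g has_real_derivative g' x) (at x)" "\<And>x. (g' has_real_derivative g'' x) (at x)"
    "continuous_on UNIV g''" "\<And>x. \<bar>g x\<bar> \<le> B0" "\<And>x. \<bar>g' x\<bar> \<le> B1" "\<And>x. \<bar>g'' x\<bar> \<le> B2"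
    and \<nu>: "\<nu> \<in> path_space" "S_rate \<mu> \<nu> \<le> ereal a" and st: "0 \<le> s" "s \<le> t" "t \<le> 1"
  shows "c * ((\<integral>x. g x \<partial>\<nu> t) - (\<integral>x. g x \<partial>\<nu> s)) \<le> a + (t - s) * (\<bar>c\<bar> * B2 + (\<bar>c\<bar> * B1)\<^sup>2) / 2"
proof -
  have C: "C21b (\<lambda>x t. c * g x) (\<lambda>x t. c * g' x) (\<lambda>x t. c * g'' x) (\<lambda>x t. 0)"
    by (rule C21b_time_independent[OF g])
  have "ereal (J_st \<nu> (\<lambda>x t. c * g x) (\<lambda>x t. c * g' x) (\<lambda>x t. c * g'' x) (\<lambda>x t. 0) s t) \<le> ereal a"
    using S_rate_ge[OF C st, of \<nu> \<mu>] \<nu>(2) by (rule order_trans)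
  then have J: "J_st \<nu> (\<lambda>x t. c * g x) (\<lambda>x t. c * g' x) (\<lambda>x t. c * g'' x) (\<lambda>x t. 0) s t \<le> a" by simp
  have rd: "real_distribution (\<nu> u)" if "u \<in> {s..t}" for u using path_space_dist[OF \<nu>(1)] that st by auto
  have B: "0 \<le> B1" "0 \<le> B2" using g(5)[of 0] g(6)[of 0] by linarith+
  have cB2: "\<bar>c * g'' x\<bar> \<le> \<bar>c\<bar> * B2" for x using g(6)[of x] by (simp add: abs_mult mult_left_mono)
  have cB1: "\<bar>(c * g' x)\<^sup>2\<bar> \<le> (\<bar>c\<bar> * B1)\<^sup>2" for x
  proof -
    have "\<bar>c * g' x\<bar> \<le> \<bar>c\<bar> * B1" using g(5)[of x] by (simp add: abs_mult mult_left_mono)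
    then have "\<bar>c * g' x\<bar>\<^sup>2 \<le> (\<bar>c\<bar> * B1)\<^sup>2" by (intro power_mono) auto
    then show ?thesis by simp
  qed
  have 1: "\<bar>LBINT u:{s..t}. (\<integral>z. divided_diff (\<lambda>x. c * g' x) (\<lambda>x. c * g'' x) (fst z) (snd z) \<partial>(\<nu> u \<Otimes>\<^sub>M \<nu> u))\<bar> \<le> (t - s) * (\<bar>c\<bar> * B2)"
    using B st by (intro set_integral_abs_le integral_divided_diff_abs_le rd cB2 DERIV_cmult g) auto
  have 2: "\<bar>LBINT u:{s..t}. (\<integral>x. (c * g' x)\<^sup>2 \<partial>\<nu> u)\<bar> \<le> (t - s) * (\<bar>c\<bar> * B1)\<^sup>2"
    using st by (intro set_integral_abs_le real_distribution_integral_abs_le rd cB1) auto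
  have 3: "(LBINT u:{s..t}. (\<integral>x. 0 \<partial>\<nu> u)) = (0::real)" by (simp add: set_lebesgue_integral_def)
  have "(\<integral>x. c * g x \<partial>\<nu> t) - (\<integral>x. c * g x \<partial>\<nu> s) \<le> a + ((t - s) * (\<bar>c\<bar> * B2) + (t - s) * (\<bar>c\<bar> * B1)\<^sup>2) / 2"
  proof -
    have *: "p - q \<le> a + (A' + B') / 2" if "p - q - 0 - 1/2 * A - 1/2 * B \<le> a" "A \<le> A'" "B \<le> B'" for p q A B A' B' :: real
      using that by (simp add: field_simps)
    show ?thesis
      using J unfolding J_st_def S_st_def bracket_st_def 3 by (rule *[OF _ abs_le_D1[OF 1] abs_le_D1[OF 2]])
  qed
  then show ?thesis by (simp add: algebra_simps)
qed

text \<open>A smooth bounded replacement for the indicator of |x| >= R: it is at least 1/2 there,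
  and its first two derivatives are of order 1/R and 1/R^2, which permits multiplying it by R in the
  rate functional.\<close>

definition chi :: "real \<Rightarrow> real \<Rightarrow> real" where "chi R x = x\<^sup>2 / (R\<^sup>2 + x\<^sup>2)"

lemma chi_denom_pos: "0 < R \<Longrightarrow> 0 < R\<^sup>2 + (x::real)\<^sup>2"
  by (rule add_pos_nonneg) auto

lemma chi_deriv:
  assumes "R > 0"
  shows "(chi R has_real_derivative 2 * x * R\<^sup>2 / (R\<^sup>2 + x\<^sup>2)\<^sup>2) (at x)"
    "((\<lambda>x. 2 * x * R\<^sup>2 / (R\<^sup>2 + x\<^sup>2)\<^sup>2) has_real_derivative 2 * R\<^sup>2 * (R\<^sup>2 - 3 * x\<^sup>2) / (R\<^sup>2 + x\<^sup>2) ^ 3) (at x)"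
proof -
  have p: "R\<^sup>2 + x\<^sup>2 \<noteq> 0" using chi_denom_pos[OF assms, of x] by linarith
  show "(chi R has_real_derivative 2 * x * R\<^sup>2 / (R\<^sup>2 + x\<^sup>2)\<^sup>2) (at x)"
    unfolding chi_def[abs_def]
    by (rule derivative_eq_intros refl p | use p assms in \<open>simp add: field_simps power2_eq_square\<close>)+
  show "((\<lambda>x. 2 * x * R\<^sup>2 / (R\<^sup>2 + x\<^sup>2)\<^sup>2) has_real_derivative 2 * R\<^sup>2 * (R\<^sup>2 - 3 * x\<^sup>2) / (R\<^sup>2 + x\<^sup>2) ^ 3) (at x)"
  proof -
    define q where "q = R\<^sup>2 + x\<^sup>2"
    have q: "q \<noteq> 0" using p by (simp add: q_def)
    have "(2 * R\<^sup>2 * q\<^sup>2 - 2 * x * R\<^sup>2 * (2 * q * (2 * x))) * q ^ 3 = 2 * R\<^sup>2 * (R\<^sup>2 - 3 * x\<^sup>2) * (q\<^sup>2 * q\<^sup>2)"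
    proof -
      have "R\<^sup>2 - 3 * x\<^sup>2 = q - 4 * x\<^sup>2" by (simp add: q_def)
      show ?thesis unfolding \<open>R\<^sup>2 - 3 * x\<^sup>2 = q - 4 * x\<^sup>2\<close>
        by (simp add: power2_eq_square power3_eq_cube algebra_simps)
    qed
    then have eq: "(2 * R\<^sup>2 * q\<^sup>2 - 2 * x * R\<^sup>2 * (2 * q * (2 * x))) / (q\<^sup>2 * q\<^sup>2) = 2 * R\<^sup>2 * (R\<^sup>2 - 3 * x\<^sup>2) / q ^ 3"
      using q by (subst frac_eq_eq) auto
    have "((\<lambda>x. 2 * x * R\<^sup>2) has_real_derivative 2 * R\<^sup>2) (at x)"
      by (auto intro!: derivative_eq_intros)
    moreover have "((\<lambda>x. (R\<^sup>2 + x\<^sup>2)\<^sup>2) has_real_derivative 2 * q * (2 * x)) (at x)"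
      unfolding q_def by (auto intro!: derivative_eq_intros)
    ultimately show ?thesis
      using DERIV_divide[of "\<lambda>x. 2 * x * R\<^sup>2" "2 * R\<^sup>2" x UNIV "\<lambda>x. (R\<^sup>2 + x\<^sup>2)\<^sup>2" "2 * q * (2 * x)"] q eq
      by (simp add: q_def)
  qed
qed

text \<open>The derivative bounds rest on 2 |x| R <= R^2 + x^2 and on |R^2 - 3 x^2| <= 3 (R^2 +
  x^2).\<close>

lemma chi_bounds:
  assumes R: "R > 0"
  shows "0 \<le> chi R x" "\<bar>chi R x\<bar> \<le> 1" "\<bar>2 * x * R\<^sup>2 / (R\<^sup>2 + x\<^sup>2)\<^sup>2\<bar> \<le> 1 / R"
    "\<bar>2 * R\<^sup>2 * (R\<^sup>2 - 3 * x\<^sup>2) / (R\<^sup>2 + x\<^sup>2) ^ 3\<bar> \<le> 6 / R\<^sup>2" "R \<le> \<bar>x\<bar> \<Longrightarrow> 1 / 2 \<le> chi R x"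
proof -
  let ?q = "R\<^sup>2 + x\<^sup>2"
  have p: "0 < ?q" using chi_denom_pos[OF R] .
  show 0: "0 \<le> chi R x" using p by (simp add: chi_def)
  show "\<bar>chi R x\<bar> \<le> 1" using p 0 by (simp add: chi_def divide_le_eq)
  have R2: "R\<^sup>2 \<le> ?q" by simp
  have "2 * \<bar>x\<bar> * R \<le> ?q" using sum_squares_bound[of "\<bar>x\<bar>" R] by (simp add: power2_eq_square algebra_simps)
  then have "2 * \<bar>x\<bar> * R * R\<^sup>2 \<le> ?q * ?q" using R R2 p by (intro mult_mono) auto
  then have "2 * \<bar>x\<bar> * R\<^sup>2 * R \<le> ?q\<^sup>2" by (simp add: power2_eq_square algebra_simps)
  then have "2 * \<bar>x\<bar> * R\<^sup>2 / ?q\<^sup>2 \<le> 1 / R" using R p by (simp only: divide_le_eq le_divide_eq zero_less_power times_divide_eq_left mult_1 if_True)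
  then show "\<bar>2 * x * R\<^sup>2 / ?q\<^sup>2\<bar> \<le> 1 / R" by (simp add: abs_mult)
  have "\<bar>R\<^sup>2 - 3 * x\<^sup>2\<bar> \<le> 3 * ?q" by (simp add: abs_le_iff)
  then have "2 * R\<^sup>2 * \<bar>R\<^sup>2 - 3 * x\<^sup>2\<bar> * R\<^sup>2 \<le> 2 * ?q * (3 * ?q) * ?q" using R2 p by (intro mult_mono) auto
  then have "2 * R\<^sup>2 * \<bar>R\<^sup>2 - 3 * x\<^sup>2\<bar> * R\<^sup>2 \<le> 6 * ?q ^ 3" by (simp add: power3_eq_cube algebra_simps)
  then have "2 * R\<^sup>2 * \<bar>R\<^sup>2 - 3 * x\<^sup>2\<bar> / ?q ^ 3 \<le> 6 / R\<^sup>2"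
    using R p by (subst divide_le_eq) (auto simp: le_divide_eq mult.commute mult.left_commute)
  then show "\<bar>2 * R\<^sup>2 * (R\<^sup>2 - 3 * x\<^sup>2) / ?q ^ 3\<bar> \<le> 6 / R\<^sup>2" using p by (simp add: abs_mult)
  show "1 / 2 \<le> chi R x" if "R \<le> \<bar>x\<bar>"
  proof -
    have "R\<^sup>2 \<le> \<bar>x\<bar>\<^sup>2" using that R by (intro power_mono) auto
    then show ?thesis using p by (simp add: chi_def le_divide_eq)
  qed
qed

lemma chi_borel: "R > 0 \<Longrightarrow> chi R \<in> borel_measurable borel"
  unfolding chi_def[abs_def] by measurable

text \<open>Pointwise \<open>1 - 2 * chi R x\<close> is at most the indicator of the interval, since
  \<open>chi\<close> is nonnegative and at least 1/2 outside.\<close>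

lemma measure_Ioc_ge_chi:
  assumes \<mu>: "real_distribution \<mu>" and R: "R > 0"
  shows "1 - 2 * (\<integral>x. chi R x \<partial>\<mu>) \<le> measure \<mu> {-R<..R}"
proof -
  interpret real_distribution \<mu> by fact
  have i: "integrable \<mu> (chi R)" using real_distribution_integrable[OF \<mu> chi_borel[OF R] chi_bounds(2)[OF R]] .
  have "1 - 2 * (\<integral>x. chi R x \<partial>\<mu>) = (\<integral>x. 1 - 2 * chi R x \<partial>\<mu>)"
    using i prob_space by (simp add: space_eq_univ)
  also have "\<dots> \<le> (\<integral>x. indicator {-R<..R} x \<partial>\<mu>)"
  proof (rule integral_mono)
    show "1 - 2 * chi R x \<le> indicator {-R<..R} x" for x
    proof (cases "x \<in> {-R<..R}")
      case False
      then have "R \<le> \<bar>x\<bar>" by auto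
      with chi_bounds(5)[OF R this] False show ?thesis by simp
    qed (use chi_bounds(1)[OF R, of x] in simp)
    show "integrable \<mu> (indicat_real {-R<..R})"
      by (rule real_distribution_integrable[OF \<mu>, of _ 1]) (auto simp: indicator_def)
  qed (use i in auto)
  also have "\<dots> = measure \<mu> {-R<..R}" by simp
  finally show ?thesis .
qed

lemma chi_integral_tendsto_0:
  assumes \<mu>: "real_distribution \<mu>"
  shows "((\<lambda>n. \<integral>x. chi (real (Suc n)) x \<partial>\<mu>) \<longlonglongrightarrow> 0)"
proof -
  interpret real_distribution \<mu> by fact
  have "(\<lambda>n. \<integral>x. chi (real (Suc n)) x \<partial>\<mu>) \<longlonglongrightarrow> (\<integral>x. 0 \<partial>\<mu>)"
  proof (rule integral_dominated_convergence[where w="\<lambda>x. 1"])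
    show "AE x in \<mu>. (\<lambda>n. chi (real (Suc n)) x) \<longlonglongrightarrow> 0"
      unfolding chi_def by (intro AE_I2) real_asymp
    show "AE x in \<mu>. norm (chi (real (Suc n)) x) \<le> 1" for n
      using chi_bounds(2)[of "real (Suc n)"] by (intro AE_I2) auto
  qed (auto intro!: real_distribution_borel[OF \<mu>] chi_borel)
  then show ?thesis by simp
qed

text \<open>Splitting into real and imaginary part reduces characteristic functions to the real test
  functions cosine and sine.\<close>

lemma char_diff_le:
  assumes \<mu>: "real_distribution \<mu>" and \<nu>: "real_distribution \<nu>"
  shows "cmod (char \<mu> \<xi> - char \<nu> \<xi>) \<le> \<bar>(\<integral>x. cos (\<xi> * x) \<partial>\<mu>) - (\<integral>x. cos (\<xi> * x) \<partial>\<nu>)\<bar>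
     + \<bar>(\<integral>x. sin (\<xi> * x) \<partial>\<mu>) - (\<integral>x. sin (\<xi> * x) \<partial>\<nu>)\<bar>"
proof -
  have *: "Re (char \<rho> \<xi>) = (\<integral>x. cos (\<xi> * x) \<partial>\<rho>)" "Im (char \<rho> \<xi>) = (\<integral>x. sin (\<xi> * x) \<partial>\<rho>)"
    if "real_distribution \<rho>" for \<rho>
  proof -
    interpret real_distribution \<rho> by fact
    have "integrable \<rho> (\<lambda>x. iexp (\<xi> * x))" by (rule integrable_iexp) auto
    then show "Re (char \<rho> \<xi>) = (\<integral>x. cos (\<xi> * x) \<partial>\<rho>)" "Im (char \<rho> \<xi>) = (\<integral>x. sin (\<xi> * x) \<partial>\<rho>)"
      unfolding char_def by (simp_all flip: integral_Re integral_Im add: Re_exp Im_exp)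
  qed
  show ?thesis
    using cmod_le[of "char \<mu> \<xi> - char \<nu> \<xi>"] by (simp add: *[OF \<mu>] *[OF \<nu>])
qed

text \<open>A failure of equicontinuity yields, by tightness, two weak limits with the same characteristic function.\<close>

lemma bl_equicontinuous_of_char:
  fixes \<nu> :: "nat \<Rightarrow> real \<Rightarrow> real measure"
  assumes \<nu>: "\<And>n t. t \<in> {0..1} \<Longrightarrow> real_distribution (\<nu> n t)"
    and tight: "\<And>e. e > 0 \<Longrightarrow> \<exists>a b. a < b \<and> (\<forall>n. \<forall>t\<in>{0..1}. measure (\<nu> n t) {a<..b} > 1 - e)"
    and char: "\<And>\<xi> e. e > 0 \<Longrightarrow> \<exists>\<delta>>0. \<forall>n. \<forall>s\<in>{0..1}. \<forall>t\<in>{0..1}. \<bar>s - t\<bar> < \<delta> \<longrightarrow> cmod (char (\<nu> n s) \<xi> - char (\<nu> n t) \<xi>) < e"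
    and e: "e > 0"
  shows "\<exists>\<delta>>0. \<forall>n. \<forall>s\<in>{0..1}. \<forall>t\<in>{0..1}. \<bar>s - t\<bar> < \<delta> \<longrightarrow> bl_dist (\<nu> n s) (\<nu> n t) < e"
proof (rule ccontr)
  assume "\<not> ?thesis"
  then have "\<exists>n s t. s \<in> {0..1} \<and> t \<in> {0..1} \<and> \<bar>s - t\<bar> < 1 / real (Suc k) \<and> e \<le> bl_dist (\<nu> n s) (\<nu> n t)" for k
    unfolding not_ex de_Morgan_conj by (metis not_less of_nat_0_less_iff zero_less_Suc zero_less_divide_1_iff)
  then obtain n s t where st: "\<And>k. s k \<in> {0..1}" "\<And>k. t k \<in> {0..1}" "\<And>k. \<bar>s k - t k\<bar> < 1 / real (Suc k)"
    and bl: "\<And>k. e \<le> bl_dist (\<nu> (n k) (s k)) (\<nu> (n k) (t k))" by metis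
  have tg: "tight (\<lambda>k. \<nu> (n k) (u k))" if u: "\<And>k. u k \<in> {0..1}" for u
    unfolding tight_def
  proof (intro conjI allI impI)
    fix e :: real assume "e > 0"
    from tight[OF this] obtain a b where "a < b" "\<forall>n. \<forall>t\<in>{0..1}. measure (\<nu> n t) {a<..b} > 1 - e" by blast
    then show "\<exists>a b. a < b \<and> (\<forall>k. 1 - e < measure (\<nu> (n k) (u k)) {a<..b})" using u by blast
  qed (rule \<nu>[OF u])
  obtain r \<alpha> where r: "strict_mono (r::nat \<Rightarrow> nat)" and \<alpha>: "real_distribution \<alpha>" "weak_conv_m (\<lambda>k. \<nu> (n (r k)) (s (r k))) \<alpha>"
    using tight_imp_convergent_subsubsequence[OF tg[of s, OF st(1)] strict_mono_id] by (auto simp: comp_def)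
  obtain r' \<beta> where r': "strict_mono (r'::nat \<Rightarrow> nat)" and \<beta>: "real_distribution \<beta>"
      "weak_conv_m (\<lambda>k. \<nu> (n (r (r' k))) (t (r (r' k)))) \<beta>"
    using tight_imp_convergent_subsubsequence[OF tg[of t, OF st(2)] r] by (auto simp: comp_def)
  \<comment> \<open>The index \<open>m k\<close> is at least \<open>k\<close>, so the paired times
    \<open>s (m k)\<close> and \<open>t (m k)\<close> are at distance less than 1/(k+1), and the two
    weak limits will share their characteristic function.\<close>
  define m where "m k = r (r' k)" for k
  have m: "k \<le> m k" for k
    using seq_suble[OF r, of "r' k"] seq_suble[OF r', of k] by (simp add: m_def)
  have \<alpha>': "weak_conv_m (\<lambda>k. \<nu> (n (m k)) (s (m k))) \<alpha>"
    unfolding weak_conv_m_def weak_conv_def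
  proof (intro allI impI)
    fix x assume "isCont (cdf \<alpha>) x"
    then have "(\<lambda>k. cdf (\<nu> (n (r k)) (s (r k))) x) \<longlonglongrightarrow> cdf \<alpha> x"
      using \<alpha>(2) unfolding weak_conv_m_def weak_conv_def by blast
    from LIMSEQ_subseq_LIMSEQ[OF this r'] show "(\<lambda>k. cdf (\<nu> (n (m k)) (s (m k))) x) \<longlonglongrightarrow> cdf \<alpha> x"
      by (simp add: m_def comp_def)
  qed
  have \<beta>': "weak_conv_m (\<lambda>k. \<nu> (n (m k)) (t (m k))) \<beta>" using \<beta>(2) by (simp add: m_def)
  have "char \<alpha> \<xi> = char \<beta> \<xi>" for \<xi>
  proof -
    have c: "(\<lambda>k. char (\<mu> k) \<xi>) \<longlonglongrightarrow> char M \<xi>"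
      if "\<And>k. real_distribution (\<mu> k)" "real_distribution M" "weak_conv_m \<mu> M" for \<mu> M
      unfolding char_def using that
      by (intro weak_conv_imp_integral_bdd_continuous_conv[where B=1]) (auto intro!: continuous_intros)
    have 1: "(\<lambda>k. char (\<nu> (n (m k)) (s (m k))) \<xi> - char (\<nu> (n (m k)) (t (m k))) \<xi>) \<longlonglongrightarrow> char \<alpha> \<xi> - char \<beta> \<xi>"
      by (intro tendsto_diff c \<nu> st \<alpha>(1) \<beta>(1) \<alpha>' \<beta>')
    have 2: "(\<lambda>k. char (\<nu> (n (m k)) (s (m k))) \<xi> - char (\<nu> (n (m k)) (t (m k))) \<xi>) \<longlonglongrightarrow> 0"
    proof (rule LIMSEQ_I)
      fix e' :: real assume "e' > 0"
      from char[OF this] obtain \<delta> where "\<delta> > 0"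
        and \<delta>: "\<And>n s t. s\<in>{0..1} \<Longrightarrow> t\<in>{0..1} \<Longrightarrow> \<bar>s - t\<bar> < \<delta> \<Longrightarrow> cmod (char (\<nu> n s) \<xi> - char (\<nu> n t) \<xi>) < e'" by blast
      obtain k0 where k0: "1 / real (Suc k0) < \<delta>" using nat_approx_posE[OF \<open>\<delta> > 0\<close>] by blast
      have "cmod (char (\<nu> (n (m k)) (s (m k))) \<xi> - char (\<nu> (n (m k)) (t (m k))) \<xi>) < e'" if "k \<ge> k0" for k
      proof (rule \<delta>[OF st(1,2)])
        have "1 / real (Suc (m k)) \<le> 1 / real (Suc k0)" using that m[of k] by (intro divide_left_mono) auto
        then show "\<bar>s (m k) - t (m k)\<bar> < \<delta>" using st(3)[of "m k"] k0 by linarith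
      qed
      then show "\<exists>no. \<forall>k\<ge>no. norm (char (\<nu> (n (m k)) (s (m k))) \<xi> - char (\<nu> (n (m k)) (t (m k))) \<xi> - 0) < e'" by auto
    qed
    show ?thesis using LIMSEQ_unique[OF 1 2] by simp
  qed
  then have ab: "\<alpha> = \<beta>" by (intro Levy_uniqueness[OF \<alpha>(1) \<beta>(1)] ext)
  have l: "(\<lambda>k. bl_dist (\<nu> (n (m k)) (s (m k))) \<alpha> + bl_dist (\<nu> (n (m k)) (t (m k))) \<alpha>) \<longlonglongrightarrow> 0 + 0"
    using \<beta>' ab by (intro tendsto_add weak_conv_imp_bl_dist \<nu> st \<alpha>(1) \<alpha>') auto
  have "e \<le> bl_dist (\<nu> (n (m k)) (s (m k))) \<alpha> + bl_dist (\<nu> (n (m k)) (t (m k))) \<alpha>" for k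
    using bl[of "m k"] bl_dist_triangle[OF \<nu>[OF st(1)] \<alpha>(1) \<nu>[OF st(2)], of "n (m k)" "m k" "n (m k)" "m k"]
      bl_dist_sym[of \<alpha>] by (metis order_trans)
  with LIMSEQ_le_const[OF l, of e] e show False by auto
qed

text \<open>The factors 1/h and -1/h with h = sqrt |s - t| balance the two sides of
  \<open>S_rate_test_function\<close>: the quadratic term |s - t| c^2 stays bounded, and dividing by
  |c| leaves Hoelder continuity of exponent 1/2.\<close>

lemma S_rate_increment_le:
  assumes g: "\<And>x. (g has_real_derivative g' x) (at x)" "\<And>x. (g' has_real_derivative g'' x) (at x)"
    "continuous_on UNIV g''" "\<And>x. \<bar>g x\<bar> \<le> B0" "\<And>x. \<bar>g' x\<bar> \<le> B1" "\<And>x. \<bar>g'' x\<bar> \<le> B2"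
    and \<nu>: "\<nu> \<in> path_space" "S_rate \<mu> \<nu> \<le> ereal a" and st: "s \<in> {0..1}" "t \<in> {0..1}"
  shows "\<bar>(\<integral>x. g x \<partial>\<nu> s) - (\<integral>x. g x \<partial>\<nu> t)\<bar> \<le> sqrt \<bar>s - t\<bar> * (a + B2 + B1\<^sup>2)"
proof -
  have *: "\<bar>(\<integral>x. g x \<partial>\<nu> v) - (\<integral>x. g x \<partial>\<nu> u)\<bar> \<le> sqrt (v - u) * (a + B2 + B1\<^sup>2)"
    if uv: "0 \<le> u" "u < v" "v \<le> 1" for u v
  proof -
    define h where "h = sqrt (v - u)"
    have h: "0 < h" "h \<le> 1" "v - u = h\<^sup>2" using uv by (auto simp: h_def)
    have B: "0 \<le> B1" "0 \<le> B2" using g(5)[of 0] g(6)[of 0] by linarith+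
    have b: "(v - u) * (\<bar>c\<bar> * B2 + (\<bar>c\<bar> * B1)\<^sup>2) / 2 \<le> B2 + B1\<^sup>2" if "\<bar>c\<bar> = 1 / h" for c
    proof -
      have "(v - u) * (\<bar>c\<bar> * B2 + (\<bar>c\<bar> * B1)\<^sup>2) = h * B2 + B1\<^sup>2"
        using h unfolding that by (simp add: field_simps power2_eq_square)
      moreover have "h * B2 \<le> 1 * B2" using h B by (intro mult_right_mono) auto
      ultimately show ?thesis using B zero_le_power2[of B1] by linarith
    qed
    let ?D = "(\<integral>x. g x \<partial>\<nu> v) - (\<integral>x. g x \<partial>\<nu> u)"
    have tr: "x \<le> a + B2 + B1\<^sup>2" if "x \<le> a + y" "y \<le> B2 + B1\<^sup>2" for x y using that by linarith
    note T = S_rate_test_function[OF g \<nu> uv(1) less_imp_le[OF uv(2)] uv(3)]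
    have "(1 / h) * ?D \<le> a + B2 + B1\<^sup>2" by (rule tr[OF T b]) (use h(1) in simp)
    moreover have "(- (1 / h)) * ?D \<le> a + B2 + B1\<^sup>2" by (rule tr[OF T b]) (use h(1) in simp)
    then have "(1 / h) * (- ?D) \<le> a + B2 + B1\<^sup>2" by (simp only: mult_minus_left mult_minus_right)
    moreover have "x \<le> h * y" if "(1 / h) * x \<le> y" for x y
    proof -
      have "x / h \<le> y" using that by simp
      then show ?thesis using h(1) by (simp only: pos_divide_le_eq mult.commute[of h])
    qed
    ultimately have "?D \<le> h * (a + B2 + B1\<^sup>2)" "- ?D \<le> h * (a + B2 + B1\<^sup>2)" by blast+
    then show ?thesis unfolding h_def by (simp add: abs_le_iff)
  qed
  consider "s = t" | "s < t" | "t < s" by linarith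
  then show ?thesis
  proof cases
    case 2 then show ?thesis using *[of s t] st by (simp add: abs_minus_commute)
  next
    case 3 then show ?thesis using *[of t s] st by simp
  qed simp
qed

lemma path_uniformly_tight:
  fixes \<nu> :: "nat \<Rightarrow> real \<Rightarrow> real measure"
  assumes \<nu>: "\<And>n t. t \<in> {0..1} \<Longrightarrow> real_distribution (\<nu> n t)"
    and chi: "\<And>e. e > 0 \<Longrightarrow> \<exists>R>0. \<forall>n. \<forall>t\<in>{0..1}. (\<integral>x. chi R x \<partial>\<nu> n t) < e" and e: "e > 0"
  shows "\<exists>a b. a < b \<and> (\<forall>n. \<forall>t\<in>{0..1}. measure (\<nu> n t) {a<..b} > 1 - e)"
proof -
  obtain R where R: "R > 0" "\<And>n t. t \<in> {0..1} \<Longrightarrow> (\<integral>x. chi R x \<partial>\<nu> n t) < e / 2"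
    using chi[of "e / 2"] e by fastforce
  show ?thesis
  proof (rule exI[of _ "- R"], rule exI[of _ R], intro conjI allI ballI)
    fix n and t :: real assume "t \<in> {0..1}"
    then show "1 - e < measure (\<nu> n t) {- R<..R}"
      using R(2)[of t n] measure_Ioc_ge_chi[OF \<nu> R(1), of t n] by linarith
  qed (use R in auto)
qed

lemma S_rate_level_compact:
  assumes \<mu>: "real_distribution \<mu>" and \<nu>: "\<And>n. \<nu> n \<in> path_space" "\<And>n. S_rate \<mu> (\<nu> n) \<le> ereal a"
  shows "\<exists>(r :: nat \<Rightarrow> nat) x. strict_mono r \<and> x \<in> path_space \<and> (\<lambda>n. path_dist (\<nu> (r n)) x) \<longlonglongrightarrow> 0"
proof -
  have rd: "real_distribution (\<nu> n t)" if "t \<in> {0..1}" for n t using path_space_dist[OF \<nu>(1) that] .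
  have init: "\<nu> n 0 = \<mu>" for n using \<nu>(2)[of n] unfolding S_rate_J by (auto split: if_splits)
  have chi: "\<exists>R>0. \<forall>n. \<forall>t\<in>{0..1}. (\<integral>x. chi R x \<partial>\<nu> n t) < e" if e: "e > 0" for e
  proof -
    have "(\<lambda>k. (\<integral>x. chi (real (Suc k)) x \<partial>\<mu>) + (a + 3 / real (Suc k) + 1/2) / real (Suc k)) \<longlonglongrightarrow> 0 + 0"
      by (intro tendsto_add chi_integral_tendsto_0[OF \<mu>]) real_asymp
    then have "\<forall>\<^sub>F k in sequentially. (\<integral>x. chi (real (Suc k)) x \<partial>\<mu>) + (a + 3 / real (Suc k) + 1/2) / real (Suc k) < e"
      using e by (intro order_tendstoD(2)) auto
    then obtain k where k: "(\<integral>x. chi (real (Suc k)) x \<partial>\<mu>) + (a + 3 / real (Suc k) + 1/2) / real (Suc k) < e"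
      unfolding eventually_sequentially by blast
    define R where "R = real (Suc k)"
    have R: "R > 0" by (simp add: R_def)
    have "(\<integral>x. chi R x \<partial>\<nu> n t) < e" if t: "t \<in> {0..1}" for n t
    proof -
      have "continuous_on UNIV (\<lambda>x. 2 * R\<^sup>2 * (R\<^sup>2 - 3 * x\<^sup>2) / (R\<^sup>2 + x\<^sup>2) ^ 3)"
        using chi_denom_pos[OF R] by (intro continuous_intros) (metis less_irrefl power_eq_0_iff)
      \<comment> \<open>Here c = R: the derivative bounds 1/R and 6/R^2 of \<open>chi\<close> absorb
        the factor, so the integral of \<open>chi R\<close> exceeds its initial value by O(1/R)
        only.\<close>
      note T = S_rate_test_function[OF chi_deriv[OF R] this chi_bounds(2-4)[OF R] \<nu>(1,2)[of n], of 0 t R]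
      have eq: "\<bar>R\<bar> * (6 / R\<^sup>2) + (\<bar>R\<bar> * (1 / R))\<^sup>2 = 6 / R + 1" using R by (simp add: power2_eq_square)
      have "R * ((\<integral>x. chi R x \<partial>\<nu> n t) - (\<integral>x. chi R x \<partial>\<nu> n 0)) \<le> a + (t - 0) * (6 / R + 1) / 2"
        using T t unfolding eq by auto
      moreover have "t * (6 / R + 1) \<le> 1 * (6 / R + 1)" using t R by (intro mult_right_mono) auto
      then have "(t - 0) * (6 / R + 1) / 2 \<le> 3 / R + 1 / 2" using R by simp
      ultimately have "R * ((\<integral>x. chi R x \<partial>\<nu> n t) - (\<integral>x. chi R x \<partial>\<nu> n 0)) \<le> a + (3 / R + 1 / 2)"
        by (rule order_trans[OF _ add_left_mono])
      then have "R * ((\<integral>x. chi R x \<partial>\<nu> n t) - (\<integral>x. chi R x \<partial>\<mu>)) \<le> a + 3 / R + 1 / 2"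
        unfolding init by simp
      then have "(\<integral>x. chi R x \<partial>\<nu> n t) - (\<integral>x. chi R x \<partial>\<mu>) \<le> (a + 3 / R + 1 / 2) / R"
        using R by (simp only: le_divide_eq mult.commute if_True)
      then show ?thesis using k unfolding R_def by linarith
    qed
    with R show ?thesis by blast
  qed
  note tight = path_uniformly_tight[OF rd chi]
  have char: "\<exists>\<delta>>0. \<forall>n. \<forall>s\<in>{0..1}. \<forall>t\<in>{0..1}. \<bar>s - t\<bar> < \<delta> \<longrightarrow> cmod (char (\<nu> n s) \<xi> - char (\<nu> n t) \<xi>) < e"
    if e: "e > 0" for \<xi> e
  proof -
    \<comment> \<open>The summand 1 keeps \<open>K\<close> positive for every \<open>a\<close> and
      \<open>\<xi>\<close>; the 2 in the threshold e / (2 K) pays for the two increments of cosine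
      and sine.\<close>
    define K where "K = \<bar>a\<bar> + \<xi>\<^sup>2 + \<bar>\<xi>\<bar>\<^sup>2 + 1"
    have K: "K > 0" by (simp add: K_def add_nonneg_pos)
    have "cmod (char (\<nu> n s) \<xi> - char (\<nu> n t) \<xi>) < e"
      if st: "s \<in> {0..1}" "t \<in> {0..1}" "\<bar>s - t\<bar> < (e / (2 * K))\<^sup>2" for n s t
    proof -
      have b: "\<bar>\<xi> * cos (\<xi> * x)\<bar> \<le> \<bar>\<xi>\<bar>" "\<bar>- (\<xi> * sin (\<xi> * x))\<bar> \<le> \<bar>\<xi>\<bar>"
        "\<bar>- (\<xi>\<^sup>2 * cos (\<xi> * x))\<bar> \<le> \<xi>\<^sup>2" "\<bar>- (\<xi>\<^sup>2 * sin (\<xi> * x))\<bar> \<le> \<xi>\<^sup>2" for x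
        by (auto simp: abs_mult intro!: mult_left_le)
      have d: "((\<lambda>x. cos (\<xi> * x)) has_real_derivative - (\<xi> * sin (\<xi> * x))) (at x)"
        "((\<lambda>x. - (\<xi> * sin (\<xi> * x))) has_real_derivative - (\<xi>\<^sup>2 * cos (\<xi> * x))) (at x)"
        "((\<lambda>x. sin (\<xi> * x)) has_real_derivative \<xi> * cos (\<xi> * x)) (at x)"
        "((\<lambda>x. \<xi> * cos (\<xi> * x)) has_real_derivative - (\<xi>\<^sup>2 * sin (\<xi> * x))) (at x)" for x
        by (auto intro!: derivative_eq_intros simp: power2_eq_square)
      have c: "continuous_on UNIV (\<lambda>x. - (\<xi>\<^sup>2 * cos (\<xi> * x)))" "continuous_on UNIV (\<lambda>x. - (\<xi>\<^sup>2 * sin (\<xi> * x)))"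
        by (intro continuous_intros)+
      have b0: "\<bar>cos (\<xi> * x)\<bar> \<le> 1" "\<bar>sin (\<xi> * x)\<bar> \<le> 1" for x by auto
      note 1 = S_rate_increment_le[OF d(1) d(2) c(1) b0(1) b(2) b(3) \<nu>(1) \<nu>(2) st(1) st(2), of n]
      note 2 = S_rate_increment_le[OF d(3) d(4) c(2) b0(2) b(1) b(4) \<nu>(1) \<nu>(2) st(1) st(2), of n]
      have "sqrt \<bar>s - t\<bar> < sqrt ((e / (2 * K))\<^sup>2)" using st(3) by (rule real_sqrt_less_mono)
      then have s: "sqrt \<bar>s - t\<bar> < e / (2 * K)" using e K by simp
      have "sqrt \<bar>s - t\<bar> * (a + \<xi>\<^sup>2 + \<bar>\<xi>\<bar>\<^sup>2) \<le> sqrt \<bar>s - t\<bar> * K"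
        unfolding K_def by (intro mult_left_mono) auto
      also have "\<dots> < e / (2 * K) * K" using s K by (intro mult_strict_right_mono) auto
      also have "\<dots> = e / 2" using K by simp
      finally show ?thesis using 1 2 char_diff_le[OF rd[OF st(1), of n] rd[OF st(2), of n], of \<xi>] by linarith
    qed
    moreover have "(e / (2 * K))\<^sup>2 > 0" using e K by simp
    ultimately show ?thesis by blast
  qed
  show ?thesis
    by (rule path_sequence_compact[OF \<nu>(1) tight bl_equicontinuous_of_char[OF rd tight char]])
qed

theorem S_rate_good:
  assumes \<mu>: "real_distribution \<mu>"
  shows "good_rate_function path_space path_dist (S_rate \<mu>)"
  unfolding good_rate_function_def
proof (intro conjI ballI allI impI)
  fix \<nu> assume "\<nu> \<in> path_space"
  \<comment> \<open>The zero test function on the interval [0, 0] contributes the value 0 to the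
    supremum; the products \<open>0 * 0\<close> match the form c g of
    \<open>C21b_time_independent\<close>.\<close>
  have "C21b (\<lambda>x t. 0 * 0) (\<lambda>x t. 0 * 0) (\<lambda>x t. 0 * 0) (\<lambda>x t. 0)"
    by (rule C21b_time_independent[where ?B0.0=0 and ?B1.0=0 and ?B2.0=0]) auto
  note ge = S_rate_ge[OF this, of 0 0 \<nu> \<mu>]
  have "divided_diff (\<lambda>x. 0) (\<lambda>x. 0) x y = 0" for x y by (simp add: divided_diff_def)
  with ge show "0 \<le> S_rate \<mu> \<nu>"
    by (simp add: J_st_def S_st_def bracket_st_def set_lebesgue_integral_def zero_ereal_def)
next
  fix \<rho> \<nu> assume "\<rho> \<in> path_space" "(\<forall>n. \<nu> n \<in> path_space) \<and> (\<lambda>n. path_dist (\<nu> n) \<rho>) \<longlonglongrightarrow> 0"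
  then show "S_rate \<mu> \<rho> \<le> liminf (\<lambda>n. S_rate \<mu> (\<nu> n))"
    using S_rate_lower_semicontinuous[OF \<mu>] by blast
next
  fix a and \<nu> :: "nat \<Rightarrow> real \<Rightarrow> real measure" assume *: "\<forall>n. \<nu> n \<in> path_space \<and> S_rate \<mu> (\<nu> n) \<le> ereal a"
  then obtain r x where r: "strict_mono (r::nat\<Rightarrow>nat)" and x: "x \<in> path_space" "(\<lambda>n. path_dist (\<nu> (r n)) x) \<longlonglongrightarrow> 0"
    using S_rate_level_compact[OF \<mu>, of \<nu> a] by blast
  have "S_rate \<mu> x \<le> liminf (\<lambda>n. S_rate \<mu> (\<nu> (r n)))"
    using * by (intro S_rate_lower_semicontinuous[OF \<mu> _ x]) auto
  also have "\<dots> \<le> ereal a"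
    using * by (intro Liminf_le always_eventually allI) auto
  finally show "\<exists>r x. strict_mono r \<and> x \<in> path_space \<and> S_rate \<mu> x \<le> ereal a \<and> (\<lambda>n. path_dist (\<nu> (r n)) x) \<longlonglongrightarrow> 0"
    using r x by blast
qed

section \<open>Spectral theorem for Hermitian matrices\<close>

text \<open>Matrices and vectors are functions on the natural numbers, read at indices below
  \<open>N\<close>; they are converted to the library's matrices where the Schur form, one-sided
  inverses or the characteristic polynomial come in.\<close>

definition hermitian :: "nat \<Rightarrow> (nat \<Rightarrow> nat \<Rightarrow> complex) \<Rightarrow> bool" where
  "hermitian N X \<longleftrightarrow> (\<forall>k<N. \<forall>l<N. X k l = cnj (X l k))"

definition ip :: "nat \<Rightarrow> (nat \<Rightarrow> complex) \<Rightarrow> (nat \<Rightarrow> complex) \<Rightarrow> complex" where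
  "ip N a b = (\<Sum>k<N. cnj (a k) * b k)"

definition mv :: "nat \<Rightarrow> (nat \<Rightarrow> nat \<Rightarrow> complex) \<Rightarrow> (nat \<Rightarrow> complex) \<Rightarrow> nat \<Rightarrow> complex" where
  "mv N X a = (\<lambda>k. \<Sum>l<N. X k l * a l)"

lemma ip_cnj: "cnj (ip N a b) = ip N b a"
  by (simp add: ip_def mult.commute)

lemma ip_cong: "(\<And>k. k < N \<Longrightarrow> a k = a' k) \<Longrightarrow> (\<And>k. k < N \<Longrightarrow> b k = b' k) \<Longrightarrow> ip N a b = ip N a' b'"
  by (simp add: ip_def)

lemma ip_scale_right: "ip N a (\<lambda>k. c * b k) = c * ip N a b"
  by (simp add: ip_def sum_distrib_left mult_ac)

lemma ip_scale_left: "ip N (\<lambda>k. c * a k) b = cnj c * ip N a b"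
  by (simp add: ip_def sum_distrib_left mult_ac)

lemma cnj_mult_self: "cnj z * z = of_real ((cmod z)\<^sup>2)"
  using complex_norm_square[of z] by (metis mult.commute)

lemma ip_self: "ip N a a = of_real (\<Sum>k<N. (cmod (a k))\<^sup>2)"
  by (simp add: ip_def cnj_mult_self)

lemma hermitianD: "hermitian N X \<Longrightarrow> k < N \<Longrightarrow> l < N \<Longrightarrow> cnj (X l k) = X k l"
  unfolding hermitian_def by metis

lemma ip_mv_hermitian:
  assumes "hermitian N X"
  shows "ip N a (mv N X b) = ip N (mv N X a) b"
proof -
  have "ip N a (mv N X b) = (\<Sum>k<N. \<Sum>l<N. cnj (a k) * X k l * b l)"
    by (simp add: ip_def mv_def sum_distrib_left mult_ac)
  also have "\<dots> = (\<Sum>k<N. \<Sum>l<N. cnj (a k) * cnj (X l k) * b l)"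
    by (intro sum.cong refl) (simp add: hermitianD[OF assms])
  also have "\<dots> = (\<Sum>l<N. \<Sum>k<N. cnj (a k) * cnj (X l k) * b l)" by (rule sum.swap)
  also have "\<dots> = ip N (mv N X a) b"
    by (simp add: ip_def mv_def sum_distrib_left sum_distrib_right mult_ac)
  finally show ?thesis .
qed

lemma sum_diag_mult_commute:
  fixes A B :: "complex mat"
  assumes "A \<in> carrier_mat n n" "B \<in> carrier_mat n n"
  shows "(\<Sum>i<n. (A * B) $$ (i, i)) = (\<Sum>i<n. (B * A) $$ (i, i))"
proof -
  have "(\<Sum>i<n. (A * B) $$ (i, i)) = (\<Sum>i<n. \<Sum>j<n. A $$ (i, j) * B $$ (j, i))"
    using assms by (intro sum.cong refl) (simp add: scalar_prod_def atLeast0LessThan)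
  also have "\<dots> = (\<Sum>j<n. \<Sum>i<n. A $$ (i, j) * B $$ (j, i))" by (rule sum.swap)
  also have "\<dots> = (\<Sum>i<n. (B * A) $$ (i, i))"
    using assms by (intro sum.cong refl) (simp add: scalar_prod_def atLeast0LessThan mult.commute)
  finally show ?thesis .
qed

text \<open>If every eigenvalue were 0, the triangular Schur form T would have zero diagonal and
  tr(A^2) = tr(T^2) = 0. For a Hermitian matrix tr(A^2) is the sum of the squared moduli of all
  entries, which contradicts \<open>X k l \<noteq> 0\<close>.\<close>

lemma hermitian_nonzero_eigenvalue:
  assumes X: "hermitian N X" and nz: "k < N" "l < N" "X k l \<noteq> 0"
  shows "\<exists>\<beta> v. \<beta> \<noteq> 0 \<and> (\<exists>m<N. v m \<noteq> 0) \<and> (\<forall>m<N. mv N X v m = \<beta> * v m)"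
proof (rule ccontr)
  assume neg: "\<not> ?thesis"
  define A where "A = mat N N (\<lambda>(i, j). X i j)"
  have A: "A \<in> carrier_mat N N" by (simp add: A_def)
  have ev0: "e = 0" if ev: "eigenvalue A e" for e
  proof (rule ccontr)
    assume "e \<noteq> 0"
    obtain v where v: "v \<in> carrier_vec N" "v \<noteq> 0\<^sub>v N" "A *\<^sub>v v = e \<cdot>\<^sub>v v"
      using ev A unfolding eigenvalue_def eigenvector_def by auto
    have "\<exists>m<N. v $ m \<noteq> 0" using v(1,2) by (metis carrier_vecD eq_vecI index_zero_vec)
    moreover have "mv N X (\<lambda>m. v $ m) m = e * v $ m" if m: "m < N" for m
    proof -
      have "(A *\<^sub>v v) $ m = mv N X (\<lambda>m. v $ m) m"
        using m v(1) by (simp add: A_def mv_def scalar_prod_def atLeast0LessThan)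
      then show ?thesis using v m by simp
    qed
    ultimately show False using neg \<open>e \<noteq> 0\<close> by blast
  qed
  obtain as where as: "char_poly A = (\<Prod>a\<leftarrow>as. [:- a, 1:])" using char_poly_factorized[OF A] by blast
  obtain T where T: "T \<in> carrier_mat N N" "upper_triangular T" "similar_mat A T"
    using schur_decomposition_exists[OF A as] by blast
  have diag0: "T $$ (i, i) = 0" if i: "i < N" for i
  proof (rule ev0)
    have "T $$ (i, i) \<in> set (diag_mat T)" using i T(1) by (auto simp: diag_mat_def)
    then have "poly (char_poly T) (T $$ (i, i)) = 0"
      unfolding char_poly_upper_triangular[OF T(1,2)] by (auto simp: poly_prod_list prod_list_zero_iff o_def)
    then show "eigenvalue A (T $$ (i, i))"
      unfolding eigenvalue_root_char_poly[OF A] char_poly_similar[OF T(3)] .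
  qed
  obtain P Q where "similar_mat_wit A T P Q" using T(3) unfolding similar_mat_def by blast
  then have PQ: "P \<in> carrier_mat N N" "Q \<in> carrier_mat N N" "Q * P = 1\<^sub>m N" "A = P * T * Q"
    using A unfolding similar_mat_wit_def Let_def by auto
  have "A * A = P * ((T * T) * Q)"
  proof -
    have "A * A = P * T * Q * (P * T * Q)" using PQ(4) by simp
    also have "\<dots> = P * (T * ((Q * P) * (T * Q)))"
      using PQ(1,2) T(1) by (simp add: assoc_mult_mat[of _ N N _ N _ N])
    also have "\<dots> = P * ((T * T) * Q)"
      using PQ(1,2) T(1) unfolding PQ(3) by (simp add: assoc_mult_mat[of _ N N _ N _ N])
    finally show ?thesis .
  qed
  then have "(\<Sum>i<N. (A * A) $$ (i, i)) = (\<Sum>i<N. (P * ((T * T) * Q)) $$ (i, i))" by simp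
  also have "\<dots> = (\<Sum>i<N. (((T * T) * Q) * P) $$ (i, i))"
    using PQ T(1) by (intro sum_diag_mult_commute) auto
  also have "((T * T) * Q) * P = T * T"
    using PQ T(1) by (simp add: assoc_mult_mat[of _ N N _ N _ N])
  also have "(\<Sum>i<N. (T * T) $$ (i, i)) = (\<Sum>i<N. \<Sum>j<N. T $$ (i, j) * T $$ (j, i))"
    using T(1) by (intro sum.cong refl) (simp add: scalar_prod_def atLeast0LessThan)
  also have "\<dots> = 0"
  proof (intro sum.neutral ballI)
    fix i j assume "i \<in> {..<N}" "j \<in> {..<N}"
    then show "T $$ (i, j) * T $$ (j, i) = 0"
      using T(1,2) diag0 unfolding upper_triangular_def by (cases i j rule: linorder_cases) auto
  qed
  finally have "0 = (\<Sum>i<N. (A * A) $$ (i, i))" by simp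
  also have "\<dots> = (\<Sum>i<N. \<Sum>j<N. X i j * X j i)"
    by (intro sum.cong refl) (simp add: A_def scalar_prod_def atLeast0LessThan)
  also have "\<dots> = of_real (\<Sum>i<N. \<Sum>j<N. (cmod (X i j))\<^sup>2)"
  proof -
    have "X i j * X j i = of_real ((cmod (X i j))\<^sup>2)" if "i < N" "j < N" for i j
      using hermitianD[OF X that(2,1)] cnj_mult_self[of "X i j"] by (simp add: mult.commute)
    then show ?thesis by simp
  qed
  finally have "(\<Sum>i<N. \<Sum>j<N. (cmod (X i j))\<^sup>2) = 0" by (metis of_real_eq_0_iff)
  moreover have "(cmod (X k l))\<^sup>2 \<le> (\<Sum>j<N. (cmod (X k j))\<^sup>2)" using nz by (intro member_le_sum) auto
  moreover have "(\<Sum>j<N. (cmod (X k j))\<^sup>2) \<le> (\<Sum>i<N. \<Sum>j<N. (cmod (X i j))\<^sup>2)"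
    using nz by (intro member_le_sum[of k "{..<N}" "\<lambda>i. \<Sum>j<N. (cmod (X i j))\<^sup>2"] sum_nonneg) auto
  moreover have "(cmod (X k l))\<^sup>2 > 0" using nz by simp
  ultimately show False by linarith
qed

lemma hermitian_eigenvalue_real:
  assumes X: "hermitian N X" and v: "\<exists>m<N. v m \<noteq> 0" "\<And>m. m < N \<Longrightarrow> mv N X v m = \<beta> * v m"
  shows "\<beta> = of_real (Re \<beta>)"
proof -
  have "ip N v (mv N X v) = \<beta> * ip N v v" unfolding ip_scale_right[symmetric] by (intro ip_cong v refl)
  moreover have "ip N (mv N X v) v = cnj \<beta> * ip N v v" unfolding ip_scale_left[symmetric] by (intro ip_cong v refl)
  ultimately have "(\<beta> - cnj \<beta>) * ip N v v = 0"
    using ip_mv_hermitian[OF X, of v v] by (simp only: left_diff_distrib diff_self)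
  moreover have "ip N v v \<noteq> 0"
  proof -
    obtain m where "m < N" "v m \<noteq> 0" using v(1) by blast
    then have "0 < (\<Sum>k<N. (cmod (v k))\<^sup>2)" by (intro sum_pos2[of _ m]) auto
    then show ?thesis unfolding ip_self by (metis less_irrefl of_real_eq_0_iff)
  qed
  ultimately have "\<beta> = cnj \<beta>" by simp
  then show ?thesis by (simp add: complex_eq_iff)
qed

text \<open>Induction by deflation: \<open>Y\<close> is \<open>X\<close> minus the spectral part
  already found. An eigenvector of \<open>Y\<close> for a nonzero eigenvalue is orthogonal to the
  old ones because \<open>Y\<close> annihilates them; if \<open>Y\<close> vanishes, any nonzero
  vector orthogonal to them is an eigenvector of \<open>X\<close> for 0.\<close>

lemma hermitian_orthonormal_eigenvectors:
  assumes X: "hermitian N X" and "k \<le> N"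
  shows "\<exists>u (lam :: nat \<Rightarrow> real). (\<forall>i<k. \<forall>j<k. ip N (u i) (u j) = (if i = j then 1 else 0)) \<and>
     (\<forall>i<k. \<forall>m<N. mv N X (u i) m = of_real (lam i) * u i m)"
  using \<open>k \<le> N\<close>
proof (induction k)
  case (Suc k)
  then obtain u and lam :: "nat \<Rightarrow> real" where *: "(\<forall>i<k. \<forall>j<k. ip N (u i) (u j) = (if i = j then 1 else 0)) \<and>
     (\<forall>i<k. \<forall>m<N. mv N X (u i) m = of_real (lam i) * u i m)" using Suc_leD by blast
  have o: "\<And>i j. i < k \<Longrightarrow> j < k \<Longrightarrow> ip N (u i) (u j) = (if i = j then 1 else 0)"
    and e: "\<And>i m. i < k \<Longrightarrow> m < N \<Longrightarrow> mv N X (u i) m = of_real (lam i) * u i m" using * by blast+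
  have kN: "k < N" using Suc by simp
  define Y where "Y m l = X m l - (\<Sum>i<k. of_real (lam i) * u i m * cnj (u i l))" for m l
  have Yh: "hermitian N Y"
    unfolding hermitian_def Y_def using hermitianD[OF X] by (simp add: mult_ac)
  have mvY: "mv N Y a m = mv N X a m - (\<Sum>i<k. of_real (lam i) * ip N (u i) a * u i m)" for a m
  proof -
    have "mv N Y a m = mv N X a m - (\<Sum>l<N. \<Sum>i<k. of_real (lam i) * u i m * cnj (u i l) * a l)"
      by (simp add: mv_def Y_def left_diff_distrib sum_subtractf sum_distrib_right)
    also have "(\<Sum>l<N. \<Sum>i<k. of_real (lam i) * u i m * cnj (u i l) * a l) = (\<Sum>i<k. \<Sum>l<N. of_real (lam i) * u i m * cnj (u i l) * a l)"
      by (rule sum.swap)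
    also have "\<dots> = (\<Sum>i<k. of_real (lam i) * ip N (u i) a * u i m)"
      by (simp add: ip_def sum_distrib_left sum_distrib_right mult_ac)
    finally show ?thesis .
  qed
  have "\<exists>v \<beta>. (\<exists>m<N. v m \<noteq> 0) \<and> (\<forall>i<k. ip N (u i) v = 0) \<and> (\<forall>m<N. mv N X v m = \<beta> * v m)"
  proof (cases "\<exists>m<N. \<exists>l<N. Y m l \<noteq> 0")
    case True
    then obtain \<beta> v where \<beta>: "\<beta> \<noteq> 0" and v: "\<exists>m<N. v m \<noteq> 0" "\<And>m. m < N \<Longrightarrow> mv N Y v m = \<beta> * v m"
      using hermitian_nonzero_eigenvalue[OF Yh] by blast
    have orth: "ip N (u i) v = 0" if i: "i < k" for i
    proof -
      have "mv N Y (u i) m = 0" if m: "m < N" for m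
      proof -
        have "(\<Sum>j<k. of_real (lam j) * ip N (u j) (u i) * u j m) = (\<Sum>j<k. if j = i then of_real (lam i) * u i m else 0)"
          using i o by (intro sum.cong refl) auto
        then show ?thesis unfolding mvY using e[OF i m] i by simp
      qed
      then have "ip N (mv N Y (u i)) v = 0" by (simp add: ip_def)
      moreover have "ip N (u i) (mv N Y v) = \<beta> * ip N (u i) v"
        unfolding ip_scale_right[symmetric] by (intro ip_cong v refl)
      ultimately show ?thesis using ip_mv_hermitian[OF Yh, of "u i" v] \<beta> by simp
    qed
    have "mv N X v m = \<beta> * v m" if "m < N" for m using v(2)[OF that] orth unfolding mvY by simp
    then show ?thesis using v(1) orth by blast
  next
    case False
    \<comment> \<open>\<open>w j\<close> is the j-th standard basis vector projected onto the
      orthogonal complement of the vectors found so far.\<close>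
    define w where "w j m = (if m = j then 1 else 0) - (\<Sum>i<k. u i m * cnj (u i j))" for j m
    have orth: "ip N (u i) (w j) = 0" if i: "i < k" and j: "j < N" for i j
    proof -
      have "ip N (u i) (w j) = (\<Sum>m<N. cnj (u i m) * (if m = j then 1 else 0)) - (\<Sum>m<N. \<Sum>l<k. cnj (u i m) * u l m * cnj (u l j))"
        by (simp add: ip_def w_def right_diff_distrib sum_subtractf sum_distrib_left mult_ac)
      also have "(\<Sum>m<N. cnj (u i m) * (if m = j then 1 else 0)) = cnj (u i j)" using j by (simp add: if_distrib cong: if_cong)
      also have "(\<Sum>m<N. \<Sum>l<k. cnj (u i m) * u l m * cnj (u l j)) = (\<Sum>l<k. \<Sum>m<N. cnj (u i m) * u l m * cnj (u l j))"
        by (rule sum.swap)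
      also have "\<dots> = (\<Sum>l<k. ip N (u i) (u l) * cnj (u l j))" by (simp add: ip_def sum_distrib_right)
      also have "\<dots> = (\<Sum>l<k. if l = i then cnj (u i j) else 0)" using i o by (intro sum.cong refl) auto
      also have "\<dots> = cnj (u i j)" using i by simp
      finally show ?thesis by simp
    qed
    \<comment> \<open>Comparison of traces: if all \<open>w j\<close> vanished, the projection onto
      the span of the k orthonormal vectors would have trace N, but its trace is k < N.\<close>
    have "\<exists>j<N. \<exists>m<N. w j m \<noteq> 0"
    proof (rule ccontr)
      assume "\<not> ?thesis"
      then have "w j j = 0" if "j < N" for j using that by blast
      then have "(\<Sum>j<N. 1 :: complex) = (\<Sum>j<N. \<Sum>i<k. u i j * cnj (u i j))"
        unfolding w_def by (intro sum.cong refl) (simp add: algebra_simps)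
      also have "\<dots> = (\<Sum>i<k. \<Sum>j<N. u i j * cnj (u i j))" by (rule sum.swap)
      also have "\<dots> = (\<Sum>i<k. ip N (u i) (u i))" by (simp add: ip_def mult.commute)
      also have "\<dots> = (\<Sum>i<k. 1)" using o by (intro sum.cong refl) auto
      finally show False using kN by simp
    qed
    then obtain j where j: "j < N" "\<exists>m<N. w j m \<noteq> 0" by blast
    have "mv N X (w j) m = 0 * w j m" if "m < N" for m
    proof -
      have "mv N Y (w j) m = 0" using False that by (simp add: mv_def)
      then show ?thesis unfolding mvY using orth[OF _ j(1)] by simp
    qed
    then show ?thesis using j orth[OF _ j(1)] by blast
  qed
  then obtain v \<beta> where v: "\<exists>m<N. v m \<noteq> 0" "\<And>i. i < k \<Longrightarrow> ip N (u i) v = 0" "\<And>m. m < N \<Longrightarrow> mv N X v m = \<beta> * v m" by blast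
  define b where "b = Re \<beta>"
  have \<beta>: "\<beta> = of_real b" unfolding b_def by (rule hermitian_eigenvalue_real[OF X v(1,3)])
  define s where "s = (\<Sum>m<N. (cmod (v m))\<^sup>2)"
  obtain m where m: "m < N" "v m \<noteq> 0" using v(1) by blast
  have s: "s > 0" unfolding s_def using m by (intro sum_pos2[of _ m]) auto
  define w where "w m = of_real (1 / sqrt s) * v m" for m
  have w1: "ip N w w = 1"
  proof -
    have "ip N w w = of_real (1 / sqrt s) * (of_real (1 / sqrt s) * of_real s)"
      unfolding w_def ip_scale_left ip_scale_right unfolding ip_self s_def[symmetric] by simp
    also have "\<dots> = of_real ((1 / sqrt s) * ((1 / sqrt s) * s))" by (simp only: of_real_mult)
    also have "(1 / sqrt s) * ((1 / sqrt s) * s) = 1" using s by (simp add: field_simps)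
    finally show ?thesis by simp
  qed
  have w0: "ip N (u i) w = 0" "ip N w (u i) = 0" if "i < k" for i
  proof -
    show "ip N (u i) w = 0" unfolding w_def ip_scale_right using v(2)[OF that] by simp
    then show "ip N w (u i) = 0" using ip_cnj[of N "u i" w] by simp
  qed
  have we: "mv N X w m = of_real b * w m" if "m < N" for m
  proof -
    have "mv N X w m = of_real (1 / sqrt s) * mv N X v m" unfolding mv_def w_def by (simp add: sum_distrib_left mult_ac)
    then show ?thesis using v(3)[OF that] \<beta> by (simp add: w_def)
  qed
  show ?case
    by (rule exI[of _ "u(k := w)"], rule exI[of _ "lam(k := b)"])
       (use o e w1 w0 we in \<open>auto simp: less_Suc_eq\<close>)
qed simp

text \<open>The second clause, the resolution of the identity, is dual to orthonormality: for the
  square matrix of eigenvectors a left inverse is also a right inverse.\<close>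

definition eigenbasis :: "nat \<Rightarrow> (nat \<Rightarrow> nat \<Rightarrow> complex) \<Rightarrow> (nat \<Rightarrow> real) \<Rightarrow> (nat \<Rightarrow> nat \<Rightarrow> complex) \<Rightarrow> bool" where
  "eigenbasis N X lam u \<longleftrightarrow> (\<forall>i<N. \<forall>j<N. ip N (u i) (u j) = (if i = j then 1 else 0)) \<and>
     (\<forall>k<N. \<forall>l<N. (\<Sum>i<N. u i k * cnj (u i l)) = (if k = l then 1 else 0)) \<and>
     (\<forall>i<N. \<forall>m<N. mv N X (u i) m = of_real (lam i) * u i m)"

theorem hermitian_eigenbasis:
  assumes X: "hermitian N X"
  shows "\<exists>lam u. eigenbasis N X lam u"
proof -
  obtain u and lam :: "nat \<Rightarrow> real" where o: "\<And>i j. i < N \<Longrightarrow> j < N \<Longrightarrow> ip N (u i) (u j) = (if i = j then 1 else 0)"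
    and e: "\<And>i m. i < N \<Longrightarrow> m < N \<Longrightarrow> mv N X (u i) m = of_real (lam i) * u i m"
    using hermitian_orthonormal_eigenvectors[OF X order_refl] by blast
  define U where "U = mat N N (\<lambda>(m, i). u i m)"
  define V where "V = mat N N (\<lambda>(i, m). cnj (u i m))"
  have c: "V \<in> carrier_mat N N" "U \<in> carrier_mat N N" by (auto simp: U_def V_def)
  have "V * U = 1\<^sub>m N"
    using o by (intro eq_matI) (auto simp: U_def V_def scalar_prod_def ip_def atLeast0LessThan)
  from mat_mult_left_right_inverse[OF c this] have UV: "U * V = 1\<^sub>m N" .
  have "(\<Sum>i<N. u i k * cnj (u i l)) = (if k = l then 1 else 0)" if kl: "k < N" "l < N" for k l
  proof -
    have "(U * V) $$ (k, l) = (\<Sum>i<N. u i k * cnj (u i l))"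
      using kl by (simp add: U_def V_def scalar_prod_def atLeast0LessThan)
    then show ?thesis unfolding UV using kl by simp
  qed
  with o e show ?thesis unfolding eigenbasis_def by blast
qed

section \<open>From an eigenbasis to the spectral measure\<close>

lemma eigenbasis_char_poly:
  assumes E: "eigenbasis N X lam u"
  shows "char_poly (mat N N (\<lambda>(i, j). X i j)) = (\<Prod>a\<leftarrow>map lam [0..<N]. [:- complex_of_real a, 1:])"
proof -
  define A where "A = mat N N (\<lambda>(i, j). X i j)"
  define U where "U = mat N N (\<lambda>(m, i). u i m)"
  define V where "V = mat N N (\<lambda>(i, m). cnj (u i m))"
  define T where "T = mat N N (\<lambda>(i, j). if i = j then complex_of_real (lam i) else 0)"
  have c: "A \<in> carrier_mat N N" "U \<in> carrier_mat N N" "V \<in> carrier_mat N N" "T \<in> carrier_mat N N"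
    by (auto simp: A_def U_def V_def T_def)
  have VU: "V * U = 1\<^sub>m N"
    using E unfolding eigenbasis_def by (intro eq_matI) (auto simp: U_def V_def scalar_prod_def ip_def atLeast0LessThan)
  have UV: "U * V = 1\<^sub>m N"
    using E unfolding eigenbasis_def by (intro eq_matI) (auto simp: U_def V_def scalar_prod_def atLeast0LessThan)
  have AU: "A * U = U * T"
  proof (rule eq_matI)
    fix m i assume mi: "m < dim_row (U * T)" "i < dim_col (U * T)"
    then have mi': "m < N" "i < N" using c by auto
    have "(A * U) $$ (m, i) = mv N X (u i) m"
      using mi' by (simp add: A_def U_def mv_def scalar_prod_def atLeast0LessThan)
    also have "\<dots> = of_real (lam i) * u i m" using E mi' unfolding eigenbasis_def by blast
    also have "\<dots> = (\<Sum>l<N. u l m * (if l = i then complex_of_real (lam l) else 0))"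
      using mi' by (simp add: if_distrib mult.commute cong: if_cong)
    also have "\<dots> = (U * T) $$ (m, i)"
      using mi' by (simp add: T_def U_def scalar_prod_def atLeast0LessThan)
    finally show "(A * U) $$ (m, i) = (U * T) $$ (m, i)" .
  qed (use c in auto)
  have "A = A * (U * V)" using c UV by simp
  also have "\<dots> = U * T * V" unfolding AU[symmetric] using assoc_mult_mat[OF c(1-3)] by simp
  finally have "similar_mat A T"
    unfolding similar_mat_def using similar_mat_witI[OF UV VU _ c(1,4,2,3)] by blast
  then have "char_poly A = char_poly T" by (rule char_poly_similar)
  also have "\<dots> = (\<Prod>a\<leftarrow>diag_mat T. [:- a, 1:])"
    by (rule char_poly_upper_triangular[OF c(4)]) (auto simp: T_def)
  also have "diag_mat T = map complex_of_real (map lam [0..<N])"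
    by (auto simp: diag_mat_def T_def)
  finally show ?thesis by (simp add: A_def o_def)
qed

lemma order_prod_linear_factors:
  "Polynomial.order (complex_of_real x) (\<Prod>a\<leftarrow>ls. [:- complex_of_real a, 1:]) = count (mset ls) x"
proof (induction ls)
  case (Cons a ls)
  have nz: "(\<Prod>a\<leftarrow>ls. [:- complex_of_real a, 1:]) \<noteq> 0" by (auto simp: prod_list_zero_iff)
  have l: "Polynomial.order (complex_of_real x) [:- complex_of_real a, 1:] = (if a = x then 1 else 0)"
    by (auto simp: order_linear')
  have "Polynomial.order (complex_of_real x) ([:- complex_of_real a, 1:] * (\<Prod>a\<leftarrow>ls. [:- complex_of_real a, 1:]))
     = Polynomial.order (complex_of_real x) [:- complex_of_real a, 1:] + Polynomial.order (complex_of_real x) (\<Prod>a\<leftarrow>ls. [:- complex_of_real a, 1:])"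
    using nz by (intro Polynomial.order_mult no_zero_divisors) auto
  then show ?case unfolding l using Cons.IH by simp
qed simp

text \<open>Ties the definition by root orders of the characteristic polynomial to an arbitrary
  eigenbasis, so that integrals against a spectral measure become averages over
  \<open>lam\<close>.\<close>

lemma real_eigenvalues_eigenbasis:
  assumes "eigenbasis N X lam u"
  shows "real_eigenvalues (mat N N (\<lambda>(i, j). X i j)) = image_mset lam (mset_set {..<N})"
proof -
  have "(\<lambda>x. Polynomial.order (complex_of_real x) (char_poly (mat N N (\<lambda>(i, j). X i j)))) = count (mset (map lam [0..<N]))"
    unfolding eigenbasis_char_poly[OF assms] order_prod_linear_factors ..
  then have "real_eigenvalues (mat N N (\<lambda>(i, j). X i j)) = mset (map lam [0..<N])"
    unfolding real_eigenvalues_def by (simp only: count_inverse)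
  then show ?thesis by (simp add: atLeast0LessThan)
qed

text \<open>The image of a \<open>pmf\<close> is a probability measure, whatever the multiset of
  real eigenvalues happens to be.\<close>

lemma real_distribution_spectral_measure: "real_distribution (spectral_measure A)"
proof -
  interpret prob_space "spectral_measure A"
    unfolding spectral_measure_def empirical_def by (rule measure_pmf.prob_space_distr) simp
  show ?thesis by standard (simp add: spectral_measure_def empirical_def)
qed

lemma spectral_measure_integral:
  fixes g :: "real \<Rightarrow> real"
  assumes E: "eigenbasis N X lam u" and N: "N > 0" and g: "g \<in> borel_measurable borel"
  shows "(\<integral>x. g x \<partial>spectral_measure (mat N N (\<lambda>(i, j). X i j))) = (\<Sum>i<N. g (lam i)) / real N"
proof -
  have ne: "{..<N} \<noteq> {}" using N by auto
  have "pmf_of_multiset (image_mset lam (mset_set {..<N})) = map_pmf lam (pmf_of_set {..<N})"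
    using ne by (simp add: map_pmf_of_set)
  then show ?thesis
    unfolding spectral_measure_def empirical_def real_eigenvalues_eigenbasis[OF E] using g ne
    by (simp add: integral_distr integral_pmf_of_set)
qed

lemma spectral_measure_pair_integral:
  fixes g :: "real \<times> real \<Rightarrow> real"
  assumes E: "eigenbasis N X lam u" and N: "N > 0" and g: "g \<in> borel_measurable borel" and B: "\<And>z. \<bar>g z\<bar> \<le> B"
  shows "(\<integral>z. g z \<partial>(spectral_measure (mat N N (\<lambda>(i, j). X i j)) \<Otimes>\<^sub>M spectral_measure (mat N N (\<lambda>(i, j). X i j))))
     = (\<Sum>i<N. \<Sum>j<N. g (lam i, lam j)) / (real N)\<^sup>2"
proof -
  let ?S = "spectral_measure (mat N N (\<lambda>(i, j). X i j))"
  interpret real_distribution ?S by (rule real_distribution_spectral_measure)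
  interpret P: pair_prob_space ?S ?S ..
  have gm: "g \<in> borel_measurable (?S \<Otimes>\<^sub>M ?S)"
    using g by (subst measurable_cong_sets[OF sets_pair_measure_cong[OF events_eq_borel events_eq_borel] refl]) (simp add: borel_prod)
  have gm': "g \<in> borel_measurable (borel \<Otimes>\<^sub>M borel)" using g by (simp add: borel_prod)
  have "integrable (?S \<Otimes>\<^sub>M ?S) g" using B gm by (intro P.integrable_const_bound[of _ B]) auto
  then have "(\<integral>z. g z \<partial>(?S \<Otimes>\<^sub>M ?S)) = (\<integral>x. \<integral>y. g (x, y) \<partial>?S \<partial>?S)"
    using P.integral_fst'[of g] by simp
  also have "\<dots> = (\<integral>x. (\<Sum>j<N. g (x, lam j)) / real N \<partial>?S)"
    by (intro Bochner_Integration.integral_cong refl spectral_measure_integral[OF E N] measurable_Pair2[OF gm']) simp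
  also have "\<dots> = (\<Sum>i<N. (\<Sum>j<N. g (lam i, lam j)) / real N) / real N"
  proof (rule spectral_measure_integral[OF E N])
    have "(\<lambda>x. g (x, lam j)) \<in> borel_measurable borel" for j by (rule measurable_Pair1[OF gm']) simp
    then show "(\<lambda>x. (\<Sum>j<N. g (x, lam j)) / real N) \<in> borel_measurable borel" by measurable
  qed
  finally show ?thesis by (simp add: sum_divide_distrib[symmetric] power2_eq_square)
qed

section \<open>Traces of functions of perturbed Hermitian matrices\<close>

text \<open>The square of the Hilbert-Schmidt norm, not the norm itself.\<close>

definition hs :: "nat \<Rightarrow> (nat \<Rightarrow> nat \<Rightarrow> complex) \<Rightarrow> real" where
  "hs N A = (\<Sum>k<N. \<Sum>l<N. (cmod (A k l))\<^sup>2)"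

lemma hs_nonneg: "0 \<le> hs N A"
  unfolding hs_def by (intro sum_nonneg) auto

lemma eigenbasis_orthonormal:
  "eigenbasis N X lam u \<Longrightarrow> i < N \<Longrightarrow> j < N \<Longrightarrow> ip N (u i) (u j) = (if i = j then 1 else 0)"
  unfolding eigenbasis_def by blast

lemma eigenbasis_complete:
  "eigenbasis N X lam u \<Longrightarrow> k < N \<Longrightarrow> l < N \<Longrightarrow> (\<Sum>i<N. u i k * cnj (u i l)) = (if k = l then 1 else 0)"
  unfolding eigenbasis_def by blast

lemma eigenbasis_mv:
  "eigenbasis N X lam u \<Longrightarrow> i < N \<Longrightarrow> m < N \<Longrightarrow> mv N X (u i) m = of_real (lam i) * u i m"
  unfolding eigenbasis_def by blast

lemma parseval:
  assumes E: "eigenbasis N X lam u"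
  shows "ip N a b = (\<Sum>i<N. ip N a (u i) * ip N (u i) b)"
proof -
  have "(\<Sum>i<N. ip N a (u i) * ip N (u i) b) = (\<Sum>i<N. \<Sum>k<N. \<Sum>l<N. cnj (a k) * b l * (u i k * cnj (u i l)))"
    unfolding ip_def sum_product by (intro sum.cong refl) (simp add: mult_ac)
  also have "\<dots> = (\<Sum>k<N. \<Sum>i<N. \<Sum>l<N. cnj (a k) * b l * (u i k * cnj (u i l)))" by (rule sum.swap)
  also have "\<dots> = (\<Sum>k<N. \<Sum>l<N. \<Sum>i<N. cnj (a k) * b l * (u i k * cnj (u i l)))"
    by (intro sum.cong refl sum.swap)
  also have "\<dots> = (\<Sum>k<N. \<Sum>l<N. cnj (a k) * b l * (if k = l then 1 else 0))"
    by (intro sum.cong refl) (simp add: sum_distrib_left[symmetric] eigenbasis_complete[OF E])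
  also have "\<dots> = (\<Sum>k<N. cnj (a k) * b k)"
    by (intro sum.cong refl) (simp add: if_distrib cong: if_cong)
  finally show ?thesis by (simp add: ip_def)
qed

lemma cmod_ip_commute: "cmod (ip N a b) = cmod (ip N b a)"
  by (metis complex_mod_cnj ip_cnj)

lemma ip_mult_commuted: "ip N a b * ip N b a = of_real ((cmod (ip N a b))\<^sup>2)"
  using cnj_mult_self[of "ip N a b"] by (simp add: ip_cnj mult.commute)

lemma parseval_norm:
  assumes E: "eigenbasis N X lam u"
  shows "(\<Sum>k<N. (cmod (a k))\<^sup>2) = (\<Sum>i<N. (cmod (ip N a (u i)))\<^sup>2)"
proof -
  have "complex_of_real (\<Sum>k<N. (cmod (a k))\<^sup>2) = (\<Sum>i<N. ip N a (u i) * ip N (u i) a)"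
    unfolding ip_self[symmetric] by (rule parseval[OF E])
  also have "\<dots> = of_real (\<Sum>i<N. (cmod (ip N a (u i)))\<^sup>2)"
    unfolding ip_mult_commuted by simp
  finally have "complex_of_real (\<Sum>k<N. (cmod (a k))\<^sup>2) = of_real (\<Sum>i<N. (cmod (ip N a (u i)))\<^sup>2)" .
  then show ?thesis by (simp only: of_real_eq_iff)
qed

text \<open>Parseval in each row: the Hilbert-Schmidt norm does not depend on the orthonormal basis
  in which it is computed.\<close>

lemma hs_eigenbasis:
  assumes E: "eigenbasis N X lam u"
  shows "(\<Sum>j<N. \<Sum>k<N. (cmod (mv N A (u j) k))\<^sup>2) = hs N A"
proof -
  have "(\<Sum>j<N. \<Sum>k<N. (cmod (mv N A (u j) k))\<^sup>2) = (\<Sum>k<N. \<Sum>j<N. (cmod (mv N A (u j) k))\<^sup>2)" by (rule sum.swap)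
  also have "\<dots> = (\<Sum>k<N. \<Sum>j<N. (cmod (ip N (\<lambda>l. cnj (A k l)) (u j)))\<^sup>2)" by (simp add: ip_def mv_def)
  also have "\<dots> = hs N A" unfolding parseval_norm[OF E, symmetric] by (simp add: hs_def)
  finally show ?thesis .
qed

lemma sum_sum_Cauchy_Schwarz:
  fixes a b :: "nat \<Rightarrow> nat \<Rightarrow> real"
  shows "(\<Sum>i<n. \<Sum>j<m. \<bar>a i j\<bar> * \<bar>b i j\<bar>) \<le> sqrt (\<Sum>i<n. \<Sum>j<m. (a i j)\<^sup>2) * sqrt (\<Sum>i<n. \<Sum>j<m. (b i j)\<^sup>2)"
  using L2_set_mult_ineq[of "\<lambda>(i, j). a i j" "\<lambda>(i, j). b i j" "{..<n} \<times> {..<m}"]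
  by (simp add: L2_set_def sum.cartesian_product case_prod_unfold)

text \<open>The eigenbases are arbitrary and the eigenvalues unordered. The difference
  \<open>A\<close> is a separate parameter, constrained at indices below \<open>N\<close>, so that
  the linear expression \<open>hm N y\<close> can be substituted for it.\<close>

locale hermitian_pair =
  fixes N X Y A lam mu u v
  assumes X: "hermitian N X" and Y: "hermitian N Y"
    and EX: "eigenbasis N X lam u" and EY: "eigenbasis N Y mu v"
    and A_def: "\<And>k l. k < N \<Longrightarrow> l < N \<Longrightarrow> A k l = Y k l - X k l"
begin

text \<open>The weights \<^term>\<open>w i j / real N\<close> couple the two spectral measures;
  the coupling has quadratic cost exactly the normalised Hilbert-Schmidt norm of the difference.\<close>

definition w :: "nat \<Rightarrow> nat \<Rightarrow> real" where "w i j = (cmod (ip N (u i) (v j)))\<^sup>2"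

lemma A_hermitian: "hermitian N A"
  unfolding hermitian_def using A_def hermitianD[OF X] hermitianD[OF Y] by simp

text \<open>\<open>X\<close> is moved to the left vector by Hermitian symmetry and \<open>Y\<close>
  acts on the right vector, so each contributes an eigenvalue. The identity converts eigenvalue gaps
  weighted by \<open>w\<close> into matrix elements of \<open>A\<close>.\<close>

lemma ip_diff:
  assumes "i < N" "j < N"
  shows "ip N (u i) (mv N A (v j)) = of_real (mu j - lam i) * ip N (u i) (v j)"
proof -
  have "ip N (u i) (mv N A (v j)) = ip N (u i) (\<lambda>k. mv N Y (v j) k - mv N X (v j) k)"
    by (intro ip_cong refl) (simp add: mv_def A_def left_diff_distrib sum_subtractf)
  also have "\<dots> = ip N (u i) (mv N Y (v j)) - ip N (u i) (mv N X (v j))"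
    by (simp add: ip_def right_diff_distrib sum_subtractf)
  also have "ip N (u i) (mv N X (v j)) = ip N (mv N X (u i)) (v j)" by (rule ip_mv_hermitian[OF X])
  also have "\<dots> = ip N (\<lambda>m. of_real (lam i) * u i m) (v j)" by (intro ip_cong refl eigenbasis_mv[OF EX] assms)
  also have "ip N (u i) (mv N Y (v j)) = ip N (u i) (\<lambda>m. of_real (mu j) * v j m)" by (intro ip_cong refl eigenbasis_mv[OF EY] assms)
  finally show ?thesis by (simp add: ip_scale_left ip_scale_right algebra_simps)
qed

lemma w_mult: "i < N \<Longrightarrow> j < N \<Longrightarrow> w i j * (mu j - lam i)\<^sup>2 = (cmod (ip N (u i) (mv N A (v j))))\<^sup>2"
  by (simp add: ip_diff w_def norm_mult power_mult_distrib flip: of_real_diff)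

lemma w_row: "i < N \<Longrightarrow> (\<Sum>j<N. w i j) = 1"
  unfolding w_def parseval_norm[OF EY, symmetric]
  using eigenbasis_orthonormal[OF EX, of i i] unfolding ip_self by (metis of_real_eq_1_iff)

lemma w_col: "j < N \<Longrightarrow> (\<Sum>i<N. w i j) = 1"
  unfolding w_def cmod_ip_commute[of N _ "v j"] parseval_norm[OF EX, symmetric]
  using eigenbasis_orthonormal[OF EY, of j j] unfolding ip_self by (metis of_real_eq_1_iff)

lemma w_cost: "(\<Sum>i<N. \<Sum>j<N. w i j * (mu j - lam i)\<^sup>2) = hs N A"
proof -
  have "(\<Sum>i<N. \<Sum>j<N. w i j * (mu j - lam i)\<^sup>2) = (\<Sum>i<N. \<Sum>j<N. (cmod (ip N (mv N A (v j)) (u i)))\<^sup>2)"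
    by (intro sum.cong refl) (simp add: w_mult cmod_ip_commute)
  also have "\<dots> = (\<Sum>j<N. \<Sum>i<N. (cmod (ip N (mv N A (v j)) (u i)))\<^sup>2)" by (rule sum.swap)
  also have "\<dots> = hs N A" unfolding parseval_norm[OF EX, symmetric] hs_eigenbasis[OF EY] ..
  finally show ?thesis .
qed

lemma sum_diff_coupling: "(\<Sum>j<N. g (mu j)) - (\<Sum>i<N. g (lam i)) = (\<Sum>i<N. \<Sum>j<N. w i j * (g (mu j) - g (lam i)))"
proof -
  have "(\<Sum>i<N. \<Sum>j<N. w i j * (g (mu j) - g (lam i))) = (\<Sum>i<N. \<Sum>j<N. w i j * g (mu j)) - (\<Sum>i<N. \<Sum>j<N. w i j * g (lam i))"
    by (simp add: right_diff_distrib sum_subtractf)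
  also have "(\<Sum>i<N. \<Sum>j<N. w i j * g (mu j)) = (\<Sum>j<N. \<Sum>i<N. w i j * g (mu j))" by (rule sum.swap)
  also have "\<dots> = (\<Sum>j<N. g (mu j))" by (intro sum.cong refl) (simp add: sum_distrib_right[symmetric] w_col)
  also have "(\<Sum>i<N. \<Sum>j<N. w i j * g (lam i)) = (\<Sum>i<N. g (lam i))"
    by (intro sum.cong refl) (simp add: sum_distrib_right[symmetric] w_row)
  finally show ?thesis by simp
qed

text \<open>A Hoffman-Wielandt type estimate: Cauchy-Schwarz in the coupling, with the summand split
  into sqrt w and sqrt w (mu - lam). The total mass of \<open>w\<close> gives sqrt N and its cost
  gives the square root of \<open>hs N A\<close>.\<close>

lemma trace_lipschitz:
  assumes L: "\<And>x y. \<bar>g x - g y\<bar> \<le> L * \<bar>x - y\<bar>"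
  shows "\<bar>(\<Sum>j<N. g (mu j)) - (\<Sum>i<N. g (lam i))\<bar> \<le> L * sqrt (real N) * sqrt (hs N A)"
proof -
  have L0: "0 \<le> L" using L[of 0 1] by simp
  have "\<bar>(\<Sum>j<N. g (mu j)) - (\<Sum>i<N. g (lam i))\<bar> \<le> (\<Sum>i<N. \<Sum>j<N. \<bar>w i j * (g (mu j) - g (lam i))\<bar>)"
    unfolding sum_diff_coupling by (intro order_trans[OF sum_abs] sum_mono sum_abs)
  also have "\<dots> \<le> (\<Sum>i<N. \<Sum>j<N. L * (\<bar>sqrt (w i j)\<bar> * \<bar>sqrt (w i j) * (mu j - lam i)\<bar>))"
  proof (intro sum_mono)
    fix i j
    have w: "0 \<le> w i j" by (simp add: w_def)
    have "\<bar>w i j * (g (mu j) - g (lam i))\<bar> \<le> w i j * (L * \<bar>mu j - lam i\<bar>)"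
      using w L by (simp add: abs_mult mult_left_mono)
    also have "\<dots> = L * (\<bar>sqrt (w i j)\<bar> * \<bar>sqrt (w i j) * (mu j - lam i)\<bar>)"
    proof -
      have "sqrt (w i j) * (sqrt (w i j) * \<bar>mu j - lam i\<bar>) = w i j * \<bar>mu j - lam i\<bar>"
        using w by (simp flip: mult.assoc)
      then show ?thesis using w by (simp add: abs_mult)
    qed
    finally show "\<bar>w i j * (g (mu j) - g (lam i))\<bar> \<le> L * (\<bar>sqrt (w i j)\<bar> * \<bar>sqrt (w i j) * (mu j - lam i)\<bar>)" .
  qed
  also have "\<dots> = L * (\<Sum>i<N. \<Sum>j<N. \<bar>sqrt (w i j)\<bar> * \<bar>sqrt (w i j) * (mu j - lam i)\<bar>)"
    by (simp add: sum_distrib_left)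
  also have "\<dots> \<le> L * (sqrt (\<Sum>i<N. \<Sum>j<N. (sqrt (w i j))\<^sup>2) * sqrt (\<Sum>i<N. \<Sum>j<N. (sqrt (w i j) * (mu j - lam i))\<^sup>2))"
    by (intro mult_left_mono sum_sum_Cauchy_Schwarz L0)
  also have "(\<Sum>i<N. \<Sum>j<N. (sqrt (w i j))\<^sup>2) = (\<Sum>i<N. \<Sum>j<N. w i j)" by (simp add: w_def)
  also have "\<dots> = real N" by (simp add: w_row)
  also have "(\<Sum>i<N. \<Sum>j<N. (sqrt (w i j) * (mu j - lam i))\<^sup>2) = (\<Sum>i<N. \<Sum>j<N. w i j * (mu j - lam i)\<^sup>2)"
    by (simp add: w_def power_mult_distrib)
  also have "\<dots> = hs N A" by (rule w_cost)
  finally show ?thesis by (simp add: mult.assoc)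
qed

text \<open>The two sums are <a, g(Y) a> and <a, g(X) a>. Expanding both in both bases gives the
  terms <a, u_k> <u_k, v_j> <v_j, a> with the factor g(mu_j) - g(lam_k), and Cauchy-Schwarz
  separates \<open>a\<close> from the cost of the coupling.\<close>

lemma quadratic_form_lipschitz:
  assumes L: "\<And>x y. \<bar>g x - g y\<bar> \<le> L * \<bar>x - y\<bar>"
  shows "\<bar>(\<Sum>j<N. (cmod (ip N a (v j)))\<^sup>2 * g (mu j)) - (\<Sum>k<N. (cmod (ip N a (u k)))\<^sup>2 * g (lam k))\<bar>
     \<le> L * sqrt (hs N A) * (\<Sum>k<N. (cmod (a k))\<^sup>2)"
proof -
  have L0: "0 \<le> L" using L[of 0 1] by simp
  define t where "t k j = ip N a (u k) * ip N (u k) (v j) * ip N (v j) a" for k j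
  have 1: "of_real (\<Sum>j<N. (cmod (ip N a (v j)))\<^sup>2 * g (mu j)) = (\<Sum>k<N. \<Sum>j<N. t k j * of_real (g (mu j)))"
  proof -
    have "of_real (\<Sum>j<N. (cmod (ip N a (v j)))\<^sup>2 * g (mu j)) = (\<Sum>j<N. (ip N a (v j) * ip N (v j) a) * of_real (g (mu j)))"
      unfolding ip_mult_commuted by simp
    also have "\<dots> = (\<Sum>j<N. \<Sum>k<N. t k j * of_real (g (mu j)))"
      by (subst parseval[OF EX, of a]) (simp add: t_def sum_distrib_right)
    finally show ?thesis by (subst sum.swap)
  qed
  have 2: "of_real (\<Sum>k<N. (cmod (ip N a (u k)))\<^sup>2 * g (lam k)) = (\<Sum>k<N. \<Sum>j<N. t k j * of_real (g (lam k)))"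
  proof -
    have "of_real (\<Sum>k<N. (cmod (ip N a (u k)))\<^sup>2 * g (lam k)) = (\<Sum>k<N. (ip N a (u k) * ip N (u k) a) * of_real (g (lam k)))"
      unfolding ip_mult_commuted by simp
    also have "\<dots> = (\<Sum>k<N. \<Sum>j<N. t k j * of_real (g (lam k)))"
      by (subst parseval[OF EY, of _ a]) (simp add: t_def sum_distrib_right sum_distrib_left mult.assoc)
    finally show ?thesis .
  qed
  have "\<bar>(\<Sum>j<N. (cmod (ip N a (v j)))\<^sup>2 * g (mu j)) - (\<Sum>k<N. (cmod (ip N a (u k)))\<^sup>2 * g (lam k))\<bar>
     = cmod (\<Sum>k<N. \<Sum>j<N. t k j * of_real (g (mu j) - g (lam k)))"
    unfolding norm_of_real[symmetric, where 'a=complex] of_real_diff 1 2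
    by (simp add: right_diff_distrib sum_subtractf)
  also have "\<dots> \<le> (\<Sum>k<N. \<Sum>j<N. cmod (t k j * of_real (g (mu j) - g (lam k))))"
    by (intro order_trans[OF norm_sum] sum_mono norm_sum)
  also have "\<dots> \<le> (\<Sum>k<N. \<Sum>j<N. L * (\<bar>cmod (ip N a (u k)) * cmod (ip N a (v j))\<bar> * \<bar>cmod (ip N (u k) (v j)) * (mu j - lam k)\<bar>))"
  proof (intro sum_mono)
    fix k j
    have "cmod (t k j * of_real (g (mu j) - g (lam k))) = cmod (t k j) * \<bar>g (mu j) - g (lam k)\<bar>"
      by (simp only: norm_mult norm_of_real)
    also have "\<dots> \<le> cmod (t k j) * (L * \<bar>mu j - lam k\<bar>)" by (intro mult_left_mono L) auto
    also have "\<dots> = L * (\<bar>cmod (ip N a (u k)) * cmod (ip N a (v j))\<bar> * \<bar>cmod (ip N (u k) (v j)) * (mu j - lam k)\<bar>)"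
      by (simp add: t_def norm_mult abs_mult cmod_ip_commute[of N "v j" a] mult_ac)
    finally show "cmod (t k j * of_real (g (mu j) - g (lam k))) \<le> \<dots>" .
  qed
  also have "\<dots> = L * (\<Sum>k<N. \<Sum>j<N. \<bar>cmod (ip N a (u k)) * cmod (ip N a (v j))\<bar> * \<bar>cmod (ip N (u k) (v j)) * (mu j - lam k)\<bar>)"
    by (simp add: sum_distrib_left)
  also have "\<dots> \<le> L * (sqrt (\<Sum>k<N. \<Sum>j<N. (cmod (ip N a (u k)) * cmod (ip N a (v j)))\<^sup>2)
      * sqrt (\<Sum>k<N. \<Sum>j<N. (cmod (ip N (u k) (v j)) * (mu j - lam k))\<^sup>2))"
    by (intro mult_left_mono sum_sum_Cauchy_Schwarz L0)
  also have "(\<Sum>k<N. \<Sum>j<N. (cmod (ip N (u k) (v j)) * (mu j - lam k))\<^sup>2) = hs N A"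
    unfolding w_cost[symmetric] by (simp add: w_def power_mult_distrib)
  also have "(\<Sum>k<N. \<Sum>j<N. (cmod (ip N a (u k)) * cmod (ip N a (v j)))\<^sup>2)
      = (\<Sum>k<N. (cmod (ip N a (u k)))\<^sup>2) * (\<Sum>j<N. (cmod (ip N a (v j)))\<^sup>2)"
    by (simp add: sum_product power_mult_distrib)
  also have "\<dots> = (\<Sum>k<N. (cmod (a k))\<^sup>2)\<^sup>2"
    unfolding parseval_norm[OF EX, symmetric] parseval_norm[OF EY, symmetric] by (simp add: power2_eq_square)
  also have "sqrt ((\<Sum>k<N. (cmod (a k))\<^sup>2)\<^sup>2) = (\<Sum>k<N. (cmod (a k))\<^sup>2)" by (simp add: sum_nonneg)
  finally show ?thesis by (simp add: mult_ac)
qed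

text \<open>Inserting the basis \<open>v\<close> between A u_i and u_i shows that the diagonal
  element of \<open>A\<close> is the mean shift of the i-th eigenvalue under the coupling.\<close>

lemma first_order_term: "i < N \<Longrightarrow> Re (ip N (u i) (mv N A (u i))) = (\<Sum>j<N. w i j * (mu j - lam i))"
proof -
  assume i: "i < N"
  have "ip N (u i) (mv N A (u i)) = ip N (mv N A (u i)) (u i)" by (rule ip_mv_hermitian[OF A_hermitian])
  also have "\<dots> = (\<Sum>j<N. ip N (mv N A (u i)) (v j) * ip N (v j) (u i))" by (rule parseval[OF EY])
  also have "\<dots> = (\<Sum>j<N. of_real (w i j * (mu j - lam i)))"
  proof (intro sum.cong refl)
    fix j assume "j \<in> {..<N}"
    then have "ip N (mv N A (u i)) (v j) = of_real (mu j - lam i) * ip N (u i) (v j)"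
      using ip_diff[OF i] ip_mv_hermitian[OF A_hermitian, of "u i" "v j"] by simp
    then have "ip N (mv N A (u i)) (v j) * ip N (v j) (u i) = of_real (mu j - lam i) * (ip N (u i) (v j) * ip N (v j) (u i))"
      by (simp only: mult.assoc)
    also have "\<dots> = of_real (w i j * (mu j - lam i))" unfolding ip_mult_commuted w_def by simp
    finally show "ip N (mv N A (u i)) (v j) * ip N (v j) (u i) = of_real (w i j * (mu j - lam i))" .
  qed
  finally show ?thesis by (simp flip: of_real_sum)
qed

text \<open>An exact second-order Taylor formula for a trace: over the coupled pairs the linear
  parts average to the diagonal elements of \<open>A\<close>, and each quadratic part becomes a
  squared matrix element between the two bases.\<close>

lemma trace_taylor_aux:
  assumes G: "\<And>x y. f y - f x - f1 x * (y - x) = (y - x)\<^sup>2 * G x y"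
  shows "(\<Sum>j<N. f (mu j)) - (\<Sum>i<N. f (lam i)) - (\<Sum>i<N. f1 (lam i) * Re (ip N (u i) (mv N A (u i))))
     = (\<Sum>i<N. \<Sum>j<N. (cmod (ip N (u i) (mv N A (v j))))\<^sup>2 * G (lam i) (mu j))"
proof -
  have "(\<Sum>i<N. f1 (lam i) * Re (ip N (u i) (mv N A (u i)))) = (\<Sum>i<N. \<Sum>j<N. w i j * (f1 (lam i) * (mu j - lam i)))"
    by (intro sum.cong refl) (simp add: first_order_term sum_distrib_left mult_ac)
  then have "(\<Sum>j<N. f (mu j)) - (\<Sum>i<N. f (lam i)) - (\<Sum>i<N. f1 (lam i) * Re (ip N (u i) (mv N A (u i))))
     = (\<Sum>i<N. \<Sum>j<N. w i j * (f (mu j) - f (lam i) - f1 (lam i) * (mu j - lam i)))"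
    unfolding sum_diff_coupling by (simp only: right_diff_distrib[of "w _ _"] sum_subtractf)
  also have "\<dots> = (\<Sum>i<N. \<Sum>j<N. (cmod (ip N (u i) (mv N A (v j))))\<^sup>2 * G (lam i) (mu j))"
    unfolding G by (intro sum.cong refl) (simp add: w_mult[symmetric] mult.assoc)
  finally show ?thesis .
qed

lemma trace_taylor_bound:
  assumes G: "\<And>x y. f y - f x - f1 x * (y - x) = (y - x)\<^sup>2 * G x y" and M: "\<And>x y. \<bar>G x y\<bar> \<le> M"
  shows "\<bar>(\<Sum>j<N. f (mu j)) - (\<Sum>i<N. f (lam i)) - (\<Sum>i<N. f1 (lam i) * Re (ip N (u i) (mv N A (u i))))\<bar> \<le> M * hs N A"
proof -
  have "\<bar>\<Sum>i<N. \<Sum>j<N. (cmod (ip N (u i) (mv N A (v j))))\<^sup>2 * G (lam i) (mu j)\<bar>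
     \<le> (\<Sum>i<N. \<Sum>j<N. \<bar>(cmod (ip N (u i) (mv N A (v j))))\<^sup>2 * G (lam i) (mu j)\<bar>)"
    by (intro order_trans[OF sum_abs] sum_mono sum_abs)
  also have "\<dots> \<le> (\<Sum>i<N. \<Sum>j<N. M * (w i j * (mu j - lam i)\<^sup>2))"
    by (intro sum_mono) (simp add: w_mult abs_mult M mult.commute[of "(_)\<^sup>2"] mult_right_mono)
  also have "\<dots> = M * hs N A" unfolding w_cost[symmetric] by (simp add: sum_distrib_left)
  finally show ?thesis unfolding trace_taylor_aux[OF G] .
qed

text \<open>The vectors \<open>v j\<close> and values \<open>mu j\<close> are replaced by
  \<open>u j\<close> and \<open>lam j\<close> through \<open>quadratic_form_lipschitz\<close>,
  applied to the vector A u_i and the function G(lam_i, .). What remains is a genuine quadratic form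
  in \<open>A\<close>, at a cost of third order.\<close>

lemma trace_taylor:
  assumes G: "\<And>x y. f y - f x - f1 x * (y - x) = (y - x)\<^sup>2 * G x y"
    and L: "\<And>x y z. \<bar>G x y - G x z\<bar> \<le> L * \<bar>y - z\<bar>"
  shows "\<bar>(\<Sum>j<N. f (mu j)) - (\<Sum>i<N. f (lam i)) - (\<Sum>i<N. f1 (lam i) * Re (ip N (u i) (mv N A (u i))))
     - (\<Sum>i<N. \<Sum>j<N. (cmod (ip N (u i) (mv N A (u j))))\<^sup>2 * G (lam i) (lam j))\<bar> \<le> L * sqrt (hs N A) * hs N A"
proof -
  have c: "ip N (u i) (mv N A b) = ip N (mv N A (u i)) b" for i b by (rule ip_mv_hermitian[OF A_hermitian])
  have "\<bar>(\<Sum>i<N. \<Sum>j<N. (cmod (ip N (u i) (mv N A (v j))))\<^sup>2 * G (lam i) (mu j))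
     - (\<Sum>i<N. \<Sum>j<N. (cmod (ip N (u i) (mv N A (u j))))\<^sup>2 * G (lam i) (lam j))\<bar>
     \<le> (\<Sum>i<N. \<bar>(\<Sum>j<N. (cmod (ip N (mv N A (u i)) (v j)))\<^sup>2 * G (lam i) (mu j))
        - (\<Sum>j<N. (cmod (ip N (mv N A (u i)) (u j)))\<^sup>2 * G (lam i) (lam j))\<bar>)"
    unfolding c sum_subtractf[symmetric] by (rule sum_abs)
  also have "\<dots> \<le> (\<Sum>i<N. L * sqrt (hs N A) * (\<Sum>k<N. (cmod (mv N A (u i) k))\<^sup>2))"
    by (intro sum_mono quadratic_form_lipschitz L)
  also have "\<dots> = L * sqrt (hs N A) * hs N A"
    unfolding sum_distrib_left[symmetric] hs_eigenbasis[OF EX] ..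
  finally show ?thesis unfolding trace_taylor_aux[OF G] .
qed

end

text \<open>The kernel of the integral form of the second-order Taylor remainder.\<close>

definition taylor_kernel :: "(real \<Rightarrow> real) \<Rightarrow> real \<Rightarrow> real \<Rightarrow> real" where
  "taylor_kernel h x y = integral {0..1} (\<lambda>r. (1 - r) * h (x + r * (y - x)))"

lemma taylor_kernel_integrand_continuous:
  fixes h :: "real \<Rightarrow> real"
  assumes "continuous_on UNIV h"
  shows "continuous_on {0..1} (\<lambda>r. (1 - r) * h (x + r * (y - x)))"
  by (intro continuous_intros continuous_on_compose2[OF assms]) auto

lemma taylor_kernel_eq:
  fixes f f1 f2 :: "real \<Rightarrow> real"
  assumes d: "\<And>x. (f has_real_derivative f1 x) (at x)" "\<And>x. (f1 has_real_derivative f2 x) (at x)"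
  shows "f y - f x - f1 x * (y - x) = (y - x)\<^sup>2 * taylor_kernel f2 x y"
proof -
  \<comment> \<open>\<open>F\<close> runs from the first-order Taylor polynomial based at
    \<open>x\<close> for r = 0 to \<open>f y\<close> for r = 1; in its derivative the terms with
    \<open>f1\<close> cancel.\<close>
  define F where "F r = f (x + r * (y - x)) + (1 - r) * (y - x) * f1 (x + r * (y - x))" for r
  have "((\<lambda>r. (y - x)\<^sup>2 * ((1 - r) * f2 (x + r * (y - x)))) has_integral (F 1 - F 0)) {0..1}"
  proof (rule fundamental_theorem_of_calculus)
    fix r :: real
    have i: "((\<lambda>r. x + r * (y - x)) has_real_derivative (y - x)) (at r)" by (auto intro!: derivative_eq_intros)
    have "(F has_real_derivative (f1 (x + r * (y - x)) * (y - x) + ((1 - r) * (y - x) * (f2 (x + r * (y - x)) * (y - x))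
        + (- (y - x)) * f1 (x + r * (y - x))))) (at r)"
      unfolding F_def[abs_def]
      by (intro DERIV_add DERIV_chain2[OF d(1) i] DERIV_mult' DERIV_chain2[OF d(2) i]) (auto intro!: derivative_eq_intros)
    then have "(F has_real_derivative (y - x)\<^sup>2 * ((1 - r) * f2 (x + r * (y - x)))) (at r)"
      by (rule DERIV_cong) (simp add: power2_eq_square algebra_simps)
    then show "(F has_vector_derivative (y - x)\<^sup>2 * ((1 - r) * f2 (x + r * (y - x)))) (at r within {0..1})"
      using has_real_derivative_iff_has_vector_derivative has_vector_derivative_at_within by blast
  qed simp
  then have "integral {0..1} (\<lambda>r. (y - x)\<^sup>2 * ((1 - r) * f2 (x + r * (y - x)))) = F 1 - F 0" by (rule integral_unique)
  then show ?thesis unfolding taylor_kernel_def by (simp add: F_def)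
qed

lemma taylor_kernel_abs_le:
  fixes h :: "real \<Rightarrow> real"
  assumes "continuous_on UNIV h" "\<And>x. \<bar>h x\<bar> \<le> B"
  shows "\<bar>taylor_kernel h x y\<bar> \<le> B"
proof -
  have B: "0 \<le> B" using assms(2)[of 0] by linarith
  have "norm (integral {0..1} (\<lambda>r. (1 - r) * h (x + r * (y - x)))) \<le> B * (1 - 0)"
  proof (rule integral_bound[OF _ taylor_kernel_integrand_continuous[OF assms(1)]])
    show "norm ((1 - r) * h (x + r * (y - x))) \<le> B" if "r \<in> {0..1}" for r
      using that assms(2)[of "x + r * (y - x)"] B mult_mono[of "\<bar>1 - r\<bar>" 1 "\<bar>h (x + r * (y - x))\<bar>" B] by (simp add: abs_mult)
  qed simp
  then show ?thesis by (simp add: taylor_kernel_def)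
qed

lemma taylor_kernel_lipschitz:
  fixes h :: "real \<Rightarrow> real"
  assumes c: "continuous_on UNIV h" and L: "\<And>x y. \<bar>h x - h y\<bar> \<le> L * \<bar>x - y\<bar>"
  shows "\<bar>taylor_kernel h x y - taylor_kernel h x z\<bar> \<le> L * \<bar>y - z\<bar>"
proof -
  have L0: "0 \<le> L" using L[of 0 1] by simp
  let ?D = "\<lambda>r. (1 - r) * h (x + r * (y - x)) - (1 - r) * h (x + r * (z - x))"
  have eq: "taylor_kernel h x y - taylor_kernel h x z = integral {0..1} ?D"
    unfolding taylor_kernel_def
    by (intro Henstock_Kurzweil_Integration.integral_diff[symmetric] integrable_continuous_real taylor_kernel_integrand_continuous[OF c])
  have "norm (integral {0..1} ?D) \<le> (L * \<bar>y - z\<bar>) * (1 - 0)"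
  proof (rule integral_bound)
    show "continuous_on {0..1} ?D" by (intro continuous_on_diff taylor_kernel_integrand_continuous[OF c])
    fix r :: real assume r: "r \<in> {0..1}"
    have "\<bar>?D r\<bar> = \<bar>1 - r\<bar> * \<bar>h (x + r * (y - x)) - h (x + r * (z - x))\<bar>"
      by (simp add: abs_mult[symmetric] right_diff_distrib)
    also have "\<dots> \<le> 1 * (L * \<bar>(x + r * (y - x)) - (x + r * (z - x))\<bar>)"
      using r by (intro mult_mono L) auto
    also have "(x + r * (y - x)) - (x + r * (z - x)) = r * (y - z)" by (simp add: algebra_simps)
    also have "1 * (L * \<bar>r * (y - z)\<bar>) \<le> L * \<bar>y - z\<bar>"
      using r L0 by (simp add: abs_mult mult_left_mono mult_left_le_one_le)
    finally show "norm (?D r) \<le> L * \<bar>y - z\<bar>" by simp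
  qed simp
  then show ?thesis unfolding eq by simp
qed

text \<open>Adding the Taylor identities based at \<open>x\<close> and at \<open>y\<close> cancels
  \<open>f\<close> and leaves (y - x) (f1 y - f1 x). This is how the divided difference of the rate
  functional emerges from second-order terms; on the diagonal each kernel equals f2(x) / 2.\<close>

lemma taylor_kernel_sym_sum:
  fixes f f1 f2 :: "real \<Rightarrow> real"
  assumes d: "\<And>x. (f has_real_derivative f1 x) (at x)" "\<And>x. (f1 has_real_derivative f2 x) (at x)"
  shows "taylor_kernel f2 x y + taylor_kernel f2 y x = divided_diff f1 f2 x y"
proof (cases "x = y")
  case True
  have "((\<lambda>r::real. r - r\<^sup>2 / 2) has_vector_derivative (1 - r)) (at r within {0..1})" for r
    unfolding has_real_derivative_iff_has_vector_derivative[symmetric] by (auto intro!: derivative_eq_intros)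
  then have "((\<lambda>r::real. 1 - r) has_integral (1 - 1\<^sup>2 / 2 - (0 - 0\<^sup>2 / 2))) {0..1}"
    by (intro fundamental_theorem_of_calculus) auto
  then have "integral {0..1} (\<lambda>r::real. 1 - r) = 1 / 2" by (simp add: integral_unique)
  then have "taylor_kernel f2 x x = f2 x / 2" by (simp add: taylor_kernel_def)
  with True show ?thesis by (simp add: divided_diff_def)
next
  case False
  have "(y - x)\<^sup>2 * (taylor_kernel f2 x y + taylor_kernel f2 y x) = (y - x) * (f1 y - f1 x)"
    using taylor_kernel_eq[OF d, of y x] taylor_kernel_eq[OF d, of x y]
    by (simp add: distrib_left power2_commute[of x y]) (simp add: algebra_simps)
  then have "(y - x) * ((y - x) * (taylor_kernel f2 x y + taylor_kernel f2 y x)) = (y - x) * (f1 y - f1 x)"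
    by (simp only: power2_eq_square mult.assoc)
  then have "(y - x) * (taylor_kernel f2 x y + taylor_kernel f2 y x) = f1 y - f1 x" using False by simp
  then have "taylor_kernel f2 x y + taylor_kernel f2 y x = (f1 y - f1 x) / (y - x)"
    using False by (simp add: eq_divide_eq mult.commute)
  also have "\<dots> = divided_diff f1 f2 y x" using False by (simp add: divided_diff_def)
  finally show ?thesis by (simp add: divided_diff_commute)
qed

section \<open>Independent centred Gaussian variables\<close>

text \<open>The common variance \<open>h\<close> will be the length of a time step.\<close>

locale gaussian_family = prob_space M for M :: "'w measure" +
  fixes I :: "'i set" and Z :: "'i \<Rightarrow> 'w \<Rightarrow> real" and h :: real
  assumes fin: "finite I" and h: "0 < h"
    and indep: "indep_vars (\<lambda>_. borel) Z I"
    and dist: "\<And>i. i \<in> I \<Longrightarrow> distributed M lborel (Z i) (normal_density 0 (sqrt h))"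
begin

lemma Z_measurable [measurable]: "i \<in> I \<Longrightarrow> Z i \<in> borel_measurable M"
  using indep unfolding indep_vars_def by auto

lemma Z_integrable: "i \<in> I \<Longrightarrow> integrable M (Z i)"
  using distributed_integrable_var[OF dist] h integrable_normal_moment_nz_1[of "sqrt h" 0] by simp

lemma Z_mean: "i \<in> I \<Longrightarrow> expectation (Z i) = 0"
  using h by (intro normal_distributed_expectation[OF _ dist]) auto

lemma Z_square:
  assumes i: "i \<in> I"
  shows "integrable M (\<lambda>\<omega>. (Z i \<omega>)\<^sup>2)" "expectation (\<lambda>\<omega>. (Z i \<omega>)\<^sup>2) = h"
proof -
  show "integrable M (\<lambda>\<omega>. (Z i \<omega>)\<^sup>2)"
    using distributed_integrable[OF dist[OF i], of "\<lambda>x. x\<^sup>2"] integrable_normal_moment[of "sqrt h" 0 2] h by simp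
  show "expectation (\<lambda>\<omega>. (Z i \<omega>)\<^sup>2) = h"
    using normal_distributed_variance[OF _ dist[OF i]] h Z_mean[OF i] by simp
qed

lemma Z_prod:
  assumes ij: "i \<in> I" "j \<in> I"
  shows "integrable M (\<lambda>\<omega>. Z i \<omega> * Z j \<omega>)" "expectation (\<lambda>\<omega>. Z i \<omega> * Z j \<omega>) = (if i = j then h else 0)"
proof -
  have "integrable M (\<lambda>\<omega>. Z i \<omega> * Z j \<omega>) \<and> expectation (\<lambda>\<omega>. Z i \<omega> * Z j \<omega>) = (if i = j then h else 0)"
  proof (cases "i = j")
    case True
    then show ?thesis using Z_square[OF ij(1)] by (simp add: power2_eq_square)
  next
    case False
    have iv: "indep_vars (\<lambda>_. borel) Z {i, j}" by (rule indep_vars_subset[OF indep]) (use ij in auto)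
    have int: "\<And>k. k \<in> {i, j} \<Longrightarrow> integrable M (Z k)" using Z_integrable ij by auto
    show ?thesis
      using indep_vars_integrable[OF _ iv int] indep_vars_lebesgue_integral[OF _ iv int] False Z_mean[OF ij(1)] by simp
  qed
  then show "integrable M (\<lambda>\<omega>. Z i \<omega> * Z j \<omega>)" "expectation (\<lambda>\<omega>. Z i \<omega> * Z j \<omega>) = (if i = j then h else 0)" by auto
qed

lemma linear_form:
  "integrable M (\<lambda>\<omega>. \<Sum>i\<in>I. c i * Z i \<omega>)" "expectation (\<lambda>\<omega>. \<Sum>i\<in>I. c i * Z i \<omega>) = 0"
  using Z_integrable Z_mean by (auto intro!: Bochner_Integration.integrable_sum simp: Bochner_Integration.integral_sum)

lemma linear_form_square:
  "integrable M (\<lambda>\<omega>. (\<Sum>i\<in>I. c i * Z i \<omega>)\<^sup>2)" "expectation (\<lambda>\<omega>. (\<Sum>i\<in>I. c i * Z i \<omega>)\<^sup>2) = h * (\<Sum>i\<in>I. (c i)\<^sup>2)"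
proof -
  have eq: "(\<Sum>i\<in>I. c i * Z i \<omega>)\<^sup>2 = (\<Sum>i\<in>I. \<Sum>j\<in>I. (c i * c j) * (Z i \<omega> * Z j \<omega>))" for \<omega>
    by (simp add: power2_eq_square sum_product mult_ac)
  show "integrable M (\<lambda>\<omega>. (\<Sum>i\<in>I. c i * Z i \<omega>)\<^sup>2)"
    unfolding eq by (intro Bochner_Integration.integrable_sum integrable_mult_right Z_prod)
  have "expectation (\<lambda>\<omega>. (\<Sum>i\<in>I. c i * Z i \<omega>)\<^sup>2) = (\<Sum>i\<in>I. \<Sum>j\<in>I. (c i * c j) * (if i = j then h else 0))"
    unfolding eq by (simp add: Bochner_Integration.integral_sum Z_prod)
  also have "\<dots> = (\<Sum>i\<in>I. c i * c i * h)"
    using fin by (intro sum.cong refl) (simp add: if_distrib cong: if_cong)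
  finally show "expectation (\<lambda>\<omega>. (\<Sum>i\<in>I. c i * Z i \<omega>)\<^sup>2) = h * (\<Sum>i\<in>I. (c i)\<^sup>2)"
    by (simp add: sum_distrib_left power2_eq_square mult_ac)
qed

lemma complex_linear_form_square:
  fixes c :: "'i \<Rightarrow> complex"
  shows "integrable M (\<lambda>\<omega>. (cmod (\<Sum>i\<in>I. of_real (Z i \<omega>) * c i))\<^sup>2)"
    "expectation (\<lambda>\<omega>. (cmod (\<Sum>i\<in>I. of_real (Z i \<omega>) * c i))\<^sup>2) = h * (\<Sum>i\<in>I. (cmod (c i))\<^sup>2)"
proof -
  have eq: "(cmod (\<Sum>i\<in>I. of_real (Z i \<omega>) * c i))\<^sup>2 = (\<Sum>i\<in>I. Re (c i) * Z i \<omega>)\<^sup>2 + (\<Sum>i\<in>I. Im (c i) * Z i \<omega>)\<^sup>2" for \<omega>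
    by (simp add: cmod_power2 mult.commute)
  show "integrable M (\<lambda>\<omega>. (cmod (\<Sum>i\<in>I. of_real (Z i \<omega>) * c i))\<^sup>2)"
    unfolding eq by (intro Bochner_Integration.integrable_add linear_form_square)
  show "expectation (\<lambda>\<omega>. (cmod (\<Sum>i\<in>I. of_real (Z i \<omega>) * c i))\<^sup>2) = h * (\<Sum>i\<in>I. (cmod (c i))\<^sup>2)"
    unfolding eq by (simp add: linear_form_square cmod_power2 sum.distrib distrib_left)
qed

text \<open>The exponent 1/(4h) is half the critical value 1/(2h): the tilted density is sqrt 2
  times the normal density of variance 2h.\<close>

lemma exp_square:
  assumes i: "i \<in> I"
  shows "(\<integral>\<^sup>+\<omega>. ennreal (exp ((Z i \<omega>)\<^sup>2 / (4 * h))) \<partial>M) = ennreal (sqrt 2)"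
proof -
  have eq: "normal_density 0 (sqrt h) x * exp (x\<^sup>2 / (4 * h)) = sqrt 2 * normal_density 0 (sqrt (2 * h)) x" for x
  proof -
    have "exp (- x\<^sup>2 / (2 * h)) * exp (x\<^sup>2 / (4 * h)) = exp (- x\<^sup>2 / (4 * h))"
      using h by (simp add: exp_add[symmetric] field_simps)
    then show ?thesis using h by (simp add: normal_density_def real_sqrt_mult field_simps)
  qed
  have "(\<integral>\<^sup>+\<omega>. ennreal (exp ((Z i \<omega>)\<^sup>2 / (4 * h))) \<partial>M)
      = (\<integral>\<^sup>+x. ennreal (normal_density 0 (sqrt h) x) * ennreal (exp (x\<^sup>2 / (4 * h))) \<partial>lborel)"
    by (rule distributed_nn_integral[OF dist[OF i], symmetric]) simp
  also have "\<dots> = (\<integral>\<^sup>+x. ennreal (sqrt 2 * normal_density 0 (sqrt (2 * h)) x) \<partial>lborel)"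
    by (simp add: ennreal_mult[symmetric] eq)
  also have "\<dots> = ennreal (\<integral>x. sqrt 2 * normal_density 0 (sqrt (2 * h)) x \<partial>lborel)"
    using h by (intro nn_integral_eq_integral integrable_mult_right) auto
  also have "\<dots> = ennreal (sqrt 2)" using h by simp
  finally show ?thesis .
qed

lemma exp_sum_squares:
  "(\<integral>\<^sup>+\<omega>. ennreal (exp ((\<Sum>i\<in>I. (Z i \<omega>)\<^sup>2) / (4 * h))) \<partial>M) = ennreal (sqrt 2 ^ card I)"
proof -
  have "(\<integral>\<^sup>+\<omega>. ennreal (exp ((\<Sum>i\<in>I. (Z i \<omega>)\<^sup>2) / (4 * h))) \<partial>M) = (\<integral>\<^sup>+\<omega>. (\<Prod>i\<in>I. ennreal (exp ((Z i \<omega>)\<^sup>2 / (4 * h)))) \<partial>M)"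
    using fin by (simp add: prod_ennreal exp_sum sum_divide_distrib)
  also have "\<dots> = (\<Prod>i\<in>I. \<integral>\<^sup>+\<omega>. ennreal (exp ((Z i \<omega>)\<^sup>2 / (4 * h))) \<partial>M)"
    by (rule indep_vars_nn_integral[OF fin]) (auto intro!: indep_vars_compose2[OF indep])
  also have "\<dots> = ennreal (sqrt 2 ^ card I)" by (simp add: exp_square ennreal_power)
  finally show ?thesis .
qed

end

section \<open>The increment of the Hermitian Brownian motion\<close>

text \<open>The matrix of \<open>herm_BM\<close> as a linear function of N^2 real coordinates: those
  above the diagonal are real parts, those below it imaginary parts.\<close>

definition hm :: "nat \<Rightarrow> (nat \<times> nat \<Rightarrow> real) \<Rightarrow> nat \<Rightarrow> nat \<Rightarrow> complex" where
  "hm N x k l = (if k < l then Complex (x (k, l)) (x (l, k)) / complex_of_real (sqrt (2 * real N))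
     else if l < k then Complex (x (l, k)) (- x (k, l)) / complex_of_real (sqrt (2 * real N))
     else complex_of_real (x (k, k) / sqrt (real N)))"

definition idx :: "nat \<Rightarrow> (nat \<times> nat) set" where "idx N = {..<N} \<times> {..<N}"

lemma finite_idx: "finite (idx N)" by (simp add: idx_def)

lemma hm_hermitian: "hermitian N (hm N x)"
  unfolding hermitian_def hm_def by (auto simp: complex_eq_iff)

lemma hm_add: "hm N (\<lambda>p. x p + y p) k l = hm N x k l + hm N y k l"
  by (auto simp: hm_def complex_eq_iff add_divide_distrib diff_divide_distrib)

text \<open>Each off-diagonal coordinate occurs in two entries with weight 1/(2N), a diagonal one in
  a single entry with weight 1/N, so in squared norms \<open>hm\<close> is an isometry up to the
  factor 1/N.\<close>

lemma hs_hm: "N > 0 \<Longrightarrow> hs N (hm N x) = (\<Sum>p\<in>idx N. (x p)\<^sup>2) / real N"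
proof -
  assume N: "N > 0"
  have e: "(cmod (hm N x k l))\<^sup>2 = ((x (k, l))\<^sup>2 + (x (l, k))\<^sup>2) / (2 * real N)" for k l
    using N by (cases k l rule: linorder_cases)
      (auto simp: hm_def norm_divide power_divide cmod_power2 abs_mult power_mult_distrib field_simps)
  have "hs N (hm N x) = ((\<Sum>k<N. \<Sum>l<N. (x (k, l))\<^sup>2) + (\<Sum>k<N. \<Sum>l<N. (x (l, k))\<^sup>2)) / (2 * real N)"
    unfolding hs_def e by (simp add: sum_divide_distrib[symmetric] sum.distrib)
  also have "(\<Sum>k<N. \<Sum>l<N. (x (l, k))\<^sup>2) = (\<Sum>k<N. \<Sum>l<N. (x (k, l))\<^sup>2)" by (rule sum.swap)
  also have "(\<Sum>k<N. \<Sum>l<N. (x (k, l))\<^sup>2) = (\<Sum>p\<in>idx N. (x p)\<^sup>2)" by (simp add: idx_def sum.cartesian_product case_prod_unfold)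
  finally show ?thesis by simp
qed

definition hm_unit :: "nat \<Rightarrow> nat \<times> nat \<Rightarrow> nat \<Rightarrow> nat \<Rightarrow> complex" where
  "hm_unit N p = hm N (\<lambda>q. if q = p then 1 else 0)"

lemma hm_unit_eq_0: "p \<noteq> (k, l) \<Longrightarrow> p \<noteq> (l, k) \<Longrightarrow> hm_unit N p k l = 0"
  unfolding hm_unit_def hm_def by (auto simp: complex_eq_iff)

lemma sum_idx_hm_unit:
  fixes g :: "nat \<times> nat \<Rightarrow> complex"
  assumes "k < N" "l < N" "\<And>p. p \<noteq> (k, l) \<Longrightarrow> p \<noteq> (l, k) \<Longrightarrow> g p = 0"
  shows "(\<Sum>p\<in>idx N. g p) = (if k = l then g (k, k) else g (k, l) + g (l, k))"
proof -
  have "(\<Sum>p\<in>idx N. g p) = (\<Sum>p\<in>{(k, l), (l, k)}. g p)"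
    using assms by (intro sum.mono_neutral_right) (auto simp: idx_def)
  then show ?thesis by auto
qed

lemma hm_expand:
  assumes "k < N" "l < N"
  shows "hm N x k l = (\<Sum>p\<in>idx N. of_real (x p) * hm_unit N p k l)"
  by (subst sum_idx_hm_unit[OF assms]) (auto simp: hm_unit_eq_0 hm_unit_def hm_def complex_eq_iff)

lemma hm_unit_values:
  "hm_unit N (k, k) k k = 1 / complex_of_real (sqrt (real N))"
  "k < l \<Longrightarrow> hm_unit N (k, l) k l = 1 / complex_of_real (sqrt (2 * real N))"
  "k < l \<Longrightarrow> hm_unit N (l, k) k l = \<i> / complex_of_real (sqrt (2 * real N))"
  "k < l \<Longrightarrow> hm_unit N (k, l) l k = 1 / complex_of_real (sqrt (2 * real N))"
  "k < l \<Longrightarrow> hm_unit N (l, k) l k = - \<i> / complex_of_real (sqrt (2 * real N))"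
proof -
  have c: "Complex 1 0 = 1" "Complex 0 1 = \<i>" "Complex 1 (-0) = 1" "Complex 0 (-1) = - \<i>"
    by (auto simp: complex_eq_iff)
  show "hm_unit N (k, k) k k = 1 / complex_of_real (sqrt (real N))"
    "k < l \<Longrightarrow> hm_unit N (k, l) k l = 1 / complex_of_real (sqrt (2 * real N))"
    "k < l \<Longrightarrow> hm_unit N (l, k) k l = \<i> / complex_of_real (sqrt (2 * real N))"
    "k < l \<Longrightarrow> hm_unit N (k, l) l k = 1 / complex_of_real (sqrt (2 * real N))"
    "k < l \<Longrightarrow> hm_unit N (l, k) l k = - \<i> / complex_of_real (sqrt (2 * real N))"
    using c by (simp_all add: hm_unit_def hm_def)
qed

text \<open>The covariance E(H_ab H_cd) of the entries for standard normal coordinates. Off the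
  diagonal, real and imaginary contributions add up when (c, d) = (b, a) and cancel when (c, d) =
  (a, b).\<close>

lemma hm_unit_covariance:
  assumes N: "N > 0" and abcd: "a < N" "b < N" "c < N" "d < N"
  shows "(\<Sum>p\<in>idx N. hm_unit N p a b * hm_unit N p c d) = (if a = d \<and> b = c then 1 / of_nat N else 0)"
proof -
  have s: "1 / complex_of_real (sqrt (real N)) * (1 / complex_of_real (sqrt (real N))) = 1 / of_nat N"
    by (simp only: times_divide_times_eq of_real_mult[symmetric] real_sqrt_mult_self) simp
  define r where "r = 1 / complex_of_real (sqrt (2 * real N))"
  have r: "r * r = 1 / (2 * of_nat N)"
    unfolding r_def by (simp only: times_divide_times_eq of_real_mult[symmetric] real_sqrt_mult_self) simp
  have rr: "r * r + r * r = 1 / of_nat N" unfolding r using N by simp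
  have v: "hm_unit N (k, l) k l = r" "hm_unit N (l, k) k l = \<i> * r" "hm_unit N (k, l) l k = r" "hm_unit N (l, k) l k = - \<i> * r"
    if "k < l" for k l
    using that by (simp_all add: hm_unit_values r_def)
  have z: "hm_unit N (k, l) c d = 0" if "\<not> (c = k \<and> d = l)" "\<not> (c = l \<and> d = k)" for k l
    using that by (intro hm_unit_eq_0) auto
  have ii: "\<i> * r * (\<i> * r) = - (r * r)" "\<i> * r * (- \<i> * r) = r * r" "- \<i> * r * (\<i> * r) = r * r" "- \<i> * r * (- \<i> * r) = - (r * r)"
  proof -
    have *: "\<i> * r * (\<i> * r) = (\<i> * \<i>) * (r * r)" by (simp only: mult_ac)
    show "\<i> * r * (\<i> * r) = - (r * r)" unfolding * by simp
    then show "\<i> * r * (- \<i> * r) = r * r" "- \<i> * r * (\<i> * r) = r * r" "- \<i> * r * (- \<i> * r) = - (r * r)"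
      by (simp_all only: mult_minus_left mult_minus_right minus_minus)
  qed
  have S: "(\<Sum>p\<in>idx N. hm_unit N p a b * hm_unit N p c d)
     = (if a = b then hm_unit N (a, a) a a * hm_unit N (a, a) c d
        else hm_unit N (a, b) a b * hm_unit N (a, b) c d + hm_unit N (b, a) a b * hm_unit N (b, a) c d)"
    by (subst sum_idx_hm_unit[OF abcd(1,2)]) (auto simp: hm_unit_eq_0)
  consider "a = b" | "a < b" | "b < a" by linarith
  then show ?thesis
  proof cases
    case 1
    show ?thesis
    proof (cases "c = a \<and> d = a")
      case True then show ?thesis using 1 unfolding S by (simp only: hm_unit_values s if_True simp_thms)
    next
      case False then show ?thesis using 1 z[of a a] unfolding S by auto
    qed
  next
    case 2
    consider "c = a \<and> d = b" | "c = b \<and> d = a" | "\<not> (c = a \<and> d = b) \<and> \<not> (c = b \<and> d = a)" by blast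
    then show ?thesis
    proof cases
      case c: 1 then show ?thesis using 2 unfolding S by (simp only: v ii) auto
    next
      case c: 2 then show ?thesis using 2 rr unfolding S by (simp only: v ii) auto
    next
      case c: 3 then show ?thesis using 2 z[of a b] z[of b a] unfolding S by auto
    qed
  next
    case 3
    consider "c = a \<and> d = b" | "c = b \<and> d = a" | "\<not> (c = a \<and> d = b) \<and> \<not> (c = b \<and> d = a)" by blast
    then show ?thesis
    proof cases
      case c: 1 then show ?thesis using 3 unfolding S by (simp only: v ii) auto
    next
      case c: 2 then show ?thesis using 3 rr unfolding S by (simp only: v ii) auto
    next
      case c: 3 then show ?thesis using 3 z[of a b] z[of b a] unfolding S by auto
    qed
  qed
qed

lemma ip_hm_expand:
  "ip N a (mv N (hm N x) b) = (\<Sum>p\<in>idx N. of_real (x p) * ip N a (mv N (hm_unit N p) b))"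
proof -
  have "ip N a (mv N (hm N x) b) = (\<Sum>k<N. \<Sum>l<N. \<Sum>p\<in>idx N. of_real (x p) * (cnj (a k) * (hm_unit N p k l * b l)))"
    by (simp add: ip_def mv_def hm_expand sum_distrib_left sum_distrib_right mult_ac)
  also have "\<dots> = (\<Sum>k<N. \<Sum>p\<in>idx N. \<Sum>l<N. of_real (x p) * (cnj (a k) * (hm_unit N p k l * b l)))"
    by (intro sum.cong refl sum.swap)
  also have "\<dots> = (\<Sum>p\<in>idx N. \<Sum>k<N. \<Sum>l<N. of_real (x p) * (cnj (a k) * (hm_unit N p k l * b l)))"
    by (rule sum.swap)
  finally show ?thesis by (simp add: ip_def mv_def sum_distrib_left)
qed

text \<open>Unitary invariance in covariance form: arbitrary vectors may take the place of the
  standard basis, in particular the eigenvectors of the current matrix.\<close>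

lemma hm_unit_ip_covariance:
  assumes N: "N > 0"
  shows "(\<Sum>p\<in>idx N. ip N a (mv N (hm_unit N p) b) * ip N a' (mv N (hm_unit N p) b')) = ip N a b' * ip N a' b / of_nat N"
proof -
  let ?E = "hm_unit N"
  have "(\<Sum>p\<in>idx N. ip N a (mv N (?E p) b) * ip N a' (mv N (?E p) b'))
     = (\<Sum>p\<in>idx N. \<Sum>k<N. \<Sum>m<N. \<Sum>l<N. \<Sum>n<N. cnj (a k) * b l * cnj (a' m) * b' n * (?E p k l * ?E p m n))"
  proof (intro sum.cong refl)
    fix p
    have "(cnj (a k) * (\<Sum>l<N. ?E p k l * b l)) * (cnj (a' m) * (\<Sum>n<N. ?E p m n * b' n))
       = (\<Sum>l<N. \<Sum>n<N. cnj (a k) * b l * cnj (a' m) * b' n * (?E p k l * ?E p m n))" for k m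
    proof -
      have "(cnj (a k) * (\<Sum>l<N. ?E p k l * b l)) * (cnj (a' m) * (\<Sum>n<N. ?E p m n * b' n))
         = (cnj (a k) * cnj (a' m)) * ((\<Sum>l<N. ?E p k l * b l) * (\<Sum>n<N. ?E p m n * b' n))" by (simp only: mult_ac)
      also have "\<dots> = (\<Sum>l<N. \<Sum>n<N. (cnj (a k) * cnj (a' m)) * ((?E p k l * b l) * (?E p m n * b' n)))"
        by (subst sum_product) (simp only: sum_distrib_left)
      also have "\<dots> = (\<Sum>l<N. \<Sum>n<N. cnj (a k) * b l * cnj (a' m) * b' n * (?E p k l * ?E p m n))"
        by (intro sum.cong refl) (simp only: mult_ac)
      finally show ?thesis .
    qed
    then show "ip N a (mv N (?E p) b) * ip N a' (mv N (?E p) b')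
       = (\<Sum>k<N. \<Sum>m<N. \<Sum>l<N. \<Sum>n<N. cnj (a k) * b l * cnj (a' m) * b' n * (?E p k l * ?E p m n))"
      unfolding ip_def mv_def sum_product[of "\<lambda>k. cnj (a k) * _ k"] by simp
  qed
  also have "\<dots> = (\<Sum>k<N. \<Sum>m<N. \<Sum>l<N. \<Sum>n<N. \<Sum>p\<in>idx N. cnj (a k) * b l * cnj (a' m) * b' n * (?E p k l * ?E p m n))"
    by (subst sum.swap, rule sum.cong[OF refl], subst sum.swap, rule sum.cong[OF refl],
        subst sum.swap, rule sum.cong[OF refl], rule sum.swap)
  also have "\<dots> = (\<Sum>k<N. \<Sum>m<N. \<Sum>l<N. \<Sum>n<N. cnj (a k) * b l * cnj (a' m) * b' n * (if k = n \<and> l = m then 1 / of_nat N else 0))"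
    using N by (intro sum.cong refl) (simp only: sum_distrib_left[symmetric] hm_unit_covariance lessThan_iff)
  also have "\<dots> = (\<Sum>k<N. \<Sum>m<N. cnj (a k) * b m * cnj (a' m) * b' k / of_nat N)"
  proof (intro sum.cong refl)
    fix k m assume km: "k \<in> {..<N}" "m \<in> {..<N}"
    have "(\<Sum>l<N. \<Sum>n<N. cnj (a k) * b l * cnj (a' m) * b' n * (if k = n \<and> l = m then 1 / of_nat N else 0))
       = (\<Sum>l<N. if l = m then cnj (a k) * b m * cnj (a' m) * b' k / of_nat N else 0)"
    proof (intro sum.cong refl)
      fix l
      have "(\<Sum>n<N. cnj (a k) * b l * cnj (a' m) * b' n * (if k = n \<and> l = m then 1 / of_nat N else 0))
         = (\<Sum>n<N. if k = n then (if l = m then cnj (a k) * b m * cnj (a' m) * b' k / of_nat N else 0) else 0)"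
        by (intro sum.cong refl) auto
      also have "\<dots> = (if l = m then cnj (a k) * b m * cnj (a' m) * b' k / of_nat N else 0)"
        using km by simp
      finally show "(\<Sum>n<N. cnj (a k) * b l * cnj (a' m) * b' n * (if k = n \<and> l = m then 1 / of_nat N else 0))
         = (if l = m then cnj (a k) * b m * cnj (a' m) * b' k / of_nat N else 0)" .
    qed
    also have "\<dots> = cnj (a k) * b m * cnj (a' m) * b' k / of_nat N" using km by simp
    finally show "(\<Sum>l<N. \<Sum>n<N. cnj (a k) * b l * cnj (a' m) * b' n * (if k = n \<and> l = m then 1 / of_nat N else 0))
       = cnj (a k) * b m * cnj (a' m) * b' k / of_nat N" .
  qed
  also have "\<dots> = ip N a b' * ip N a' b / of_nat N"
    unfolding ip_def sum_product sum_divide_distrib by (intro sum.cong refl) (simp add: mult_ac)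
  finally show ?thesis .
qed

text \<open>The covariance formula with a' = b and b' = a: for standard normal coordinates a matrix
  element between unit vectors has mean square 1/N, whatever the vectors.\<close>

lemma hm_unit_norm_sum:
  assumes N: "N > 0" and a: "ip N a a = 1" and b: "ip N b b = 1"
  shows "(\<Sum>p\<in>idx N. (cmod (ip N a (mv N (hm_unit N p) b)))\<^sup>2) = 1 / real N"
proof -
  have "ip N a (mv N (hm_unit N p) b) * ip N b (mv N (hm_unit N p) a) = of_real ((cmod (ip N a (mv N (hm_unit N p) b)))\<^sup>2)" for p
  proof -
    have "ip N b (mv N (hm_unit N p) a) = ip N (mv N (hm_unit N p) b) a"
      unfolding hm_unit_def by (rule ip_mv_hermitian[OF hm_hermitian])
    then show ?thesis by (simp add: ip_mult_commuted)
  qed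
  then have "complex_of_real (\<Sum>p\<in>idx N. (cmod (ip N a (mv N (hm_unit N p) b)))\<^sup>2)
     = (\<Sum>p\<in>idx N. ip N a (mv N (hm_unit N p) b) * ip N b (mv N (hm_unit N p) a))" by simp
  also have "\<dots> = complex_of_real (1 / real N)"
    unfolding hm_unit_ip_covariance[OF N] using a b by simp
  finally show ?thesis by (simp only: of_real_eq_iff)
qed

text \<open>In the application \<open>\<rho>\<close> is one plus the squared norm of a standard Gaussian vector.\<close>

lemma exp_third_order:
  fixes c h \<rho> l T q :: real
  assumes c: "0 \<le> c" and h: "0 < h" "h \<le> 1" and \<rho>: "1 \<le> \<rho>" and small: "2 * c * sqrt h \<le> 1 / 8"
    and l: "\<bar>l\<bar> \<le> c * sqrt h * \<rho>" and T: "\<bar>T\<bar> \<le> c * h * \<rho>" and q: "\<bar>T - q\<bar> \<le> c * (h * sqrt h) * \<rho>\<^sup>2"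
  shows "exp (l + T) \<le> 1 + l + (q + l\<^sup>2 / 2) + 3072 * (c + 2 * c\<^sup>2 + 8 * c ^ 3) * (h * sqrt h) * exp (\<rho> / 4)"
proof -
  define s where "s = sqrt h"
  have s: "0 < s" "s \<le> 1" "h = s * s" using h by (auto simp: s_def)
  have ss: "s * s \<le> s" using s by simp
  define w where "w = l + T"
  obtain t where t: "\<bar>t\<bar> \<le> \<bar>w\<bar>" "exp w = (\<Sum>m<3. w ^ m / fact m) + exp t / fact 3 * w ^ 3"
    using Maclaurin_exp_le[of w 3] by blast
  have l': "\<bar>l\<bar> \<le> c * s * \<rho>" using l by (simp add: s_def)
  have T': "\<bar>T\<bar> \<le> c * (s * s) * \<rho>" using T s by simp
  have T'': "\<bar>T\<bar> \<le> c * s * \<rho>"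
    using ss c \<rho> by (intro order_trans[OF T'] mult_right_mono mult_left_mono) auto
  have w1: "\<bar>w\<bar> \<le> 2 * c * s * \<rho>" unfolding w_def using l' T'' by linarith
  have "2 * c * s * \<rho> \<le> 1 / 8 * \<rho>" using small \<rho> unfolding s_def by (intro mult_right_mono) auto
  then have w8: "\<bar>w\<bar> \<le> \<rho> / 8" using w1 by linarith
  \<comment> \<open>The final weight exp(rho/4) is split into two factors \<open>E\<close>: one
    absorbs the power rho^3, the other the factor e^t of the Taylor remainder, where |t| <= |w| <=
    rho/8.\<close>
  define E where "E = exp (\<rho> / 8)"
  have E1: "1 \<le> E" using \<rho> by (simp add: E_def)
  \<comment> \<open>The cubic term of the exponential series at rho/8 gives the constant 3072 = 6
    times 8^3.\<close>
  have e8: "\<rho> ^ 3 \<le> 3072 * E"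
  proof -
    obtain t where "exp (\<rho> / 8) = (\<Sum>m<4. (\<rho> / 8) ^ m / fact m) + exp t / fact 4 * (\<rho> / 8) ^ 4"
      using Maclaurin_exp_le[of "\<rho> / 8" 4] by blast
    moreover have "0 \<le> exp t / fact 4 * (\<rho> / 8) ^ 4" by simp
    moreover have "(\<Sum>m<4. (\<rho> / 8) ^ m / fact m) = 1 + \<rho> / 8 + (\<rho> / 8)\<^sup>2 / 2 + (\<rho> / 8) ^ 3 / 6"
      by (simp add: eval_nat_numeral)
    moreover have "0 \<le> (\<rho> / 8)\<^sup>2 / 2" by simp
    ultimately have "(\<rho> / 8) ^ 3 / 6 \<le> E" using \<rho> unfolding E_def by linarith
    then show ?thesis by (simp add: power_divide)
  qed
  have EE: "E * E = exp (\<rho> / 4)" by (simp add: E_def exp_add[symmetric])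
  have P: "\<rho> ^ 3 * E \<le> 3072 * exp (\<rho> / 4)"
    using mult_right_mono[OF e8, of E] E1 by (simp add: EE[symmetric] mult.assoc)
  have \<rho>23: "\<rho>\<^sup>2 \<le> \<rho> ^ 3 * E"
  proof -
    have "\<rho>\<^sup>2 * 1 \<le> \<rho>\<^sup>2 * (\<rho> * E)" using \<rho> E1 mult_mono[of 1 \<rho> 1 E] by (intro mult_left_mono) auto
    then show ?thesis by (simp add: power2_eq_square power3_eq_cube mult_ac)
  qed
  have w3: "exp t / 6 * w ^ 3 \<le> 8 * c ^ 3 * s ^ 3 * (\<rho> ^ 3 * E)"
  proof -
    have "exp t \<le> E" using t(1) w8 by (simp add: E_def)
    moreover have "\<bar>w\<bar> ^ 3 \<le> (2 * c * s * \<rho>) ^ 3" by (rule power_mono[OF w1]) simp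
    ultimately have B: "exp t * \<bar>w\<bar> ^ 3 \<le> E * (2 * c * s * \<rho>) ^ 3" using E1 by (intro mult_mono) auto
    have A: "exp t / 6 * w ^ 3 \<le> exp t * \<bar>w\<bar> ^ 3"
    proof -
      have "exp t / 6 * w ^ 3 \<le> exp t / 6 * \<bar>w\<bar> ^ 3" by (intro mult_left_mono) (auto simp: power_abs[symmetric])
      also have "\<dots> \<le> exp t * \<bar>w\<bar> ^ 3" by (intro mult_right_mono) auto
      finally show ?thesis .
    qed
    show ?thesis using order_trans[OF A B] by (simp only: power_mult_distrib mult_ac) simp
  qed
  have lT: "l * T \<le> c\<^sup>2 * s ^ 3 * \<rho>\<^sup>2"
  proof -
    have "l * T \<le> \<bar>l\<bar> * \<bar>T\<bar>" by (simp add: abs_mult[symmetric])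
    also have "\<dots> \<le> (c * s * \<rho>) * (c * (s * s) * \<rho>)" using c s \<rho> by (intro mult_mono l' T') auto
    finally show ?thesis by (simp add: power2_eq_square power3_eq_cube mult_ac)
  qed
  have TT: "T\<^sup>2 \<le> c\<^sup>2 * s ^ 3 * \<rho>\<^sup>2"
  proof -
    have "T\<^sup>2 = \<bar>T\<bar> * \<bar>T\<bar>" by (simp add: power2_eq_square)
    also have "\<dots> \<le> (c * s * \<rho>) * (c * (s * s) * \<rho>)" using c s \<rho> by (intro mult_mono T'' T') auto
    finally show ?thesis by (simp add: power2_eq_square power3_eq_cube mult_ac)
  qed
  have w2: "w\<^sup>2 / 2 \<le> l\<^sup>2 / 2 + 2 * c\<^sup>2 * s ^ 3 * \<rho>\<^sup>2"
  proof -
    have "w\<^sup>2 / 2 = l\<^sup>2 / 2 + l * T + T\<^sup>2 / 2" by (simp add: w_def power2_sum add_divide_distrib)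
    moreover have "0 \<le> T\<^sup>2" by simp
    ultimately show ?thesis using lT TT by linarith
  qed
  have Tq: "T \<le> q + c * s ^ 3 * \<rho>\<^sup>2"
    using abs_le_D1[OF q] s by (simp add: s_def[symmetric] power3_eq_cube mult_ac)
  have "exp w = 1 + w + w\<^sup>2 / 2 + exp t / 6 * w ^ 3"
    unfolding t(2) by (simp add: eval_nat_numeral)
  also have "\<dots> \<le> 1 + l + (q + l\<^sup>2 / 2) + (c * s ^ 3 * \<rho>\<^sup>2 + 2 * c\<^sup>2 * s ^ 3 * \<rho>\<^sup>2 + 8 * c ^ 3 * s ^ 3 * (\<rho> ^ 3 * E))"
    using Tq w2 w3 w_def by linarith
  also have "c * s ^ 3 * \<rho>\<^sup>2 + 2 * c\<^sup>2 * s ^ 3 * \<rho>\<^sup>2 + 8 * c ^ 3 * s ^ 3 * (\<rho> ^ 3 * E)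
     \<le> c * s ^ 3 * (\<rho> ^ 3 * E) + 2 * c\<^sup>2 * s ^ 3 * (\<rho> ^ 3 * E) + 8 * c ^ 3 * s ^ 3 * (\<rho> ^ 3 * E)"
    using c s \<rho>23 by (intro add_mono mult_left_mono order_refl) auto
  also have "\<dots> = (c + 2 * c\<^sup>2 + 8 * c ^ 3) * s ^ 3 * (\<rho> ^ 3 * E)" by (simp add: algebra_simps)
  also have "\<dots> \<le> (c + 2 * c\<^sup>2 + 8 * c ^ 3) * s ^ 3 * (3072 * exp (\<rho> / 4))"
    using c s by (intro mult_left_mono P) auto
  also have "s ^ 3 = h * sqrt h" using s by (simp add: s_def[symmetric] power3_eq_cube)
  finally show ?thesis by (simp add: w_def mult_ac)
qed

section \<open>The spectral measure as a function of the Gaussian coordinates\<close>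

definition shifted_hm :: "nat \<Rightarrow> (nat \<Rightarrow> real) \<Rightarrow> (nat \<times> nat \<Rightarrow> real) \<Rightarrow> nat \<Rightarrow> nat \<Rightarrow> complex" where
  "shifted_hm N d x k l = (if k = l then complex_of_real (d k) else 0) + hm N x k l"

definition spec :: "nat \<Rightarrow> (nat \<Rightarrow> real) \<Rightarrow> (nat \<times> nat \<Rightarrow> real) \<Rightarrow> real measure" where
  "spec N d x = spectral_measure (mat N N (\<lambda>(k, l). shifted_hm N d x k l))"

lemma spectral_process_eq: "spectral_process N d B \<omega> t = spec N d (\<lambda>p. B p t \<omega>)"
proof -
  have "diag_real N d + herm_BM N B t \<omega> = mat N N (\<lambda>(k, l). shifted_hm N d (\<lambda>p. B p t \<omega>) k l)"
    by (rule eq_matI) (auto simp: diag_real_def mat_diag_def herm_BM_def shifted_hm_def hm_def)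
  then show ?thesis by (simp add: spectral_process_def spec_def)
qed

lemma real_distribution_spec: "real_distribution (spec N d x)"
  unfolding spec_def by (rule real_distribution_spectral_measure)

lemma shifted_hm_hermitian: "hermitian N (shifted_hm N d x)"
  unfolding hermitian_def shifted_hm_def using hermitianD[OF hm_hermitian] by simp

lemma shifted_hm_diff: "hm N y k l = shifted_hm N d (\<lambda>p. x p + y p) k l - shifted_hm N d x k l"
  by (simp add: shifted_hm_def hm_add)

lemma hermitian_pair_shifted_hm:
  assumes "eigenbasis N (shifted_hm N d x) lam u" "eigenbasis N (shifted_hm N d (\<lambda>p. x p + y p)) mu v"
  shows "hermitian_pair N (shifted_hm N d x) (shifted_hm N d (\<lambda>p. x p + y p)) (hm N y) lam mu u v"
  by standard (use assms shifted_hm_diff in \<open>auto simp: shifted_hm_hermitian\<close>)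

lemma spec_integral:
  fixes g :: "real \<Rightarrow> real"
  assumes "eigenbasis N (shifted_hm N d x) lam u" "N > 0" "g \<in> borel_measurable borel"
  shows "(\<integral>x. g x \<partial>spec N d x) = (\<Sum>i<N. g (lam i)) / real N"
  unfolding spec_def by (rule spectral_measure_integral[OF assms])

lemma spec_pair_integral:
  fixes g :: "real \<times> real \<Rightarrow> real"
  assumes "eigenbasis N (shifted_hm N d x) lam u" "N > 0" "g \<in> borel_measurable borel" "\<And>z. \<bar>g z\<bar> \<le> B"
  shows "(\<integral>z. g z \<partial>(spec N d x \<Otimes>\<^sub>M spec N d x)) = (\<Sum>i<N. \<Sum>j<N. g (lam i, lam j)) / (real N)\<^sup>2"
  unfolding spec_def by (rule spectral_measure_pair_integral[OF assms])

lemma lipschitz_continuous_borel: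
  fixes g :: "real \<Rightarrow> real"
  assumes L: "\<And>x y. \<bar>g x - g y\<bar> \<le> L * \<bar>x - y\<bar>"
  shows "continuous_on UNIV g" "g \<in> borel_measurable borel"
proof -
  have "L-lipschitz_on UNIV g"
    using L[of 0 1] L by (intro lipschitz_onI) (auto simp: dist_real_def)
  then show "continuous_on UNIV g" by (rule lipschitz_on_continuous_on)
  then show "g \<in> borel_measurable borel" by (rule borel_measurable_continuous_onI)
qed

lemma DERIV_borel:
  fixes g :: "real \<Rightarrow> real"
  assumes "\<And>x. (g has_real_derivative g' x) (at x)"
  shows "g \<in> borel_measurable borel"
  using assms by (intro borel_measurable_continuous_onI) (meson DERIV_continuous continuous_at_imp_continuous_on)

lemma spec_lipschitz:
  fixes g :: "real \<Rightarrow> real"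
  assumes N: "N > 0" and L: "\<And>x y. \<bar>g x - g y\<bar> \<le> L * \<bar>x - y\<bar>"
  shows "\<bar>(\<integral>r. g r \<partial>spec N d y) - (\<integral>r. g r \<partial>spec N d x)\<bar> \<le> L * (sqrt (\<Sum>p\<in>idx N. (y p - x p)\<^sup>2) / real N)"
proof -
  have y: "(\<lambda>p. x p + (y p - x p)) = y" by simp
  obtain lam u where E1: "eigenbasis N (shifted_hm N d x) lam u" using hermitian_eigenbasis[OF shifted_hm_hermitian] by blast
  obtain mu v where E2: "eigenbasis N (shifted_hm N d y) mu v" using hermitian_eigenbasis[OF shifted_hm_hermitian] by blast
  interpret hermitian_pair N "shifted_hm N d x" "shifted_hm N d y" "hm N (\<lambda>p. y p - x p)" lam mu u v
    using hermitian_pair_shifted_hm[of N d x lam u "\<lambda>p. y p - x p" mu v] E1 E2 unfolding y by blast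
  have g: "g \<in> borel_measurable borel" using lipschitz_continuous_borel[OF L] by blast
  have "(\<integral>r. g r \<partial>spec N d y) - (\<integral>r. g r \<partial>spec N d x) = ((\<Sum>j<N. g (mu j)) - (\<Sum>i<N. g (lam i))) / real N"
    unfolding spec_integral[OF E1 N g] spec_integral[OF E2 N g] by (rule diff_divide_distrib[symmetric])
  then have "\<bar>(\<integral>r. g r \<partial>spec N d y) - (\<integral>r. g r \<partial>spec N d x)\<bar> \<le> L * sqrt (real N) * sqrt (hs N (hm N (\<lambda>p. y p - x p))) / real N"
    using trace_lipschitz[OF L] N by (simp add: divide_right_mono)
  also have "\<dots> = L * (sqrt (\<Sum>p\<in>idx N. (y p - x p)\<^sup>2) / real N)"
    using N by (simp add: hs_hm real_sqrt_divide)
  finally show ?thesis .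
qed

lemma spec_bl_dist:
  assumes N: "N > 0"
  shows "bl_dist (spec N d y) (spec N d x) \<le> sqrt (\<Sum>p\<in>idx N. (y p - x p)\<^sup>2) / real N"
proof (rule bl_dist_le)
  fix f assume f: "f \<in> BL_unit"
  show "\<bar>(\<integral>r. f r \<partial>spec N d y) - (\<integral>r. f r \<partial>spec N d x)\<bar> \<le> sqrt (\<Sum>p\<in>idx N. (y p - x p)\<^sup>2) / real N"
    using spec_lipschitz[OF N, of f 1 d y x] BL_unit_lipschitz[OF f] by simp
qed

text \<open>\<open>drift\<close> is the generator applied to the exponential of \<^term>\<open>(real N)\<^sup>2 * (\<integral>x. f x \<partial>\<mu>)\<close>, divided by that exponential.\<close>

definition drift :: "nat \<Rightarrow> (real \<Rightarrow> real) \<Rightarrow> (real \<Rightarrow> real) \<Rightarrow> real measure \<Rightarrow> real" where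
  "drift N f1 f2 \<mu> = (real N)\<^sup>2 * (1/2 * (\<integral>z. divided_diff f1 f2 (fst z) (snd z) \<partial>(\<mu> \<Otimes>\<^sub>M \<mu>)) + 1/2 * (\<integral>x. (f1 x)\<^sup>2 \<partial>\<mu>))"

text \<open>Under the symmetric double sum a divided difference counts as twice a Taylor kernel;
  this is the form in which the expectation of the second-order term of the trace appears.\<close>

lemma drift_eigenbasis:
  assumes N: "N > 0" and E: "eigenbasis N (shifted_hm N d x) lam u"
    and d: "\<And>x. (f has_real_derivative f1 x) (at x)" "\<And>x. (f1 has_real_derivative f2 x) (at x)"
    and c: "continuous_on UNIV f2" and M2: "\<And>x. \<bar>f2 x\<bar> \<le> M2"
  shows "drift N f1 f2 (spec N d x) = (\<Sum>i<N. \<Sum>j<N. taylor_kernel f2 (lam i) (lam j)) + real N * (\<Sum>i<N. (f1 (lam i))\<^sup>2) / 2"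
proof -
  have f1m: "f1 \<in> borel_measurable borel" by (rule DERIV_borel[OF d(2)])
  have "(\<integral>z. divided_diff f1 f2 (fst z) (snd z) \<partial>(spec N d x \<Otimes>\<^sub>M spec N d x))
     = (\<Sum>i<N. \<Sum>j<N. divided_diff f1 f2 (lam i) (lam j)) / (real N)\<^sup>2"
    by (subst spec_pair_integral[OF E N divided_diff_measurable[OF d(2) c], of M2]) (auto intro: divided_diff_abs_le d(2) M2)
  also have "(\<Sum>i<N. \<Sum>j<N. divided_diff f1 f2 (lam i) (lam j))
     = (\<Sum>i<N. \<Sum>j<N. taylor_kernel f2 (lam i) (lam j)) + (\<Sum>i<N. \<Sum>j<N. taylor_kernel f2 (lam j) (lam i))"
    unfolding taylor_kernel_sym_sum[OF d, symmetric] by (simp only: sum.distrib)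
  also have "(\<Sum>i<N. \<Sum>j<N. taylor_kernel f2 (lam j) (lam i)) = (\<Sum>i<N. \<Sum>j<N. taylor_kernel f2 (lam i) (lam j))"
    by (rule sum.swap)
  finally have 1: "(\<integral>z. divided_diff f1 f2 (fst z) (snd z) \<partial>(spec N d x \<Otimes>\<^sub>M spec N d x))
     = 2 * (\<Sum>i<N. \<Sum>j<N. taylor_kernel f2 (lam i) (lam j)) / (real N)\<^sup>2" by simp
  have 2: "(\<integral>x. (f1 x)\<^sup>2 \<partial>spec N d x) = (\<Sum>i<N. (f1 (lam i))\<^sup>2) / real N"
    using f1m by (intro spec_integral[OF E N]) simp
  show ?thesis unfolding drift_def 1 2 using N by (simp add: power2_eq_square field_simps)
qed

lemma drift_abs_le:
  assumes d: "\<And>x. (f1 has_real_derivative f2 x) (at x)"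
    and M1: "\<And>x. \<bar>f1 x\<bar> \<le> M1" and M2: "\<And>x. \<bar>f2 x\<bar> \<le> M2" and \<mu>: "real_distribution \<mu>"
  shows "\<bar>drift N f1 f2 \<mu>\<bar> \<le> (real N)\<^sup>2 * (M1\<^sup>2 + M2)"
proof -
  have "\<bar>\<integral>x. (f1 x)\<^sup>2 \<partial>\<mu>\<bar> \<le> M1\<^sup>2"
  proof (rule real_distribution_integral_abs_le[OF \<mu>])
    show "\<bar>(f1 x)\<^sup>2\<bar> \<le> M1\<^sup>2" for x using power_mono[OF M1[of x], of 2] by simp
  qed
  then have "\<bar>1/2 * (\<integral>z. divided_diff f1 f2 (fst z) (snd z) \<partial>(\<mu> \<Otimes>\<^sub>M \<mu>)) + 1/2 * (\<integral>x. (f1 x)\<^sup>2 \<partial>\<mu>)\<bar> \<le> M1\<^sup>2 + M2"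
    using integral_divided_diff_abs_le[OF d M2 \<mu>] by linarith
  then show ?thesis unfolding drift_def by (simp add: abs_mult mult_left_mono)
qed

section \<open>Exponential moment of one Gaussian increment\<close>

lemma cmod_ip_le: "cmod (ip N a b) \<le> sqrt (\<Sum>k<N. (cmod (a k))\<^sup>2) * sqrt (\<Sum>k<N. (cmod (b k))\<^sup>2)"
proof -
  have "cmod (ip N a b) \<le> (\<Sum>k<N. \<bar>cmod (a k)\<bar> * \<bar>cmod (b k)\<bar>)"
    unfolding ip_def by (rule order_trans[OF norm_sum]) (simp add: norm_mult)
  also have "\<dots> \<le> L2_set (\<lambda>k. cmod (a k)) {..<N} * L2_set (\<lambda>k. cmod (b k)) {..<N}" by (rule L2_set_mult_ineq)
  finally show ?thesis by (simp add: L2_set_def)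
qed

text \<open>The exponential is dominated by an expression in the linear form \<open>l\<close>, its
  square and the quadratic form \<open>Q\<close>, plus a remainder of finite expectation. The
  summands of \<open>c\<close> bound the linear term (M1), the second-order term together with the
  drift (M2 + M1^2 + M2) and the exchange of eigenbases (L); a single \<open>c\<close> fits the
  hypotheses of \<open>exp_third_order\<close>.\<close>

lemma one_step_pointwise:
  assumes N: "N > 0" and M: "0 \<le> M1" "0 \<le> M2" "0 \<le> L" and h: "0 < h" "h \<le> 1"
    and c: "c = (real N)\<^sup>2 * (M1 + M2 + M1\<^sup>2 + M2 + L)" and small: "2 * c * sqrt h \<le> 1 / 8"
    and f: "\<And>x. (f has_real_derivative f1 x) (at x)" and f1: "\<And>x. (f1 has_real_derivative f2 x) (at x)"
    and M1: "\<And>x. \<bar>f1 x\<bar> \<le> M1" and M2: "\<And>x. \<bar>f2 x\<bar> \<le> M2" and L: "\<And>x y. \<bar>f2 x - f2 y\<bar> \<le> L * \<bar>x - y\<bar>"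
    and E: "eigenbasis N (shifted_hm N d x) lam u"
    and V: "V = drift N f1 f2 (spec N d x)" and \<rho>: "\<rho> = 1 + (\<Sum>p\<in>idx N. (z p)\<^sup>2) / h"
    and D: "D = (real N)\<^sup>2 * (\<integral>r. f r \<partial>spec N d (\<lambda>p. x p + z p)) - (real N)\<^sup>2 * (\<integral>r. f r \<partial>spec N d x)"
    and l: "l = real N * (\<Sum>i<N. f1 (lam i) * Re (ip N (u i) (mv N (hm N z) (u i))))"
    and Q: "Q = real N * (\<Sum>i<N. \<Sum>j<N. (cmod (ip N (u i) (mv N (hm N z) (u j))))\<^sup>2 * taylor_kernel f2 (lam i) (lam j))"
  shows "exp (D - h * V) \<le> 1 + l + ((Q - h * V) + l\<^sup>2 / 2) + 3072 * (c + 2 * c\<^sup>2 + 8 * c ^ 3) * (h * sqrt h) * exp (\<rho> / 4)"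
proof -
  have c0: "0 \<le> c" unfolding c using M by (intro mult_nonneg_nonneg add_nonneg_nonneg) auto
  have f2c: "continuous_on UNIV f2" using lipschitz_continuous_borel[OF L] by blast
  have fm: "f \<in> borel_measurable borel" by (rule DERIV_borel[OF f])
  define A where Aeq: "A = hm N z"
  obtain mu v where E': "eigenbasis N (shifted_hm N d (\<lambda>p. x p + z p)) mu v"
    using hermitian_eigenbasis[OF shifted_hm_hermitian] by blast
  interpret hermitian_pair N "shifted_hm N d x" "shifted_hm N d (\<lambda>p. x p + z p)" A lam mu u v
    unfolding Aeq by (rule hermitian_pair_shifted_hm[OF E E'])
  have hsA: "hs N A = (\<Sum>p\<in>idx N. (z p)\<^sup>2) / real N" unfolding Aeq by (rule hs_hm[OF N])
  have s0: "0 \<le> (\<Sum>p\<in>idx N. (z p)\<^sup>2)" by (intro sum_nonneg) auto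
  have N1: "1 \<le> real N" using N by simp
  have NN: "real N \<le> (real N)\<^sup>2" using N1 by (simp add: power2_eq_square)
  have \<rho>1: "1 \<le> \<rho>" unfolding \<rho> using s0 h by simp
  have hsle: "hs N A \<le> h * \<rho>"
  proof -
    have "hs N A \<le> (\<Sum>p\<in>idx N. (z p)\<^sup>2) / 1" unfolding hsA using N1 s0 by (intro divide_left_mono) auto
    also have "\<dots> \<le> h * \<rho>" unfolding \<rho> using h by (simp add: distrib_left)
    finally show ?thesis .
  qed
  have sqrtle: "sqrt (hs N A) \<le> sqrt h * \<rho>"
  proof -
    have "sqrt (hs N A) \<le> sqrt (h * \<rho>)" using hsle by (rule real_sqrt_le_mono)
    also have "\<dots> = sqrt h * sqrt \<rho>" by (rule real_sqrt_mult)
    also have "\<dots> \<le> sqrt h * \<rho>"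
      using \<rho>1 h by (intro mult_left_mono) (auto intro!: real_le_lsqrt simp: power2_eq_square)
    finally show ?thesis .
  qed
  note l = l[folded Aeq] and Q = Q[folded Aeq]
  have Deq: "D = real N * ((\<Sum>j<N. f (mu j)) - (\<Sum>i<N. f (lam i)))"
    unfolding D spec_integral[OF E N fm] spec_integral[OF E' N fm] using N
    by (simp add: power2_eq_square right_diff_distrib)
  note Gt = taylor_kernel_eq[OF f f1] and GM = taylor_kernel_abs_le[OF f2c M2] and GL = taylor_kernel_lipschitz[OF f2c L]
  define T where "T = D - l - h * V"
  have Dl: "\<bar>D - l\<bar> \<le> (real N)\<^sup>2 * M2 * (h * \<rho>)"
  proof -
    have "\<bar>D - l\<bar> = real N * \<bar>(\<Sum>j<N. f (mu j)) - (\<Sum>i<N. f (lam i)) - (\<Sum>i<N. f1 (lam i) * Re (ip N (u i) (mv N A (u i))))\<bar>"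
      unfolding Deq l by (simp add: abs_mult right_diff_distrib[symmetric])
    also have "\<dots> \<le> real N * (M2 * hs N A)" by (intro mult_left_mono trace_taylor_bound[OF Gt GM]) simp
    also have "\<dots> \<le> (real N)\<^sup>2 * (M2 * (h * \<rho>))"
      using NN M hsle hs_nonneg[of N A] by (intro mult_mono mult_nonneg_nonneg) auto
    finally show ?thesis by (simp add: mult.assoc)
  qed
  have DlQ: "\<bar>D - l - Q\<bar> \<le> (real N)\<^sup>2 * L * (h * sqrt h * \<rho>\<^sup>2)"
  proof -
    have "\<bar>D - l - Q\<bar> = real N * \<bar>(\<Sum>j<N. f (mu j)) - (\<Sum>i<N. f (lam i)) - (\<Sum>i<N. f1 (lam i) * Re (ip N (u i) (mv N A (u i))))
       - (\<Sum>i<N. \<Sum>j<N. (cmod (ip N (u i) (mv N A (u j))))\<^sup>2 * taylor_kernel f2 (lam i) (lam j))\<bar>"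
      unfolding Deq l Q by (simp add: abs_mult right_diff_distrib[symmetric])
    also have "\<dots> \<le> real N * (L * sqrt (hs N A) * hs N A)" by (intro mult_left_mono trace_taylor[OF Gt GL]) simp
    also have "\<dots> \<le> (real N)\<^sup>2 * (L * (sqrt h * \<rho>) * (h * \<rho>))"
      using NN M hsle sqrtle hs_nonneg[of N A] \<rho>1 h by (intro mult_mono mult_nonneg_nonneg) auto
    finally show ?thesis by (simp add: power2_eq_square mult_ac)
  qed
  have lb: "\<bar>l\<bar> \<le> (real N)\<^sup>2 * M1 * (sqrt h * \<rho>)"
  proof -
    have one: "\<bar>f1 (lam i) * Re (ip N (u i) (mv N A (u i)))\<bar> \<le> M1 * (sqrt h * \<rho>)" if i: "i < N" for i
    proof -
      have u1: "(\<Sum>k<N. (cmod (u i k))\<^sup>2) = 1"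
        using eigenbasis_orthonormal[OF E i i] unfolding ip_self by (metis of_real_eq_1_iff)
      have u2: "(\<Sum>k<N. (cmod (mv N A (u i) k))\<^sup>2) \<le> hs N A"
        unfolding hs_eigenbasis[OF E, symmetric] using i
        by (intro member_le_sum[of i "{..<N}" "\<lambda>i. \<Sum>k<N. (cmod (mv N A (u i) k))\<^sup>2"] sum_nonneg) auto
      have "\<bar>Re (ip N (u i) (mv N A (u i)))\<bar> \<le> sqrt (\<Sum>k<N. (cmod (u i k))\<^sup>2) * sqrt (\<Sum>k<N. (cmod (mv N A (u i) k))\<^sup>2)"
        by (rule order_trans[OF abs_Re_le_cmod cmod_ip_le])
      also have "\<dots> \<le> sqrt (hs N A)" unfolding u1 using u2 by simp
      finally have "\<bar>Re (ip N (u i) (mv N A (u i)))\<bar> \<le> sqrt h * \<rho>" using sqrtle by (rule order_trans)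
      then show ?thesis unfolding abs_mult using M M1 by (intro mult_mono) auto
    qed
    have "\<bar>l\<bar> = real N * \<bar>\<Sum>i<N. f1 (lam i) * Re (ip N (u i) (mv N A (u i)))\<bar>" unfolding l by (simp add: abs_mult)
    also have "\<dots> \<le> real N * (\<Sum>i<N. M1 * (sqrt h * \<rho>))"
      by (intro mult_left_mono order_trans[OF sum_abs] sum_mono one) auto
    finally show ?thesis by (simp add: power2_eq_square mult_ac)
  qed
  have hV: "\<bar>h * V\<bar> \<le> (real N)\<^sup>2 * (M1\<^sup>2 + M2) * (h * \<rho>)"
  proof -
    have "\<bar>h * V\<bar> \<le> h * ((real N)\<^sup>2 * (M1\<^sup>2 + M2))"
      unfolding abs_mult V using h drift_abs_le[OF f1 M1 M2 real_distribution_spec] by (intro mult_mono) auto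
    also have "\<dots> \<le> (h * \<rho>) * ((real N)\<^sup>2 * (M1\<^sup>2 + M2))"
      using h \<rho>1 M by (intro mult_right_mono mult_nonneg_nonneg) auto
    finally show ?thesis by (simp add: mult_ac)
  qed
  have hr: "0 \<le> sqrt h * \<rho>" "0 \<le> h * \<rho>" "0 \<le> h * sqrt h * \<rho>\<^sup>2" using h \<rho>1 by auto
  have cM: "(real N)\<^sup>2 * M1 \<le> c" "(real N)\<^sup>2 * (M2 + (M1\<^sup>2 + M2)) \<le> c" "(real N)\<^sup>2 * L \<le> c"
    unfolding c using M by (intro mult_left_mono; simp)+
  have "exp (l + T) \<le> 1 + l + ((Q - h * V) + l\<^sup>2 / 2) + 3072 * (c + 2 * c\<^sup>2 + 8 * c ^ 3) * (h * sqrt h) * exp (\<rho> / 4)"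
  proof (rule exp_third_order[OF c0 h \<rho>1 small])
    show "\<bar>l\<bar> \<le> c * sqrt h * \<rho>" using order_trans[OF lb mult_right_mono[OF cM(1) hr(1)]] by (simp add: mult.assoc)
    have "\<bar>T\<bar> \<le> (real N)\<^sup>2 * M2 * (h * \<rho>) + (real N)\<^sup>2 * (M1\<^sup>2 + M2) * (h * \<rho>)"
      unfolding T_def using Dl hV by linarith
    also have "\<dots> = (real N)\<^sup>2 * (M2 + (M1\<^sup>2 + M2)) * (h * \<rho>)" by (simp only: distrib_left distrib_right)
    also have "\<dots> \<le> c * (h * \<rho>)" by (rule mult_right_mono[OF cM(2) hr(2)])
    finally show "\<bar>T\<bar> \<le> c * h * \<rho>" by (simp only: mult.assoc)
    have "T - (Q - h * V) = D - l - Q" by (simp add: T_def)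
    then show "\<bar>T - (Q - h * V)\<bar> \<le> c * (h * sqrt h) * \<rho>\<^sup>2"
      using order_trans[OF DlQ mult_right_mono[OF cM(3) hr(3)]] by (simp only: mult.assoc)
  qed
  then show ?thesis by (simp add: T_def)
qed

text \<open>\<open>K\<close> and \<open>h0\<close> are fixed before the function, the position
  \<open>x\<close> and the probability space, so that the bound can be used conditionally on the
  past, at every step and for every sufficiently fine partition.\<close>

theorem one_step_exponential_bound:
  assumes N: "N > 0" and M: "0 \<le> M1" "0 \<le> M2" "0 \<le> L"
  obtains K h0 where "0 \<le> K" "0 < h0"
    "\<And>f f1 f2 d x h (M :: 'w measure) Z.
     (\<And>x. (f has_real_derivative f1 x) (at x)) \<Longrightarrow> (\<And>x. (f1 has_real_derivative f2 x) (at x)) \<Longrightarrow>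
     (\<And>x. \<bar>f1 x\<bar> \<le> M1) \<Longrightarrow> (\<And>x. \<bar>f2 x\<bar> \<le> M2) \<Longrightarrow> (\<And>x y. \<bar>f2 x - f2 y\<bar> \<le> L * \<bar>x - y\<bar>) \<Longrightarrow> h \<le> h0 \<Longrightarrow>
     gaussian_family M (idx N) Z h \<Longrightarrow>
     (\<integral>\<^sup>+\<omega>. ennreal (exp ((real N)\<^sup>2 * (\<integral>r. f r \<partial>spec N d (\<lambda>p. x p + Z p \<omega>)) - (real N)\<^sup>2 * (\<integral>r. f r \<partial>spec N d x)
        - h * drift N f1 f2 (spec N d x))) \<partial>M) \<le> ennreal (exp (K * (h * sqrt h)))"
proof -
  define c where "c = (real N)\<^sup>2 * (M1 + M2 + M1\<^sup>2 + M2 + L)"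
  have c0: "0 \<le> c" unfolding c_def using M by (intro mult_nonneg_nonneg add_nonneg_nonneg) auto
  \<comment> \<open>The choice gives sqrt h <= 1/(16 (c + 1)), hence the smallness 2 c sqrt h <= 1/8
    demanded by \<open>exp_third_order\<close>.\<close>
  define h0 where "h0 = min 1 ((1 / (16 * (c + 1)))\<^sup>2)"
  define K where "K = 3072 * (c + 2 * c\<^sup>2 + 8 * c ^ 3) * (exp (1 / 4) * sqrt 2 ^ card (idx N))"
  have h0: "0 < h0" using c0 by (simp add: h0_def)
  have K0: "0 \<le> K" unfolding K_def using c0 by (intro mult_nonneg_nonneg add_nonneg_nonneg) auto
  have main: "(\<integral>\<^sup>+\<omega>. ennreal (exp ((real N)\<^sup>2 * (\<integral>r. f r \<partial>spec N d (\<lambda>p. x p + Z p \<omega>)) - (real N)\<^sup>2 * (\<integral>r. f r \<partial>spec N d x)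
        - h * drift N f1 f2 (spec N d x))) \<partial>M) \<le> ennreal (exp (K * (h * sqrt h)))"
    if f: "\<And>x. (f has_real_derivative f1 x) (at x)" and f1: "\<And>x. (f1 has_real_derivative f2 x) (at x)"
      and M1: "\<And>x. \<bar>f1 x\<bar> \<le> M1" and M2: "\<And>x. \<bar>f2 x\<bar> \<le> M2" and L: "\<And>x y. \<bar>f2 x - f2 y\<bar> \<le> L * \<bar>x - y\<bar>"
      and hh: "h \<le> h0" and GF: "gaussian_family M (idx N) Z h"
    for f f1 f2 d x h and M :: "'w measure" and Z
  proof -
    interpret gaussian_family M "idx N" Z h by fact
    have h1: "h \<le> 1" using hh by (simp add: h0_def)
    have small: "2 * c * sqrt h \<le> 1 / 8"
    proof -
      have "sqrt h \<le> sqrt ((1 / (16 * (c + 1)))\<^sup>2)" using hh by (intro real_sqrt_le_mono) (simp add: h0_def)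
      then have "sqrt h \<le> 1 / (16 * (c + 1))" using c0 by simp
      then have "2 * c * sqrt h \<le> 2 * c * (1 / (16 * (c + 1)))" using c0 by (intro mult_left_mono) auto
      also have "\<dots> \<le> 1 / 8" using c0 by (simp add: divide_simps)
      finally show ?thesis .
    qed
    have f2c: "continuous_on UNIV f2" using lipschitz_continuous_borel[OF L] by blast
    obtain lam u where E: "eigenbasis N (shifted_hm N d x) lam u" using hermitian_eigenbasis[OF shifted_hm_hermitian] by blast
    define G where "G = taylor_kernel f2"
    define cf where "cf i j p = ip N (u i) (mv N (hm_unit N p) (u j))" for i j p
    define Lc where "Lc p = real N * (\<Sum>i<N. f1 (lam i) * Re (cf i i p))" for p
    define l where "l \<omega> = (\<Sum>p\<in>idx N. Lc p * Z p \<omega>)" for \<omega>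
    define Q where "Q \<omega> = real N * (\<Sum>i<N. \<Sum>j<N. (cmod (\<Sum>p\<in>idx N. of_real (Z p \<omega>) * cf i j p))\<^sup>2 * G (lam i) (lam j))" for \<omega>
    define V where "V = drift N f1 f2 (spec N d x)"
    define \<rho> where "\<rho> \<omega> = 1 + (\<Sum>p\<in>idx N. (Z p \<omega>)\<^sup>2) / h" for \<omega>
    define D where "D \<omega> = (real N)\<^sup>2 * (\<integral>r. f r \<partial>spec N d (\<lambda>p. x p + Z p \<omega>)) - (real N)\<^sup>2 * (\<integral>r. f r \<partial>spec N d x)" for \<omega>
    have Veq: "V = (\<Sum>i<N. \<Sum>j<N. G (lam i) (lam j)) + real N * (\<Sum>i<N. (f1 (lam i))\<^sup>2) / 2"
      unfolding V_def G_def by (rule drift_eigenbasis[OF N E f f1 f2c M2])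
    note orth = eigenbasis_orthonormal[OF E]
    have cf_real: "of_real (Re (cf i i p)) = cf i i p" for i p
    proof -
      have "ip N (u i) (mv N (hm_unit N p) (u i)) = ip N (mv N (hm_unit N p) (u i)) (u i)"
        unfolding hm_unit_def by (rule ip_mv_hermitian[OF hm_hermitian])
      then have "cnj (cf i i p) = cf i i p" unfolding cf_def ip_cnj by simp
      then show ?thesis by (simp add: complex_eq_iff)
    qed
    \<comment> \<open>Up to the factor \<open>h\<close> this is the variance of the linear form
      \<open>l\<close>; orthonormality of the eigenbasis leaves only i = j in the covariance
      formula.\<close>
    have Lc2: "(\<Sum>p\<in>idx N. (Lc p)\<^sup>2) = real N * (\<Sum>i<N. (f1 (lam i))\<^sup>2)"
    proof -
      have Lc: "complex_of_real (Lc p) = of_nat N * (\<Sum>i<N. of_real (f1 (lam i)) * cf i i p)" for p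
        unfolding Lc_def by (simp add: cf_real)
      have "complex_of_real (\<Sum>p\<in>idx N. (Lc p)\<^sup>2) = (\<Sum>p\<in>idx N. \<Sum>i<N. \<Sum>j<N. (of_nat N)\<^sup>2 * (of_real (f1 (lam i)) * of_real (f1 (lam j))) * (cf i i p * cf j j p))"
        unfolding of_real_sum
      proof (intro sum.cong refl)
        fix p
        have "complex_of_real ((Lc p)\<^sup>2) = (of_nat N)\<^sup>2 * ((\<Sum>i<N. of_real (f1 (lam i)) * cf i i p) * (\<Sum>j<N. of_real (f1 (lam j)) * cf j j p))"
          unfolding of_real_power Lc by (simp only: power2_eq_square mult_ac)
        also have "\<dots> = (\<Sum>i<N. \<Sum>j<N. (of_nat N)\<^sup>2 * ((of_real (f1 (lam i)) * cf i i p) * (of_real (f1 (lam j)) * cf j j p)))"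
          by (subst sum_product) (simp only: sum_distrib_left)
        also have "\<dots> = (\<Sum>i<N. \<Sum>j<N. (of_nat N)\<^sup>2 * (of_real (f1 (lam i)) * of_real (f1 (lam j))) * (cf i i p * cf j j p))"
          by (intro sum.cong refl) (simp only: mult_ac)
        finally show "complex_of_real ((Lc p)\<^sup>2)
          = (\<Sum>i<N. \<Sum>j<N. (of_nat N)\<^sup>2 * (of_real (f1 (lam i)) * of_real (f1 (lam j))) * (cf i i p * cf j j p))" .
      qed
      also have "\<dots> = (\<Sum>i<N. \<Sum>j<N. \<Sum>p\<in>idx N. (of_nat N)\<^sup>2 * (of_real (f1 (lam i)) * of_real (f1 (lam j))) * (cf i i p * cf j j p))"
        by (subst sum.swap, rule sum.cong[OF refl], rule sum.swap)
      also have "\<dots> = (\<Sum>i<N. \<Sum>j<N. (of_nat N)\<^sup>2 * (of_real (f1 (lam i)) * of_real (f1 (lam j))) * (ip N (u i) (u j) * ip N (u j) (u i) / of_nat N))"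
        unfolding sum_distrib_left[symmetric] cf_def hm_unit_ip_covariance[OF N] ..
      also have "\<dots> = (\<Sum>i<N. \<Sum>j<N. if i = j then of_nat N * (of_real (f1 (lam i)))\<^sup>2 else 0)"
        using N by (intro sum.cong refl) (auto simp: orth power2_eq_square)
      also have "\<dots> = complex_of_real (real N * (\<Sum>i<N. (f1 (lam i))\<^sup>2))" by (simp add: sum_distrib_left)
      finally show ?thesis by (simp only: of_real_eq_iff)
    qed
    have cf2: "(\<Sum>p\<in>idx N. (cmod (cf i j p))\<^sup>2) = 1 / real N" if "i < N" "j < N" for i j
      unfolding cf_def using that by (intro hm_unit_norm_sum[OF N]) (auto simp: orth)
    have IQ: "integrable M Q" unfolding Q_def
      by (intro integrable_mult_right Bochner_Integration.integrable_sum integrable_mult_left complex_linear_form_square)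
    have EQ: "expectation Q = h * (\<Sum>i<N. \<Sum>j<N. G (lam i) (lam j))"
    proof -
      have "expectation Q = real N * (\<Sum>i<N. \<Sum>j<N. expectation (\<lambda>\<omega>. (cmod (\<Sum>p\<in>idx N. of_real (Z p \<omega>) * cf i j p))\<^sup>2) * G (lam i) (lam j))"
        unfolding Q_def by (simp add: Bochner_Integration.integral_sum complex_linear_form_square(1) Bochner_Integration.integrable_sum)
      also have "\<dots> = real N * (\<Sum>i<N. \<Sum>j<N. h * (1 / real N) * G (lam i) (lam j))"
        unfolding complex_linear_form_square by (simp add: cf2)
      finally show ?thesis
        using N by (simp add: sum_distrib_left)
    qed
    have El: "integrable M l" "expectation l = 0" "integrable M (\<lambda>\<omega>. (l \<omega>)\<^sup>2)" "expectation (\<lambda>\<omega>. (l \<omega>)\<^sup>2) = h * (real N * (\<Sum>i<N. (f1 (lam i))\<^sup>2))"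
      unfolding l_def Lc2[symmetric] using linear_form linear_form_square by auto
    have Erho: "(\<integral>\<^sup>+\<omega>. ennreal (exp (\<rho> \<omega> / 4)) \<partial>M) = ennreal (exp (1 / 4) * sqrt 2 ^ card (idx N))"
    proof -
      have eq: "ennreal (exp (\<rho> \<omega> / 4)) = ennreal (exp (1 / 4)) * ennreal (exp ((\<Sum>p\<in>idx N. (Z p \<omega>)\<^sup>2) / (4 * h)))" for \<omega>
        by (simp add: \<rho>_def ennreal_mult[symmetric] exp_add[symmetric] add_divide_distrib mult.commute)
      show ?thesis unfolding eq
        by (subst nn_integral_cmult) (auto simp: exp_sum_squares ennreal_mult)
    qed
    have rho_m: "(\<lambda>\<omega>. exp (\<rho> \<omega> / 4)) \<in> borel_measurable M" unfolding \<rho>_def by measurable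
    have Irho: "integrable M (\<lambda>\<omega>. exp (\<rho> \<omega> / 4))"
      by (rule integrableI_nonneg[OF rho_m]) (auto simp: Erho)
    have Erho': "expectation (\<lambda>\<omega>. exp (\<rho> \<omega> / 4)) = exp (1 / 4) * sqrt 2 ^ card (idx N)"
      by (subst integral_eq_nn_integral[OF rho_m]) (auto simp: Erho)
    define U where "U \<omega> = 1 + l \<omega> + ((Q \<omega> - h * V) + (l \<omega>)\<^sup>2 / 2) + 3072 * (c + 2 * c\<^sup>2 + 8 * c ^ 3) * (h * sqrt h) * exp (\<rho> \<omega> / 4)" for \<omega>
    have bound: "exp (D \<omega> - h * V) \<le> U \<omega>" for \<omega>
      unfolding U_def
    proof (rule one_step_pointwise[OF N M h h1 c_def small f f1 M1 M2 L E V_def \<rho>_def D_def])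
      have ipA: "ip N (u i) (mv N (hm N (\<lambda>p. Z p \<omega>)) (u j)) = (\<Sum>p\<in>idx N. of_real (Z p \<omega>) * cf i j p)" for i j
        unfolding cf_def by (rule ip_hm_expand)
      show "l \<omega> = real N * (\<Sum>i<N. f1 (lam i) * Re (ip N (u i) (mv N (hm N (\<lambda>p. Z p \<omega>)) (u i))))"
      proof -
        have "l \<omega> = (\<Sum>p\<in>idx N. \<Sum>i<N. real N * (f1 (lam i) * (Z p \<omega> * Re (cf i i p))))"
          unfolding l_def Lc_def by (simp add: sum_distrib_left sum_distrib_right mult_ac)
        also have "\<dots> = (\<Sum>i<N. \<Sum>p\<in>idx N. real N * (f1 (lam i) * (Z p \<omega> * Re (cf i i p))))" by (rule sum.swap)
        also have "\<dots> = real N * (\<Sum>i<N. f1 (lam i) * Re (ip N (u i) (mv N (hm N (\<lambda>p. Z p \<omega>)) (u i))))"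
          unfolding ipA by (simp add: sum_distrib_left)
        finally show ?thesis .
      qed
      show "Q \<omega> = real N * (\<Sum>i<N. \<Sum>j<N. (cmod (ip N (u i) (mv N (hm N (\<lambda>p. Z p \<omega>)) (u j))))\<^sup>2 * taylor_kernel f2 (lam i) (lam j))"
        unfolding Q_def ipA G_def ..
    qed
    have IU: "integrable M U"
      unfolding U_def using El IQ Irho
      by (intro Bochner_Integration.integrable_add Bochner_Integration.integrable_diff integrable_mult_right integrable_divide integrable_const) auto
    \<comment> \<open>The drift cancels exactly: E Q contributes h times the double sum of kernels
      and E l^2 / 2 contributes h N / 2 times the sum of the squares of f1, which together are h V.
      Only the remainder of order h^(3/2) survives.\<close>
    have EU: "expectation U = 1 + K * (h * sqrt h)"
    proof -
      have "expectation U = 1 + expectation l + ((expectation Q - h * V) + expectation (\<lambda>\<omega>. (l \<omega>)\<^sup>2) / 2)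
          + 3072 * (c + 2 * c\<^sup>2 + 8 * c ^ 3) * (h * sqrt h) * expectation (\<lambda>\<omega>. exp (\<rho> \<omega> / 4))"
        unfolding U_def using El IQ Irho prob_space by simp
      also have "\<dots> = 1 + 3072 * (c + 2 * c\<^sup>2 + 8 * c ^ 3) * (h * sqrt h) * (exp (1 / 4) * sqrt 2 ^ card (idx N))"
        unfolding El EQ Erho' Veq by (simp add: algebra_simps)
      also have "\<dots> = 1 + K * (h * sqrt h)" unfolding K_def by (simp only: mult_ac)
      finally show ?thesis .
    qed
    have "(\<integral>\<^sup>+\<omega>. ennreal (exp (D \<omega> - h * V)) \<partial>M) \<le> (\<integral>\<^sup>+\<omega>. ennreal (U \<omega>) \<partial>M)"
      by (intro nn_integral_mono ennreal_leI bound)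
    also have "\<dots> = ennreal (expectation U)"
      by (intro nn_integral_eq_integral IU AE_I2 order_trans[OF exp_ge_zero bound])
    also have "\<dots> \<le> ennreal (exp (K * (h * sqrt h)))"
      unfolding EU by (intro ennreal_leI exp_ge_add_one_self)
    finally show ?thesis unfolding D_def V_def .
  qed
  show ?thesis
    by (rule that[OF K0 h0 main])
qed

section \<open>Continuity and measurability in the coordinates\<close>

lemma spec_cong:
  assumes "\<And>p. p \<in> idx N \<Longrightarrow> x p = y p"
  shows "spec N d x = spec N d y"
proof -
  have "mat N N (\<lambda>(k, l). shifted_hm N d x k l) = mat N N (\<lambda>(k, l). shifted_hm N d y k l)"
    using assms by (intro eq_matI) (auto simp: shifted_hm_def hm_def idx_def)
  then show ?thesis by (simp add: spec_def)
qed

lemma spec_weak_conv: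
  assumes N: "N > 0" and lim: "\<And>p. p \<in> idx N \<Longrightarrow> (\<lambda>n. xs n p) \<longlonglongrightarrow> x p"
  shows "weak_conv_m (\<lambda>n. spec N d (xs n)) (spec N d x)"
proof (rule bl_dist_imp_weak_conv[OF real_distribution_spec real_distribution_spec])
  have "(\<lambda>n. sqrt (\<Sum>p\<in>idx N. (xs n p - x p)\<^sup>2) / real N) \<longlonglongrightarrow> sqrt (\<Sum>p\<in>idx N. (x p - x p)\<^sup>2) / real N"
    by (intro tendsto_intros lim) (use N in auto)
  then have l: "(\<lambda>n. sqrt (\<Sum>p\<in>idx N. (xs n p - x p)\<^sup>2) / real N) \<longlonglongrightarrow> 0" by simp
  show "(\<lambda>n. bl_dist (spec N d (xs n)) (spec N d x)) \<longlonglongrightarrow> 0"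
    by (rule real_tendsto_sandwich[OF _ _ tendsto_const l])
       (intro always_eventually allI bl_dist_nonneg real_distribution_spec spec_bl_dist N)+
qed

lemma function_tendsto_component: "xs \<longlonglongrightarrow> x \<Longrightarrow> (\<lambda>n. xs n p) \<longlonglongrightarrow> x p" for x :: "nat \<times> nat \<Rightarrow> real"
  by (rule continuous_on_tendsto_compose[OF continuous_on_product_coordinates[of p]]) auto

text \<open>Measurability comes from continuity on the space of all coordinate functions with the
  product topology, since the spectral measure depends weakly continuously on finitely many
  coordinates.\<close>

lemma spec_integral_measurable:
  assumes N: "N > 0" and g: "cbdd g" and t: "t \<in> {0..1}"
  shows "(\<lambda>x. \<integral>r. g r t \<partial>spec N d x) \<in> borel_measurable borel"
proof (intro borel_measurable_continuous_onI continuous_on_sequentially[THEN iffD2] allI ballI impI, elim conjE)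
  fix xs :: "nat \<Rightarrow> nat \<times> nat \<Rightarrow> real" and x assume "xs \<longlonglongrightarrow> x"
  then show "((\<lambda>x. \<integral>r. g r t \<partial>spec N d x) \<circ> xs) \<longlonglongrightarrow> (\<integral>r. g r t \<partial>spec N d x)"
    unfolding comp_def
    by (intro cbdd_tendsto_integral[OF g real_distribution_spec real_distribution_spec _ tendsto_const t t] spec_weak_conv N
        function_tendsto_component)
qed

lemma spec_drift_measurable:
  assumes N: "N > 0" and g: "cbdd g" "cbdd g'" and t: "t \<in> {0..1}"
    and d: "\<And>x t. t \<in> {0..1} \<Longrightarrow> ((\<lambda>y. g y t) has_real_derivative g' x t) (at x)"
  shows "(\<lambda>x. drift N (\<lambda>r. g r t) (\<lambda>r. g' r t) (spec N d x)) \<in> borel_measurable borel"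
proof (intro borel_measurable_continuous_onI continuous_on_sequentially[THEN iffD2] allI ballI impI, elim conjE)
  fix xs :: "nat \<Rightarrow> nat \<times> nat \<Rightarrow> real" and x assume x: "xs \<longlonglongrightarrow> x"
  have w: "weak_conv_m (\<lambda>n. spec N d (xs n)) (spec N d x)"
    by (intro spec_weak_conv N function_tendsto_component x)
  show "((\<lambda>x. drift N (\<lambda>r. g r t) (\<lambda>r. g' r t) (spec N d x)) \<circ> xs) \<longlonglongrightarrow> drift N (\<lambda>r. g r t) (\<lambda>r. g' r t) (spec N d x)"
    unfolding comp_def drift_def
    by (intro tendsto_mult tendsto_add tendsto_const cbdd_tendsto_integral[OF cbdd_power2[OF g(1)] real_distribution_spec real_distribution_spec w tendsto_const t t]
        divided_diff_tendsto_integral[OF g d real_distribution_spec real_distribution_spec w tendsto_const t t])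
qed

lemma sum_function_measurable:
  fixes f g :: "'a \<Rightarrow> nat \<times> nat \<Rightarrow> real"
  assumes "f \<in> borel_measurable M" "g \<in> borel_measurable M"
  shows "(\<lambda>a p. f a p + g a p) \<in> borel_measurable M"
proof (rule measurable_coordinatewise_then_product)
  have c: "(\<lambda>x::nat \<times> nat \<Rightarrow> real. x p) \<in> borel_measurable borel" for p
    by (intro borel_measurable_continuous_onI continuous_on_product_coordinates)
  show "(\<lambda>a. f a p + g a p) \<in> borel_measurable M" for p
    using measurable_compose[OF assms(1) c] measurable_compose[OF assms(2) c] by simp
qed

section \<open>Increments of the driving Brownian motions\<close>

locale hermitian_BM = prob_space M for M :: "'w measure" +
  fixes N :: nat and B :: "nat \<times> nat \<Rightarrow> real \<Rightarrow> 'w \<Rightarrow> real"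
  assumes N: "N > 0" and BM: "indep_std_BMs M (idx N) B"
begin

text \<open>Coordinates outside \<open>idx N\<close> are set to 0, since nothing is known of
  \<open>B\<close> there; this makes \<open>pos t\<close> measurable into the whole function
  space.\<close>

definition pos :: "real \<Rightarrow> 'w \<Rightarrow> nat \<times> nat \<Rightarrow> real" where
  "pos t \<omega> p = (if p \<in> idx N then B p t \<omega> else 0)"

lemma B_measurable: "p \<in> idx N \<Longrightarrow> t \<in> {0..1} \<Longrightarrow> B p t \<in> borel_measurable M"
  using BM unfolding indep_std_BMs_def by blast

lemma B_0: "p \<in> idx N \<Longrightarrow> \<omega> \<in> space M \<Longrightarrow> B p 0 \<omega> = 0"
  using BM unfolding indep_std_BMs_def by blast

lemma B_continuous: "p \<in> idx N \<Longrightarrow> \<omega> \<in> space M \<Longrightarrow> continuous_on {0..1} (\<lambda>t. B p t \<omega>)"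
  using BM unfolding indep_std_BMs_def by blast

lemma pos_measurable:
  assumes "t \<in> {0..1}"
  shows "pos t \<in> borel_measurable M"
proof (rule measurable_coordinatewise_then_product)
  show "(\<lambda>\<omega>. pos t \<omega> p) \<in> borel_measurable M" for p
    using B_measurable[of p, OF _ assms] by (cases "p \<in> idx N") (simp_all add: pos_def)
qed

lemma spectral_process_pos: "spectral_process N d B \<omega> t = spec N d (pos t \<omega>)"
  unfolding spectral_process_eq by (rule spec_cong) (simp add: pos_def)

lemma pos_continuous:
  assumes "\<omega> \<in> space M" "us \<longlonglongrightarrow> u" "\<And>n. us n \<in> {0..1}" "u \<in> {0..1}"
  shows "(\<lambda>n. pos (us n) \<omega> p) \<longlonglongrightarrow> pos u \<omega> p"
proof (cases "p \<in> idx N")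
  case True
  then show ?thesis unfolding pos_def
    using continuous_on_tendsto_compose[OF B_continuous[OF True assms(1)] assms(2,4)] assms(3) by auto
qed (simp add: pos_def)

lemma spectral_process_path:
  assumes \<omega>: "\<omega> \<in> space M"
  shows "spectral_process N d B \<omega> \<in> path_space"
  unfolding path_space_def
proof (intro CollectI conjI ballI allI impI)
  show "real_distribution (spectral_process N d B \<omega> t)" for t unfolding spectral_process_pos by (rule real_distribution_spec)
next
  fix t e :: real assume t: "t \<in> {0..1}" and e: "e > 0"
  define F where "F s = sqrt (\<Sum>p\<in>idx N. (pos s \<omega> p - pos t \<omega> p)\<^sup>2) / real N" for s
  have "continuous_on {0..1} F" unfolding F_def
    using N by (intro continuous_intros) (auto simp: pos_def intro!: B_continuous \<omega>)
  moreover have "F t = 0" by (simp add: F_def)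
  ultimately obtain \<delta> where "\<delta> > 0" "\<And>s. s \<in> {0..1} \<Longrightarrow> \<bar>s - t\<bar> < \<delta> \<Longrightarrow> \<bar>F s\<bar> < e"
    using t e unfolding continuous_on_iff dist_real_def by (metis diff_zero)
  moreover have "bl_dist (spectral_process N d B \<omega> s) (spectral_process N d B \<omega> t) \<le> F s" for s
    unfolding spectral_process_pos F_def by (rule spec_bl_dist[OF N])
  ultimately show "\<exists>\<delta>>0. \<forall>s\<in>{0..1}. \<bar>s - t\<bar> < \<delta> \<longrightarrow> bl_dist (spectral_process N d B \<omega> s) (spectral_process N d B \<omega> t) < e"
    by (intro exI[of _ \<delta>]) (meson abs_ge_self le_less_trans)
qed

definition inc :: "real \<Rightarrow> real \<Rightarrow> 'w \<Rightarrow> nat \<times> nat \<Rightarrow> real" where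
  "inc s t \<omega> p = (if p \<in> idx N then B p t \<omega> - B p s \<omega> else 0)"

context
  fixes n :: nat and ts :: "nat \<Rightarrow> real"
  assumes ts0: "0 \<le> ts 0" and tsn: "ts n \<le> 1" and ts_less: "\<And>j. j < n \<Longrightarrow> ts j < ts (Suc j)"
begin

lemma ts_mono: "i \<le> j \<Longrightarrow> j \<le> n \<Longrightarrow> ts i \<le> ts j"
proof (induction j)
  case (Suc j)
  then show ?case using ts_less[of j] by (cases "i = Suc j") auto
qed simp

lemma ts01: "j \<le> n \<Longrightarrow> ts j \<in> {0..1}"
  using ts_mono[of 0 j] ts_mono[of j n] ts0 tsn by auto

lemma increments_indep: "indep_vars (\<lambda>_. borel) (\<lambda>(p, j) \<omega>. B p (ts (Suc j)) \<omega> - B p (ts j) \<omega>) (idx N \<times> {..<n})"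
  using BM ts0 tsn ts_less unfolding indep_std_BMs_def by blast

lemma increments_gaussian:
  assumes j: "j < n"
  shows "gaussian_family M (idx N) (\<lambda>p \<omega>. inc (ts j) (ts (Suc j)) \<omega> p) (ts (Suc j) - ts j)"
proof
  show "finite (idx N)" by (rule finite_idx)
  show "0 < ts (Suc j) - ts j" using ts_less[OF j] by simp
  let ?X = "\<lambda>(p, j) \<omega>. B p (ts (Suc j)) \<omega> - B p (ts j) \<omega>"
  \<comment> \<open>The family is indexed by pairs (p, j); grouping it into the singletons {(p, j)}
    with \<open>j\<close> fixed reindexes it by p alone.\<close>
  have "indep_vars (\<lambda>p. PiM {(p, j)} (\<lambda>_. borel)) (\<lambda>p \<omega>. restrict (\<lambda>i. ?X i \<omega>) {(p, j)}) (idx N)"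
    using j by (intro indep_vars_restrict[OF increments_indep]) (auto simp: disjoint_family_on_def)
  then have "indep_vars (\<lambda>_. borel) (\<lambda>p \<omega>. (restrict (\<lambda>i. ?X i \<omega>) {(p, j)}) (p, j)) (idx N)"
    by (rule indep_vars_compose2) (rule measurable_component_singleton, simp)
  then show "indep_vars (\<lambda>_. borel) (\<lambda>p \<omega>. inc (ts j) (ts (Suc j)) \<omega> p) (idx N)"
    by (rule indep_vars_cong[THEN iffD1, rotated 3]) (auto simp: inc_def)
  show "distributed M lborel (\<lambda>\<omega>. inc (ts j) (ts (Suc j)) \<omega> p) (normal_density 0 (sqrt (ts (Suc j) - ts j)))"
    if p: "p \<in> idx N" for p
    using BM ts0 tsn ts_less p j unfolding indep_std_BMs_def inc_def by simp blast
qed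

lemma pos_as_sum:
  assumes "ts 0 = 0" "\<omega> \<in> space M" "j \<le> n"
  shows "pos (ts j) \<omega> p = (if p \<in> idx N then \<Sum>i<j. B p (ts (Suc i)) \<omega> - B p (ts i) \<omega> else 0)"
  using assms sum_lessThan_telescope[of "\<lambda>i. B p (ts i) \<omega>" j] by (simp add: pos_def B_0)

text \<open>The Markov property in integrated form, by induction on the number of steps. Since
  \<open>ts 0 = 0\<close>, the position at step m is a function of the earlier increments and hence
  independent of increment m; Fubini freezes the position, and there the bound
  \<open>\<Phi>c\<close>, uniform in x, applies.\<close>

lemma multi_step_product:
  fixes \<Phi> :: "nat \<Rightarrow> (nat \<times> nat \<Rightarrow> real) \<Rightarrow> (nat \<times> nat \<Rightarrow> real) \<Rightarrow> ennreal"
  assumes t0: "ts 0 = 0"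
    and \<Phi>m: "\<And>j. j < n \<Longrightarrow> (\<lambda>(x, z). \<Phi> j x z) \<in> borel_measurable (borel \<Otimes>\<^sub>M borel)"
    and \<Phi>c: "\<And>j x. j < n \<Longrightarrow> (\<integral>\<^sup>+\<omega>. \<Phi> j x (inc (ts j) (ts (Suc j)) \<omega>) \<partial>M) \<le> c j"
    and m: "m \<le> n"
  shows "(\<integral>\<^sup>+\<omega>. (\<Prod>j<m. \<Phi> j (pos (ts j) \<omega>) (inc (ts j) (ts (Suc j)) \<omega>)) \<partial>M) \<le> (\<Prod>j<m. c j)"
  using m
proof (induction m)
  case 0
  then show ?case by (simp add: emeasure_space_1)
next
  case (Suc m)
  then have mn: "m < n" by simp
  define X where "X = (\<lambda>(p, j) \<omega>. B p (ts (Suc j)) \<omega> - B p (ts j) \<omega>)"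
  define I1 where "I1 = idx N \<times> {..<m}"
  define I2 where "I2 = idx N \<times> {m}"
  define S1 where "S1 = PiM I1 (\<lambda>_. borel :: real measure)"
  define S2 where "S2 = PiM I2 (\<lambda>_. borel :: real measure)"
  \<comment> \<open>\<open>R\<close> records all increments before step m and \<open>S\<close> those
    of step m; \<open>posr\<close> and \<open>incr\<close> below read positions and increments off
    such records.\<close>
  define R where "R \<omega> = restrict (\<lambda>i. X i \<omega>) I1" for \<omega>
  define S where "S \<omega> = restrict (\<lambda>i. X i \<omega>) I2" for \<omega>
  have iv: "indep_var S1 R S2 S"
    unfolding S1_def S2_def R_def S_def X_def I1_def I2_def
    by (rule indep_var_restrict[OF increments_indep]) (use mn in auto)
  define posr where "posr j r p = (if p \<in> idx N then \<Sum>i<j. r (p, i) else 0)" for j and r :: "(nat \<times> nat) \<times> nat \<Rightarrow> real" and p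
  define incr where "incr j r p = (if p \<in> idx N then r (p, j) else 0)" for j and r :: "(nat \<times> nat) \<times> nat \<Rightarrow> real" and p
  have posr_m: "posr j \<in> borel_measurable S1" if "j \<le> m" for j
  proof (rule measurable_coordinatewise_then_product)
    fix p
    have "(\<lambda>r. r (p, i)) \<in> borel_measurable S1" if "p \<in> idx N" "i < j" for i
      unfolding S1_def using that \<open>j \<le> m\<close> by (intro measurable_component_singleton) (auto simp: I1_def)
    then show "(\<lambda>r. posr j r p) \<in> borel_measurable S1" unfolding posr_def by (cases "p \<in> idx N") auto
  qed
  have incr_m1: "incr j \<in> borel_measurable S1" if "j < m" for j
  proof (rule measurable_coordinatewise_then_product)
    fix p
    have "(\<lambda>r. r (p, j)) \<in> borel_measurable S1" if "p \<in> idx N"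
      unfolding S1_def using that \<open>j < m\<close> by (intro measurable_component_singleton) (auto simp: I1_def)
    then show "(\<lambda>r. incr j r p) \<in> borel_measurable S1" unfolding incr_def by (cases "p \<in> idx N") auto
  qed
  have incr_m2: "incr m \<in> borel_measurable S2"
  proof (rule measurable_coordinatewise_then_product)
    fix p
    have "(\<lambda>r. r (p, m)) \<in> borel_measurable S2" if "p \<in> idx N"
      unfolding S2_def using that by (intro measurable_component_singleton) (auto simp: I2_def)
    then show "(\<lambda>r. incr m r p) \<in> borel_measurable S2" unfolding incr_def by (cases "p \<in> idx N") auto
  qed
  define F where "F r = (\<Prod>j<m. \<Phi> j (posr j r) (incr j r))" for r
  have Fm: "F \<in> borel_measurable S1"
    unfolding F_def
  proof (rule borel_measurable_prod_ennreal)
    fix j assume j: "j \<in> {..<m}"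
    have "(\<lambda>r. (posr j r, incr j r)) \<in> measurable S1 (borel \<Otimes>\<^sub>M borel)"
      using posr_m[of j] incr_m1[of j] j by (intro measurable_Pair) auto
    from measurable_compose[OF this \<Phi>m[of j]] show "(\<lambda>r. \<Phi> j (posr j r) (incr j r)) \<in> borel_measurable S1"
      using j mn by simp
  qed
  have Hm: "(\<lambda>(r, s). F r * \<Phi> m (posr m r) (incr m s)) \<in> borel_measurable (S1 \<Otimes>\<^sub>M S2)"
  proof -
    have "(\<lambda>z. (posr m (fst z), incr m (snd z))) \<in> measurable (S1 \<Otimes>\<^sub>M S2) (borel \<Otimes>\<^sub>M borel)"
      by (intro measurable_Pair measurable_compose[OF measurable_fst posr_m] measurable_compose[OF measurable_snd incr_m2]) simp
    from measurable_compose[OF this \<Phi>m[OF mn]]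
    have "(\<lambda>z. \<Phi> m (posr m (fst z)) (incr m (snd z))) \<in> borel_measurable (S1 \<Otimes>\<^sub>M S2)" by simp
    moreover have "(\<lambda>z. F (fst z)) \<in> borel_measurable (S1 \<Otimes>\<^sub>M S2)" by (rule measurable_compose[OF measurable_fst Fm])
    ultimately show ?thesis unfolding case_prod_unfold by (rule borel_measurable_times_ennreal[rotated])
  qed
  have Hm2: "(\<lambda>s. \<Phi> m (posr m r) (incr m s)) \<in> borel_measurable S2" if "r \<in> space S1" for r
  proof -
    have "(\<lambda>s. (posr m r, incr m s)) \<in> measurable S2 (borel \<Otimes>\<^sub>M borel)"
      by (intro measurable_Pair incr_m2) simp
    from measurable_compose[OF this \<Phi>m[OF mn]] show ?thesis by simp
  qed
  have RS: "R \<in> measurable M S1" "S \<in> measurable M S2"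
    and D: "distr M S1 R \<Otimes>\<^sub>M distr M S2 S = distr M (S1 \<Otimes>\<^sub>M S2) (\<lambda>\<omega>. (R \<omega>, S \<omega>))"
    using iv unfolding indep_var_distribution_eq by auto
  interpret P2: prob_space "distr M S2 S" by (rule prob_space_distr[OF RS(2)])
  have FR: "F (R \<omega>) = (\<Prod>j<m. \<Phi> j (pos (ts j) \<omega>) (inc (ts j) (ts (Suc j)) \<omega>))" if "\<omega> \<in> space M" for \<omega>
    unfolding F_def
  proof (intro prod.cong refl)
    fix j assume j: "j \<in> {..<m}"
    have "posr j (R \<omega>) = pos (ts j) \<omega>"
      using j mn that by (intro ext) (auto simp: posr_def R_def X_def I1_def pos_as_sum[OF t0] intro!: sum.cong)
    moreover have "incr j (R \<omega>) = inc (ts j) (ts (Suc j)) \<omega>"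
      using j by (intro ext) (auto simp: incr_def R_def X_def I1_def inc_def)
    ultimately show "\<Phi> j (posr j (R \<omega>)) (incr j (R \<omega>)) = \<Phi> j (pos (ts j) \<omega>) (inc (ts j) (ts (Suc j)) \<omega>)" by simp
  qed
  have posm: "posr m (R \<omega>) = pos (ts m) \<omega>" if "\<omega> \<in> space M" for \<omega>
    using mn that by (intro ext) (auto simp: posr_def R_def X_def I1_def pos_as_sum[OF t0] intro!: sum.cong)
  have incm: "incr m (S \<omega>) = inc (ts m) (ts (Suc m)) \<omega>" for \<omega>
    by (intro ext) (auto simp: incr_def S_def X_def I2_def inc_def)
  have "(\<integral>\<^sup>+\<omega>. (\<Prod>j<Suc m. \<Phi> j (pos (ts j) \<omega>) (inc (ts j) (ts (Suc j)) \<omega>)) \<partial>M)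
      = (\<integral>\<^sup>+\<omega>. (\<lambda>(r, s). F r * \<Phi> m (posr m r) (incr m s)) (R \<omega>, S \<omega>) \<partial>M)"
    by (intro nn_integral_cong) (simp add: FR posm incm)
  also have "\<dots> = (\<integral>\<^sup>+z. (\<lambda>(r, s). F r * \<Phi> m (posr m r) (incr m s)) z \<partial>distr M (S1 \<Otimes>\<^sub>M S2) (\<lambda>\<omega>. (R \<omega>, S \<omega>)))"
    by (rule nn_integral_distr[symmetric, OF measurable_Pair[OF RS]]) (use Hm in simp)
  also have "\<dots> = (\<integral>\<^sup>+r. \<integral>\<^sup>+s. F r * \<Phi> m (posr m r) (incr m s) \<partial>distr M S2 S \<partial>distr M S1 R)"
  proof -
    have "(\<lambda>(r, s). F r * \<Phi> m (posr m r) (incr m s)) \<in> borel_measurable (distr M S1 R \<Otimes>\<^sub>M distr M S2 S)"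
      using Hm by (subst measurable_cong_sets[OF sets_pair_measure_cong[OF sets_distr sets_distr] refl])
    from P2.nn_integral_fst[OF this] show ?thesis unfolding D[symmetric] by simp
  qed
  also have "\<dots> \<le> (\<integral>\<^sup>+r. F r * c m \<partial>distr M S1 R)"
  proof (intro nn_integral_mono)
    fix r assume "r \<in> space (distr M S1 R)"
    then have r: "r \<in> space S1" by simp
    have "(\<integral>\<^sup>+s. F r * \<Phi> m (posr m r) (incr m s) \<partial>distr M S2 S) = F r * (\<integral>\<^sup>+s. \<Phi> m (posr m r) (incr m s) \<partial>distr M S2 S)"
      using Hm2[OF r] by (intro nn_integral_cmult) simp
    also have "(\<integral>\<^sup>+s. \<Phi> m (posr m r) (incr m s) \<partial>distr M S2 S) = (\<integral>\<^sup>+\<omega>. \<Phi> m (posr m r) (inc (ts m) (ts (Suc m)) \<omega>) \<partial>M)"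
      using Hm2[OF r] by (subst nn_integral_distr[OF RS(2)]) (simp_all add: incm)
    finally show "(\<integral>\<^sup>+s. F r * \<Phi> m (posr m r) (incr m s) \<partial>distr M S2 S) \<le> F r * c m"
      using mult_left_mono[OF \<Phi>c[OF mn, of "posr m r"], of "F r"] by simp
  qed
  also have "\<dots> = (\<integral>\<^sup>+r. F r \<partial>distr M S1 R) * c m" using Fm by (intro nn_integral_multc) simp
  also have "(\<integral>\<^sup>+r. F r \<partial>distr M S1 R) = (\<integral>\<^sup>+\<omega>. (\<Prod>j<m. \<Phi> j (pos (ts j) \<omega>) (inc (ts j) (ts (Suc j)) \<omega>)) \<partial>M)"
    using Fm by (subst nn_integral_distr[OF RS(1)]) (auto intro!: nn_integral_cong simp: FR)
  also have "\<dots> * c m \<le> (\<Prod>j<m. c j) * c m"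
    using Suc by (intro mult_right_mono) auto
  finally show ?case by simp
qed

end

end

section \<open>The exponential supermartingale bound\<close>

lemma integral_partition:
  fixes g :: "real \<Rightarrow> real"
  assumes p: "\<And>j. j < n \<Longrightarrow> p j \<le> p (Suc j)" and g: "g integrable_on {p 0..p n}"
  shows "(\<Sum>j<n. integral {p j..p (Suc j)} g) = integral {p 0..p n} g"
proof -
  have mono: "p i \<le> p j" if "i \<le> j" "j \<le> n" for i j
    using that
  proof (induction j)
    case (Suc j)
    then show ?case using p[of j] by (cases "i = Suc j") auto
  qed simp
  have "m \<le> n \<Longrightarrow> (\<Sum>j<m. integral {p j..p (Suc j)} g) = integral {p 0..p m} g" for m
  proof (induction m)
    case (Suc m)
    have "g integrable_on {p 0..p (Suc m)}"
      by (rule integrable_on_subinterval[OF g]) (use mono Suc in auto)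
    then have "integral {p 0..p m} g + integral {p m..p (Suc m)} g = integral {p 0..p (Suc m)} g"
      using mono[of 0 m] p[of m] Suc by (intro Henstock_Kurzweil_Integration.integral_combine) auto
    then show ?case using Suc by simp
  qed simp
  then show ?thesis by simp
qed

text \<open>Uniform continuity on the square allows the tag \<open>\<tau> n j\<close> to be replaced
  by the integration variable. Both limits of the discretised functional are instances: a right tag
  for a function of two times, and a left tag for the drift, which depends on the tag alone.\<close>

lemma riemann_diagonal_tendsto:
  fixes \<phi> :: "real \<Rightarrow> real \<Rightarrow> real"
  assumes c: "continuous_on ({0..1} \<times> {0..1}) (\<lambda>(u, v). \<phi> u v)" and ab: "0 \<le> a" "a \<le> b" "b \<le> 1"
    and p: "\<And>n j. p n j = a + real j * ((b - a) / real (Suc n))"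
    and \<tau>: "\<And>n j. j < Suc n \<Longrightarrow> \<tau> n j \<in> {p n j..p n (Suc j)}"
  shows "(\<lambda>n. \<Sum>j<Suc n. integral {p n j..p n (Suc j)} (\<lambda>u. \<phi> u (\<tau> n j))) \<longlonglongrightarrow> integral {a..b} (\<lambda>u. \<phi> u u)"
proof (rule LIMSEQ_I)
  fix e :: real assume e: "e > 0"
  have uc: "uniformly_continuous_on ({0..1} \<times> {0..1}) (\<lambda>(u, v). \<phi> u v)"
    using c by (intro compact_uniformly_continuous compact_Times) auto
  obtain \<delta> where \<delta>: "\<delta> > 0" and \<delta>': "\<And>z z'. z \<in> {0..1} \<times> {0..1} \<Longrightarrow> z' \<in> {0..1} \<times> {0..1} \<Longrightarrow> dist z' z < \<delta> \<Longrightarrow>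
      dist ((\<lambda>(u, v). \<phi> u v) z') ((\<lambda>(u, v). \<phi> u v) z) < e / 2"
    using uc e unfolding uniformly_continuous_on_def by (metis half_gt_zero)
  obtain n0 where n0: "1 / real (Suc n0) < \<delta>" using nat_approx_posE[OF \<delta>] by blast
  have cd: "continuous_on {0..1} (\<lambda>u. \<phi> u u)"
  proof -
    have "continuous_on {0..1} (\<lambda>u. (\<lambda>(u, v). \<phi> u v) (u, u))"
      by (rule continuous_on_compose2[OF c]) (auto intro!: continuous_intros)
    then show ?thesis by simp
  qed
  have cf: "continuous_on {0..1} (\<lambda>u. \<phi> u v)" if "v \<in> {0..1}" for v
  proof -
    have "continuous_on {0..1} (\<lambda>u. (\<lambda>(u, v). \<phi> u v) (u, v))"
      by (rule continuous_on_compose2[OF c]) (use that in \<open>auto intro!: continuous_intros\<close>)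
    then show ?thesis by simp
  qed
  show "\<exists>no. \<forall>n\<ge>no. norm ((\<Sum>j<Suc n. integral {p n j..p n (Suc j)} (\<lambda>u. \<phi> u (\<tau> n j))) - integral {a..b} (\<lambda>u. \<phi> u u)) < e"
  proof (intro exI[of _ n0] allI impI)
    fix n assume n: "n \<ge> n0"
    define h where "h = (b - a) / real (Suc n)"
    have h0: "0 \<le> h" using ab by (simp add: h_def)
    have hn: "h \<le> 1 / real (Suc n)" using ab unfolding h_def by (intro divide_right_mono) auto
    also have "\<dots> \<le> 1 / real (Suc n0)" using n by (intro divide_left_mono) auto
    finally have h\<delta>: "h < \<delta>" using n0 by simp
    have pn: "p n j = a + real j * h" for j by (simp add: p h_def)
    have ps: "p n (Suc j) = p n j + h" for j by (simp add: pn algebra_simps)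
    have pb: "p n (Suc n) = b" using ab by (simp add: pn h_def)
    have p0: "p n 0 = a" by (simp add: pn)
    have p01: "p n j \<in> {a..b}" if "j \<le> Suc n" for j
    proof -
      have "real j * h \<le> real (Suc n) * h" using that h0 by (intro mult_right_mono) auto
      also have "real (Suc n) * h = b - a" by (simp add: h_def)
      finally show ?thesis using h0 by (simp add: pn)
    qed
    have int: "(\<lambda>u. \<phi> u u) integrable_on {x..y}" "(\<lambda>u. \<phi> u v) integrable_on {x..y}" if "{x..y} \<subseteq> {0..1}" "v \<in> {0..1}" for x y v
      using that by (auto intro!: integrable_continuous_real continuous_on_subset[OF cd] continuous_on_subset[OF cf])
    have "integral {a..b} (\<lambda>u. \<phi> u u) = (\<Sum>j<Suc n. integral {p n j..p n (Suc j)} (\<lambda>u. \<phi> u u))"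
    proof -
      have "(\<lambda>u. \<phi> u u) integrable_on {p n 0..p n (Suc n)}" unfolding p0 pb using ab by (intro int[of _ _ 0]) auto
      then show ?thesis
        using integral_partition[of "Suc n" "p n" "\<lambda>u. \<phi> u u"] h0 unfolding p0 pb by (simp add: ps)
    qed
    then have "norm ((\<Sum>j<Suc n. integral {p n j..p n (Suc j)} (\<lambda>u. \<phi> u (\<tau> n j))) - integral {a..b} (\<lambda>u. \<phi> u u))
       = norm (\<Sum>j<Suc n. integral {p n j..p n (Suc j)} (\<lambda>u. \<phi> u (\<tau> n j)) - integral {p n j..p n (Suc j)} (\<lambda>u. \<phi> u u))"
      by (simp only: sum_subtractf)
    also have "\<dots> \<le> (\<Sum>j<Suc n. e / 2 * h)"
    proof (rule order_trans[OF norm_sum], rule sum_mono)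
      fix j assume "j \<in> {..<Suc n}"
      then have j: "j < Suc n" by simp
      have sub: "{p n j..p n (Suc j)} \<subseteq> {a..b}" "{p n j..p n (Suc j)} \<subseteq> {0..1}" using p01[of j] p01[of "Suc j"] j ab by auto
      have \<tau>01: "\<tau> n j \<in> {0..1}" using \<tau>[OF j] sub by blast
      have "norm (integral {p n j..p n (Suc j)} (\<lambda>u. \<phi> u (\<tau> n j) - \<phi> u u)) \<le> e / 2 * (p n (Suc j) - p n j)"
      proof (rule integral_bound)
        show "p n j \<le> p n (Suc j)" using h0 by (simp add: ps)
        show "continuous_on {p n j..p n (Suc j)} (\<lambda>u. \<phi> u (\<tau> n j) - \<phi> u u)"
          by (intro continuous_on_diff continuous_on_subset[OF cd sub(2)] continuous_on_subset[OF cf[OF \<tau>01] sub(2)])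
        fix u assume u: "u \<in> {p n j..p n (Suc j)}"
        have "dist (u, \<tau> n j) (u, u) = \<bar>\<tau> n j - u\<bar>" by (simp add: dist_Pair_Pair dist_real_def)
        also have "\<dots> \<le> h" using \<tau>[OF j] u unfolding ps by auto
        finally have "dist (u, \<tau> n j) (u, u) < \<delta>" using h\<delta> by linarith
        moreover have "u \<in> {0..1}" using u sub by blast
        ultimately have "dist (\<phi> u (\<tau> n j)) (\<phi> u u) < e / 2" using \<delta>'[of "(u, u)" "(u, \<tau> n j)"] \<tau>01 by auto
        then show "norm (\<phi> u (\<tau> n j) - \<phi> u u) \<le> e / 2" by (simp add: dist_real_def)
      qed
      then show "norm (integral {p n j..p n (Suc j)} (\<lambda>u. \<phi> u (\<tau> n j)) - integral {p n j..p n (Suc j)} (\<lambda>u. \<phi> u u)) \<le> e / 2 * h"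
        using int[OF sub(2) \<tau>01] by (simp add: ps Henstock_Kurzweil_Integration.integral_diff)
    qed
    also have "\<dots> = e / 2 * (real (Suc n) * h)" by (simp only: sum_constant card_lessThan mult_ac)
    also have "real (Suc n) * h = b - a" by (simp add: h_def)
    also have "e / 2 * (b - a) \<le> e / 2 * 1" using ab e by (intro mult_left_mono) auto
    also have "\<dots> < e" using e by simp
    finally show "norm ((\<Sum>j<Suc n. integral {p n j..p n (Suc j)} (\<lambda>u. \<phi> u (\<tau> n j))) - integral {a..b} (\<lambda>u. \<phi> u u)) < e" .
  qed
qed

lemma LBINT_eq_integral:
  fixes g :: "real \<Rightarrow> real"
  assumes "continuous_on {a..b} g"
  shows "(LBINT u:{a..b}. g u) = integral {a..b} g"
  using set_borel_integral_eq_integral(2)[OF borel_integrable_atLeastAtMost'[OF assms]] .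

text \<open>For a fixed matrix the integrals are finite sums over eigenvalues, so the fundamental
  theorem of calculus applies term by term.\<close>

lemma spec_time_integral:
  assumes N: "N > 0" and f: "C21b f fx fxx ft" and ab: "0 \<le> a" "a \<le> b" "b \<le> 1"
  shows "integral {a..b} (\<lambda>u. \<integral>r. ft r u \<partial>spec N d x) = (\<integral>r. f r b \<partial>spec N d x) - (\<integral>r. f r a \<partial>spec N d x)"
proof -
  obtain lam w where E: "eigenbasis N (shifted_hm N d x) lam w" using hermitian_eigenbasis[OF shifted_hm_hermitian] by blast
  have c: "cbdd f" "cbdd ft" using C21b_cbdd[OF f] by auto
  have F: "(\<integral>r. f r u \<partial>spec N d x) = (\<Sum>i<N. f (lam i) u) / real N" "(\<integral>r. ft r u \<partial>spec N d x) = (\<Sum>i<N. ft (lam i) u) / real N"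
    if "u \<in> {0..1}" for u
    by (intro spec_integral[OF E N] cbdd_measurable[OF _ that] c)+
  have sub: "{a..b} \<subseteq> {0..1}" using ab by auto
  have "((\<lambda>u. (\<Sum>i<N. ft (lam i) u) / real N) has_integral ((\<Sum>i<N. f (lam i) b) / real N - (\<Sum>i<N. f (lam i) a) / real N)) {a..b}"
  proof (rule fundamental_theorem_of_calculus[OF ab(2)])
    fix u assume "u \<in> {a..b}"
    then have u: "u \<in> {0..1}" using sub by blast
    have "((\<lambda>u. f (lam i) u) has_real_derivative ft (lam i) u) (at u within {a..b})" for i
      using C21b_deriv(3)[OF f u] by (rule DERIV_subset) (rule sub)
    then have "((\<lambda>u. (\<Sum>i<N. f (lam i) u) / real N) has_real_derivative (\<Sum>i<N. ft (lam i) u) / real N) (at u within {a..b})"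
      by (intro DERIV_cdivide DERIV_sum)
    then show "((\<lambda>u. (\<Sum>i<N. f (lam i) u) / real N) has_vector_derivative (\<Sum>i<N. ft (lam i) u) / real N) (at u within {a..b})"
      by (simp add: has_real_derivative_iff_has_vector_derivative)
  qed
  then have "integral {a..b} (\<lambda>u. (\<Sum>i<N. ft (lam i) u) / real N) = (\<Sum>i<N. f (lam i) b) / real N - (\<Sum>i<N. f (lam i) a) / real N"
    by (rule integral_unique)
  moreover have "integral {a..b} (\<lambda>u. \<integral>r. ft r u \<partial>spec N d x) = integral {a..b} (\<lambda>u. (\<Sum>i<N. ft (lam i) u) / real N)"
    using sub by (intro Henstock_Kurzweil_Integration.integral_cong) (auto simp: F)
  moreover have "a \<in> {0..1}" "b \<in> {0..1}" using ab by auto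
  ultimately show ?thesis using F(1) by simp
qed

lemma path_integral_continuous2:
  assumes g: "cbdd g" and \<nu>: "\<nu> \<in> path_space"
  shows "continuous_on ({0..1} \<times> {0..1}) (\<lambda>(u, v). \<integral>r. g r u \<partial>\<nu> v)"
proof (intro continuous_on_sequentially[THEN iffD2] allI ballI impI, elim conjE)
  fix zs and z :: "real \<times> real" assume z: "z \<in> {0..1} \<times> {0..1}" "\<forall>n. zs n \<in> {0..1} \<times> {0..1}" "zs \<longlonglongrightarrow> z"
  have 1: "fst z \<in> {0..1}" "snd z \<in> {0..1}" "\<And>n. fst (zs n) \<in> {0..1}" "\<And>n. snd (zs n) \<in> {0..1}"
    using z by (auto simp: mem_Times_iff)
  have "(\<lambda>n. \<integral>r. g r (fst (zs n)) \<partial>\<nu> (snd (zs n))) \<longlonglongrightarrow> (\<integral>r. g r (fst z) \<partial>\<nu> (snd z))"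
    by (intro cbdd_tendsto_integral[OF g] path_space_dist[OF \<nu>] path_space_weak_conv[OF \<nu>] tendsto_fst tendsto_snd z(3) 1)
  then show "((\<lambda>(u, v). \<integral>r. g r u \<partial>\<nu> v) \<circ> zs) \<longlonglongrightarrow> (case z of (u, v) \<Rightarrow> \<integral>r. g r u \<partial>\<nu> v)"
    by (simp add: comp_def case_prod_unfold)
qed

text \<open>Folds the interaction term and the bracket of \<open>J_st\<close> into a single
  \<open>drift\<close>, whose Riemann sums occur in the discretisation.\<close>

lemma J_st_scaled:
  assumes f: "C21b f fx fxx ft" and \<nu>: "\<nu> \<in> path_space" and st: "0 \<le> s" "s \<le> t" "t \<le> 1"
  shows "(real N)\<^sup>2 * J_st \<nu> f fx fxx ft s t = (real N)\<^sup>2 * ((\<integral>x. f x t \<partial>\<nu> t) - (\<integral>x. f x s \<partial>\<nu> s))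
     - (real N)\<^sup>2 * integral {s..t} (\<lambda>u. \<integral>x. ft x u \<partial>\<nu> u)
     - integral {s..t} (\<lambda>u. drift N (\<lambda>x. fx x u) (\<lambda>x. fxx x u) (\<nu> u))"
proof -
  have c: "cbdd f" "cbdd fx" "cbdd fxx" "cbdd ft" using C21b_cbdd[OF f] by auto
  have sub: "{s..t} \<subseteq> {0..1}" using st by auto
  let ?D = "\<lambda>u. \<integral>z. divided_diff (\<lambda>x. fx x u) (\<lambda>x. fxx x u) (fst z) (snd z) \<partial>(\<nu> u \<Otimes>\<^sub>M \<nu> u)"
  let ?E = "\<lambda>u. \<integral>x. (fx x u)\<^sup>2 \<partial>\<nu> u"
  note cc = continuous_on_subset[OF path_integral_continuous[OF c(4) \<nu>] sub]
    continuous_on_subset[OF path_divided_diff_continuous[OF c(2,3) C21b_deriv(2)[OF f] \<nu>] sub]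
    continuous_on_subset[OF path_integral_continuous[OF cbdd_power2[OF c(2)] \<nu>] sub]
  have i: "?D integrable_on {s..t}" "?E integrable_on {s..t}" using cc by (auto intro: integrable_continuous_real)
  have "integral {s..t} (\<lambda>u. drift N (\<lambda>x. fx x u) (\<lambda>x. fxx x u) (\<nu> u))
     = (real N)\<^sup>2 * (1/2 * integral {s..t} ?D + 1/2 * integral {s..t} ?E)"
    unfolding drift_def using i
    by (simp add: Henstock_Kurzweil_Integration.integral_add integrable_on_cmult_left)
  moreover have "(LBINT u:{s..t}. ?D u) = integral {s..t} ?D" by (rule LBINT_eq_integral[OF cc(2)])
  ultimately show ?thesis
    unfolding J_st_def S_st_def bracket_st_def LBINT_eq_integral[OF cc(1)] LBINT_eq_integral[OF cc(3)]
    by (simp add: algebra_simps)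
qed

section \<open>The discretised functional\<close>

lemma prod_lessThan_add:
  fixes F :: "nat \<Rightarrow> 'a :: comm_monoid_mult"
  shows "(\<Prod>i<a + k. F i) = (\<Prod>i<k. F i) * (\<Prod>j<a. F (j + k))"
  by (induction a) (simp_all add: mult.assoc)

context hermitian_BM
begin

text \<open>The discretisation of N^2 times \<open>J_st\<close>. In each step the test function is
  frozen at the left time, so that a summand is exactly the exponent of the one-step bound; the time
  derivative of \<open>f\<close> is absent here and reappears in the limit.\<close>

definition W :: "(nat \<Rightarrow> real) \<Rightarrow> (real \<Rightarrow> real \<Rightarrow> real) \<Rightarrow> (real \<Rightarrow> real \<Rightarrow> real) \<Rightarrow> (real \<Rightarrow> real \<Rightarrow> real) \<Rightarrow>
    real \<Rightarrow> real \<Rightarrow> nat \<Rightarrow> 'w \<Rightarrow> real" where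
  "W d f fx fxx s t n \<omega> = (let h = (t - s) / real (Suc n); p = (\<lambda>j. s + real j * h) in
     \<Sum>j<Suc n. (real N)\<^sup>2 * (\<integral>r. f r (p j) \<partial>spec N d (pos (p (Suc j)) \<omega>)) - (real N)\<^sup>2 * (\<integral>r. f r (p j) \<partial>spec N d (pos (p j) \<omega>))
       - h * drift N (\<lambda>r. fx r (p j)) (\<lambda>r. fxx r (p j)) (spec N d (pos (p j) \<omega>)))"

lemma partition_01:
  assumes "0 \<le> s" "s \<le> t" "t \<le> 1" "j \<le> Suc n"
  shows "s + real j * ((t - s) / real (Suc n)) \<in> {s..t}"
proof -
  have "real j * ((t - s) / real (Suc n)) \<le> real (Suc n) * ((t - s) / real (Suc n))"
    using assms by (intro mult_right_mono) auto
  then show ?thesis using assms by simp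
qed

lemma W_measurable:
  assumes f: "C21b f fx fxx ft" and st: "0 \<le> s" "s \<le> t" "t \<le> 1"
  shows "W d f fx fxx s t n \<in> borel_measurable M"
proof -
  have c: "cbdd f" "cbdd fx" "cbdd fxx" "cbdd ft" using C21b_cbdd[OF f] by auto
  define p where "p j = s + real j * ((t - s) / real (Suc n))" for j
  have p01: "p j \<in> {0..1}" if "j \<le> Suc n" for j using partition_01[OF st that] st by (auto simp: p_def)
  have 1: "(\<lambda>\<omega>. \<integral>r. f r (p i) \<partial>spec N d (pos (p j) \<omega>)) \<in> borel_measurable M" if "i \<le> Suc n" "j \<le> Suc n" for i j
    using that by (intro measurable_compose[OF pos_measurable spec_integral_measurable] N c p01)
  have 2: "(\<lambda>\<omega>. drift N (\<lambda>r. fx r (p j)) (\<lambda>r. fxx r (p j)) (spec N d (pos (p j) \<omega>))) \<in> borel_measurable M" if "j \<le> Suc n" for j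
    using that by (intro measurable_compose[OF pos_measurable spec_drift_measurable] N c p01 C21b_deriv(2)[OF f])
  show ?thesis
    unfolding W_def Let_def p_def[symmetric]
    by (intro borel_measurable_sum borel_measurable_diff borel_measurable_times borel_measurable_const 1 2) auto
qed

lemma W_tendsto:
  assumes f: "C21b f fx fxx ft" and st: "0 \<le> s" "s \<le> t" "t \<le> 1" and \<omega>: "\<omega> \<in> space M"
  shows "(\<lambda>n. W d f fx fxx s t n \<omega>) \<longlonglongrightarrow> (real N)\<^sup>2 * J_st (spectral_process N d B \<omega>) f fx fxx ft s t"
proof -
  have c: "cbdd f" "cbdd fx" "cbdd fxx" "cbdd ft" using C21b_cbdd[OF f] by auto
  define \<nu> where "\<nu> = spectral_process N d B \<omega>"
  have \<nu>: "\<nu> \<in> path_space" unfolding \<nu>_def by (rule spectral_process_path[OF \<omega>])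
  have \<nu>spec: "spec N d (pos u \<omega>) = \<nu> u" for u unfolding \<nu>_def spectral_process_pos ..
  define p where "p n j = s + real j * ((t - s) / real (Suc n))" for n j
  define G where "G u v = (\<integral>r. f r u \<partial>\<nu> v)" for u v
  define g where "g u v = (\<integral>r. ft r u \<partial>\<nu> v)" for u v
  define D where "D u = drift N (\<lambda>r. fx r u) (\<lambda>r. fxx r u) (\<nu> u)" for u
  have pst: "p n j \<in> {s..t}" if "j \<le> Suc n" for n j using partition_01[OF st that] by (simp add: p_def)
  have ps: "p n (Suc j) = p n j + (t - s) / real (Suc n)" for n j
    by (simp only: p_def of_nat_Suc distrib_right mult_1 add_ac)
  have h0: "0 \<le> (t - s) / real (Suc n)" for n using st by simp
  have FTC: "integral {a..b} (\<lambda>u. g u v) = G b v - G a v" if "0 \<le> a" "a \<le> b" "b \<le> 1" for a b v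
    unfolding g_def G_def \<nu>spec[symmetric] by (rule spec_time_integral[OF N f that])
  have lim1: "(\<lambda>n. \<Sum>j<Suc n. integral {p n j..p n (Suc j)} (\<lambda>u. g u (p n (Suc j)))) \<longlonglongrightarrow> integral {s..t} (\<lambda>u. g u u)"
  proof (rule riemann_diagonal_tendsto[OF _ st p_def])
    show "continuous_on ({0..1} \<times> {0..1}) (\<lambda>(u, v). g u v)" unfolding g_def by (rule path_integral_continuous2[OF c(4) \<nu>])
    show "p n (Suc j) \<in> {p n j..p n (Suc j)}" for n j using h0 by (simp add: ps)
  qed
  have Dc: "continuous_on {0..1} D" unfolding D_def drift_def
    by (intro continuous_intros path_integral_continuous path_divided_diff_continuous[OF c(2,3) C21b_deriv(2)[OF f]] cbdd_power2 c \<nu>)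
  have lim2: "(\<lambda>n. \<Sum>j<Suc n. integral {p n j..p n (Suc j)} (\<lambda>u. D (p n j))) \<longlonglongrightarrow> integral {s..t} (\<lambda>u. D u)"
  proof (rule riemann_diagonal_tendsto[OF _ st p_def, where \<phi>="\<lambda>u v. D v"])
    show "continuous_on ({0..1} \<times> {0..1}) (\<lambda>(u, v). D v)"
      unfolding case_prod_unfold by (intro continuous_on_compose2[OF Dc] continuous_intros) auto
    show "p n j \<in> {p n j..p n (Suc j)}" for n j using h0 by (simp add: ps)
  qed
  \<comment> \<open>The increment G(p_j, p_(j+1)) - G(p_j, p_j) is the diagonal increment G(p_(j+1),
    p_(j+1)) - G(p_j, p_j), which telescopes, minus G(p_(j+1), p_(j+1)) - G(p_j, p_(j+1)), which is
    the integral of the time derivative with the path frozen at the right end point.\<close>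
  have Weq: "W d f fx fxx s t n \<omega> = (real N)\<^sup>2 * (G t t - G s s)
     - (real N)\<^sup>2 * (\<Sum>j<Suc n. integral {p n j..p n (Suc j)} (\<lambda>u. g u (p n (Suc j))))
     - (\<Sum>j<Suc n. integral {p n j..p n (Suc j)} (\<lambda>u. D (p n j)))" for n
  proof -
    have "(\<Sum>j<Suc n. integral {p n j..p n (Suc j)} (\<lambda>u. g u (p n (Suc j))))
       = (\<Sum>j<Suc n. G (p n (Suc j)) (p n (Suc j)) - G (p n j) (p n (Suc j)))"
    proof (intro sum.cong refl FTC)
      fix j assume "j \<in> {..<Suc n}"
      then show "0 \<le> p n j" "p n (Suc j) \<le> 1" using pst[of j n] pst[of "Suc j" n] st by auto
      show "p n j \<le> p n (Suc j)" using h0 by (simp add: ps)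
    qed
    moreover have "(\<Sum>j<Suc n. G (p n (Suc j)) (p n (Suc j)) - G (p n j) (p n j)) = G t t - G s s"
    proof -
      have "p n (Suc n) = t" "p n 0 = s" by (simp_all add: p_def)
      then show ?thesis using sum_lessThan_telescope[of "\<lambda>j. G (p n j) (p n j)" "Suc n"] by simp
    qed
    moreover have "W d f fx fxx s t n \<omega> = (\<Sum>j<Suc n. (real N)\<^sup>2 * G (p n j) (p n (Suc j)) - (real N)\<^sup>2 * G (p n j) (p n j)
       - integral {p n j..p n (Suc j)} (\<lambda>u. D (p n j)))"
      unfolding W_def Let_def p_def[symmetric] \<nu>spec G_def[symmetric] D_def[symmetric]
      using h0 by (intro sum.cong refl) (simp add: ps)
    moreover have "(\<Sum>j<Suc n. (real N)\<^sup>2 * G (p n j) (p n (Suc j)) - (real N)\<^sup>2 * G (p n j) (p n j)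
       - integral {p n j..p n (Suc j)} (\<lambda>u. D (p n j)))
       = (real N)\<^sup>2 * ((\<Sum>j<Suc n. G (p n (Suc j)) (p n (Suc j)) - G (p n j) (p n j)) - (\<Sum>j<Suc n. G (p n (Suc j)) (p n (Suc j)) - G (p n j) (p n (Suc j))))
         - (\<Sum>j<Suc n. integral {p n j..p n (Suc j)} (\<lambda>u. D (p n j)))"
      unfolding sum_subtractf[symmetric] sum_distrib_left by (intro sum.cong refl) (simp add: algebra_simps)
    ultimately show ?thesis by (simp only: right_diff_distrib)
  qed
  have "(\<lambda>n. W d f fx fxx s t n \<omega>) \<longlonglongrightarrow> (real N)\<^sup>2 * (G t t - G s s) - (real N)\<^sup>2 * integral {s..t} (\<lambda>u. g u u) - integral {s..t} (\<lambda>u. D u)"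
    unfolding Weq by (intro tendsto_intros lim1 lim2)
  then show ?thesis
    unfolding J_st_scaled[OF f \<nu>[unfolded \<nu>_def] st] G_def g_def D_def \<nu>_def .
qed

lemma W_exponential_bound:
  assumes f: "C21b f fx fxx ft" and st: "0 \<le> s" "s < t" "t \<le> 1"
    and L: "\<And>x y u. u \<in> {0..1} \<Longrightarrow> \<bar>fxx x u - fxx y u\<bar> \<le> L * \<bar>x - y\<bar>"
  obtains K h0 where "0 \<le> K" "0 < h0" "\<And>n. (t - s) / real (Suc n) \<le> h0 \<Longrightarrow>
     (\<integral>\<^sup>+\<omega>. ennreal (exp (W d f fx fxx s t n \<omega>)) \<partial>M)
     \<le> ennreal (exp (real (Suc n) * (K * ((t - s) / real (Suc n) * sqrt ((t - s) / real (Suc n))))))"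
proof -
  have c: "cbdd f" "cbdd fx" "cbdd fxx" "cbdd ft" using C21b_cbdd[OF f] by auto
  obtain M1 where M1: "M1 > 0" "\<forall>x. \<forall>u\<in>{0..1}. \<bar>fx x u\<bar> \<le> M1" using cbdd_bound[OF c(2)] by blast
  obtain M2 where M2: "M2 > 0" "\<forall>x. \<forall>u\<in>{0..1}. \<bar>fxx x u\<bar> \<le> M2" using cbdd_bound[OF c(3)] by blast
  have L0: "0 \<le> L" using L[of 0 0 1] by simp
  show thesis
  proof (rule one_step_exponential_bound[OF N less_imp_le[OF M1(1)] less_imp_le[OF M2(1)] L0, where 'w='w])
  fix K h0 :: real
  assume K: "0 \<le> K" "0 < h0" and step: "\<And>f f1 f2 d x h (M :: 'w measure) Z.
     (\<And>x. (f has_real_derivative f1 x) (at x)) \<Longrightarrow> (\<And>x. (f1 has_real_derivative f2 x) (at x)) \<Longrightarrow>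
     (\<And>x. \<bar>f1 x\<bar> \<le> M1) \<Longrightarrow> (\<And>x. \<bar>f2 x\<bar> \<le> M2) \<Longrightarrow> (\<And>x y. \<bar>f2 x - f2 y\<bar> \<le> L * \<bar>x - y\<bar>) \<Longrightarrow> h \<le> h0 \<Longrightarrow>
     gaussian_family M (idx N) Z h \<Longrightarrow>
     (\<integral>\<^sup>+\<omega>. ennreal (exp ((real N)\<^sup>2 * (\<integral>r. f r \<partial>spec N d (\<lambda>p. x p + Z p \<omega>)) - (real N)\<^sup>2 * (\<integral>r. f r \<partial>spec N d x)
        - h * drift N f1 f2 (spec N d x))) \<partial>M) \<le> ennreal (exp (K * (h * sqrt h)))"
  have "(\<integral>\<^sup>+\<omega>. ennreal (exp (W d f fx fxx s t n \<omega>)) \<partial>M)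
     \<le> ennreal (exp (real (Suc n) * (K * ((t - s) / real (Suc n) * sqrt ((t - s) / real (Suc n))))))"
    if hh: "(t - s) / real (Suc n) \<le> h0" for n
  proof -
    define h where "h = (t - s) / real (Suc n)"
    define p where "p j = s + real j * h" for j
    have h: "0 < h" using st by (simp add: h_def)
    have pst: "p j \<in> {s..t}" if "j \<le> Suc n" for j using partition_01[of s t j n] st that by (simp add: p_def h_def)
    \<comment> \<open>For s > 0 one step from 0 to s is put in front (k = 1) with factor 1, because
      positions are reconstructed from increments starting at time 0.\<close>
    define k :: nat where "k = (if s = 0 then 0 else 1)"
    define ts where "ts i = (if i < k then 0 else p (i - k))" for i
    define m where "m = Suc n + k"
    have k1: "k \<le> 1" by (simp add: k_def)
    have ts0: "ts 0 = 0" by (auto simp: ts_def k_def p_def)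
    have tsm: "ts m \<le> 1" using pst[of "Suc n"] st by (simp add: ts_def m_def)
    have tsk: "ts (j + k) = p j" for j by (simp add: ts_def)
    have tsl: "ts i < ts (Suc i)" if "i < m" for i
    proof (cases "i < k")
      case True
      then have "i = 0" "k = 1" "s \<noteq> 0" using k1 by (auto simp: k_def split: if_splits)
      then show ?thesis using st by (simp add: ts_def p_def)
    next
      case False
      then show ?thesis using h by (simp add: ts_def p_def Suc_diff_le)
    qed
    have ts0': "0 \<le> ts 0" using ts0 by simp
    have G: "gaussian_family M (idx N) (\<lambda>p \<omega>. inc (ts i) (ts (Suc i)) \<omega> p) (ts (Suc i) - ts i)" if "i < m" for i
      by (rule increments_gaussian[of ts m, OF ts0' tsm tsl that])
    have t01: "ts i \<in> {0..1}" if "i \<le> m" for i by (rule ts01[of ts m, OF ts0' tsm tsl that])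
    define \<Phi> where "\<Phi> i x z = (if i < k then 1 else ennreal (exp ((real N)\<^sup>2 * (\<integral>r. f r (ts i) \<partial>spec N d (\<lambda>p. x p + z p))
        - (real N)\<^sup>2 * (\<integral>r. f r (ts i) \<partial>spec N d x) - h * drift N (\<lambda>r. fx r (ts i)) (\<lambda>r. fxx r (ts i)) (spec N d x))))" for i x z
    define c' where "c' i = (if i < k then 1 else ennreal (exp (K * (h * sqrt h))))" for i
    have "(\<integral>\<^sup>+\<omega>. (\<Prod>i<m. \<Phi> i (pos (ts i) \<omega>) (inc (ts i) (ts (Suc i)) \<omega>)) \<partial>M) \<le> (\<Prod>i<m. c' i)"
    proof (rule multi_step_product[of ts m, OF ts0' tsm tsl ts0 _ _ order_refl])
      fix i assume i: "i < m"
      have a: "(\<lambda>z. (\<lambda>p. fst z p + snd z p)) \<in> borel_measurable (borel \<Otimes>\<^sub>M borel :: ((nat \<times> nat \<Rightarrow> real) \<times> (nat \<times> nat \<Rightarrow> real)) measure)"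
        by (rule sum_function_measurable) auto
      have b: "(\<lambda>x. \<integral>r. f r (ts i) \<partial>spec N d x) \<in> borel_measurable borel"
        "(\<lambda>x. drift N (\<lambda>r. fx r (ts i)) (\<lambda>r. fxx r (ts i)) (spec N d x)) \<in> borel_measurable borel"
        using t01[of i] i by (intro spec_integral_measurable spec_drift_measurable N c C21b_deriv(2)[OF f]; simp)+
      note m1 = measurable_compose[OF a b(1)] and m2 = measurable_compose[OF measurable_fst b(1)] and m3 = measurable_compose[OF measurable_fst b(2)]
      show "(\<lambda>(x, z). \<Phi> i x z) \<in> borel_measurable (borel \<Otimes>\<^sub>M borel)"
      proof (cases "i < k")
        case False
        note [measurable] = m1 m2 m3
        have "(\<lambda>z. ennreal (exp ((real N)\<^sup>2 * (\<integral>r. f r (ts i) \<partial>spec N d (\<lambda>p. fst z p + snd z p))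
          - (real N)\<^sup>2 * (\<integral>r. f r (ts i) \<partial>spec N d (fst z)) - h * drift N (\<lambda>r. fx r (ts i)) (\<lambda>r. fxx r (ts i)) (spec N d (fst z)))))
          \<in> borel_measurable (borel \<Otimes>\<^sub>M borel)" by measurable
        with False show ?thesis unfolding \<Phi>_def case_prod_unfold by simp
      qed (simp add: \<Phi>_def case_prod_unfold)
      show "(\<integral>\<^sup>+\<omega>. \<Phi> i x (inc (ts i) (ts (Suc i)) \<omega>) \<partial>M) \<le> c' i" for x
      proof (cases "i < k")
        case True then show ?thesis by (simp add: \<Phi>_def c'_def emeasure_space_1)
      next
        case False
        have d: "ts (Suc i) - ts i = h" using False by (simp add: ts_def p_def Suc_diff_le algebra_simps)
        have ti: "ts i \<in> {0..1}" using t01 i by simp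
        show ?thesis
          unfolding \<Phi>_def c'_def using False
          by simp (rule step; (rule C21b_deriv[OF f ti] | use M1 M2 L ti hh G[OF i] d in \<open>simp add: h_def\<close>))
      qed
    qed
    also have "(\<Prod>i<m. c' i) = ennreal (exp (real (Suc n) * (K * (h * sqrt h))))"
    proof -
      have "(\<Prod>i<k. c' i) = 1" by (simp add: c'_def)
      moreover have "(\<Prod>j<Suc n. c' (j + k)) = (\<Prod>j<Suc n. ennreal (exp (K * (h * sqrt h))))"
        by (intro prod.cong refl) (simp add: c'_def)
      moreover have "\<dots> = ennreal (exp (real (Suc n) * (K * (h * sqrt h))))"
        by (simp only: prod_constant card_lessThan ennreal_power exp_ge_zero exp_of_nat_mult)
      ultimately show ?thesis unfolding m_def prod_lessThan_add by simp
    qed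
    also have "(\<integral>\<^sup>+\<omega>. (\<Prod>i<m. \<Phi> i (pos (ts i) \<omega>) (inc (ts i) (ts (Suc i)) \<omega>)) \<partial>M) = (\<integral>\<^sup>+\<omega>. ennreal (exp (W d f fx fxx s t n \<omega>)) \<partial>M)"
    proof (intro nn_integral_cong)
      fix \<omega>
      have pi: "(\<lambda>q. pos a \<omega> q + inc a b \<omega> q) = pos b \<omega>" for a b by (rule ext) (simp add: pos_def inc_def)
      have "(\<Prod>i<m. \<Phi> i (pos (ts i) \<omega>) (inc (ts i) (ts (Suc i)) \<omega>))
         = (\<Prod>j<Suc n. ennreal (exp ((real N)\<^sup>2 * (\<integral>r. f r (p j) \<partial>spec N d (pos (p (Suc j)) \<omega>)) - (real N)\<^sup>2 * (\<integral>r. f r (p j) \<partial>spec N d (pos (p j) \<omega>))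
            - h * drift N (\<lambda>r. fx r (p j)) (\<lambda>r. fxx r (p j)) (spec N d (pos (p j) \<omega>)))))"
        unfolding m_def prod_lessThan_add
        using tsk[of "Suc _"] by (simp add: \<Phi>_def pi tsk del: prod.lessThan_Suc)
      also have "\<dots> = ennreal (exp (W d f fx fxx s t n \<omega>))"
        unfolding W_def Let_def h_def[symmetric] p_def[symmetric] by (simp only: exp_sum[OF finite_lessThan] prod_ennreal exp_ge_zero)
      finally show "(\<Prod>i<m. \<Phi> i (pos (ts i) \<omega>) (inc (ts i) (ts (Suc i)) \<omega>)) = ennreal (exp (W d f fx fxx s t n \<omega>))" .
    qed
    finally show ?thesis unfolding h_def .
  qed
  with K show thesis by (rule that)
  qed
qed

text \<open>Suc n factors exp(K h^(3/2)) multiply to exp(K (t - s) sqrt h), and this tends to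
  1.\<close>

theorem exp_J_st_le_1:
  assumes f: "C21b f fx fxx ft" and st: "0 \<le> s" "s \<le> t" "t \<le> 1"
    and L: "\<And>x y u. u \<in> {0..1} \<Longrightarrow> \<bar>fxx x u - fxx y u\<bar> \<le> L * \<bar>x - y\<bar>"
  shows "(\<integral>\<^sup>+\<omega>. ennreal (exp ((real N)\<^sup>2 * J_st (spectral_process N d B \<omega>) f fx fxx ft s t)) \<partial>M) \<le> 1"
proof (cases "s = t")
  \<comment> \<open>Treated separately because the Gaussian increments need a positive time step;
    here the end point terms cancel and the integrals over a single point vanish.\<close>
  case True
  have 0: "(LBINT u:{t..t}. g u) = 0" for g :: "real \<Rightarrow> real"
    using set_integral_abs_le[of t t "\<lambda>u. \<bar>g t\<bar>"] set_integral_abs_le[of t t g "\<bar>g t\<bar>"] by simp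
  have "J_st (spectral_process N d B \<omega>) f fx fxx ft s t = 0" for \<omega>
    unfolding J_st_def S_st_def bracket_st_def True 0 by simp
  then show ?thesis by (simp add: emeasure_space_1)
next
  case False
  then have "s < t" using st by simp
  obtain K h0 where K: "0 \<le> K" "0 < h0" and bound: "\<And>n. (t - s) / real (Suc n) \<le> h0 \<Longrightarrow>
     (\<integral>\<^sup>+\<omega>. ennreal (exp (W d f fx fxx s t n \<omega>)) \<partial>M)
     \<le> ennreal (exp (real (Suc n) * (K * ((t - s) / real (Suc n) * sqrt ((t - s) / real (Suc n))))))"
    using W_exponential_bound[OF f st(1) \<open>s < t\<close> st(3) L] by blast
  have lim: "(\<lambda>n. ennreal (exp (real (Suc n) * (K * ((t - s) / real (Suc n) * sqrt ((t - s) / real (Suc n))))))) \<longlonglongrightarrow> 1"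
  proof -
    have eq: "real (Suc n) * (K * ((t - s) / real (Suc n) * sqrt ((t - s) / real (Suc n)))) = K * (t - s) * sqrt ((t - s) / real (Suc n))" for n
      by simp
    have "(\<lambda>n. (t - s) / real (Suc n)) \<longlonglongrightarrow> 0" by real_asymp
    then have "(\<lambda>n. exp (K * (t - s) * sqrt ((t - s) / real (Suc n)))) \<longlonglongrightarrow> exp (K * (t - s) * sqrt 0)" by (intro tendsto_intros)
    then show ?thesis unfolding eq using tendsto_ennrealI by fastforce
  qed
  have "(\<integral>\<^sup>+\<omega>. ennreal (exp ((real N)\<^sup>2 * J_st (spectral_process N d B \<omega>) f fx fxx ft s t)) \<partial>M)
     = (\<integral>\<^sup>+\<omega>. liminf (\<lambda>n. ennreal (exp (W d f fx fxx s t n \<omega>))) \<partial>M)"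
  proof (intro nn_integral_cong)
    fix \<omega> assume "\<omega> \<in> space M"
    then have "(\<lambda>n. ennreal (exp (W d f fx fxx s t n \<omega>))) \<longlonglongrightarrow> ennreal (exp ((real N)\<^sup>2 * J_st (spectral_process N d B \<omega>) f fx fxx ft s t))"
      by (intro tendsto_ennrealI tendsto_exp W_tendsto f st)
    from lim_imp_Liminf[OF sequentially_bot this]
    show "ennreal (exp ((real N)\<^sup>2 * J_st (spectral_process N d B \<omega>) f fx fxx ft s t)) = liminf (\<lambda>n. ennreal (exp (W d f fx fxx s t n \<omega>)))"
      by (rule sym)
  qed
  also have "\<dots> \<le> liminf (\<lambda>n. \<integral>\<^sup>+\<omega>. ennreal (exp (W d f fx fxx s t n \<omega>)) \<partial>M)"
    using W_measurable[OF f st] by (intro nn_integral_liminf) simp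
  also have "\<dots> \<le> liminf (\<lambda>n. ennreal (exp (real (Suc n) * (K * ((t - s) / real (Suc n) * sqrt ((t - s) / real (Suc n)))))))"
  proof (rule Liminf_mono)
    have "(\<lambda>n. (t - s) / real (Suc n)) \<longlonglongrightarrow> 0" by real_asymp
    from order_tendstoD(2)[OF this K(2)]
    show "\<forall>\<^sub>F n in sequentially. (\<integral>\<^sup>+\<omega>. ennreal (exp (W d f fx fxx s t n \<omega>)) \<partial>M)
       \<le> ennreal (exp (real (Suc n) * (K * ((t - s) / real (Suc n) * sqrt ((t - s) / real (Suc n))))))"
      by eventually_elim (intro bound less_imp_le)
  qed
  also have "\<dots> = 1" by (rule lim_imp_Liminf[OF sequentially_bot lim])
  finally show ?thesis .
qed

text \<open>The pointwise limit of the measurable functions \<open>W\<close>, divided by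
  N^2.\<close>

lemma J_st_measurable:
  assumes f: "C21b f fx fxx ft" and st: "0 \<le> s" "s \<le> t" "t \<le> 1"
  shows "(\<lambda>\<omega>. J_st (spectral_process N d B \<omega>) f fx fxx ft s t) \<in> borel_measurable M"
proof -
  have "(\<lambda>\<omega>. (real N)\<^sup>2 * J_st (spectral_process N d B \<omega>) f fx fxx ft s t) \<in> borel_measurable M"
    using W_measurable[OF f st] W_tendsto[OF f st] by (rule borel_measurable_LIMSEQ_real[rotated])
  then have "(\<lambda>\<omega>. (1 / (real N)\<^sup>2) * ((real N)\<^sup>2 * J_st (spectral_process N d B \<omega>) f fx fxx ft s t)) \<in> borel_measurable M"
    by (rule borel_measurable_times[OF borel_measurable_const])
  moreover have "(\<lambda>\<omega>. (1 / (real N)\<^sup>2) * ((real N)\<^sup>2 * J_st (spectral_process N d B \<omega>) f fx fxx ft s t))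
     = (\<lambda>\<omega>. J_st (spectral_process N d B \<omega>) f fx fxx ft s t)"
    using N by (intro ext) simp
  ultimately show ?thesis by (simp only:)
qed

lemma J_st_tail:
  assumes f: "C21b f fx fxx ft" and st: "0 \<le> s" "s \<le> t" "t \<le> 1"
    and L: "\<And>x y u. u \<in> {0..1} \<Longrightarrow> \<bar>fxx x u - fxx y u\<bar> \<le> L * \<bar>x - y\<bar>"
  shows "prob {\<omega> \<in> space M. a \<le> J_st (spectral_process N d B \<omega>) f fx fxx ft s t} \<le> exp (- ((real N)\<^sup>2 * a))"
proof -
  let ?J = "\<lambda>\<omega>. J_st (spectral_process N d B \<omega>) f fx fxx ft s t"
  have "emeasure M {\<omega> \<in> space M. a \<le> ?J \<omega>} \<le> (\<integral>\<^sup>+\<omega>. ennreal (exp (- ((real N)\<^sup>2 * a))) * ennreal (exp ((real N)\<^sup>2 * ?J \<omega>)) \<partial>M)"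
  proof -
    have m: "{\<omega> \<in> space M. a \<le> ?J \<omega>} \<in> sets M" using J_st_measurable[OF f st] by measurable
    have "emeasure M {\<omega> \<in> space M. a \<le> ?J \<omega>} = (\<integral>\<^sup>+\<omega>. indicator {\<omega> \<in> space M. a \<le> ?J \<omega>} \<omega> \<partial>M)"
      using m by simp
    also have "\<dots> \<le> (\<integral>\<^sup>+\<omega>. ennreal (exp (- ((real N)\<^sup>2 * a))) * ennreal (exp ((real N)\<^sup>2 * ?J \<omega>)) \<partial>M)"
    proof (intro nn_integral_mono)
      fix \<omega>
      have "1 \<le> exp (- ((real N)\<^sup>2 * a)) * exp ((real N)\<^sup>2 * ?J \<omega>)" if "a \<le> ?J \<omega>"
      proof -
        have "(real N)\<^sup>2 * a \<le> (real N)\<^sup>2 * ?J \<omega>" using that by (intro mult_left_mono) auto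
        then show ?thesis by (simp add: exp_add[symmetric])
      qed
      then show "indicator {\<omega> \<in> space M. a \<le> ?J \<omega>} \<omega> \<le> ennreal (exp (- ((real N)\<^sup>2 * a))) * ennreal (exp ((real N)\<^sup>2 * ?J \<omega>))"
        by (auto simp: indicator_def ennreal_mult[symmetric] simp del: ennreal_1 simp flip: ennreal_1 intro!: ennreal_leI)
    qed
    finally show ?thesis .
  qed
  also have "\<dots> = ennreal (exp (- ((real N)\<^sup>2 * a))) * (\<integral>\<^sup>+\<omega>. ennreal (exp ((real N)\<^sup>2 * ?J \<omega>)) \<partial>M)"
    using J_st_measurable[OF f st] by (intro nn_integral_cmult) simp
  also have "\<dots> \<le> ennreal (exp (- ((real N)\<^sup>2 * a))) * 1"
    by (intro mult_left_mono exp_J_st_le_1[OF f st L]) auto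
  finally show ?thesis by (simp add: emeasure_eq_measure)
qed

end

section \<open>Regularisation of test functions\<close>

text \<open>The mean over the interval from x to x + e. It commutes with both derivatives, preserves
  sup bounds and provides the highest space derivative with a Lipschitz constant.\<close>

definition avg :: "real \<Rightarrow> (real \<Rightarrow> real \<Rightarrow> real) \<Rightarrow> real \<Rightarrow> real \<Rightarrow> real" where
  "avg e g x t = integral {0..1} (\<lambda>r. g (x + e * r) t)"

lemma cbdd_shift_jointly_continuous:
  assumes "cbdd g"
  shows "continuous_on ((UNIV \<times> {0..1}) \<times> cbox 0 1) (\<lambda>(z, r). g (fst z + e * r) (snd z))"
proof -
  have "continuous_on (UNIV \<times> {0..1}) (\<lambda>(x, t). g x t)" using assms by (simp add: cbdd_def)
  then have "continuous_on ((UNIV \<times> {0..1}) \<times> cbox 0 1) (\<lambda>w. (\<lambda>(x, t). g x t) (fst (fst w) + e * snd w, snd (fst w)))"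
    by (rule continuous_on_compose2) (auto intro!: continuous_intros)
  then show ?thesis by (simp add: case_prod_unfold)
qed

lemma cbdd_shift_continuous:
  assumes "cbdd g" "t \<in> {0..1}"
  shows "continuous_on {0..1} (\<lambda>r. g (x + e * r) t)"
  by (rule continuous_on_compose2[OF cbdd_continuous[OF assms]]) (auto intro!: continuous_intros)

lemma avg_abs_le:
  assumes "cbdd g" "t \<in> {0..1}" "\<And>x. \<bar>g x t\<bar> \<le> B"
  shows "\<bar>avg e g x t\<bar> \<le> B"
  using integral_bound[of 0 1 "\<lambda>r. g (x + e * r) t" B] cbdd_shift_continuous[OF assms(1,2)] assms(3)
  by (simp add: avg_def)

lemma cbdd_avg:
  assumes g: "cbdd g"
  shows "cbdd (avg e g)"
proof -
  obtain B where B: "B > 0" "\<forall>x. \<forall>t\<in>{0..1}. \<bar>g x t\<bar> \<le> B" using cbdd_bound[OF g] by blast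
  have "continuous_on (UNIV \<times> {0..1}) (\<lambda>z. integral (cbox 0 1) (\<lambda>r. g (fst z + e * r) (snd z)))"
    by (rule integral_continuous_on_param[OF cbdd_shift_jointly_continuous[OF g]])
  then have "continuous_on (UNIV \<times> {0..1}) (\<lambda>(x, t). avg e g x t)" by (simp add: avg_def case_prod_unfold)
  moreover have "\<bar>avg e g x t\<bar> \<le> B" if "t \<in> {0..1}" for x t
    using B that by (intro avg_abs_le[OF g that]) auto
  then have "bounded ((\<lambda>(x, t). avg e g x t) ` (UNIV \<times> {0..1}))"
    unfolding bounded_iff by (intro exI[of _ B]) auto
  ultimately show ?thesis by (simp add: cbdd_def)
qed

lemma avg_deriv_x:
  assumes g: "cbdd g" "cbdd g'" and t: "t \<in> {0..1}" and d: "\<And>x. ((\<lambda>y. g y t) has_real_derivative g' x t) (at x)"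
  shows "((\<lambda>y. avg e g y t) has_real_derivative avg e g' x t) (at x)"
proof -
  have "((\<lambda>y. integral (cbox 0 1) (\<lambda>r. g (y + e * r) t)) has_field_derivative integral (cbox 0 1) (\<lambda>r. g' (x + e * r) t)) (at x within UNIV)"
  proof (rule leibniz_rule_field_derivative[where U=UNIV])
    show "((\<lambda>y. g (y + e * r) t) has_field_derivative g' (y + e * r) t) (at y within UNIV)" for y r
    proof -
      have "((\<lambda>y. y + e * r) has_real_derivative 1) (at y)" by (auto intro!: derivative_eq_intros)
      from DERIV_chain2[OF d this] show ?thesis by simp
    qed
    show "(\<lambda>r. g (y + e * r) t) integrable_on cbox 0 1" for y
      using cbdd_shift_continuous[OF g(1) t] by (intro integrable_continuous) simp
    have "continuous_on (UNIV \<times> cbox 0 1) (\<lambda>w. (\<lambda>y. g' y t) (fst w + e * snd w))"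
      by (rule continuous_on_compose2[OF cbdd_continuous[OF g(2) t]]) (auto intro!: continuous_intros)
    then show "continuous_on (UNIV \<times> cbox 0 1) (\<lambda>(y, r). g' (y + e * r) t)" by (simp add: case_prod_unfold)
  qed auto
  then show ?thesis by (simp add: avg_def)
qed

lemma avg_deriv_t:
  assumes g: "cbdd g" "cbdd g'" and t: "t \<in> {0..1}" and d: "\<And>x t. t \<in> {0..1} \<Longrightarrow> ((\<lambda>s. g x s) has_real_derivative g' x t) (at t within {0..1})"
  shows "((\<lambda>s. avg e g x s) has_real_derivative avg e g' x t) (at t within {0..1})"
proof -
  have "((\<lambda>s. integral (cbox 0 1) (\<lambda>r. g (x + e * r) s)) has_field_derivative integral (cbox 0 1) (\<lambda>r. g' (x + e * r) t)) (at t within {0..1})"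
  proof (rule leibniz_rule_field_derivative[where U="{0..1}"])
    show "((\<lambda>s. g (x + e * r) s) has_field_derivative g' (x + e * r) s) (at s within {0..1})" if "s \<in> {0..1}" for s r
      by (rule d[OF that])
    show "(\<lambda>r. g (x + e * r) s) integrable_on cbox 0 1" if "s \<in> {0..1}" for s
      using cbdd_shift_continuous[OF g(1) that] by (intro integrable_continuous) simp
    have "continuous_on ({0..1} \<times> cbox 0 1) (\<lambda>w. (\<lambda>(y, s). g' y s) (x + e * snd w, fst w))"
    proof -
      have h: "continuous_on (UNIV \<times> {0..1}) (\<lambda>(y, s). g' y s)" using g(2) by (simp add: cbdd_def)
      show ?thesis
        by (rule continuous_on_compose2[OF h, of "{0..1} \<times> cbox 0 1" "\<lambda>w. (x + e * snd w, fst w)"]) (auto intro!: continuous_intros)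
    qed
    then show "continuous_on ({0..1} \<times> cbox 0 1) (\<lambda>(s, r). g' (x + e * r) s)" by (simp add: case_prod_unfold)
  qed (use t in auto)
  then show ?thesis by (simp add: avg_def)
qed

lemma C21b_avg:
  assumes f: "C21b f fx fxx ft"
  shows "C21b (avg e f) (avg e fx) (avg e fxx) (avg e ft)"
proof -
  have c: "cbdd f" "cbdd fx" "cbdd fxx" "cbdd ft" using C21b_cbdd[OF f] by auto
  have "cbdd (avg e f)" "cbdd (avg e fx)" "cbdd (avg e fxx)" "cbdd (avg e ft)" by (intro cbdd_avg c)+
  moreover have "((\<lambda>y. avg e f y t) has_real_derivative avg e fx x t) (at x) \<and>
        ((\<lambda>y. avg e fx y t) has_real_derivative avg e fxx x t) (at x) \<and>
        ((\<lambda>s. avg e f x s) has_real_derivative avg e ft x t) (at t within {0..1})" if t: "t \<in> {0..1}" for x t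
    by (intro conjI avg_deriv_x avg_deriv_t c t C21b_deriv[OF f]; assumption)
  ultimately show ?thesis unfolding C21b_def
    by (intro conjI allI ballI) (auto simp: cbdd_def)
qed

text \<open>The mean of a derivative is the difference quotient (g(x + e) - g(x)) / e, and both
  terms of the numerator are Lipschitz with constant \<open>B\<close>; hence 2 B / e.\<close>

lemma avg_deriv_lipschitz:
  assumes g: "cbdd g'" and t: "t \<in> {0..1}" and d: "\<And>x. ((\<lambda>y. g y t) has_real_derivative g' x t) (at x)"
    and B: "\<And>x. \<bar>g' x t\<bar> \<le> B" and e: "e > 0"
  shows "\<bar>avg e g' x t - avg e g' y t\<bar> \<le> (2 * B / e) * \<bar>x - y\<bar>"
proof -
  have eq: "avg e g' z t = (g (z + e) t - g z t) / e" for z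
  proof -
    have "((\<lambda>r. g' (z + e * r) t) has_integral (g (z + e * 1) t / e - g (z + e * 0) t / e)) {0..1}"
    proof (rule fundamental_theorem_of_calculus)
      fix r :: real
      have "((\<lambda>r. g (z + e * r) t / e) has_real_derivative g' (z + e * r) t * e / e) (at r)"
        by (intro DERIV_cdivide DERIV_chain2[OF d]) (auto intro!: derivative_eq_intros)
      then have "((\<lambda>r. g (z + e * r) t / e) has_real_derivative g' (z + e * r) t) (at r within {0..1})"
        using e by (simp add: has_field_derivative_at_within)
      then show "((\<lambda>r. g (z + e * r) t / e) has_vector_derivative g' (z + e * r) t) (at r within {0..1})"
        by (simp add: has_real_derivative_iff_has_vector_derivative)
    qed simp
    then show ?thesis unfolding avg_def by (simp add: integral_unique diff_divide_distrib)
  qed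
  have lip: "\<bar>g a t - g b t\<bar> \<le> B * \<bar>a - b\<bar>" for a b
  proof (cases "a = b")
    case False
    have "\<bar>(g a t - g b t) / (a - b)\<bar> \<le> B"
      using divided_diff_abs_le[OF d B, of a b] False by (simp add: divided_diff_def)
    then show ?thesis using False by (simp add: abs_divide divide_le_eq)
  qed simp
  have "\<bar>(g (x + e) t - g x t) - (g (y + e) t - g y t)\<bar> \<le> 2 * B * \<bar>x - y\<bar>"
    using lip[of "x + e" "y + e"] lip[of x y] by simp
  then have "\<bar>(g (x + e) t - g x t) - (g (y + e) t - g y t)\<bar> / e \<le> 2 * B * \<bar>x - y\<bar> / e"
    using e by (intro divide_right_mono) auto
  then show ?thesis unfolding eq using e by (simp add: diff_divide_distrib[symmetric])
qed

lemma avg_tendsto: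
  assumes g: "cbdd g" and t: "t \<in> {0..1}"
  shows "(\<lambda>n. avg (1 / real (Suc n)) g x t) \<longlonglongrightarrow> g x t"
proof (rule LIMSEQ_I)
  fix e :: real assume e: "e > 0"
  have "isCont (\<lambda>y. g y t) x" using cbdd_continuous[OF g t] by (simp add: continuous_on_eq_continuous_at)
  then obtain \<delta> where \<delta>: "\<delta> > 0" "\<And>y. \<bar>y - x\<bar> < \<delta> \<Longrightarrow> \<bar>g y t - g x t\<bar> < e / 2"
    using e unfolding isCont_def LIM_def dist_real_def by (metis half_gt_zero abs_zero diff_self)
  obtain n0 where n0: "1 / real (Suc n0) < \<delta>" using nat_approx_posE[OF \<delta>(1)] by blast
  show "\<exists>no. \<forall>n\<ge>no. norm (avg (1 / real (Suc n)) g x t - g x t) < e"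
  proof (intro exI[of _ n0] allI impI)
    fix n assume n: "n \<ge> n0"
    have h: "1 / real (Suc n) < \<delta>"
    proof -
      have "1 / real (Suc n) \<le> 1 / real (Suc n0)" using n by (intro divide_left_mono) auto
      then show ?thesis using n0 by linarith
    qed
    let ?h = "1 / real (Suc n)"
    have c: "continuous_on {0..1} (\<lambda>r. g (x + ?h * r) t)" by (rule cbdd_shift_continuous[OF g t])
    have "norm (integral {0..1} (\<lambda>r. g (x + ?h * r) t - g x t)) \<le> e / 2 * (1 - 0)"
    proof (rule integral_bound)
      show "continuous_on {0..1} (\<lambda>r. g (x + ?h * r) t - g x t)" by (intro continuous_on_diff c continuous_on_const)
      fix r :: real assume r: "r \<in> {0..1}"
      have "\<bar>?h * r\<bar> \<le> ?h" using r by (simp add: abs_mult divide_right_mono)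
      then have "\<bar>(x + ?h * r) - x\<bar> < \<delta>" using h by simp
      then show "norm (g (x + ?h * r) t - g x t) \<le> e / 2" using \<delta>(2) by (simp add: less_imp_le)
    qed simp
    also have "integral {0..1} (\<lambda>r. g (x + ?h * r) t - g x t) = avg ?h g x t - g x t"
      unfolding avg_def using c by (subst Henstock_Kurzweil_Integration.integral_diff) (auto intro: integrable_continuous_real)
    finally show "norm (avg ?h g x t - g x t) < e" using e by simp
  qed
qed

text \<open>Averaging never increases sup bounds, so bounds of the original functions dominate all
  integrands, in the integrals against the measures as well as in those over time.\<close>

lemma J_st_avg_tendsto:
  assumes f: "C21b f fx fxx ft" and \<nu>: "\<nu> \<in> path_space" and st: "0 \<le> s" "s \<le> t" "t \<le> 1"
  shows "(\<lambda>n. J_st \<nu> (avg (1 / real (Suc n)) f) (avg (1 / real (Suc n)) fx) (avg (1 / real (Suc n)) fxx) (avg (1 / real (Suc n)) ft) s t)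
     \<longlonglongrightarrow> J_st \<nu> f fx fxx ft s t"
proof -
  have c: "cbdd f" "cbdd fx" "cbdd fxx" "cbdd ft" using C21b_cbdd[OF f] by auto
  let ?a = "\<lambda>n. avg (1 / real (Suc n))"
  have dom: "(\<lambda>n. \<integral>x. F n x \<partial>\<mu>) \<longlonglongrightarrow> (\<integral>x. G x \<partial>\<mu>)"
    if \<mu>: "real_distribution \<mu>" and m: "\<And>n. F n \<in> borel_measurable borel" "G \<in> borel_measurable borel"
      and l: "\<And>x. (\<lambda>n. F n x) \<longlonglongrightarrow> G x" and B: "\<And>n x. \<bar>F n x\<bar> \<le> B" for F :: "nat \<Rightarrow> real \<Rightarrow> real" and G \<mu> B
  proof -
    interpret real_distribution \<mu> by fact
    show ?thesis
      by (rule integral_dominated_convergence[where w="\<lambda>_. B"])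
         (use m l B real_distribution_borel[OF \<mu>] in auto)
  qed
  note rd = path_space_dist[OF \<nu>]
  have lim: "(\<lambda>n. \<integral>x. ?a n g x u \<partial>\<nu> u) \<longlonglongrightarrow> (\<integral>x. g x u \<partial>\<nu> u)" if g: "cbdd g" and u: "u \<in> {0..1}" for g u
  proof -
    obtain B where B: "\<And>x t. t \<in> {0..1} \<Longrightarrow> \<bar>g x t\<bar> \<le> B" using cbdd_bound[OF g] by blast
    show ?thesis
      by (rule dom[OF rd[OF u], of _ _ B]) (intro cbdd_measurable cbdd_avg g u avg_tendsto avg_abs_le B)+
  qed
  have lim2: "(\<lambda>n. LBINT u:{s..t}. (\<integral>x. ?a n g x u \<partial>\<nu> u)) \<longlonglongrightarrow> (LBINT u:{s..t}. (\<integral>x. g x u \<partial>\<nu> u))" if g: "cbdd g" for g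
  proof -
    obtain B where B: "\<And>x t. t \<in> {0..1} \<Longrightarrow> \<bar>g x t\<bar> \<le> B" using cbdd_bound[OF g] by blast
    show ?thesis
      by (rule set_integral_tendsto[where B=B])
         (intro path_integral_continuous cbdd_avg g \<nu> st lim real_distribution_integral_abs_le rd avg_abs_le B; assumption)+
  qed
  have lim3: "(\<lambda>n. LBINT u:{s..t}. (\<integral>x. (?a n fx x u)\<^sup>2 \<partial>\<nu> u)) \<longlonglongrightarrow> (LBINT u:{s..t}. (\<integral>x. (fx x u)\<^sup>2 \<partial>\<nu> u))"
  proof -
    obtain B where B: "\<And>x t. t \<in> {0..1} \<Longrightarrow> \<bar>fx x t\<bar> \<le> B" using cbdd_bound[OF c(2)] by blast
    have sq: "\<bar>(?a n fx x u)\<^sup>2\<bar> \<le> B\<^sup>2" if "u \<in> {0..1}" for n x u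
    proof -
      have "\<bar>?a n fx x u\<bar> \<le> B" by (rule avg_abs_le[OF c(2) that B[OF that]])
      from power_mono[OF this, of 2] show ?thesis by simp
    qed
    have p: "(\<lambda>n. \<integral>x. (?a n fx x u)\<^sup>2 \<partial>\<nu> u) \<longlonglongrightarrow> (\<integral>x. (fx x u)\<^sup>2 \<partial>\<nu> u)" if u: "u \<in> {0..1}" for u
    proof (rule dom[OF rd[OF u], of _ _ "B\<^sup>2"])
      show "(\<lambda>x. (?a n fx x u)\<^sup>2) \<in> borel_measurable borel" for n
        using cbdd_measurable[OF cbdd_avg[OF c(2)] u] by simp
      show "(\<lambda>x. (fx x u)\<^sup>2) \<in> borel_measurable borel" using cbdd_measurable[OF c(2) u] by simp
      show "(\<lambda>n. (?a n fx x u)\<^sup>2) \<longlonglongrightarrow> (fx x u)\<^sup>2" for x by (intro tendsto_power avg_tendsto c u)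
      show "\<bar>(?a n fx x u)\<^sup>2\<bar> \<le> B\<^sup>2" for n x by (rule sq[OF u])
    qed
    show ?thesis
    proof (rule set_integral_tendsto[where B="B\<^sup>2", OF _ _ st(1) st(3) p])
      show "continuous_on {0..1} (\<lambda>u. \<integral>x. (?a n fx x u)\<^sup>2 \<partial>\<nu> u)" for n
        by (rule path_integral_continuous[OF cbdd_power2[OF cbdd_avg[OF c(2)]] \<nu>])
      show "continuous_on {0..1} (\<lambda>u. \<integral>x. (fx x u)\<^sup>2 \<partial>\<nu> u)"
        by (rule path_integral_continuous[OF cbdd_power2[OF c(2)] \<nu>])
      show "\<bar>\<integral>x. (?a n fx x u)\<^sup>2 \<partial>\<nu> u\<bar> \<le> B\<^sup>2" if u: "u \<in> {0..1}" for n u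
        by (rule real_distribution_integral_abs_le[OF rd[OF u] sq[OF u]])
    qed
  qed
  have fa: "C21b (?a n f) (?a n fx) (?a n fxx) (?a n ft)" for n by (rule C21b_avg[OF f])
  have lim4: "(\<lambda>n. LBINT u:{s..t}. (\<integral>z. divided_diff (\<lambda>x. ?a n fx x u) (\<lambda>x. ?a n fxx x u) (fst z) (snd z) \<partial>(\<nu> u \<Otimes>\<^sub>M \<nu> u)))
      \<longlonglongrightarrow> (LBINT u:{s..t}. (\<integral>z. divided_diff (\<lambda>x. fx x u) (\<lambda>x. fxx x u) (fst z) (snd z) \<partial>(\<nu> u \<Otimes>\<^sub>M \<nu> u)))"
  proof -
    obtain B where B: "\<And>x t. t \<in> {0..1} \<Longrightarrow> \<bar>fxx x t\<bar> \<le> B" using cbdd_bound[OF c(3)] by blast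
    have Ba: "\<bar>?a n fxx x u\<bar> \<le> B" if "u \<in> {0..1}" for n x u by (rule avg_abs_le[OF c(3) that B[OF that]])
    have p: "(\<lambda>n. \<integral>z. divided_diff (\<lambda>x. ?a n fx x u) (\<lambda>x. ?a n fxx x u) (fst z) (snd z) \<partial>(\<nu> u \<Otimes>\<^sub>M \<nu> u))
       \<longlonglongrightarrow> (\<integral>z. divided_diff (\<lambda>x. fx x u) (\<lambda>x. fxx x u) (fst z) (snd z) \<partial>(\<nu> u \<Otimes>\<^sub>M \<nu> u))" if u: "u \<in> {0..1}" for u
    proof -
      interpret real_distribution "\<nu> u" by (rule rd[OF u])
      interpret P: pair_prob_space "\<nu> u" "\<nu> u" ..
      have m: "h \<in> borel_measurable (\<nu> u \<Otimes>\<^sub>M \<nu> u)" if "h \<in> borel_measurable borel" for h :: "real \<times> real \<Rightarrow> real"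
        using that by (subst measurable_cong_sets[OF sets_pair_measure_cong[OF events_eq_borel events_eq_borel] refl]) (simp add: borel_prod)
      show ?thesis
      proof (rule integral_dominated_convergence[where w="\<lambda>_. B"])
        show "(\<lambda>z. divided_diff (\<lambda>x. fx x u) (\<lambda>x. fxx x u) (fst z) (snd z)) \<in> borel_measurable (\<nu> u \<Otimes>\<^sub>M \<nu> u)"
          by (intro m divided_diff_measurable C21b_deriv(2)[OF f u] cbdd_continuous c u)
        show "(\<lambda>z. divided_diff (\<lambda>x. ?a n fx x u) (\<lambda>x. ?a n fxx x u) (fst z) (snd z)) \<in> borel_measurable (\<nu> u \<Otimes>\<^sub>M \<nu> u)" for n
          by (intro m divided_diff_measurable C21b_deriv(2)[OF fa u] cbdd_continuous cbdd_avg c u)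
        show "AE z in \<nu> u \<Otimes>\<^sub>M \<nu> u. (\<lambda>n. divided_diff (\<lambda>x. ?a n fx x u) (\<lambda>x. ?a n fxx x u) (fst z) (snd z))
          \<longlonglongrightarrow> divided_diff (\<lambda>x. fx x u) (\<lambda>x. fxx x u) (fst z) (snd z)"
        proof (intro AE_I2)
          fix z
          show "(\<lambda>n. divided_diff (\<lambda>x. ?a n fx x u) (\<lambda>x. ?a n fxx x u) (fst z) (snd z))
            \<longlonglongrightarrow> divided_diff (\<lambda>x. fx x u) (\<lambda>x. fxx x u) (fst z) (snd z)"
          proof (cases "fst z = snd z")
            case True
            then show ?thesis using avg_tendsto[OF c(3) u, of "snd z"] by (simp add: divided_diff_def del: of_nat_Suc)
          next
            case False
            then have "(\<lambda>n. (?a n fx (fst z) u - ?a n fx (snd z) u) / (fst z - snd z)) \<longlonglongrightarrow> (fx (fst z) u - fx (snd z) u) / (fst z - snd z)"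
              by (intro tendsto_divide tendsto_diff avg_tendsto c u tendsto_const) auto
            then show ?thesis using False by (simp add: divided_diff_def)
          qed
        qed
        show "AE z in \<nu> u \<Otimes>\<^sub>M \<nu> u. norm (divided_diff (\<lambda>x. ?a n fx x u) (\<lambda>x. ?a n fxx x u) (fst z) (snd z)) \<le> B" for n
          using divided_diff_abs_le[OF C21b_deriv(2)[OF fa u] Ba[OF u]] by (intro AE_I2) simp
      qed simp
    qed
    show ?thesis
    proof (rule set_integral_tendsto[where B=B, OF _ _ st(1) st(3) p])
      show "continuous_on {0..1} (\<lambda>u. \<integral>z. divided_diff (\<lambda>x. ?a n fx x u) (\<lambda>x. ?a n fxx x u) (fst z) (snd z) \<partial>(\<nu> u \<Otimes>\<^sub>M \<nu> u))" for n
        by (rule path_divided_diff_continuous[OF cbdd_avg[OF c(2)] cbdd_avg[OF c(3)] C21b_deriv(2)[OF fa] \<nu>])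
      show "continuous_on {0..1} (\<lambda>u. \<integral>z. divided_diff (\<lambda>x. fx x u) (\<lambda>x. fxx x u) (fst z) (snd z) \<partial>(\<nu> u \<Otimes>\<^sub>M \<nu> u))"
        by (rule path_divided_diff_continuous[OF c(2,3) C21b_deriv(2)[OF f] \<nu>])
      show "\<bar>\<integral>z. divided_diff (\<lambda>x. ?a n fx x u) (\<lambda>x. ?a n fxx x u) (fst z) (snd z) \<partial>(\<nu> u \<Otimes>\<^sub>M \<nu> u)\<bar> \<le> B" if u: "u \<in> {0..1}" for n u
        by (rule integral_divided_diff_abs_le[OF C21b_deriv(2)[OF fa u] Ba[OF u] rd[OF u]])
    qed
  qed
  have s01: "s \<in> {0..1}" and t01: "t \<in> {0..1}" using st by auto
  show ?thesis
    unfolding J_st_def S_st_def bracket_st_def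
    by (intro tendsto_diff tendsto_mult tendsto_const lim lim2 lim3 lim4 c s01 t01)
qed

lemma J_st_regular_test_function:
  assumes f: "C21b f fx fxx ft" and \<nu>: "\<nu> \<in> path_space" and st: "0 \<le> s" "s \<le> t" "t \<le> 1" and a: "a < J_st \<nu> f fx fxx ft s t"
  shows "\<exists>g gx gxx gt L. C21b g gx gxx gt \<and> (\<forall>u\<in>{0..1}. \<forall>x y. \<bar>gxx x u - gxx y u\<bar> \<le> L * \<bar>x - y\<bar>) \<and> a < J_st \<nu> g gx gxx gt s t"
proof -
  have c: "cbdd fx" "cbdd fxx" using C21b_cbdd[OF f] by auto
  obtain B where B: "\<And>x t. t \<in> {0..1} \<Longrightarrow> \<bar>fxx x t\<bar> \<le> B" using cbdd_bound[OF c(2)] by blast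
  obtain n where n: "a < J_st \<nu> (avg (1 / real (Suc n)) f) (avg (1 / real (Suc n)) fx) (avg (1 / real (Suc n)) fxx) (avg (1 / real (Suc n)) ft) s t"
    using order_tendstoD(1)[OF J_st_avg_tendsto[OF f \<nu> st] a] unfolding eventually_sequentially by blast
  have "\<forall>u\<in>{0..1}. \<forall>x y. \<bar>avg (1 / real (Suc n)) fxx x u - avg (1 / real (Suc n)) fxx y u\<bar> \<le> (2 * B / (1 / real (Suc n))) * \<bar>x - y\<bar>"
    by (intro ballI allI avg_deriv_lipschitz[OF c(2) _ C21b_deriv(2)[OF f] B]) auto
  with n C21b_avg[OF f] show ?thesis by blast
qed

section \<open>Finite covers of relatively compact sets of paths\<close>

text \<open>\<open>op\<close> asks that some member of the family be a sequential neighbourhood of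
  each point of \<open>F\<close>, and limits of sequences in \<open>G\<close> lie in
  \<open>F\<close> rather than in \<open>G\<close>. The usual proof adapts: a Lebesgue number for
  the cover and a finite net of that radius.\<close>

lemma path_finite_cover:
  assumes G: "G \<subseteq> path_space" and F: "F \<subseteq> path_space"
    and comp: "\<And>\<nu> :: nat \<Rightarrow> real \<Rightarrow> real measure. (\<And>n. \<nu> n \<in> G) \<Longrightarrow>
       \<exists>(r :: nat \<Rightarrow> nat) x. strict_mono r \<and> x \<in> F \<and> (\<lambda>n. path_dist (\<nu> (r n)) x) \<longlonglongrightarrow> 0"
    and op: "\<And>x. x \<in> F \<Longrightarrow> \<exists>U\<in>\<U>. \<forall>\<nu> :: nat \<Rightarrow> real \<Rightarrow> real measure. (\<forall>n. \<nu> n \<in> path_space) \<longrightarrow> (\<lambda>n. path_dist (\<nu> n) x) \<longlonglongrightarrow> 0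
        \<longrightarrow> (\<forall>\<^sub>F n in sequentially. \<nu> n \<in> U)"
  shows "\<exists>\<V>. finite \<V> \<and> \<V> \<subseteq> \<U> \<and> G \<subseteq> \<Union>\<V>"
proof -
  have lebesgue: "\<exists>r>0. \<forall>g\<in>G. \<exists>U\<in>\<U>. \<forall>y\<in>path_space. path_dist y g < r \<longrightarrow> y \<in> U"
  proof (rule ccontr)
    assume "\<not> ?thesis"
    then have neg: "\<And>r. r > 0 \<Longrightarrow> \<exists>g. g \<in> G \<and> (\<forall>U\<in>\<U>. \<exists>y\<in>path_space. path_dist y g < r \<and> y \<notin> U)" by meson
    have "\<forall>n. \<exists>g. g \<in> G \<and> (\<forall>U\<in>\<U>. \<exists>y\<in>path_space. path_dist y g < 1 / real (Suc n) \<and> y \<notin> U)"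
    proof
      fix n
      show "\<exists>g. g \<in> G \<and> (\<forall>U\<in>\<U>. \<exists>y\<in>path_space. path_dist y g < 1 / real (Suc n) \<and> y \<notin> U)" by (rule neg) simp
    qed
    from choice[OF this] obtain g where g': "\<forall>n. g n \<in> G \<and> (\<forall>U\<in>\<U>. \<exists>y\<in>path_space. path_dist y (g n) < 1 / real (Suc n) \<and> y \<notin> U)"
      by (elim exE)
    have g: "\<And>n. g n \<in> G" "\<And>n U. U \<in> \<U> \<Longrightarrow> \<exists>y\<in>path_space. path_dist y (g n) < 1 / real (Suc n) \<and> y \<notin> U"
      using g' by blast+
    obtain r x where r: "strict_mono (r :: nat \<Rightarrow> nat)" and x: "x \<in> F" and lim: "(\<lambda>n. path_dist (g (r n)) x) \<longlonglongrightarrow> 0"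
      using comp[of g] g(1) by blast
    obtain U where U: "U \<in> \<U>" and ev: "\<And>\<nu> :: nat \<Rightarrow> real \<Rightarrow> real measure. (\<forall>n. \<nu> n \<in> path_space) \<Longrightarrow> (\<lambda>n. path_dist (\<nu> n) x) \<longlonglongrightarrow> 0
        \<Longrightarrow> (\<forall>\<^sub>F n in sequentially. \<nu> n \<in> U)" using op[OF x] by blast
    have "\<forall>n. \<exists>y. y \<in> path_space \<and> path_dist y (g (r n)) < 1 / real (Suc (r n)) \<and> y \<notin> U" using g(2)[OF U] by blast
    from choice[OF this] obtain y where y: "\<And>n. y n \<in> path_space" "\<And>n. path_dist (y n) (g (r n)) < 1 / real (Suc (r n))" "\<And>n. y n \<notin> U"
      by blast
    have xp: "x \<in> path_space" using x F by blast
    have l: "(\<lambda>n. 1 / real (Suc n) + path_dist (g (r n)) x) \<longlonglongrightarrow> 0 + 0"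
      by (intro tendsto_add lim) real_asymp
    have le: "path_dist (y n) x \<le> 1 / real (Suc n) + path_dist (g (r n)) x" for n
    proof -
      have "1 / real (Suc (r n)) \<le> 1 / real (Suc n)" using seq_suble[OF r, of n] by (intro divide_left_mono) auto
      moreover have "path_dist (y n) x \<le> path_dist (y n) (g (r n)) + path_dist (g (r n)) x"
        using G g(1) by (intro path_dist_triangle y xp) auto
      ultimately show ?thesis using y(2)[of n] by linarith
    qed
    have "(\<lambda>n. path_dist (y n) x) \<longlonglongrightarrow> 0"
      by (rule real_tendsto_sandwich[OF _ _ tendsto_const l[simplified]]) (auto intro!: path_dist_nonneg y xp always_eventually simp: le[simplified])
    from ev[OF _ this] y(1) have "\<forall>\<^sub>F n in sequentially. y n \<in> U" by blast
    then show False using y(3) by simp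
  qed
  then obtain r where r: "r > 0" and leb: "\<And>g. g \<in> G \<Longrightarrow> \<exists>U\<in>\<U>. \<forall>y\<in>path_space. path_dist y g < r \<longrightarrow> y \<in> U" by blast
  have net: "\<exists>T. finite T \<and> T \<subseteq> G \<and> (\<forall>y\<in>G. \<exists>g\<in>T. path_dist y g < r)"
  proof (rule ccontr)
    assume "\<not> ?thesis"
    then have neg: "\<And>T. finite T \<Longrightarrow> T \<subseteq> G \<Longrightarrow> \<exists>y. y \<in> G \<and> (\<forall>g\<in>T. \<not> path_dist y g < r)" by meson
    \<comment> \<open>Without a finite net there is an infinite r-separated sequence in
      \<open>G\<close>, which cannot have a convergent subsequence.\<close>
    have "\<exists>f :: nat \<Rightarrow> real \<Rightarrow> real measure. \<forall>n. f n \<in> G \<and> (\<forall>m<n. r \<le> path_dist (f n) (f m))"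
    proof (rule dependent_wellorder_choice)
      fix n :: nat and f :: "nat \<Rightarrow> real \<Rightarrow> real measure"
      assume "\<And>y. y < n \<Longrightarrow> f y \<in> G \<and> (\<forall>m<y. r \<le> path_dist (f y) (f m))"
      then have "finite (f ` {..<n})" "f ` {..<n} \<subseteq> G" by auto
      from neg[OF this] obtain y where "y \<in> G" "\<forall>g\<in>f ` {..<n}. \<not> path_dist y g < r" by (elim exE conjE)
      then show "\<exists>y. y \<in> G \<and> (\<forall>m<n. r \<le> path_dist y (f m))" by (intro exI[of _ y]) (auto simp: not_less)
    qed simp
    then obtain f :: "nat \<Rightarrow> real \<Rightarrow> real measure" where f': "\<forall>n. f n \<in> G \<and> (\<forall>m<n. r \<le> path_dist (f n) (f m))" ..
    have f: "f n \<in> G" "m < n \<Longrightarrow> r \<le> path_dist (f n) (f m)" for m n using f' by auto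
    obtain q x where q: "strict_mono (q :: nat \<Rightarrow> nat)" and x: "x \<in> F" and lim: "(\<lambda>n. path_dist (f (q n)) x) \<longlonglongrightarrow> 0"
      using comp[of f] f(1) by blast
    have "r / 2 > 0" using r by simp
    from order_tendstoD(2)[OF lim this] obtain n0 where n0: "\<And>n. n \<ge> n0 \<Longrightarrow> path_dist (f (q n)) x < r / 2"
      unfolding eventually_sequentially by blast
    have "q n0 < q (Suc n0)" using q by (simp add: strict_mono_Suc_iff)
    then have "r \<le> path_dist (f (q (Suc n0))) (f (q n0))" by (rule f(2))
    also have "\<dots> \<le> path_dist (f (q (Suc n0))) x + path_dist x (f (q n0))"
      using f(1) G F x by (intro path_dist_triangle) auto
    also have "\<dots> < r" using n0[of n0] n0[of "Suc n0"] by (simp add: path_dist_sym[of x])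
    finally show False by simp
  qed
  then obtain T where T: "finite T" "T \<subseteq> G" "\<And>y. y \<in> G \<Longrightarrow> \<exists>g\<in>T. path_dist y g < r" by blast
  have "\<forall>g\<in>T. \<exists>U. U \<in> \<U> \<and> (\<forall>y\<in>path_space. path_dist y g < r \<longrightarrow> y \<in> U)" using leb T(2) by blast
  from bchoice[OF this] obtain u where u: "\<And>g. g \<in> T \<Longrightarrow> u g \<in> \<U>" "\<And>g y. g \<in> T \<Longrightarrow> y \<in> path_space \<Longrightarrow> path_dist y g < r \<Longrightarrow> y \<in> u g"
    by blast
  have "G \<subseteq> \<Union>(u ` T)"
  proof
    fix y assume y: "y \<in> G"
    then obtain g where "g \<in> T" "path_dist y g < r" using T(3) by blast
    then show "y \<in> \<Union>(u ` T)" using u(2)[of g y] y G by blast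
  qed
  with T(1) u(1) show ?thesis by (intro exI[of _ "u ` T"]) auto
qed

section \<open>Chaining along dyadic points\<close>

text \<open>The left dyadic approximations of \<open>s\<close> and \<open>t\<close> at level m are
  equal or adjacent, which costs K (3/4)^m; from each of them to its own point the levels beyond m
  add the geometric series 3 K (3/4)^m. Hence 7 = 3 + 1 + 3.\<close>

lemma dyadic_chaining:
  fixes \<rho> :: "real \<Rightarrow> real \<Rightarrow> real"
  assumes refl: "\<And>t. \<rho> t t = 0" and sym: "\<And>s t. \<rho> s t = \<rho> t s" and tri: "\<And>s t u. \<rho> s u \<le> \<rho> s t + \<rho> t u"
    and cont: "\<And>us t. us \<longlonglongrightarrow> t \<Longrightarrow> (\<And>n. us n \<in> {0..1}) \<Longrightarrow> t \<in> {0..1} \<Longrightarrow> (\<lambda>n. \<rho> (us n) t) \<longlonglongrightarrow> 0"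
    and K: "0 \<le> K" and dy: "\<And>n k. k < 2 ^ n \<Longrightarrow> \<rho> (real (Suc k) / 2 ^ n) (real k / 2 ^ n) \<le> K * (3 / 4) ^ n"
    and st: "s \<in> {0..1}" "t \<in> {0..1}" "\<bar>s - t\<bar> \<le> (1 / 2) ^ m"
  shows "\<rho> s t \<le> 7 * K * (3 / 4) ^ m"
proof -
  define k where "k n t = nat \<lfloor>2 ^ n * t\<rfloor>" for n and t :: real
  define p where "p n t = real (k n t) / 2 ^ n" for n t
  have kb: "real (k n t) \<le> 2 ^ n * t" "2 ^ n * t < real (k n t) + 1" if "t \<in> {0..1}" for n t
    using that by (auto simp: k_def)
  have kle: "k n t \<le> 2 ^ n" if "t \<in> {0..1}" for n t
  proof -
    have "2 ^ n * t \<le> 2 ^ n * (1::real)" using that by (intro mult_left_mono) auto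
    then have "real (k n t) \<le> 2 ^ n" using kb(1)[OF that, of n] by linarith
    then show ?thesis using of_nat_le_iff[of "k n t" "2 ^ n", where 'a=real] by simp
  qed
  have adj: "\<rho> (real i / 2 ^ n) (real j / 2 ^ n) \<le> K * (3 / 4) ^ n" if ij: "i \<le> 2 ^ n" "j \<le> 2 ^ n" "i \<le> Suc j" "j \<le> Suc i" for i j n
  proof -
    consider "i = j" | "i = Suc j" | "j = Suc i" using ij by linarith
    then show ?thesis
    proof cases
      case 1 then show ?thesis using refl K by simp
    next
      case 2 then show ?thesis using dy[of j n] ij by simp
    next
      case 3 then show ?thesis using dy[of i n] ij sym by simp
    qed
  qed
  \<comment> \<open>The left approximation either persists at level n + 1 or moves to the next grid
    point of that level.\<close>
  have step: "\<rho> (p n t) (p (Suc n) t) \<le> K * (3 / 4) ^ Suc n" if t: "t \<in> {0..1}" for n t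
  proof -
    have "p n t = real (2 * k n t) / 2 ^ Suc n" by (simp add: p_def)
    moreover have "real (2 * k n t) < real (k (Suc n) t) + 1" "real (k (Suc n) t) < real (2 * k n t) + 2"
      using kb[OF t, of n] kb[OF t, of "Suc n"] by (auto simp: mult.assoc)
    then have "2 * k n t \<le> k (Suc n) t" "k (Suc n) t \<le> Suc (2 * k n t)" by linarith+
    ultimately show ?thesis unfolding p_def[of "Suc n"] using kle[OF t, of "Suc n"] by (simp only:) (intro adj; simp)
  qed
  \<comment> \<open>The partial sum of the geometric series is written in closed form, as a
    difference, so that the induction telescopes.\<close>
  have chain: "\<rho> (p m t) (p (m + j) t) \<le> 3 * K * (3 / 4) ^ m - 3 * K * (3 / 4) ^ (m + j)" if t: "t \<in> {0..1}" for t j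
  proof (induction j)
    case 0 then show ?case using refl by simp
  next
    case (Suc j)
    have "\<rho> (p m t) (p (m + Suc j) t) \<le> \<rho> (p m t) (p (m + j) t) + \<rho> (p (m + j) t) (p (Suc (m + j)) t)" using tri by simp
    also have "\<dots> \<le> (3 * K * (3 / 4) ^ m - 3 * K * (3 / 4) ^ (m + j)) + K * (3 / 4) ^ Suc (m + j)"
      using Suc step[OF t] by (intro add_mono)
    also have "\<dots> = 3 * K * (3 / 4) ^ m - 3 * K * (3 / 4) ^ (m + Suc j)" by simp
    finally show ?case .
  qed
  have p01: "p n t \<in> {0..1}" if t: "t \<in> {0..1}" for n t
  proof -
    have "real (k n t) \<le> 2 ^ n" using kle[OF t, of n] of_nat_le_iff[of "k n t" "2 ^ n", where 'a=real] by simp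
    then show ?thesis by (simp add: p_def divide_le_eq)
  qed
  have plim: "(\<lambda>j. p (m + j) t) \<longlonglongrightarrow> t" if t: "t \<in> {0..1}" for t
  proof -
    have b: "t - (1 / 2) ^ n \<le> p n t" "p n t \<le> t" for n
    proof -
      have "t \<le> (real (k n t) + 1) / 2 ^ n" using kb(2)[OF t, of n] by (simp add: pos_le_divide_eq mult.commute)
      then show "t - (1 / 2) ^ n \<le> p n t" by (simp add: p_def add_divide_distrib power_one_over)
      show "p n t \<le> t" using kb(1)[OF t, of n] by (simp add: p_def pos_divide_le_eq mult.commute)
    qed
    have "(\<lambda>n. t - (1 / 2) ^ n) \<longlonglongrightarrow> t - 0" by (intro tendsto_diff tendsto_const LIMSEQ_power_zero) auto
    then have l0: "(\<lambda>n. t - (1 / 2) ^ n) \<longlonglongrightarrow> t" by simp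
    have "(\<lambda>n. p n t) \<longlonglongrightarrow> t"
      by (rule real_tendsto_sandwich[OF _ _ l0 tendsto_const]) (simp_all add: b)
    from LIMSEQ_ignore_initial_segment[OF this, of m] show ?thesis by (simp only: add.commute[of m])
  qed
  have end_bound: "\<rho> (p m t) t \<le> 3 * K * (3 / 4) ^ m" if t: "t \<in> {0..1}" for t
  proof -
    have l: "(\<lambda>j. 3 * K * (3 / 4) ^ m + \<rho> (p (m + j) t) t) \<longlonglongrightarrow> 3 * K * (3 / 4) ^ m + 0"
      by (intro tendsto_add tendsto_const cont plim t p01)
    have "\<rho> (p m t) t \<le> 3 * K * (3 / 4) ^ m + \<rho> (p (m + j) t) t" for j
    proof -
      have "0 \<le> 3 * K * (3 / 4) ^ (m + j)" using K by simp
      then show ?thesis using tri[of "p m t" t "p (m + j) t"] chain[OF t, of j] by linarith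
    qed
    then show ?thesis using LIMSEQ_le_const[OF l, of "\<rho> (p m t) t"] by auto
  qed
  have mid: "\<rho> (p m s) (p m t) \<le> K * (3 / 4) ^ m"
    unfolding p_def
  proof (rule adj)
    have "\<bar>2 ^ m * s - 2 ^ m * t\<bar> = 2 ^ m * \<bar>s - t\<bar>" by (simp add: abs_mult right_diff_distrib[symmetric])
    also have "\<dots> \<le> 2 ^ m * (1 / 2) ^ m" using st(3) by (intro mult_left_mono) auto
    also have "\<dots> = (1::real)" by (simp add: power_mult_distrib[symmetric])
    finally have d: "\<bar>2 ^ m * s - 2 ^ m * t\<bar> \<le> 1" .
    have "real (k m s) < real (k m t) + 2" "real (k m t) < real (k m s) + 2"
      using kb[OF st(1), of m] kb[OF st(2), of m] d by linarith+
    then show "k m s \<le> Suc (k m t)" "k m t \<le> Suc (k m s)" by linarith+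
  qed (use kle st in auto)
  have "\<rho> s t \<le> \<rho> s (p m s) + (\<rho> (p m s) (p m t) + \<rho> (p m t) t)"
    using tri[of s t "p m s"] tri[of "p m s" t "p m t"] by linarith
  also have "\<dots> \<le> 3 * K * (3 / 4) ^ m + (K * (3 / 4) ^ m + 3 * K * (3 / 4) ^ m)"
    using end_bound[OF st(1)] end_bound[OF st(2)] mid sym[of s "p m s"] by (intro add_mono) auto
  finally show ?thesis by simp
qed

section \<open>Exponential tightness\<close>

text \<open>The relatively compact set of exponential tightness. The terms 1/R + C / ln (1 + R) stem
  from the tail of the initial law, K / R from the displacement up to time t; the modulus (3/4)^m at
  distance 2^(-m) is Hoelder continuity of exponent log_2 (4/3), which is below the Brownian
  exponent 1/2.\<close>

definition regular_paths :: "real \<Rightarrow> real \<Rightarrow> (real \<Rightarrow> real measure) set" where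
  "regular_paths C K = {\<nu>\<in>path_space.
     (\<forall>R>0. \<forall>t\<in>{0..1}. (\<integral>x. chi R x \<partial>\<nu> t) \<le> 1 / R + C / ln (1 + R) + K / R) \<and>
     (\<forall>m. \<forall>s\<in>{0..1}. \<forall>t\<in>{0..1}. \<bar>s - t\<bar> \<le> (1 / 2) ^ m \<longrightarrow> bl_dist (\<nu> s) (\<nu> t) \<le> K * (3 / 4) ^ m)}"

lemma regular_paths_compact:
  fixes \<nu> :: "nat \<Rightarrow> real \<Rightarrow> real measure"
  assumes \<nu>: "\<And>n. \<nu> n \<in> regular_paths C K"
  shows "\<exists>(r :: nat \<Rightarrow> nat) x. strict_mono r \<and> x \<in> path_space \<and> (\<lambda>n. path_dist (\<nu> (r n)) x) \<longlonglongrightarrow> 0"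
proof (rule path_sequence_compact)
  show p: "\<nu> n \<in> path_space" for n using \<nu>[of n] by (simp add: regular_paths_def)
  show "\<exists>a b. a < b \<and> (\<forall>n. \<forall>t\<in>{0..1}. measure (\<nu> n t) {a<..b} > 1 - e)" if e: "e > 0" for e
  proof (rule path_uniformly_tight[OF path_space_dist[OF p] _ e])
    fix e :: real assume e: "e > 0"
    have "(\<lambda>n. 1 / real (Suc n) + C / ln (1 + real (Suc n)) + K / real (Suc n)) \<longlonglongrightarrow> 0" by real_asymp
    from order_tendstoD(2)[OF this e] obtain n where n: "1 / real (Suc n) + C / ln (1 + real (Suc n)) + K / real (Suc n) < e"
      unfolding eventually_sequentially by blast
    have b: "(\<integral>x. chi R x \<partial>\<nu> k t) \<le> 1 / R + C / ln (1 + R) + K / R" if "R > 0" "t \<in> {0..1}" for k t R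
      using \<nu>[of k] that unfolding regular_paths_def by blast
    show "\<exists>R>0. \<forall>k. \<forall>t\<in>{0..1}. (\<integral>x. chi R x \<partial>\<nu> k t) < e"
    proof (rule exI[of _ "real (Suc n)"], intro conjI allI ballI)
      show "(\<integral>x. chi (real (Suc n)) x \<partial>\<nu> k t) < e" if "t \<in> {0..1}" for k t
        by (rule le_less_trans[OF b[OF _ that] n]) simp
    qed simp
  qed
  show "\<exists>\<delta>>0. \<forall>n. \<forall>s\<in>{0..1}. \<forall>t\<in>{0..1}. \<bar>s - t\<bar> < \<delta> \<longrightarrow> bl_dist (\<nu> n s) (\<nu> n t) < e" if e: "e > 0" for e
  proof -
    have "(\<lambda>m. K * (3 / 4) ^ m) \<longlonglongrightarrow> K * 0" by (intro tendsto_mult tendsto_const LIMSEQ_power_zero) auto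
    then have l: "(\<lambda>m. K * (3 / 4) ^ m) \<longlonglongrightarrow> 0" by simp
    from order_tendstoD(2)[OF l e] obtain m where m: "K * (3 / 4) ^ m < e" unfolding eventually_sequentially by blast
    have "bl_dist (\<nu> n s) (\<nu> n t) < e" if "s \<in> {0..1}" "t \<in> {0..1}" "\<bar>s - t\<bar> < (1 / 2) ^ m" for n s t
    proof -
      have "bl_dist (\<nu> n s) (\<nu> n t) \<le> K * (3 / 4) ^ m"
        using \<nu>[of n] that less_imp_le[OF that(3)] unfolding regular_paths_def by blast
      then show ?thesis using m by linarith
    qed
    then show ?thesis by (intro exI[of _ "(1 / 2) ^ m"]) auto
  qed
qed

lemma chi_lipschitz:
  assumes R: "R > 0"
  shows "\<bar>chi R x - chi R y\<bar> \<le> (1 / R) * \<bar>x - y\<bar>"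
proof (cases "x = y")
  case False
  have "\<bar>divided_diff (chi R) (\<lambda>x. 2 * x * R\<^sup>2 / (R\<^sup>2 + x\<^sup>2)\<^sup>2) x y\<bar> \<le> 1 / R"
    by (rule divided_diff_abs_le[OF chi_deriv(1)[OF R] chi_bounds(3)[OF R]])
  then have "\<bar>chi R x - chi R y\<bar> / \<bar>x - y\<bar> \<le> 1 / R" using False by (simp add: divided_diff_def abs_divide)
  then show ?thesis using False by (simp only: pos_divide_le_eq zero_less_abs_iff right_minus_eq not_False_eq_True)
qed simp

text \<open>The split is at x^2 = R: below it x^2 / R^2 <= 1 / R, above it the quotient of
  logarithms is at least 1. This is how a logarithmic moment controls the tail function.\<close>

lemma chi_le_ln:
  assumes R: "R > 0"
  shows "chi R x \<le> 1 / R + ln (1 + x\<^sup>2) / ln (1 + R)"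
proof -
  have lR: "0 < ln (1 + R)" using R by simp
  have lx: "0 \<le> ln (1 + x\<^sup>2)" by simp
  show ?thesis
  proof (cases "x\<^sup>2 \<le> R")
    case True
    have "chi R x \<le> x\<^sup>2 / R\<^sup>2" unfolding chi_def using R by (intro divide_left_mono) (auto intro!: mult_pos_pos add_pos_nonneg)
    also have "\<dots> \<le> R / R\<^sup>2" using True by (intro divide_right_mono) auto
    also have "\<dots> = 1 / R" using R by (simp add: power2_eq_square)
    finally show ?thesis using lx lR by (simp add: add_increasing2)
  next
    case False
    have "chi R x \<le> 1" using chi_bounds(2)[OF R, of x] by linarith
    also have "\<dots> \<le> ln (1 + x\<^sup>2) / ln (1 + R)" using False R lR by (simp add: le_divide_eq)
    finally show ?thesis using R by (simp add: add_increasing)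
  qed
qed

lemma spec_0: "spectral_measure (diag_real N d) = spec N d (\<lambda>p. 0)"
proof -
  have "diag_real N d = mat N N (\<lambda>(k, l). shifted_hm N d (\<lambda>p. 0) k l)"
    by (rule eq_matI) (auto simp: diag_real_def mat_diag_def shifted_hm_def hm_def complex_eq_iff)
  then show ?thesis by (simp add: spec_def)
qed

lemma spec_chi_le_ln:
  assumes N: "N > 0" and R: "R > 0" and C: "(\<integral>x. ln (1 + x\<^sup>2) \<partial>spec N d x) \<le> C"
  shows "(\<integral>r. chi R r \<partial>spec N d x) \<le> 1 / R + C / ln (1 + R)"
proof -
  obtain lam w where E: "eigenbasis N (shifted_hm N d x) lam w" using hermitian_eigenbasis[OF shifted_hm_hermitian] by blast
  have lR: "0 < ln (1 + R)" using R by simp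
  have "(\<integral>r. chi R r \<partial>spec N d x) = (\<Sum>i<N. chi R (lam i)) / real N"
    by (rule spec_integral[OF E N chi_borel[OF R]])
  also have "\<dots> \<le> (\<Sum>i<N. 1 / R + ln (1 + (lam i)\<^sup>2) / ln (1 + R)) / real N"
    by (intro divide_right_mono sum_mono chi_le_ln R) simp
  also have "\<dots> = 1 / R + ((\<Sum>i<N. ln (1 + (lam i)\<^sup>2)) / real N) / ln (1 + R)"
    using N by (simp add: sum.distrib add_divide_distrib sum_divide_distrib[symmetric])
  also have "(\<Sum>i<N. ln (1 + (lam i)\<^sup>2)) / real N = (\<integral>x. ln (1 + x\<^sup>2) \<partial>spec N d x)"
    by (rule spec_integral[OF E N, symmetric]) simp
  also have "1 / R + (\<integral>x. ln (1 + x\<^sup>2) \<partial>spec N d x) / ln (1 + R) \<le> 1 / R + C / ln (1 + R)"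
    using C lR by (intro add_left_mono divide_right_mono) auto
  finally show ?thesis .
qed

section \<open>Tails of the displacement and the exceptional event\<close>

context hermitian_BM
begin

text \<open>The Euclidean distance of the coordinates divided by N, equal to the normalised
  Hilbert-Schmidt distance of the matrices. It dominates \<open>bl_dist\<close> of the spectral
  measures and has an explicit Gaussian tail, so chaining is applied to it.\<close>

definition disp :: "real \<Rightarrow> real \<Rightarrow> 'w \<Rightarrow> real" where
  "disp s t \<omega> = sqrt (\<Sum>p\<in>idx N. (pos s \<omega> p - pos t \<omega> p)\<^sup>2) / real N"

lemma disp_triangle: "disp s u \<omega> \<le> disp s t \<omega> + disp t u \<omega>"
proof -
  have "L2_set (\<lambda>p. (pos s \<omega> p - pos t \<omega> p) + (pos t \<omega> p - pos u \<omega> p)) (idx N)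
     \<le> L2_set (\<lambda>p. pos s \<omega> p - pos t \<omega> p) (idx N) + L2_set (\<lambda>p. pos t \<omega> p - pos u \<omega> p) (idx N)"
    by (rule L2_set_triangle_ineq)
  then have "L2_set (\<lambda>p. pos s \<omega> p - pos u \<omega> p) (idx N) / real N
     \<le> (L2_set (\<lambda>p. pos s \<omega> p - pos t \<omega> p) (idx N) + L2_set (\<lambda>p. pos t \<omega> p - pos u \<omega> p) (idx N)) / real N"
    by (intro divide_right_mono) auto
  then show ?thesis unfolding disp_def L2_set_def by (simp add: add_divide_distrib)
qed

lemma disp_measurable:
  assumes "s \<in> {0..1}" "t \<in> {0..1}"
  shows "disp s t \<in> borel_measurable M"
proof -
  have c: "(\<lambda>\<omega>. pos u \<omega> p) \<in> borel_measurable M" if "u \<in> {0..1}" for u p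
    using B_measurable[of p, OF _ that] by (cases "p \<in> idx N") (simp_all add: pos_def)
  note [measurable] = c[OF assms(1)] c[OF assms(2)]
  show ?thesis unfolding disp_def[abs_def] by measurable
qed

text \<open>Exponential Chebyshev inequality at the exponent 1/(4h), h = t - s. The exponential
  moment, sqrt 2 to the power N^2, is at most exp(N^2), which accounts for the summand -1.\<close>

lemma disp_tail:
  assumes st: "0 \<le> s" "s < t" "t \<le> 1" and c: "0 \<le> c"
  shows "prob {\<omega> \<in> space M. c < disp t s \<omega>} \<le> exp (- ((real N)\<^sup>2 * (c\<^sup>2 / (4 * (t - s)) - 1)))"
proof -
  define ts where "ts i = (if i = 0 then s else t)" for i :: nat
  have "gaussian_family M (idx N) (\<lambda>p \<omega>. inc (ts 0) (ts (Suc 0)) \<omega> p) (ts (Suc 0) - ts 0)"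
    by (rule increments_gaussian[of ts 1]) (use st in \<open>auto simp: ts_def\<close>)
  then interpret G: gaussian_family M "idx N" "\<lambda>p \<omega>. inc s t \<omega> p" "t - s" by (simp add: ts_def)
  have N2: "card (idx N) = N\<^sup>2" by (simp add: idx_def power2_eq_square)
  let ?S = "\<lambda>\<omega>. (\<Sum>p\<in>idx N. (inc s t \<omega> p)\<^sup>2)"
  have dS: "disp t s \<omega> = sqrt (?S \<omega>) / real N" for \<omega>
    unfolding disp_def by (intro arg_cong2[where f="(/)"] arg_cong[where f=sqrt] sum.cong refl) (simp_all add: pos_def inc_def)
  let ?A = "{\<omega> \<in> space M. c < disp t s \<omega>}"
  let ?x = "(real N)\<^sup>2 * c\<^sup>2 / (4 * (t - s))"
  have mA: "?A \<in> sets M" using disp_measurable[of t s] st by auto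
  have "emeasure M ?A = (\<integral>\<^sup>+\<omega>. indicator ?A \<omega> \<partial>M)" using mA by simp
  also have "\<dots> \<le> (\<integral>\<^sup>+\<omega>. ennreal (exp (- ?x)) * ennreal (exp (?S \<omega> / (4 * (t - s)))) \<partial>M)"
  proof (intro nn_integral_mono)
    fix \<omega>
    have "1 \<le> exp (- ?x) * exp (?S \<omega> / (4 * (t - s)))" if "c < disp t s \<omega>"
    proof -
      have S0: "0 \<le> ?S \<omega>" by (intro sum_nonneg) auto
      have "c * real N < sqrt (?S \<omega>)" using that N unfolding dS by (simp add: less_divide_eq)
      then have "(c * real N)\<^sup>2 \<le> (sqrt (?S \<omega>))\<^sup>2" using c by (intro power_mono) auto
      then have "(real N)\<^sup>2 * c\<^sup>2 \<le> ?S \<omega>" using S0 by (simp add: power_mult_distrib mult.commute)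
      then have "?x \<le> ?S \<omega> / (4 * (t - s))" using st by (intro divide_right_mono) auto
      then show ?thesis by (simp add: exp_add[symmetric])
    qed
    then show "indicator ?A \<omega> \<le> ennreal (exp (- ?x)) * ennreal (exp (?S \<omega> / (4 * (t - s))))"
      by (auto simp: indicator_def ennreal_mult[symmetric] simp del: ennreal_1 simp flip: ennreal_1 intro!: ennreal_leI)
  qed
  also have "\<dots> = ennreal (exp (- ?x)) * ennreal (sqrt 2 ^ card (idx N))"
    unfolding G.exp_sum_squares[symmetric] by (rule nn_integral_cmult) (use G.Z_measurable in measurable)
  also have "\<dots> \<le> ennreal (exp (- ?x)) * ennreal (exp ((real N)\<^sup>2))"
  proof (intro mult_left_mono ennreal_leI)
    have "sqrt 2 \<le> exp 1"
    proof -
      have "sqrt 2 \<le> sqrt (2\<^sup>2)" by (rule real_sqrt_le_mono) simp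
      also have "\<dots> \<le> exp 1" using exp_ge_add_one_self[of 1] by simp
      finally show ?thesis .
    qed
    then have "sqrt 2 ^ card (idx N) \<le> exp 1 ^ card (idx N)" by (intro power_mono) auto
    also have "\<dots> = exp ((real N)\<^sup>2)" unfolding N2 exp_of_nat_mult[symmetric] by simp
    finally show "sqrt 2 ^ card (idx N) \<le> exp ((real N)\<^sup>2)" .
  qed simp
  also have "\<dots> = ennreal (exp (- ((real N)\<^sup>2 * (c\<^sup>2 / (4 * (t - s)) - 1))))"
    by (simp add: ennreal_mult[symmetric] exp_add[symmetric] right_diff_distrib)
  finally show ?thesis by (simp add: emeasure_eq_measure)
qed

text \<open>At level n an increment is typically of size 2^(-n/2), smaller than the allowed (3/4)^n
  by a geometric factor; all levels can therefore be controlled simultaneously.\<close>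

definition bad :: "real \<Rightarrow> 'w set" where
  "bad K = (\<Union>n. \<Union>k<2 ^ n. {\<omega> \<in> space M. K * (3 / 4) ^ n < disp (real (Suc k) / 2 ^ n) (real k / 2 ^ n) \<omega>})"

lemma dyadic_01: "k < 2 ^ n \<Longrightarrow> real (Suc k) / 2 ^ n \<le> 1"
proof -
  assume "k < 2 ^ n"
  then have "Suc k \<le> 2 ^ n" by simp
  then have "real (Suc k) \<le> real (2 ^ n)" by (simp only: of_nat_le_iff)
  then show ?thesis by (simp add: divide_le_eq)
qed

lemma bad_level_sets:
  assumes "k < 2 ^ n"
  shows "{\<omega> \<in> space M. c < disp (real (Suc k) / 2 ^ n) (real k / 2 ^ n) \<omega>} \<in> sets M"
proof -
  have "real k / 2 ^ n \<le> real (Suc k) / 2 ^ n" by (intro divide_right_mono) auto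
  then have "disp (real (Suc k) / 2 ^ n) (real k / 2 ^ n) \<in> borel_measurable M"
    using dyadic_01[OF assms] dyadic_01[of k n] by (intro disp_measurable) (use assms in auto)
  then show ?thesis by measurable
qed

lemma bad_sets: "bad K \<in> sets M"
  unfolding bad_def by (intro sets.countable_UN sets.finite_UN image_subsetI bad_level_sets) auto

text \<open>With K = 2 sqrt L the exponent at level n is L (9/8)^n, and L >= 16 with Bernoulli's
  inequality makes it at least L + 2n. The factor exp(-2n) <= 4^(-n) beats the 2^n intervals of the
  level, and the remaining series of 2^(-n) sums to 2.\<close>

lemma bad_prob:
  assumes L: "16 \<le> L"
  shows "prob (bad (2 * sqrt L)) \<le> 2 * exp (- ((real N)\<^sup>2 * (L - 1)))"
proof -
  let ?K = "2 * sqrt L"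
  let ?A = "\<lambda>n k. {\<omega> \<in> space M. ?K * (3 / 4) ^ n < disp (real (Suc k) / 2 ^ n) (real k / 2 ^ n) \<omega>}"
  let ?U = "\<lambda>n. \<Union>k<2 ^ n. ?A n k"
  have N1: "1 \<le> (real N)\<^sup>2" using N by (simp add: one_le_power)
  have A: "prob (?A n k) \<le> exp (- ((real N)\<^sup>2 * (L - 1))) * (1 / 4) ^ n" if k: "k < 2 ^ n" for n k
  proof -
    have d: "real (Suc k) / 2 ^ n - real k / 2 ^ n = 1 / 2 ^ n" by (simp add: add_divide_distrib)
    have "prob (?A n k) \<le> exp (- ((real N)\<^sup>2 * ((?K * (3 / 4) ^ n)\<^sup>2 / (4 * (1 / 2 ^ n)) - 1)))"
      unfolding d[symmetric] using dyadic_01[OF k] L by (intro disp_tail) (auto simp: divide_strict_right_mono)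
    also have "(?K * (3 / 4) ^ n)\<^sup>2 / (4 * (1 / 2 ^ n)) = L * (9 / 8) ^ n"
    proof -
      have "(?K * (3 / 4) ^ n)\<^sup>2 = 4 * L * (9 / 16) ^ n"
        using L by (simp add: power_mult_distrib power_mult[symmetric] mult.commute[of n 2]) (simp add: power_mult power2_eq_square)
      then have "(?K * (3 / 4) ^ n)\<^sup>2 / (4 * (1 / 2 ^ n)) = L * ((9 / 16) ^ n * 2 ^ n)" by simp
      also have "(9 / 16) ^ n * 2 ^ n = (9 / 8 :: real) ^ n" by (simp add: power_mult_distrib[symmetric])
      finally show ?thesis .
    qed
    also have "exp (- ((real N)\<^sup>2 * (L * (9 / 8) ^ n - 1))) \<le> exp (- ((real N)\<^sup>2 * (L - 1)) + - (2 * real n))"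
    proof -
      have "1 + real n * (1 / 8) \<le> (1 + 1 / 8) ^ n" by (rule Bernoulli_inequality) simp
      then have "L * (1 + real n * (1 / 8)) \<le> L * (9 / 8) ^ n" using L by (intro mult_left_mono) auto
      moreover have "16 * (real n / 8) \<le> L * (real n / 8)" using L by (intro mult_right_mono) auto
      ultimately have "L - 1 + 2 * real n \<le> L * (9 / 8) ^ n - 1" by (simp add: distrib_left)
      then have "(real N)\<^sup>2 * (L - 1 + 2 * real n) \<le> (real N)\<^sup>2 * (L * (9 / 8) ^ n - 1)" by (intro mult_left_mono) auto
      moreover have "1 * (2 * real n) \<le> (real N)\<^sup>2 * (2 * real n)" using N1 by (intro mult_right_mono) auto
      ultimately have "(real N)\<^sup>2 * (L - 1) + 2 * real n \<le> (real N)\<^sup>2 * (L * (9 / 8) ^ n - 1)"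
        unfolding distrib_left by linarith
      then show ?thesis by simp
    qed
    also have "\<dots> = exp (- ((real N)\<^sup>2 * (L - 1))) * exp (- 2) ^ n"
      by (simp only: exp_add exp_of_nat_mult[symmetric]) (simp add: mult.commute)
    also have "\<dots> \<le> exp (- ((real N)\<^sup>2 * (L - 1))) * (1 / 4) ^ n"
    proof (intro mult_left_mono power_mono)
      have "4 \<le> exp (2 :: real)"
      proof -
        have "(2::real) * 2 \<le> exp 1 * exp 1" using exp_ge_add_one_self[of 1] by (intro mult_mono) auto
        then show ?thesis by (simp add: exp_add[symmetric])
      qed
      then show "exp (- 2) \<le> (1 / 4 :: real)" by (simp add: exp_minus divide_simps)
    qed auto
    finally show ?thesis .
  qed
  have U: "prob (?U n) \<le> exp (- ((real N)\<^sup>2 * (L - 1))) * (1 / 2) ^ n" for n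
  proof -
    have "prob (?U n) \<le> (\<Sum>k<2 ^ n. prob (?A n k))"
      by (intro finite_measure_subadditive_finite) (use bad_level_sets in \<open>auto simp del: of_nat_Suc\<close>)
    also have "\<dots> \<le> (\<Sum>k<(2::nat) ^ n. exp (- ((real N)\<^sup>2 * (L - 1))) * (1 / 4) ^ n)"
      by (intro sum_mono A) simp
    also have "\<dots> = exp (- ((real N)\<^sup>2 * (L - 1))) * (2 ^ n * (1 / 4) ^ n)" by simp
    also have "2 ^ n * (1 / 4) ^ n = (1 / 2 :: real) ^ n" by (simp add: power_mult_distrib[symmetric])
    finally show ?thesis .
  qed
  have Us: "?U n \<in> sets M" for n by (intro sets.finite_UN bad_level_sets) auto
  have sm: "summable (\<lambda>n. exp (- ((real N)\<^sup>2 * (L - 1))) * (1 / 2 :: real) ^ n)" by (intro summable_mult summable_geometric) simp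
  have sU: "summable (\<lambda>n. prob (?U n))"
    by (rule summable_comparison_test'[OF sm, of 0]) (use U in simp)
  have "prob (\<Union>n. ?U n) \<le> (\<Sum>n. prob (?U n))"
    using Us by (intro finite_measure_subadditive_countably sU) auto
  also have "\<dots> \<le> (\<Sum>n. exp (- ((real N)\<^sup>2 * (L - 1))) * (1 / 2) ^ n)"
    by (intro suminf_le U sU sm)
  also have "\<dots> = exp (- ((real N)\<^sup>2 * (L - 1))) * 2"
    by (subst suminf_mult) (auto simp: suminf_geometric summable_geometric)
  finally show ?thesis unfolding bad_def by simp
qed

lemma disp_le_of_not_bad:
  assumes \<omega>: "\<omega> \<in> space M" "\<omega> \<notin> bad K" and K: "0 \<le> K"
    and st: "s \<in> {0..1}" "t \<in> {0..1}" "\<bar>s - t\<bar> \<le> (1 / 2) ^ m"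
  shows "disp s t \<omega> \<le> 7 * K * (3 / 4) ^ m"
proof (rule dyadic_chaining[where \<rho>="\<lambda>s t. disp s t \<omega>", OF _ _ _ _ K _ st])
  show "disp t t \<omega> = 0" for t by (simp add: disp_def)
  show "disp s t \<omega> = disp t s \<omega>" for s t by (simp add: disp_def power2_commute)
  show "disp s u \<omega> \<le> disp s t \<omega> + disp t u \<omega>" for s t u by (rule disp_triangle)
  show "disp (real (Suc k) / 2 ^ n) (real k / 2 ^ n) \<omega> \<le> K * (3 / 4) ^ n" if "k < 2 ^ n" for n k
  proof (rule ccontr)
    assume "\<not> ?thesis"
    then have "\<omega> \<in> bad K" using that \<omega>(1) unfolding bad_def by (auto simp: not_le)
    with \<omega>(2) show False ..
  qed
  show "(\<lambda>n. disp (us n) t \<omega>) \<longlonglongrightarrow> 0" if us: "us \<longlonglongrightarrow> t" "\<And>n. us n \<in> {0..1}" "t \<in> {0..1}" for us t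
  proof -
    have "(\<lambda>n. disp (us n) t \<omega>) \<longlonglongrightarrow> sqrt (\<Sum>p\<in>idx N. (pos t \<omega> p - pos t \<omega> p)\<^sup>2) / real N"
      unfolding disp_def by (intro tendsto_intros pos_continuous[OF \<omega>(1) us]) (use N in auto)
    then show ?thesis by simp
  qed
qed

lemma regular_of_not_bad:
  assumes \<omega>: "\<omega> \<in> space M" "\<omega> \<notin> bad K" and K: "0 \<le> K"
    and C: "(\<integral>x. ln (1 + x\<^sup>2) \<partial>spectral_measure (diag_real N d)) \<le> C"
  shows "spectral_process N d B \<omega> \<in> regular_paths C (7 * K)"
  unfolding regular_paths_def
proof (intro CollectI conjI allI impI ballI)
  show "spectral_process N d B \<omega> \<in> path_space" by (rule spectral_process_path[OF \<omega>(1)])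
next
  fix R t :: real assume R: "R > 0" and t: "t \<in> {0..1}"
  have p0: "pos 0 \<omega> = (\<lambda>p. 0)" using \<omega>(1) by (intro ext) (simp add: pos_def B_0)
  \<comment> \<open>Level 0 of the chaining bound: the displacement from time 0 never exceeds 7
    K.\<close>
  have "\<bar>t - 0\<bar> \<le> (1 / 2) ^ 0" using t by simp
  from disp_le_of_not_bad[OF \<omega> K t _ this] have d: "disp t 0 \<omega> \<le> 7 * K" by simp
  have "\<bar>(\<integral>r. chi R r \<partial>spec N d (pos t \<omega>)) - (\<integral>r. chi R r \<partial>spec N d (pos 0 \<omega>))\<bar> \<le> 1 / R * disp t 0 \<omega>"
    unfolding disp_def by (rule spec_lipschitz[OF N chi_lipschitz[OF R]])
  also have "\<dots> \<le> 1 / R * (7 * K)" using d R by (intro mult_left_mono) auto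
  finally have "(\<integral>r. chi R r \<partial>spec N d (pos t \<omega>)) \<le> (\<integral>r. chi R r \<partial>spec N d (pos 0 \<omega>)) + 7 * K / R" by simp
  moreover have "(\<integral>r. chi R r \<partial>spec N d (pos 0 \<omega>)) \<le> 1 / R + C / ln (1 + R)"
    unfolding p0 using C unfolding spec_0 by (rule spec_chi_le_ln[OF N R])
  ultimately show "(\<integral>x. chi R x \<partial>spectral_process N d B \<omega> t) \<le> 1 / R + C / ln (1 + R) + 7 * K / R"
    unfolding spectral_process_pos by linarith
next
  fix m and s t :: real assume st: "s \<in> {0..1}" "t \<in> {0..1}" "\<bar>s - t\<bar> \<le> (1 / 2) ^ m"
  have "bl_dist (spec N d (pos s \<omega>)) (spec N d (pos t \<omega>)) \<le> disp s t \<omega>"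
    unfolding disp_def by (rule spec_bl_dist[OF N])
  also have "\<dots> \<le> 7 * K * (3 / 4) ^ m" by (rule disp_le_of_not_bad[OF \<omega> K st])
  finally show "bl_dist (spectral_process N d B \<omega> s) (spectral_process N d B \<omega> t) \<le> 7 * K * (3 / 4) ^ m"
    unfolding spectral_process_pos .
qed

end

section \<open>The large deviation upper bound\<close>

lemma outer_prob_le:
  assumes "E \<in> sets M" "A \<inter> space M \<subseteq> E"
  shows "outer_prob M A \<le> measure M E"
  unfolding outer_prob_def using assms
  by (intro cINF_lower bdd_belowI2[where m=0]) auto

text \<open>Used with n = N^2: the number of covering events enters through \<open>c\<close> and
  disappears in ln c / n. For p <= 0 the logarithm is minus infinity, and the positive factor 1/n
  keeps it so.\<close>

lemma log_ereal_bound: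
  assumes p: "p \<le> c * exp (- (real n * a))" and c: "c > 0" and n: "n > 0"
  shows "ereal (1 / real n) * log_ereal p \<le> ereal (ln c / real n - a)"
proof (cases "p \<le> 0")
  case True
  then show ?thesis using n by (simp add: log_ereal_def)
next
  case False
  then have "ln p \<le> ln (c * exp (- (real n * a)))" using p by (subst ln_le_cancel_iff) auto
  also have "\<dots> = ln c - real n * a" using c by (simp add: ln_mult)
  finally have "(1 / real n) * ln p \<le> (1 / real n) * (ln c - real n * a)" by (intro mult_left_mono) auto
  also have "\<dots> = ln c / real n - a" using n by (simp add: diff_divide_distrib)
  finally show ?thesis using False by (simp add: log_ereal_def)
qed

text \<open>The bound at a single level \<open>a\<close> below the infimum; the case of the infimum
  itself follows by approximation from below.\<close>

lemma large_deviation_upper_bound: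
  fixes d :: "nat \<Rightarrow> nat \<Rightarrow> real"
    and \<mu>D :: "real measure"
    and M :: "nat \<Rightarrow> 'w measure"
    and B :: "nat \<Rightarrow> nat \<times> nat \<Rightarrow> real \<Rightarrow> 'w \<Rightarrow> real"
  assumes C: "\<And>N. N \<ge> 1 \<Longrightarrow> (\<integral>x. ln (1 + x\<^sup>2) \<partial>spectral_measure (diag_real N (d N))) \<le> C"
    and \<mu>D: "real_distribution \<mu>D"
    and conv: "weak_conv_m (\<lambda>N. spectral_measure (diag_real N (d N))) \<mu>D"
    and M: "\<And>N. prob_space (M N)"
    and B: "\<And>N. indep_std_BMs (M N) ({..<N} \<times> {..<N}) (B N)"
    and F: "path_closed F" and a: "ereal a < (INF \<nu>\<in>F. S_rate \<mu>D \<nu>)"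
  shows "limsup (\<lambda>N. ereal (1 / (real N)\<^sup>2) *
              log_ereal (outer_prob (M N) {\<omega>\<in>space (M N). spectral_process N (d N) (B N) \<omega> \<in> F})) \<le> ereal (- a)"
proof -
  \<comment> \<open>16 is the threshold of \<open>bad_prob\<close>; L - 1 >= a makes the exceptional
    event negligible at the target scale exp(-N^2 a), up to a factor 2.\<close>
  define L where "L = max 16 (a + 1)"
  define K where "K = 2 * sqrt L"
  have L: "16 \<le> L" "a \<le> L - 1" by (auto simp: L_def)
  have K: "0 \<le> K" by (simp add: K_def L_def)
  \<comment> \<open>The test functions carry a Lipschitz condition on the second derivative because
    the exponential bound was established for these.\<close>
  define \<U> where "\<U> = {U. (\<exists>\<delta>>0. U = {\<nu>. \<delta> < bl_dist (\<nu> 0) \<mu>D}) \<or>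
     (\<exists>f fx fxx ft s t l. C21b f fx fxx ft \<and> (\<forall>u\<in>{0..1}. \<forall>x y. \<bar>fxx x u - fxx y u\<bar> \<le> l * \<bar>x - y\<bar>) \<and>
        0 \<le> s \<and> s \<le> t \<and> t \<le> 1 \<and> U = {\<nu>. a < J_st \<nu> f fx fxx ft s t})}"
  have Fp: "F \<subseteq> path_space" using F by (simp add: path_closed_def)
  have 0: "(0::real) \<in> {0..1}" by simp
  define G where "G = F \<inter> regular_paths C (7 * K)"
  have "\<exists>\<V>. finite \<V> \<and> \<V> \<subseteq> \<U> \<and> G \<subseteq> \<Union>\<V>"
  proof (rule path_finite_cover[where F=F])
    show "G \<subseteq> path_space" "F \<subseteq> path_space" using Fp by (auto simp: G_def)
  next
    fix \<nu> :: "nat \<Rightarrow> real \<Rightarrow> real measure" assume \<nu>: "\<And>n. \<nu> n \<in> G"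
    then have "\<And>n. \<nu> n \<in> regular_paths C (7 * K)" by (simp add: G_def)
    from regular_paths_compact[of \<nu>, OF this] obtain r x where r: "strict_mono (r::nat \<Rightarrow> nat)" "x \<in> path_space" "(\<lambda>n. path_dist (\<nu> (r n)) x) \<longlonglongrightarrow> 0"
      by (elim exE conjE) (rule that)
    have rF: "\<forall>n. \<nu> (r n) \<in> F" using \<nu> by (simp add: G_def)
    have "x \<in> F" using F[unfolded path_closed_def, THEN conjunct2, rule_format, of x "\<lambda>n. \<nu> (r n)"] r(2,3) rF by simp
    with r show "\<exists>r x. strict_mono (r::nat \<Rightarrow> nat) \<and> x \<in> F \<and> (\<lambda>n. path_dist (\<nu> (r n)) x) \<longlonglongrightarrow> 0" by (intro exI[of _ r] exI[of _ x]) simp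
  next
    fix x assume x: "x \<in> F"
    then have xp: "x \<in> path_space" using Fp by blast
    have "ereal a < S_rate \<mu>D x" using a x by (meson INF_lower less_le_trans)
    from S_rate_less_cases[OF this]
    show "\<exists>U\<in>\<U>. \<forall>\<nu> :: nat \<Rightarrow> real \<Rightarrow> real measure. (\<forall>n. \<nu> n \<in> path_space) \<longrightarrow> (\<lambda>n. path_dist (\<nu> n) x) \<longlonglongrightarrow> 0
        \<longrightarrow> (\<forall>\<^sub>F n in sequentially. \<nu> n \<in> U)"
    proof
      assume ne: "x 0 \<noteq> \<mu>D"
      note rx = path_space_dist[OF xp 0]
      have "bl_dist (x 0) \<mu>D \<noteq> 0" using bl_dist_eq_0_imp_eq[OF rx \<mu>D] ne by blast
      then have pos: "bl_dist (x 0) \<mu>D > 0" using bl_dist_nonneg[OF rx \<mu>D] by linarith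
      define \<delta> where "\<delta> = bl_dist (x 0) \<mu>D / 2"
      have \<delta>: "\<delta> > 0" using pos by (simp add: \<delta>_def)
      have "\<forall>\<^sub>F n in sequentially. \<nu> n \<in> {\<nu>. \<delta> < bl_dist (\<nu> 0) \<mu>D}"
        if \<nu>: "\<forall>n. \<nu> n \<in> path_space" "(\<lambda>n. path_dist (\<nu> n) x) \<longlonglongrightarrow> 0" for \<nu> :: "nat \<Rightarrow> real \<Rightarrow> real measure"
      proof -
        have \<nu>p: "\<nu> n \<in> path_space" for n using \<nu>(1) by blast
        from order_tendstoD(2)[OF path_tendsto_weak_conv(1)[OF \<nu>p xp \<nu>(2) 0] \<delta>]
        show ?thesis
        proof eventually_elim
          case (elim n)
          have "bl_dist (x 0) \<mu>D \<le> bl_dist (x 0) (\<nu> n 0) + bl_dist (\<nu> n 0) \<mu>D"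
            by (rule bl_dist_triangle[OF rx path_space_dist[OF \<nu>p 0] \<mu>D])
          then have "\<delta> < bl_dist (\<nu> n 0) \<mu>D" using elim bl_dist_sym[of "x 0" "\<nu> n 0"] unfolding \<delta>_def by linarith
          then show ?case by simp
        qed
      qed
      moreover have "{\<nu>. \<delta> < bl_dist (\<nu> 0) \<mu>D} \<in> \<U>" unfolding \<U>_def using \<delta> by blast
      ultimately show ?thesis by blast
    next
      assume "\<exists>f fx fxx ft s t. C21b f fx fxx ft \<and> 0 \<le> s \<and> s \<le> t \<and> t \<le> 1 \<and> a < J_st x f fx fxx ft s t"
      then obtain f fx fxx ft s t where f: "C21b f fx fxx ft" and st: "0 \<le> s" "s \<le> t" "t \<le> 1" and J: "a < J_st x f fx fxx ft s t"
        by blast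
      obtain g gx gxx gt l where g: "C21b g gx gxx gt" "\<forall>u\<in>{0..1}. \<forall>x y. \<bar>gxx x u - gxx y u\<bar> \<le> l * \<bar>x - y\<bar>"
        and Jg: "a < J_st x g gx gxx gt s t"
        using J_st_regular_test_function[OF f xp st J] by (elim exE conjE)
      have "\<forall>\<^sub>F n in sequentially. \<nu> n \<in> {\<nu>. a < J_st \<nu> g gx gxx gt s t}"
        if \<nu>: "\<forall>n. \<nu> n \<in> path_space" "(\<lambda>n. path_dist (\<nu> n) x) \<longlonglongrightarrow> 0" for \<nu> :: "nat \<Rightarrow> real \<Rightarrow> real measure"
        using order_tendstoD(1)[OF J_st_tendsto[OF g(1) st _ xp \<nu>(2)] Jg] \<nu>(1) by simp
      moreover have "{\<nu>. a < J_st \<nu> g gx gxx gt s t} \<in> \<U>" unfolding \<U>_def using g st by blast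
      ultimately show ?thesis by blast
    qed
  qed
  then obtain \<V> where \<V>: "finite \<V>" "\<V> \<subseteq> \<U>" "G \<subseteq> \<Union>\<V>" by blast
  let ?E = "\<lambda>N. exp (- ((real N)\<^sup>2 * a))"
  have each: "\<forall>\<^sub>F N in sequentially. \<exists>E\<in>sets (M N). {\<omega>\<in>space (M N). spectral_process N (d N) (B N) \<omega> \<in> U} \<subseteq> E \<and> measure (M N) E \<le> ?E N"
    if U: "U \<in> \<V>" for U
  proof -
    have "U \<in> \<U>" using U \<V> by blast
    then consider (init) \<delta> where "\<delta> > 0" "U = {\<nu>. \<delta> < bl_dist (\<nu> 0) \<mu>D}"
      | (test) f fx fxx ft s t l where "C21b f fx fxx ft" "\<forall>u\<in>{0..1}. \<forall>x y. \<bar>fxx x u - fxx y u\<bar> \<le> l * \<bar>x - y\<bar>"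
        "0 \<le> s" "s \<le> t" "t \<le> 1" "U = {\<nu>. a < J_st \<nu> f fx fxx ft s t}"
      unfolding \<U>_def mem_Collect_eq by (elim disjE exE conjE) blast+
    then show ?thesis
    proof cases
      case init
      \<comment> \<open>Sets of the first kind cost nothing: the initial law is deterministic and
        within \<open>\<delta>\<close> of \<open>\<mu>D\<close> for large N, so the event is
        empty.\<close>
      have "(\<lambda>N. bl_dist (spectral_measure (diag_real N (d N))) \<mu>D) \<longlonglongrightarrow> 0"
        by (rule weak_conv_imp_bl_dist[OF real_distribution_spectral_measure \<mu>D conv])
      from order_tendstoD(2)[OF this init(1)] eventually_gt_at_top[of 0] show ?thesis
      proof eventually_elim
        case (elim N)
        interpret prob_space "M N" by (rule M)
        interpret hermitian_BM "M N" N "B N" by standard (use elim B[of N] in \<open>simp_all add: idx_def\<close>)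
        have "spectral_process N (d N) (B N) \<omega> \<notin> U" if "\<omega> \<in> space (M N)" for \<omega>
        proof -
          have "pos 0 \<omega> = (\<lambda>p. 0)" using that by (intro ext) (simp add: pos_def B_0)
          then show ?thesis using elim(1) unfolding init(2) mem_Collect_eq spectral_process_pos spec_0 by simp
        qed
        then show ?case by (intro bexI[of _ "{}"]) auto
      qed
    next
      case test
      from eventually_gt_at_top[of 0] show ?thesis
      proof eventually_elim
        case (elim N)
        interpret prob_space "M N" by (rule M)
        interpret hermitian_BM "M N" N "B N" by standard (use elim B[of N] in \<open>simp_all add: idx_def\<close>)
        let ?A = "{\<omega>\<in>space (M N). a \<le> J_st (spectral_process N (d N) (B N) \<omega>) f fx fxx ft s t}"
        have "?A \<in> sets (M N)" using J_st_measurable[OF test(1,3,4,5), of "d N"] by measurable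
        moreover have "measure (M N) ?A \<le> ?E N"
          by (rule J_st_tail[OF test(1,3,4,5)]) (use test(2) in blast)
        ultimately show ?case unfolding test(6) by (intro bexI[of _ ?A]) auto
      qed
    qed
  qed
  have "\<forall>\<^sub>F N in sequentially. \<forall>U\<in>\<V>. \<exists>E\<in>sets (M N). {\<omega>\<in>space (M N). spectral_process N (d N) (B N) \<omega> \<in> U} \<subseteq> E \<and> measure (M N) E \<le> ?E N"
    using each \<V>(1) by (intro eventually_ball_finite) auto
  \<comment> \<open>One term exp(-N^2 a) for each covering set and two for the exceptional event,
    from the factor 2 in \<open>bad_prob\<close>.\<close>
  define c where "c = real (card \<V>) + 2"
  have bound: "\<forall>\<^sub>F N in sequentially. ereal (1 / (real N)\<^sup>2) *
      log_ereal (outer_prob (M N) {\<omega>\<in>space (M N). spectral_process N (d N) (B N) \<omega> \<in> F}) \<le> ereal (ln c / (real N)\<^sup>2 - a)"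
    using \<open>\<forall>\<^sub>F N in sequentially. \<forall>U\<in>\<V>. _ N U\<close> eventually_gt_at_top[of 0]
  proof eventually_elim
    case (elim N)
    interpret prob_space "M N" by (rule M)
    interpret hermitian_BM "M N" N "B N" by standard (use elim B[of N] in \<open>simp_all add: idx_def\<close>)
    from bchoice[OF elim(1)[unfolded Bex_def]] obtain E where E: "\<And>U. U \<in> \<V> \<Longrightarrow> E U \<in> sets (M N)"
      "\<And>U. U \<in> \<V> \<Longrightarrow> {\<omega>\<in>space (M N). spectral_process N (d N) (B N) \<omega> \<in> U} \<subseteq> E U" "\<And>U. U \<in> \<V> \<Longrightarrow> measure (M N) (E U) \<le> ?E N"
      by blast
    have CN: "(\<integral>x. ln (1 + x\<^sup>2) \<partial>spectral_measure (diag_real N (d N))) \<le> C" using C[of N] elim(2) by simp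
    let ?T = "bad K \<union> (\<Union>U\<in>\<V>. E U)"
    have sub: "{\<omega>\<in>space (M N). spectral_process N (d N) (B N) \<omega> \<in> F} \<inter> space (M N) \<subseteq> ?T"
    proof
      fix \<omega> assume "\<omega> \<in> {\<omega>\<in>space (M N). spectral_process N (d N) (B N) \<omega> \<in> F} \<inter> space (M N)"
      then have \<omega>: "\<omega> \<in> space (M N)" "spectral_process N (d N) (B N) \<omega> \<in> F" by auto
      show "\<omega> \<in> ?T"
      proof (cases "\<omega> \<in> bad K")
        case False
        then have "spectral_process N (d N) (B N) \<omega> \<in> G"
          using regular_of_not_bad[OF \<omega>(1) False K CN] \<omega>(2) by (simp add: G_def)
        then obtain U where "U \<in> \<V>" "spectral_process N (d N) (B N) \<omega> \<in> U" using \<V>(3) by blast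
        then show ?thesis using E(2)[of U] \<omega>(1) by blast
      qed simp
    qed
    have UE: "(\<Union>U\<in>\<V>. E U) \<in> sets (M N)" using E(1) \<V>(1) by (intro sets.finite_UN) auto
    have T: "?T \<in> sets (M N)" using UE bad_sets by auto
    have "outer_prob (M N) {\<omega>\<in>space (M N). spectral_process N (d N) (B N) \<omega> \<in> F} \<le> prob ?T"
      by (rule outer_prob_le[OF T sub])
    also have "\<dots> \<le> prob (bad K) + prob (\<Union>U\<in>\<V>. E U)"
      by (rule measure_subadditive[OF bad_sets UE]) simp_all
    also have "\<dots> \<le> 2 * ?E N + real (card \<V>) * ?E N"
    proof (rule add_mono)
      have "(real N)\<^sup>2 * a \<le> (real N)\<^sup>2 * (L - 1)" using L by (intro mult_left_mono) auto
      then have "exp (- ((real N)\<^sup>2 * (L - 1))) \<le> ?E N" by simp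
      then show "prob (bad K) \<le> 2 * ?E N" using bad_prob[OF L(1)] unfolding K_def by linarith
      have "prob (\<Union>U\<in>\<V>. E U) \<le> (\<Sum>U\<in>\<V>. prob (E U))"
        using E(1) \<V>(1) by (intro finite_measure_subadditive_finite) auto
      also have "\<dots> \<le> (\<Sum>U\<in>\<V>. ?E N)" by (intro sum_mono E(3))
      finally show "prob (\<Union>U\<in>\<V>. E U) \<le> real (card \<V>) * ?E N" by simp
    qed
    also have "\<dots> = c * exp (- (real (N\<^sup>2) * a))" by (simp add: c_def distrib_right)
    finally have "ereal (1 / real (N\<^sup>2)) * log_ereal (outer_prob (M N) {\<omega>\<in>space (M N). spectral_process N (d N) (B N) \<omega> \<in> F})
        \<le> ereal (ln c / real (N\<^sup>2) - a)"
      by (rule log_ereal_bound) (use elim in \<open>auto simp: c_def\<close>)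
    then show ?case by simp
  qed
  have "(\<lambda>N. ln c / (real N)\<^sup>2 - a) \<longlonglongrightarrow> - a" by real_asymp
  then have lim: "(\<lambda>N. ereal (ln c / (real N)\<^sup>2 - a)) \<longlonglongrightarrow> ereal (- a)" by simp
  from Limsup_mono[OF bound] show ?thesis
    unfolding lim_imp_Limsup[OF sequentially_bot lim] .
qed

theorem theorem4p12:
  fixes d :: "nat \<Rightarrow> nat \<Rightarrow> real"
    and \<mu>D :: "real measure"
    and M :: "nat \<Rightarrow> 'w measure"
    and B :: "nat \<Rightarrow> nat \<times> nat \<Rightarrow> real \<Rightarrow> 'w \<Rightarrow> real"
  assumes C_D: "\<exists>C. \<forall>N\<ge>1. (\<integral>x. ln (1 + x\<^sup>2) \<partial>spectral_measure (diag_real N (d N))) \<le> C"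
    and \<mu>D: "real_distribution \<mu>D"
    and conv: "weak_conv_m (\<lambda>N. spectral_measure (diag_real N (d N))) \<mu>D"
    and M: "\<And>N. prob_space (M N)"
    and B: "\<And>N. indep_std_BMs (M N) ({..<N} \<times> {..<N}) (B N)"
  shows "good_rate_function path_space path_dist (S_rate \<mu>D) \<and>
         (\<forall>F. path_closed F \<longrightarrow>
           limsup (\<lambda>N. ereal (1 / (real N)\<^sup>2) *
              log_ereal (outer_prob (M N) {\<omega>\<in>space (M N). spectral_process N (d N) (B N) \<omega> \<in> F}))
           \<le> - (INF \<nu>\<in>F. S_rate \<mu>D \<nu>))"
proof (intro conjI allI impI S_rate_good[OF \<mu>D])
  fix F assume F: "path_closed F"
  obtain C where C: "\<And>N. N \<ge> 1 \<Longrightarrow> (\<integral>x. ln (1 + x\<^sup>2) \<partial>spectral_measure (diag_real N (d N))) \<le> C"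
    using C_D by blast
  let ?l = "limsup (\<lambda>N. ereal (1 / (real N)\<^sup>2) *
              log_ereal (outer_prob (M N) {\<omega>\<in>space (M N). spectral_process N (d N) (B N) \<omega> \<in> F}))"
  \<comment> \<open>Comparison with all reals \<open>a\<close> strictly below the infimum also
    covers an infinite infimum.\<close>
  have "(INF \<nu>\<in>F. S_rate \<mu>D \<nu>) \<le> - ?l"
  proof (rule dense_le)
    fix y assume "y < (INF \<nu>\<in>F. S_rate \<mu>D \<nu>)"
    then obtain a where a: "y < ereal a" "ereal a < (INF \<nu>\<in>F. S_rate \<mu>D \<nu>)" using ereal_dense2 by blast
    have "?l \<le> ereal (- a)" by (rule large_deviation_upper_bound[OF C \<mu>D conv M B F a(2)])
    then have "ereal a \<le> - ?l" by (subst ereal_minus_le_minus[symmetric]) simp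
    with a(1) show "y \<le> - ?l" by (meson less_imp_le less_le_trans)
  qed
  then show "?l \<le> - (INF \<nu>\<in>F. S_rate \<mu>D \<nu>)" by (subst ereal_minus_le_minus[symmetric]) (simp only: ereal_uminus_uminus)
qed

end
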